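(* Let $u\in V$ be the solution of the Kirchhoff plate problem $a(u,v)=l(v)$ for all $v\in V$, and let $u_h\in V_h$ be its conforming finite element approximation, i.e. $a(u_h,v_h)=l(v_h)$ for all $v_h\in V_h$. Let the error estimator $\eta\ge0$ be defined by $$\begin{aligned}\eta^2={}&\sum_{K\in\mathcal C_h}h_K^4\|\mathcal A(u_h)-f\|_{0,K}^2+\sum_{E\in\mathcal E_h^S}h_E^3\|\llbracket V_n(u_h)\rrbracket-g\|_{0,E}^2+\sum_{E\in\mathcal E_h^i\setminus\mathcal E_h^S}h_E^3\|\llbracket V_n(u_h)\rrbracket\|_{0,E}^2\\&+\sum_{E\in\mathcal E_h^i}h_E\|\llbracket M_{nn}(u_h)\rrbracket\|_{0,E}^2+\sum_{E\in\mathcal E_h^f}h_E^3\|V_n(u_h)\|_{0,E}^2+\sum_{E\in\mathcal E_h^f\cup\mathcal E_h^s}h_E\|M_{nn}(u_h)\|_{0,E}^2 .\end{aligned}$$ Then there is a constant $C>0$ independent of the finite element mesh such that $$\eta\le C\big(\|u-u_h\|_2+\mathrm{osc}(f)+\mathrm{osc}(g)\big),$$ where $\|\cdot\|_2$ is the $H^2(\Omega)$-norm and $$\mathrm{osc}(f)=\sqrt{\sum_{K\in\mathcal C_h}\mathrm{osc}_K(f)^2},\qquad \mathrm{osc}(g)=\sqrt{\sum_{E\in\mathcal E_h^S}\mathrm{osc}_E(g)^2}.$$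
   Context: **Plate model.** $\Omega\subset\mathbb R^2$ is a polygonal domain with $\partial\Omega=\Gamma_{\mathrm c}\cup\Gamma_{\mathrm s}\cup\Gamma_{\mathrm f}$ (clamped, simply supported and free parts). The plate thickness is $d>0$, Young's modulus is $E>0$ and Poisson ratio is $\nu$ (with the usual admissible range $-1<\nu\le 1/2$). For $A\in\mathbb R^{2\times2}$, $\mathbb C A=\frac{E}{1+\nu}\big(A+\frac{\nu}{1-\nu}(\operatorname{tr}A)I\big)$. For a scalar function $w$: curvature $\boldsymbol K(w)=-\boldsymbol\varepsilon(\nabla w)$, with $\boldsymbol\varepsilon(\boldsymbol v)=\frac12(\nabla\boldsymbol v+\nabla\boldsymbol v^T)$; moment tensor $\boldsymbol M(w)=\frac{d^3}{12}\mathbb C\boldsymbol K(w)$; shear force $\boldsymbol Q(w)=\operatorname{\mathbf{div}}\boldsymbol M(w)$ (row-wise divergence); $\mathcal A(w)=-\operatorname{div}\boldsymbol Q(w)=D\Delta^2w$ with $D=\frac{Ed^3}{12(1-\nu^2)}$. The expression $\mathcal A(v_h)$ for finite element functions is understood elementwise. The loads are $f\in L^2(\Omega)$, a line load $g\in L^2(S)$ along a line $S\subset\Omega$, and a point load $F\in\mathbb R$ at an interior point $x_0\in\Omega$. Set $$V=\{v\in H^2(\Omega): v|_{\Gamma_{\mathrm c}\cup\Gamma_{\mathrm s}}=0,\ \nabla v\cdot\boldsymbol n|_{\Gamma_{\mathrm c}}=0\},$$ $$a(w,v)=\int_\Omega\boldsymbol M(w):\boldsymbol K(v)\,dx,\qquad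 l(v)=\int_\Omega fv\,dx+\int_Sgv\,ds+Fv(x_0).$$ The boundary conditions are assumed to be such that $a$ is coercive on $V$ with respect to the $H^2(\Omega)$-norm. **Boundary quantities.** On the boundary of a (sub)domain with unit outward normal $\boldsymbol n$ and unit tangent $\boldsymbol s$: $Q_n(w)=\boldsymbol Q(w)\cdot\boldsymbol n$, $M_{nn}(w)=\boldsymbol n\cdot\boldsymbol M(w)\boldsymbol n$, $M_{ns}(w)=\boldsymbol s\cdot\boldsymbol M(w)\boldsymbol n$, and the Kirchhoff shear force is $V_n(w)=Q_n(w)+\frac{\partial M_{ns}(w)}{\partial s}$. **Mesh.** $\mathcal C_h$ is a shape regular (conforming) triangulation of $\Omega$, with $x_0$ a mesh node, $S$ a union of (interior) element edges, and each boundary edge contained in one of $\Gamma_{\mathrm c},\Gamma_{\mathrm s},\Gamma_{\mathrm f}$. $h_K$, $h_E$ are the sizes (diameters) of the triangle $K$ and the edge $E$. $\mathcal E_h^i$ is the set of interior edges, $\mathcal E_h^S\subset\mathcal E_h^i$ the edges on $S$, $\mathcal E_h^f$ the edges on $\Gamma_{\mathrm f}$, and $\mathcal E_h^s$ the edges on $\Gamma_{\mathrm s}$. $\|\cdot\|_{0,K}$, $\|\cdot\|_{0,E}$ are $L^2$-norms. For an interior edge $E=K\cap K'$ with outward normals $\boldsymbol n,\boldsymbol n'$ of $K,K'$, $$\llbracket M_{nn}(v)\rrbracket|_E=M_{nn}(v)-M_{n'n'}(v),\qquad \llbracket V_n(v)\rrbracket|_E=V_n(v)+V_{n'}(v),$$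 where the unprimed quantities are computed from $v|_K$ and the primed ones from $v|_{K'}$. **Finite element space.** $V_h\subset V$ is a conforming space of $C^1$ functions that are polynomials of a fixed maximal degree on each $K\in\mathcal C_h$, e.g. built from Bell triangles (polynomials in $P_5(K)$ with normal derivative in $P_3(E)$ on each edge; degrees of freedom: values, first and second derivatives at the vertices), from Argyris triangles ($P_5(K)$; the Bell degrees of freedom plus normal derivatives at edge midpoints), or from higher-order generalizations of the Argyris triangle. **Data oscillation.** $f_h\in V_h$ is a fixed interpolant (approximation) of $f$ in $V_h$, and for each $E\in\mathcal E_h^S$, $g_h$ is a polynomial approximation of $g$ on $E$ of fixed maximal degree. Then $$\mathrm{osc}_K(f)=h_K^2\|f-f_h\|_{0,K},\qquad \mathrm{osc}_E(g)=h_E^{3/2}\|g-g_h\|_{0,E}.$$ "Independent of the mesh" means: depending only on $\Omega$, the boundary partition, the material parameters, the shape-regularity constant, the type/degree of element and the maximal degree of $g_h$, and not on the loads, the functions involved, or the mesh sizes. *)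

theory Defs
  imports "HOL-Analysis.Analysis"
begin

section \<open>Lebesgue spaces and arc length\<close>

definition L2 :: "'a measure \<Rightarrow> ('a \<Rightarrow> real) set" where
  "L2 M = {f \<in> borel_measurable M. integrable M (\<lambda>x. (f x)\<^sup>2)}"

definition L2norm :: "'a measure \<Rightarrow> ('a \<Rightarrow> real) \<Rightarrow> real" where
  "L2norm M f = sqrt (LINT x|M. (f x)\<^sup>2)"

definition is_segment :: "(real^2) set \<Rightarrow> bool" where
  "is_segment e \<longleftrightarrow> (\<exists>a b. a \<noteq> b \<and> e = closed_segment a b)"

text \<open>Arc length measure on a segment (a measure on the space \<open>e\<close>). The choice of the
  endpoints is unique up to their order, which does not affect the measure.\<close>

definition arc_measure :: "(real^2) set \<Rightarrow> (real^2) measure" where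
  "arc_measure e =
    (let (a, b) = (SOME (a, b). e = closed_segment a b) in
       completion
         (distr (restrict_space lborel {0..dist a b}) (restrict_space borel e)
           (\<lambda>t. a + (t / dist a b) *\<^sub>R (b - a))))"


section \<open>Classical and weak partial derivatives, Sobolev spaces\<close>

definition pd :: "2 \<Rightarrow> (real^2 \<Rightarrow> real) \<Rightarrow> real^2 \<Rightarrow> real" where
  "pd i f x = frechet_derivative f (at x) (axis i 1)"

definition smooth :: "(real^2 \<Rightarrow> real) \<Rightarrow> bool" where
  "smooth f \<longleftrightarrow> (\<forall>is. foldr pd is f differentiable_on UNIV)"

definition test_functions :: "(real^2) set \<Rightarrow> (real^2 \<Rightarrow> real) set" where
  "test_functions \<Omega> =
    {\<phi>. smooth \<phi> \<and> compact (closure {x. \<phi> x \<noteq> 0}) \<and> closure {x. \<phi> x \<noteq> 0} \<subseteq> \<Omega>}"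

definition has_weak_pd ::
    "(real^2) set \<Rightarrow> 2 \<Rightarrow> (real^2 \<Rightarrow> real) \<Rightarrow> (real^2 \<Rightarrow> real) \<Rightarrow> bool" where
  "has_weak_pd \<Omega> i w w' \<longleftrightarrow>
    w' \<in> L2 (lebesgue_on \<Omega>) \<and>
    (\<forall>\<phi>\<in>test_functions \<Omega>.
      (LINT x|lebesgue_on \<Omega>. w x * pd i \<phi> x) = - (LINT x|lebesgue_on \<Omega>. w' x * \<phi> x))"

text \<open>Elements of the Sobolev spaces are represented by functions on the whole plane; only their
  values almost everywhere on \<open>\<Omega>\<close> matter. \<open>wpd\<close> selects one representative of the (almost
  everywhere unique) weak derivative.\<close>

definition wpd :: "(real^2) set \<Rightarrow> 2 \<Rightarrow> (real^2 \<Rightarrow> real) \<Rightarrow> real^2 \<Rightarrow> real" where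
  "wpd \<Omega> i w = (SOME w'. has_weak_pd \<Omega> i w w')"

definition H1 :: "(real^2) set \<Rightarrow> (real^2 \<Rightarrow> real) set" where
  "H1 \<Omega> = {w \<in> L2 (lebesgue_on \<Omega>). \<forall>i. \<exists>w'. has_weak_pd \<Omega> i w w'}"

definition H1norm :: "(real^2) set \<Rightarrow> (real^2 \<Rightarrow> real) \<Rightarrow> real" where
  "H1norm \<Omega> w =
    sqrt ((L2norm (lebesgue_on \<Omega>) w)\<^sup>2 + (\<Sum>i\<in>UNIV. (L2norm (lebesgue_on \<Omega>) (wpd \<Omega> i w))\<^sup>2))"

definition H2 :: "(real^2) set \<Rightarrow> (real^2 \<Rightarrow> real) set" where
  "H2 \<Omega> = {w \<in> H1 \<Omega>. \<forall>i. wpd \<Omega> i w \<in> H1 \<Omega>}"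

definition H2norm :: "(real^2) set \<Rightarrow> (real^2 \<Rightarrow> real) \<Rightarrow> real" where
  "H2norm \<Omega> w =
    sqrt ((L2norm (lebesgue_on \<Omega>) w)\<^sup>2
      + (\<Sum>i\<in>UNIV. (L2norm (lebesgue_on \<Omega>) (wpd \<Omega> i w))\<^sup>2)
      + (\<Sum>i\<in>UNIV. \<Sum>j\<in>UNIV. (L2norm (lebesgue_on \<Omega>) (wpd \<Omega> j (wpd \<Omega> i w)))\<^sup>2))"

text \<open>Boundary traces of \<open>H1\<close>-functions, for polygonal \<open>\<Omega>\<close>: the continuous extension of the
  restriction map from functions that are continuous up to the boundary. Convergence in
  \<open>L2 (frontier \<Omega>)\<close> is convergence on every segment contained in the frontier.\<close>

definition has_trace :: "(real^2) set \<Rightarrow> (real^2 \<Rightarrow> real) \<Rightarrow> (real^2 \<Rightarrow> real) \<Rightarrow> bool" where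
  "has_trace \<Omega> w t \<longleftrightarrow>
    w \<in> H1 \<Omega> \<and>
    (\<exists>\<phi>::nat \<Rightarrow> real^2 \<Rightarrow> real.
      (\<forall>k. \<phi> k \<in> H1 \<Omega> \<and> continuous_on (closure \<Omega>) (\<phi> k)) \<and>
      (\<lambda>k. H1norm \<Omega> (\<lambda>x. \<phi> k x - w x)) \<longlonglongrightarrow> 0 \<and>
      (\<forall>e. is_segment e \<and> e \<subseteq> frontier \<Omega> \<longrightarrow>
        t \<in> L2 (arc_measure e) \<and>
        (\<lambda>k. L2norm (arc_measure e) (\<lambda>x. \<phi> k x - t x)) \<longlonglongrightarrow> 0))"

text \<open>Point values of \<open>H2\<close>-functions, which are meant via the representative that is continuous
  on \<open>closure \<Omega>\<close> (and unique there); it exists by the Sobolev embedding theorem.\<close>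

definition cont_rep :: "(real^2) set \<Rightarrow> (real^2 \<Rightarrow> real) \<Rightarrow> real^2 \<Rightarrow> real" where
  "cont_rep \<Omega> v =
    (SOME w. continuous_on (closure \<Omega>) w \<and> (AE x in lebesgue_on \<Omega>. w x = v x))"


section \<open>Polygonal domains\<close>

definition perp :: "real^2 \<Rightarrow> real^2" where
  "perp n = vector [- (n $ 2), n $ 1]"

definition lipschitz_domain :: "(real^2) set \<Rightarrow> bool" where
  "lipschitz_domain \<Omega> \<longleftrightarrow>
    open \<Omega> \<and> bounded \<Omega> \<and> connected \<Omega> \<and> \<Omega> \<noteq> {} \<and>
    (\<forall>x\<in>frontier \<Omega>. \<exists>r>0. \<exists>n L. \<exists>\<gamma>::real \<Rightarrow> real.
      norm n = 1 \<and> L-lipschitz_on UNIV \<gamma> \<and>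
      \<Omega> \<inter> ball x r = {y \<in> ball x r. y \<bullet> n < \<gamma> (y \<bullet> perp n)})"

definition segment_union :: "(real^2) set \<Rightarrow> bool" where
  "segment_union \<Gamma> \<longleftrightarrow> (\<exists>\<S>. finite \<S> \<and> (\<forall>e\<in>\<S>. is_segment e) \<and> \<Gamma> = \<Union>\<S>)"

definition polygonal_domain :: "(real^2) set \<Rightarrow> bool" where
  "polygonal_domain \<Omega> \<longleftrightarrow> lipschitz_domain \<Omega> \<and> segment_union (frontier \<Omega>)"

definition boundary_partition ::
    "(real^2) set \<Rightarrow> (real^2) set \<Rightarrow> (real^2) set \<Rightarrow> (real^2) set \<Rightarrow> bool" where
  "boundary_partition \<Omega> \<Gamma>c \<Gamma>s \<Gamma>f \<longleftrightarrow>
    frontier \<Omega> = \<Gamma>c \<union> \<Gamma>s \<union> \<Gamma>f \<and>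
    segment_union \<Gamma>c \<and> segment_union \<Gamma>s \<and> segment_union \<Gamma>f \<and>
    finite (\<Gamma>c \<inter> \<Gamma>s) \<and> finite (\<Gamma>c \<inter> \<Gamma>f) \<and> finite (\<Gamma>s \<inter> \<Gamma>f)"

text \<open>Outward unit normal of \<open>\<Omega>\<close>, meaningful at boundary points that are not corners.\<close>

definition boundary_normal :: "(real^2) set \<Rightarrow> real^2 \<Rightarrow> real^2" where
  "boundary_normal \<Omega> x =
    (THE n. norm n = 1 \<and> (\<exists>r>0. \<Omega> \<inter> ball x r = {y \<in> ball x r. (y - x) \<bullet> n < 0}))"


section \<open>The Kirchhoff plate model\<close>

text \<open>Throughout, \<open>d\<close> is the thickness, \<open>Y\<close> Young's modulus and \<open>\<nu>\<close> the Poisson ratio. \<open>curvature\<close>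
  and \<open>moment\<close> take the partial derivative operator \<open>\<D>\<close> as a parameter: \<open>wpd \<Omega>\<close> for the bilinear
  form, \<open>pd\<close> for the elementwise quantities.\<close>

definition elasticity :: "real \<Rightarrow> real \<Rightarrow> real^2^2 \<Rightarrow> real^2^2" where
  "elasticity Y \<nu> A = (Y / (1 + \<nu>)) *\<^sub>R (A + (\<nu> / (1 - \<nu>) * trace A) *\<^sub>R mat 1)"

definition sym_part :: "real^2^2 \<Rightarrow> real^2^2" where
  "sym_part A = (1/2) *\<^sub>R (A + transpose A)"

definition curvature ::
    "(2 \<Rightarrow> (real^2 \<Rightarrow> real) \<Rightarrow> real^2 \<Rightarrow> real) \<Rightarrow> (real^2 \<Rightarrow> real) \<Rightarrow> real^2 \<Rightarrow> real^2^2" where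
  "curvature \<D> w x = - sym_part (\<chi> i j. \<D> j (\<D> i w) x)"

definition moment ::
    "(2 \<Rightarrow> (real^2 \<Rightarrow> real) \<Rightarrow> real^2 \<Rightarrow> real) \<Rightarrow> real \<Rightarrow> real \<Rightarrow> real
      \<Rightarrow> (real^2 \<Rightarrow> real) \<Rightarrow> real^2 \<Rightarrow> real^2^2" where
  "moment \<D> d Y \<nu> w x = (d ^ 3 / 12) *\<^sub>R elasticity Y \<nu> (curvature \<D> w x)"

definition shear :: "real \<Rightarrow> real \<Rightarrow> real \<Rightarrow> (real^2 \<Rightarrow> real) \<Rightarrow> real^2 \<Rightarrow> real^2" where
  "shear d Y \<nu> w x = (\<chi> i. \<Sum>j\<in>UNIV. pd j (\<lambda>y. moment pd d Y \<nu> w y $ i $ j) x)"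

definition plate_op :: "real \<Rightarrow> real \<Rightarrow> real \<Rightarrow> (real^2 \<Rightarrow> real) \<Rightarrow> real^2 \<Rightarrow> real" where
  "plate_op d Y \<nu> w x = - (\<Sum>i\<in>UNIV. pd i (\<lambda>y. shear d Y \<nu> w y $ i) x)"

text \<open>Boundary quantities for a straight piece of boundary with constant unit normal \<open>n\<close>. The unit
  tangent is \<open>perp n\<close>; the Kirchhoff shear force does not depend on its orientation.\<close>

definition M_nn ::
    "real \<Rightarrow> real \<Rightarrow> real \<Rightarrow> real^2 \<Rightarrow> (real^2 \<Rightarrow> real) \<Rightarrow> real^2 \<Rightarrow> real" where
  "M_nn d Y \<nu> n w x = n \<bullet> (moment pd d Y \<nu> w x *v n)"

definition M_ns ::
    "real \<Rightarrow> real \<Rightarrow> real \<Rightarrow> real^2 \<Rightarrow> (real^2 \<Rightarrow> real) \<Rightarrow> real^2 \<Rightarrow> real" where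
  "M_ns d Y \<nu> n w x = perp n \<bullet> (moment pd d Y \<nu> w x *v n)"

definition Q_n ::
    "real \<Rightarrow> real \<Rightarrow> real \<Rightarrow> real^2 \<Rightarrow> (real^2 \<Rightarrow> real) \<Rightarrow> real^2 \<Rightarrow> real" where
  "Q_n d Y \<nu> n w x = shear d Y \<nu> w x \<bullet> n"

definition V_n ::
    "real \<Rightarrow> real \<Rightarrow> real \<Rightarrow> real^2 \<Rightarrow> (real^2 \<Rightarrow> real) \<Rightarrow> real^2 \<Rightarrow> real" where
  "V_n d Y \<nu> n w x =
    Q_n d Y \<nu> n w x + frechet_derivative (M_ns d Y \<nu> n w) (at x) (perp n)"

definition plate_space ::
    "(real^2) set \<Rightarrow> (real^2) set \<Rightarrow> (real^2) set \<Rightarrow> (real^2 \<Rightarrow> real) set" where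
  "plate_space \<Omega> \<Gamma>c \<Gamma>s =
    {v \<in> H2 \<Omega>.
      (\<exists>t. has_trace \<Omega> v t \<and>
        (\<forall>e. is_segment e \<and> e \<subseteq> \<Gamma>c \<union> \<Gamma>s \<longrightarrow> (AE x in arc_measure e. t x = 0))) \<and>
      (\<exists>t. (\<forall>i. has_trace \<Omega> (wpd \<Omega> i v) (\<lambda>x. t x $ i)) \<and>
        (\<forall>e. is_segment e \<and> e \<subseteq> \<Gamma>c \<longrightarrow>
          (AE x in arc_measure e. t x \<bullet> boundary_normal \<Omega> x = 0)))}"

text \<open>The inner product of matrices in \<open>real^2^2\<close> is the Frobenius product.\<close>

definition plate_form ::
    "(real^2) set \<Rightarrow> real \<Rightarrow> real \<Rightarrow> real \<Rightarrow> (real^2 \<Rightarrow> real) \<Rightarrow> (real^2 \<Rightarrow> real) \<Rightarrow> real" where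
  "plate_form \<Omega> d Y \<nu> w v =
    (LINT x|lebesgue_on \<Omega>. moment (wpd \<Omega>) d Y \<nu> w x \<bullet> curvature (wpd \<Omega>) v x)"

definition plate_load ::
    "(real^2) set \<Rightarrow> (real^2) set \<Rightarrow> real^2 \<Rightarrow> (real^2 \<Rightarrow> real) \<Rightarrow> (real^2 \<Rightarrow> real) \<Rightarrow> real
      \<Rightarrow> (real^2 \<Rightarrow> real) \<Rightarrow> real" where
  "plate_load \<Omega> S x0 f g F v =
    (LINT x|lebesgue_on \<Omega>. f x * v x) + (LINT x|arc_measure S. g x * cont_rep \<Omega> v x)
      + F * cont_rep \<Omega> v x0"

definition plate_coercive ::
    "(real^2) set \<Rightarrow> (real^2) set \<Rightarrow> (real^2) set \<Rightarrow> real \<Rightarrow> real \<Rightarrow> real \<Rightarrow> bool" where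
  "plate_coercive \<Omega> \<Gamma>c \<Gamma>s d Y \<nu> \<longleftrightarrow>
    (\<exists>\<alpha>>0. \<forall>v\<in>plate_space \<Omega> \<Gamma>c \<Gamma>s. \<alpha> * (H2norm \<Omega> v)\<^sup>2 \<le> plate_form \<Omega> d Y \<nu> v v)"


section \<open>Meshes and finite element spaces\<close>

definition edges :: "(real^2) set set \<Rightarrow> (real^2) set set" where
  "edges \<T> = {e. \<exists>K\<in>\<T>. e edge_of K}"

definition interior_edges :: "(real^2) set set \<Rightarrow> (real^2) set set" where
  "interior_edges \<T> = {e. \<exists>K\<in>\<T>. \<exists>K'\<in>\<T>. K \<noteq> K' \<and> e edge_of K \<and> e edge_of K'}"

definition edges_on :: "(real^2) set set \<Rightarrow> (real^2) set \<Rightarrow> (real^2) set set" where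
  "edges_on \<T> \<Gamma> = {e \<in> edges \<T>. e \<subseteq> \<Gamma>}"

text \<open>\<open>triangulation\<close> includes conformity: two triangles meet in a common face or not at all.
  The last condition bounds the ratio of the diameter to the inradius.\<close>

definition plate_mesh ::
    "(real^2) set \<Rightarrow> (real^2) set \<Rightarrow> (real^2) set \<Rightarrow> (real^2) set \<Rightarrow> real
      \<Rightarrow> (real^2) set set \<Rightarrow> bool" where
  "plate_mesh \<Omega> \<Gamma>c \<Gamma>s \<Gamma>f \<kappa> \<T> \<longleftrightarrow>
    triangulation \<T> \<and> (\<forall>K\<in>\<T>. 2 simplex K) \<and> \<Union>\<T> = closure \<Omega> \<and>
    (\<forall>e\<in>edges_on \<T> (frontier \<Omega>). e \<subseteq> \<Gamma>c \<or> e \<subseteq> \<Gamma>s \<or> e \<subseteq> \<Gamma>f) \<and>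
    (\<forall>K\<in>\<T>. \<exists>x. \<exists>\<rho>>0. ball x \<rho> \<subseteq> K \<and> diameter K \<le> \<kappa> * \<rho>)"

definition poly_of_degree :: "nat \<Rightarrow> (real^2 \<Rightarrow> real) \<Rightarrow> bool" where
  "poly_of_degree r p \<longleftrightarrow>
    (\<exists>c::nat \<Rightarrow> nat \<Rightarrow> real. \<forall>x. p x = (\<Sum>i\<le>r. \<Sum>j\<le>r - i. c i j * (x $ 1) ^ i * (x $ 2) ^ j))"

definition C1_closure :: "(real^2) set \<Rightarrow> (real^2 \<Rightarrow> real) \<Rightarrow> bool" where
  "C1_closure \<Omega> v \<longleftrightarrow>
    continuous_on (closure \<Omega>) v \<and>
    (\<exists>G::real^2 \<Rightarrow> real^2. continuous_on (closure \<Omega>) G \<and>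
      (\<forall>x\<in>\<Omega>. (v has_derivative (\<lambda>h. G x \<bullet> h)) (at x)))"

definition fe_space ::
    "(real^2) set \<Rightarrow> (real^2) set \<Rightarrow> (real^2) set \<Rightarrow> (real^2) set set \<Rightarrow> nat
      \<Rightarrow> (real^2 \<Rightarrow> real) set \<Rightarrow> bool" where
  "fe_space \<Omega> \<Gamma>c \<Gamma>s \<T> r Vh \<longleftrightarrow>
    Vh \<noteq> {} \<and> (\<forall>v\<in>Vh. \<forall>w\<in>Vh. \<forall>a b. (\<lambda>x. a * v x + b * w x) \<in> Vh) \<and>
    Vh \<subseteq> plate_space \<Omega> \<Gamma>c \<Gamma>s \<and>
    (\<forall>v\<in>Vh. C1_closure \<Omega> v \<and> (\<forall>K\<in>\<T>. \<exists>p. poly_of_degree r p \<and> (\<forall>x\<in>K. v x = p x)))"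

text \<open>The polynomial that coincides with \<open>v\<close> on \<open>K\<close>. Its derivatives are those of the restriction
  of \<open>v\<close> to \<open>K\<close>, also on the edges of \<open>K\<close>.\<close>

definition piece :: "(real^2) set \<Rightarrow> (real^2 \<Rightarrow> real) \<Rightarrow> real^2 \<Rightarrow> real" where
  "piece K v = (SOME p. (\<exists>r. poly_of_degree r p) \<and> (\<forall>x\<in>K. v x = p x))"

definition edge_normal :: "(real^2) set \<Rightarrow> (real^2) set \<Rightarrow> real^2" where
  "edge_normal K e = (THE n. norm n = 1 \<and> (\<forall>x\<in>K. \<forall>y\<in>e. (x - y) \<bullet> n \<le> 0))"

text \<open>The two triangles at an interior edge, in an arbitrary order (which does not affect the
  norms of the jumps), and the triangle at a boundary edge.\<close>

definition adjacent_pair ::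
    "(real^2) set set \<Rightarrow> (real^2) set \<Rightarrow> (real^2) set \<times> (real^2) set" where
  "adjacent_pair \<T> e =
    (SOME (K, K'). K \<in> \<T> \<and> K' \<in> \<T> \<and> K \<noteq> K' \<and> e edge_of K \<and> e edge_of K')"

definition adjacent :: "(real^2) set set \<Rightarrow> (real^2) set \<Rightarrow> (real^2) set" where
  "adjacent \<T> e = (THE K. K \<in> \<T> \<and> e edge_of K)"

definition jump_M ::
    "real \<Rightarrow> real \<Rightarrow> real \<Rightarrow> (real^2) set set \<Rightarrow> (real^2) set
      \<Rightarrow> (real^2 \<Rightarrow> real) \<Rightarrow> real^2 \<Rightarrow> real" where
  "jump_M d Y \<nu> \<T> e v x =
    (let (K, K') = adjacent_pair \<T> e in
      M_nn d Y \<nu> (edge_normal K e) (piece K v) x - M_nn d Y \<nu> (edge_normal K' e) (piece K' v) x)"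

definition jump_V ::
    "real \<Rightarrow> real \<Rightarrow> real \<Rightarrow> (real^2) set set \<Rightarrow> (real^2) set
      \<Rightarrow> (real^2 \<Rightarrow> real) \<Rightarrow> real^2 \<Rightarrow> real" where
  "jump_V d Y \<nu> \<T> e v x =
    (let (K, K') = adjacent_pair \<T> e in
      V_n d Y \<nu> (edge_normal K e) (piece K v) x + V_n d Y \<nu> (edge_normal K' e) (piece K' v) x)"

definition bdry_M ::
    "real \<Rightarrow> real \<Rightarrow> real \<Rightarrow> (real^2) set set \<Rightarrow> (real^2) set
      \<Rightarrow> (real^2 \<Rightarrow> real) \<Rightarrow> real^2 \<Rightarrow> real" where
  "bdry_M d Y \<nu> \<T> e v x =
    (let K = adjacent \<T> e in M_nn d Y \<nu> (edge_normal K e) (piece K v) x)"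

definition bdry_V ::
    "real \<Rightarrow> real \<Rightarrow> real \<Rightarrow> (real^2) set set \<Rightarrow> (real^2) set
      \<Rightarrow> (real^2 \<Rightarrow> real) \<Rightarrow> real^2 \<Rightarrow> real" where
  "bdry_V d Y \<nu> \<T> e v x =
    (let K = adjacent \<T> e in V_n d Y \<nu> (edge_normal K e) (piece K v) x)"


section \<open>Error estimator and data oscillation\<close>

text \<open>The edges on the free and on the simply supported part are \<open>edges_on \<T> \<Gamma>f\<close> and
  \<open>edges_on \<T> \<Gamma>s\<close>.\<close>

definition edges_S :: "(real^2) set set \<Rightarrow> (real^2) set \<Rightarrow> (real^2) set set" where
  "edges_S \<T> S = {e \<in> interior_edges \<T>. e \<subseteq> S}"

definition estimator ::
    "real \<Rightarrow> real \<Rightarrow> real \<Rightarrow> (real^2) set \<Rightarrow> (real^2) set \<Rightarrow> (real^2) set \<Rightarrow> (real^2) set set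
      \<Rightarrow> (real^2 \<Rightarrow> real) \<Rightarrow> (real^2 \<Rightarrow> real) \<Rightarrow> (real^2 \<Rightarrow> real) \<Rightarrow> real" where
  "estimator d Y \<nu> \<Gamma>s \<Gamma>f S \<T> f g uh =
    sqrt (
      (\<Sum>K\<in>\<T>. diameter K ^ 4
        * (L2norm (lebesgue_on K) (\<lambda>x. plate_op d Y \<nu> (piece K uh) x - f x))\<^sup>2)
    + (\<Sum>e\<in>edges_S \<T> S. diameter e ^ 3
        * (L2norm (arc_measure e) (\<lambda>x. jump_V d Y \<nu> \<T> e uh x - g x))\<^sup>2)
    + (\<Sum>e\<in>interior_edges \<T> - edges_S \<T> S. diameter e ^ 3
        * (L2norm (arc_measure e) (jump_V d Y \<nu> \<T> e uh))\<^sup>2)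
    + (\<Sum>e\<in>interior_edges \<T>. diameter e
        * (L2norm (arc_measure e) (jump_M d Y \<nu> \<T> e uh))\<^sup>2)
    + (\<Sum>e\<in>edges_on \<T> \<Gamma>f. diameter e ^ 3
        * (L2norm (arc_measure e) (bdry_V d Y \<nu> \<T> e uh))\<^sup>2)
    + (\<Sum>e\<in>edges_on \<T> \<Gamma>f \<union> edges_on \<T> \<Gamma>s. diameter e
        * (L2norm (arc_measure e) (bdry_M d Y \<nu> \<T> e uh))\<^sup>2))"

definition osc_f ::
    "(real^2) set set \<Rightarrow> (real^2 \<Rightarrow> real) \<Rightarrow> (real^2 \<Rightarrow> real) \<Rightarrow> real" where
  "osc_f \<T> f fh =
    sqrt (\<Sum>K\<in>\<T>. ((diameter K)\<^sup>2 * L2norm (lebesgue_on K) (\<lambda>x. f x - fh x))\<^sup>2)"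

definition osc_g ::
    "(real^2) set set \<Rightarrow> (real^2) set \<Rightarrow> (real^2 \<Rightarrow> real)
      \<Rightarrow> ((real^2) set \<Rightarrow> real^2 \<Rightarrow> real) \<Rightarrow> real" where
  "osc_g \<T> S g gh =
    sqrt (\<Sum>e\<in>edges_S \<T> S.
      (diameter e powr (3/2) * L2norm (arc_measure e) (\<lambda>x. g x - gh e x))\<^sup>2)"

end

theory Submission
  imports Defs
begin

text \<open>The discrete solution solves the plate equation up to residuals: in the triangles, the element residual
  \<open>\<A>(u\<^sub>h) - f\<close>, and on the edges, the jumps of \<open>V\<^sub>n(u\<^sub>h)\<close> (minus \<open>g\<close> on \<open>S\<close>) and of \<open>M\<^sub>n\<^sub>n(u\<^sub>h)\<close>. For every
  \<open>v\<close> in the plate space, elementwise integration by parts turns \<open>a(u - u\<^sub>h, v)\<close> into the sum of these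
  residuals tested with \<open>v\<close>. The estimator is bounded from above by the error because each of its terms
  can be recovered by a well chosen test function \<open>v\<close> that lives on one triangle or on the two triangles at
  one edge: a smooth bump times the residual itself. Then the residual term is comparable with the square
  of the norm of the residual (equivalence of norms on polynomials of bounded degree), while
  \<open>a(u - u\<^sub>h, v)\<close> is at most a constant times the local \<open>H\<^sup>2\<close> seminorm of the error times the size of the
  second derivatives of \<open>v\<close>. Non-polynomial data \<open>f\<close> and \<open>g\<close> are replaced by \<open>f\<^sub>h\<close> and \<open>g\<^sub>h\<close> first, which
  costs the oscillation; the point load acts at a vertex, where these test functions vanish.

  The test functions are the restrictions of smooth functions on the plane to a patch of triangles,
  extended by zero. In a triangle \<open>K\<close>, the bump is supported in a square inside the inscribed ball. At an edge
  \<open>e\<close>, it is supported in a thin box around the middle half of \<open>e\<close>, so thin that each half of the box lies in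
  the triangle on that side. Hence the only part of \<open>\<partial>K\<close> that meets the support is \<open>e\<close>, and on it Green's
  formula is the one for a half-plane (\<open>plate_green\<close>): corner terms never appear. The two kinds of edge
  residuals are separated by parity in the normal coordinate \<open>t\<close>: for a bump that is even in \<open>t\<close> the normal
  derivative vanishes on \<open>e\<close>, so that only \<open>V\<^sub>n\<close> is seen; multiplied by \<open>t\<close>, the bump itself vanishes on \<open>e\<close>, so that
  only \<open>M\<^sub>n\<^sub>n\<close> is seen. The same choice makes the test functions admissible: on a free edge nothing is
  required, and on a simply supported edge only the function has to vanish.

  The identity behind all estimates is \<open>residual_bound\<close>. The lemmas \<open>element_estimate\<close>,
  \<open>moment_jump_estimate\<close> and \<open>shear_jump_estimate\<close> bound the three kinds of residuals on one triangle or
  one edge; their constants come from affine transformation to a reference square, where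
  \<open>inverse_estimate_interval\<close> compares the weighted \<open>L\<^sup>2\<close> norm of a polynomial with its maximum. Since each
  triangle has a bounded number of edges, the local bounds add up to the theorem.\<close>

section \<open>Smooth functions on the plane\<close>

lemma pd_eq: "(f has_derivative f') (at x) \<Longrightarrow> pd i f x = f' (axis i 1)"
  unfolding pd_def by (metis frechet_derivative_at)

lemma differentiable_pd:
  assumes "f differentiable (at (x::real^2))"
  shows "(f has_derivative (\<lambda>h. \<Sum>i\<in>UNIV. pd i f x * h $ i)) (at x)"
proof -
  let ?f' = "frechet_derivative f (at x)"
  have d: "(f has_derivative ?f') (at x)" using assms frechet_derivative_works by blast
  interpret linear ?f' using d has_derivative_linear by blast
  have "?f' h = (\<Sum>i\<in>UNIV. pd i f x * h $ i)" for h
  proof -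
    have "h = (\<Sum>i\<in>UNIV. (h $ i) *\<^sub>R axis i 1)"
      using basis_expansion[of h] by (simp add: scalar_mult_eq_scaleR)
    then have "?f' h = (\<Sum>i\<in>UNIV. (h $ i) *\<^sub>R ?f' (axis i 1))"
      by (metis (no_types, lifting) sum scale sum.cong)
    then show ?thesis by (simp add: pd_def mult.commute)
  qed
  then show ?thesis using d by (metis (no_types, lifting) ext)
qed

text \<open>Smoothness is a greatest fixed point: a class of differentiable functions that is closed under partial
  derivatives contains smooth functions only.\<close>

lemma smooth_coinduct:
  assumes "f \<in> \<F>" "\<And>f. f \<in> \<F> \<Longrightarrow> f differentiable_on UNIV" "\<And>f i. f \<in> \<F> \<Longrightarrow> pd i f \<in> \<F>"
  shows "smooth f"
proof -
  have "foldr pd is f \<in> \<F>" for "is" using assms by (induction "is") auto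
  then show ?thesis using assms(2) smooth_def by blast
qed

lemma smooth_differentiable: "smooth f \<Longrightarrow> f differentiable (at x)"
  unfolding smooth_def differentiable_on_def
  by (metis UNIV_I foldr.simps(1) id_apply)

lemma smooth_pd: assumes "smooth f" shows "smooth (pd i f)"
proof -
  have "foldr pd is (pd i f) = foldr pd (is @ [i]) f" for "is" by simp
  then show ?thesis using assms unfolding smooth_def by metis
qed

lemmas smooth_has_derivative = differentiable_pd[OF smooth_differentiable]

lemma smooth_continuous: "smooth f \<Longrightarrow> continuous_on S f"
  by (meson continuous_at_imp_continuous_on differentiable_imp_continuous_within smooth_differentiable)

lemma smooth_borel [measurable (raw)]: "smooth f \<Longrightarrow> f \<in> borel_measurable borel"
  by (simp add: borel_measurable_continuous_onI smooth_continuous)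

lemma pd_const [simp]: "pd i (\<lambda>x. c) = (\<lambda>x. 0)"
  by (rule ext) (rule pd_eq[where f' = "\<lambda>_. 0", THEN trans], auto)

lemma smooth_const [simp, intro]: "smooth (\<lambda>x. c)"
  by (rule smooth_coinduct[where \<F> = "{f. \<exists>c. f = (\<lambda>x. c)}"]) auto

lemma differentiable_pd_add:
  "f differentiable (at x) \<Longrightarrow> g differentiable (at x) \<Longrightarrow>
    pd i (\<lambda>x. f x + g x) x = pd i f x + pd i g x"
  using pd_eq[OF has_derivative_add[OF differentiable_pd[of f x] differentiable_pd[of g x]]]
  by (simp add: axis_def if_distrib cong: if_cong)

lemma differentiable_pd_mult:
  "f differentiable (at x) \<Longrightarrow> g differentiable (at x) \<Longrightarrow>
    pd i (\<lambda>x. f x * g x) x = pd i f x * g x + f x * pd i g x"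
  using pd_eq[OF has_derivative_mult[OF differentiable_pd[of f x] differentiable_pd[of g x]]]
  by (simp add: axis_def if_distrib cong: if_cong)

lemma pd_add: "smooth f \<Longrightarrow> smooth g \<Longrightarrow> pd i (\<lambda>x. f x + g x) = (\<lambda>x. pd i f x + pd i g x)"
  by (rule ext) (simp add: differentiable_pd_add smooth_differentiable)

lemma pd_mult: "smooth f \<Longrightarrow> smooth g \<Longrightarrow>
    pd i (\<lambda>x. f x * g x) = (\<lambda>x. pd i f x * g x + f x * pd i g x)"
  by (rule ext) (simp add: differentiable_pd_mult smooth_differentiable)

lemma smooth_add [intro]:
  assumes "smooth f" "smooth g" shows "smooth (\<lambda>x. f x + g x)"
proof (rule smooth_coinduct[where \<F> = "{h. \<exists>f g. smooth f \<and> smooth g \<and> h = (\<lambda>x. f x + g x)}"])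
  show "h differentiable_on UNIV" if "h \<in> {h. \<exists>f g. smooth f \<and> smooth g \<and> h = (\<lambda>x. f x + g x)}" for h
    using that by (auto simp: differentiable_on_def smooth_differentiable)
  show "pd i h \<in> {h. \<exists>f g. smooth f \<and> smooth g \<and> h = (\<lambda>x. f x + g x)}"
    if "h \<in> {h. \<exists>f g. smooth f \<and> smooth g \<and> h = (\<lambda>x. f x + g x)}" for h i
    using that pd_add smooth_pd unfolding mem_Collect_eq by metis
qed (use assms in blast)

text \<open>Products of smooth functions are not closed under partial derivatives, but sums of products are, by the
  Leibniz rule. This is the class to which \<open>smooth_coinduct\<close> is applied for \<open>smooth_mult\<close>.\<close>

inductive sum_of_smooth_products :: "(real^2 \<Rightarrow> real) \<Rightarrow> bool" where
  prod: "smooth f \<Longrightarrow> smooth g \<Longrightarrow> sum_of_smooth_products (\<lambda>x. f x * g x)"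
| add: "sum_of_smooth_products f \<Longrightarrow> sum_of_smooth_products g \<Longrightarrow>
    sum_of_smooth_products (\<lambda>x. f x + g x)"

lemma sum_of_smooth_products_pd:
  "sum_of_smooth_products h \<Longrightarrow>
    (\<forall>x. h differentiable (at x)) \<and> (\<forall>i. sum_of_smooth_products (pd i h))"
proof (induction rule: sum_of_smooth_products.induct)
  case (prod f g)
  then show ?case
    by (auto simp: pd_mult smooth_differentiable intro!: sum_of_smooth_products.intros smooth_pd)
next
  case (add f g)
  then have "pd i (\<lambda>x. f x + g x) = (\<lambda>x. pd i f x + pd i g x)" for i
    by (intro ext) (simp add: differentiable_pd_add)
  then show ?case using add by (auto intro: sum_of_smooth_products.intros)
qed

lemma smooth_mult [intro]:
  assumes "smooth f" "smooth g" shows "smooth (\<lambda>x. f x * g x)"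
  by (rule smooth_coinduct[where \<F> = "Collect sum_of_smooth_products"])
    (use assms sum_of_smooth_products_pd in
      \<open>auto simp: differentiable_on_def intro!: sum_of_smooth_products.prod\<close>)

lemma smooth_minus [intro]: "smooth f \<Longrightarrow> smooth (\<lambda>x. - f x)"
  using smooth_mult[of "\<lambda>x. -1" f] by simp

lemma pd_cmult: "smooth f \<Longrightarrow> pd i (\<lambda>x. c * f x) = (\<lambda>x. c * pd i f x)"
  using pd_mult[of "\<lambda>x. c" f i] by simp

lemma smooth_sum [intro]: "(\<And>k. k \<in> A \<Longrightarrow> smooth (f k)) \<Longrightarrow> smooth (\<lambda>x. \<Sum>k\<in>A. f k x)"
  by (induction A rule: infinite_finite_induct) auto

lemma pd_sum: "(\<And>k. k \<in> A \<Longrightarrow> smooth (f k)) \<Longrightarrow>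
    pd i (\<lambda>x. \<Sum>k\<in>A. f k x) = (\<lambda>x. \<Sum>k\<in>A. pd i (f k) x)"
  by (induction A rule: infinite_finite_induct) (auto simp: pd_add smooth_sum)

lemma pd_affine: "pd i (\<lambda>x. c \<bullet> x + d) = (\<lambda>x. c $ i)"
proof
  fix x
  have "((\<lambda>x. c \<bullet> x + d) has_derivative (\<lambda>h. c \<bullet> h)) (at x)"
    by (auto intro!: derivative_eq_intros)
  from pd_eq[OF this] show "pd i (\<lambda>x. c \<bullet> x + d) x = c $ i" by (simp add: inner_axis)
qed

lemma smooth_affine [intro]: "smooth (\<lambda>x. c \<bullet> x + d)"
  by (rule smooth_coinduct[where \<F> = "{f. (\<exists>c. f = (\<lambda>x. c)) \<or> (\<exists>c d. f = (\<lambda>x. c \<bullet> x + d))}"])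
    (auto simp: pd_affine differentiable_on_def)

lemma smooth_coord [intro]: "smooth (\<lambda>x. x $ i)"
  using smooth_affine[of "axis i 1" 0] by (simp add: inner_axis')

lemma differentiable_pd_comp:
  assumes "f differentiable (at (A *v x + b))"
  shows "((\<lambda>x. f (A *v x + b)) has_derivative
      (\<lambda>h. \<Sum>k\<in>UNIV. pd k f (A *v x + b) * (A *v h) $ k)) (at x)"
proof -
  have "((\<lambda>x. A *v x + b) has_derivative (\<lambda>h. A *v h)) (at x)"
    by (auto intro!: derivative_eq_intros bounded_linear_imp_has_derivative
        simp: matrix_vector_mul_bounded_linear)
  from has_derivative_compose[OF this differentiable_pd[OF assms]] show ?thesis by simp
qed

lemma pd_comp:
  "smooth f \<Longrightarrow> pd i (\<lambda>x. f (A *v x + b)) = (\<lambda>x. \<Sum>k\<in>UNIV. A $ k $ i * pd k f (A *v x + b))"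
  by (rule ext, rule pd_eq[OF differentiable_pd_comp, THEN trans])
    (auto simp: smooth_differentiable matrix_vector_mult_basis column_def mult.commute)

lemma smooth_comp [intro]:
  assumes "smooth f" shows "smooth (\<lambda>x. f (A *v x + b))"
proof -
  let ?F = "{g. \<exists>f. smooth f \<and> g = (\<lambda>x. f (A *v x + b))}"
  show ?thesis
  proof (rule smooth_coinduct[where \<F> = ?F])
    show "g differentiable_on UNIV" if "g \<in> ?F" for g
      using that differentiable_pd_comp smooth_differentiable
      unfolding differentiable_on_def differentiable_def by fastforce
    show "pd i g \<in> ?F" if "g \<in> ?F" for g i
    proof -
      from that obtain f where f: "smooth f" "g = (\<lambda>x. f (A *v x + b))" by auto
      have "pd i g = (\<lambda>x. (\<lambda>y. \<Sum>k\<in>UNIV. A $ k $ i * pd k f y) (A *v x + b))"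
        unfolding f(2) by (rule pd_comp[OF f(1)])
      moreover have "smooth (\<lambda>y. \<Sum>k\<in>UNIV. A $ k $ i * pd k f y)"
        by (intro smooth_sum smooth_mult smooth_const smooth_pd f)
      ultimately show ?thesis unfolding mem_Collect_eq by (intro exI conjI)
    qed
  qed (use assms in blast)
qed

section \<open>A smooth bump function\<close>

text \<open>The functions \<open>P(1/x) exp(-1/x)\<close>, extended by zero to \<open>x \<le> 0\<close>, contain the standard flat function and are closed
  under derivatives: the derivative belongs to the polynomial \<open>y\<^sup>2 (P - P')\<close> in \<open>y = 1/x\<close>.\<close>

definition flat_poly :: "real poly \<Rightarrow> real \<Rightarrow> real" where
  "flat_poly P x = (if x > 0 then poly P (1 / x) * exp (- (1 / x)) else 0)"

lemma poly_exp_tendsto_0: "((\<lambda>y. poly P y * exp (- y)) \<longlongrightarrow> 0) (at_top :: real filter)"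
proof -
  have "((\<lambda>y. \<Sum>i\<le>degree P. coeff P i * (y ^ i / exp y)) \<longlongrightarrow> (\<Sum>i\<le>degree P. coeff P i * 0)) at_top"
    by (intro tendsto_intros tendsto_power_div_exp_0)
  moreover have "(\<lambda>y. poly P y * exp (- y)) = (\<lambda>y. \<Sum>i\<le>degree P. coeff P i * (y ^ i / exp y))"
    by (rule ext) (simp add: poly_altdef sum_distrib_right exp_minus divide_inverse mult.assoc)
  ultimately show ?thesis by simp
qed

lemma flat_poly_derivative:
  "(flat_poly P has_real_derivative flat_poly (monom 1 2 * (P - pderiv P)) x) (at x)"
proof -
  consider "x > 0" | "x < 0" | "x = 0" by linarith
  then show ?thesis
  proof cases
    case 1
    have "((\<lambda>x. poly P (1 / x) * exp (- (1 / x))) has_real_derivative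
        flat_poly (monom 1 2 * (P - pderiv P)) x) (at x)"
      using 1 by (auto intro!: derivative_eq_intros DERIV_chain'[where g = "poly P", OF _ poly_DERIV]
          simp: flat_poly_def poly_monom field_simps power2_eq_square)
    moreover have "\<forall>\<^sub>F y in nhds x. y \<in> {0<..}" using 1 by (intro eventually_nhds_in_open) auto
    then have "\<forall>\<^sub>F y in nhds x. flat_poly P y = poly P (1 / y) * exp (- (1 / y))"
      by eventually_elim (simp add: flat_poly_def)
    ultimately show ?thesis by (subst DERIV_cong_ev[OF refl _ refl]) auto
  next
    case 2
    have "\<forall>\<^sub>F y in nhds x. y \<in> {..<0}" using 2 by (intro eventually_nhds_in_open) auto
    then have "\<forall>\<^sub>F y in nhds x. flat_poly P y = 0"
      by eventually_elim (simp add: flat_poly_def)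
    then show ?thesis using 2 by (subst DERIV_cong_ev[OF refl _ refl]) (auto simp: flat_poly_def)
  next
    case 3
    have l: "((\<lambda>h. flat_poly P h / h) \<longlongrightarrow> 0) (at_left 0)"
      by (rule tendsto_eventually) (auto simp: flat_poly_def eventually_at_filter)
    have "((\<lambda>h. (\<lambda>y. poly ([:0,1:] * P) y * exp (- y)) (inverse h)) \<longlongrightarrow> 0) (at_right 0)"
      by (rule filterlim_compose[OF poly_exp_tendsto_0 filterlim_inverse_at_top_right])
    moreover have "\<forall>\<^sub>F h in at_right 0. (\<lambda>y. poly ([:0,1:] * P) y * exp (- y)) (inverse h) = flat_poly P h / h"
      using eventually_at_right_less[of "0::real"]
      by eventually_elim (simp add: flat_poly_def divide_inverse)
    ultimately have "((\<lambda>h. flat_poly P h / h) \<longlongrightarrow> 0) (at_right 0)"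
      by (rule Lim_transform_eventually)
    then have "((\<lambda>h. flat_poly P h / h) \<longlongrightarrow> 0) (at 0)"
      using l unfolding filterlim_at_split by blast
    moreover have z: "flat_poly Q 0 = 0" for Q by (simp add: flat_poly_def)
    ultimately show ?thesis unfolding 3 DERIV_def z by (simp only: add_0 diff_zero)
  qed
qed

lemma flat_poly_pd:
  "((\<lambda>x. k * flat_poly P (c \<bullet> x + d)) has_derivative
     (\<lambda>h. k * (flat_poly (monom 1 2 * (P - pderiv P)) (c \<bullet> x + d) * (c \<bullet> h)))) (at x)"
proof -
  have "((\<lambda>x. c \<bullet> x + d) has_derivative (\<lambda>h. c \<bullet> h)) (at x)"
    by (auto intro!: derivative_eq_intros)
  from has_derivative_compose[OF this flat_poly_derivative[unfolded has_field_derivative_def]]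
  show ?thesis by (intro has_derivative_mult_right) simp
qed

lemma smooth_flat_poly: "smooth (\<lambda>x. k * flat_poly P (c \<bullet> x + d))"
proof (rule smooth_coinduct[where \<F> = "{f. \<exists>k P. f = (\<lambda>x. k * flat_poly P (c \<bullet> x + d))}"])
  show "pd i f \<in> {f. \<exists>k P. f = (\<lambda>x. k * flat_poly P (c \<bullet> x + d))}"
    if "f \<in> {f. \<exists>k P. f = (\<lambda>x. k * flat_poly P (c \<bullet> x + d))}" for f i
  proof -
    from that obtain k P where f: "f = (\<lambda>x. k * flat_poly P (c \<bullet> x + d))" by auto
    have "pd i f = (\<lambda>x. (k * (c $ i)) * flat_poly (monom 1 2 * (P - pderiv P)) (c \<bullet> x + d))"
      unfolding f by (rule ext, rule pd_eq[OF flat_poly_pd, THEN trans]) (simp add: inner_axis)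
    then show ?thesis by blast
  qed
qed (use flat_poly_pd in \<open>auto simp: differentiable_on_def differentiable_def\<close>, blast+)

definition flat :: "real \<Rightarrow> real" where "flat x = (if x > 0 then exp (- (1 / x)) else 0)"

lemma flat_eq: "flat = flat_poly 1" by (auto simp: flat_def flat_poly_def)

lemma smooth_flat [intro]: "smooth (\<lambda>x. flat (c \<bullet> x + d))"
  using smooth_flat_poly[of 1 1 c d] by (simp add: flat_eq)

lemma flat_bounds: "0 \<le> flat x" "flat x \<le> 1" and flat_pos_iff: "flat x > 0 \<longleftrightarrow> x > 0"
  and flat_zero: "x \<le> 0 \<Longrightarrow> flat x = 0"
  by (auto simp: flat_def)

lemma flat_continuous: "continuous_on S flat"
  unfolding flat_eq by (meson DERIV_continuous_on flat_poly_derivative has_field_derivative_at_within)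

text \<open>The bump is symmetric about \<open>1/2\<close>. The parity argument for the edge test functions depends on this.\<close>

definition bump :: "real \<Rightarrow> real" where "bump x = flat (x - 1/4) * flat (3/4 - x)"

lemma bump_bounds: "0 \<le> bump x" "bump x \<le> 1"
  unfolding bump_def using flat_bounds by (auto intro: mult_le_one)

lemma bump_pos: "1/4 < x \<Longrightarrow> x < 3/4 \<Longrightarrow> bump x > 0"
  unfolding bump_def using flat_pos_iff by simp

lemma bump_zero: "\<not> (1/4 < x \<and> x < 3/4) \<Longrightarrow> bump x = 0"
  unfolding bump_def using flat_zero by auto

lemma bump_sym: "bump (1/2 + t) = bump (1/2 - t)"
  unfolding bump_def by (simp add: mult.commute)

lemma bump_continuous: "continuous_on S bump"
  unfolding bump_def
  by (intro continuous_on_mult continuous_on_compose2[OF flat_continuous[of UNIV]] continuous_intros) auto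

lemma smooth_bump [intro]: "smooth (\<lambda>x. bump (c \<bullet> x + d))"
proof -
  have "smooth (\<lambda>x. flat (c \<bullet> x + (d - 1/4)) * flat ((- c) \<bullet> x + (3/4 - d)))"
    by (intro smooth_mult smooth_flat)
  then show ?thesis by (simp add: bump_def algebra_simps)
qed

section \<open>Integration by parts on half-planes\<close>

lemma perp_nth [simp]: "perp n $ 1 = - (n $ 2)" "perp n $ 2 = n $ 1"
  by (simp_all add: perp_def)

lemma inner_2: "(x::real^2) \<bullet> y = x $ 1 * y $ 1 + x $ 2 * y $ 2"
  by (simp add: inner_vec_def sum_2)

lemma norm_1_2: "norm (n::real^2) = 1 \<longleftrightarrow> n $ 1 * n $ 1 + n $ 2 * n $ 2 = 1"
  by (simp add: norm_eq_1 inner_2)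

lemma vec_eq_2: "(x::real^2) = y \<longleftrightarrow> x $ 1 = y $ 1 \<and> x $ 2 = y $ 2"
  by (simp add: vec_eq_iff forall_2)

lemma norm_perp [simp]: "norm (perp n) = norm n"
  by (simp add: norm_eq_sqrt_inner inner_2 algebra_simps)

lemma perp_inner [simp]: "n \<bullet> perp n = 0" "perp n \<bullet> n = 0"
  by (simp_all add: inner_2)

lemma perp_expansion:
  assumes "norm n = 1" shows "h = (h \<bullet> perp n) *\<^sub>R perp n + (h \<bullet> n) *\<^sub>R n"
  using assms unfolding norm_1_2 vec_eq_2 by (auto simp: inner_2) algebra+

text \<open>Cartesian coordinates with origin \<open>a\<close> and axes \<open>perp n\<close> and \<open>n\<close>: along a line with normal \<open>n\<close>, and across it.\<close>

definition frame :: "real^2 \<Rightarrow> real^2 \<Rightarrow> real \<times> real \<Rightarrow> real^2" where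
  "frame a n p = a + fst p *\<^sub>R perp n + snd p *\<^sub>R n"

lemma frame_measurable [measurable]: "frame a n \<in> borel_measurable borel"
  unfolding frame_def[abs_def] borel_prod[symmetric] by measurable

lemma Basis_2: "(Basis :: (real^2) set) = {axis 1 1, axis 2 1}"
  by (auto simp: Basis_vec_def) (metis exhaust_2)

lemma vector_2_continuous: "continuous_on UNIV (\<lambda>p::real\<times>real. vector [fst p, snd p] :: real^2)"
proof -
  have "(\<lambda>p::real\<times>real. vector [fst p, snd p] :: real^2) = (\<lambda>p. fst p *\<^sub>R axis 1 1 + snd p *\<^sub>R axis 2 1)"
    by (rule ext) (simp add: vec_eq_2 axis_def)
  then show ?thesis by (simp only:) (intro continuous_intros)
qed

lemma prod_Basis_2: "(\<Prod>b\<in>Basis. (x::real^2) \<bullet> b) = x $ 1 * x $ 2"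
proof -
  have "(axis 1 1 :: real^2) \<noteq> axis 2 1" by (simp add: axis_eq_axis)
  then show ?thesis unfolding Basis_2 by (simp add: inner_axis)
qed

lemma lborel_distr_vector_2:
  "distr lborel borel (\<lambda>p::real\<times>real. vector [fst p, snd p]) = (lborel :: (real^2) measure)"
proof (rule lborel_eqI[symmetric])
  fix l u :: "real^2" assume le: "\<And>b. b \<in> Basis \<Longrightarrow> l \<bullet> b \<le> u \<bullet> b"
  have [measurable]: "(\<lambda>p::real\<times>real. vector [fst p, snd p] :: real^2) \<in> borel_measurable borel"
    using vector_2_continuous by (rule borel_measurable_continuous_onI)
  have "l $ i \<le> u $ i" for i using le[of "axis i 1"] by (simp add: inner_axis)
  then have "emeasure lborel (box (l $ 1, l $ 2) (u $ 1, u $ 2)) = ennreal ((u $ 1 - l $ 1) * (u $ 2 - l $ 2))"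
    by (subst emeasure_lborel_box) (auto simp: Basis_prod_def prod.union_disjoint)
  moreover have "(\<lambda>p::real\<times>real. vector [fst p, snd p] :: real^2) -` box l u = box (l $ 1, l $ 2) (u $ 1, u $ 2)"
    by (auto simp: box_def Basis_prod_def Basis_2 inner_axis)
  ultimately show "emeasure (distr lborel borel (\<lambda>p::real\<times>real. vector [fst p, snd p])) (box l u) =
      ennreal (\<Prod>b\<in>Basis. (u - l) \<bullet> b)"
    by (simp add: emeasure_distr prod_Basis_2)
qed simp

lemma lborel_distr_orthogonal:
  fixes f :: "real^2 \<Rightarrow> real^2"
  assumes "orthogonal_transformation f" shows "distr lborel borel f = lborel"
proof (rule lborel_eqI[symmetric])
  fix l u :: "real^2" assume le: "\<And>b. b \<in> Basis \<Longrightarrow> l \<bullet> b \<le> u \<bullet> b"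
  have lin: "linear f" using assms by (simp add: orthogonal_transformation_linear)
  have [measurable]: "f \<in> borel_measurable borel"
    using lin by (simp add: borel_measurable_continuous_onI linear_continuous_on linear_conv_bounded_linear)
  obtain g where g: "orthogonal_transformation g" "\<And>x. f (g x) = x" "\<And>x. g (f x) = x"
    using assms orthogonal_transformation_inv orthogonal_transformation_bij
    by (metis bij_inv_eq_iff)
  have v: "f -` box l u = g ` box l u" 
    by (auto simp: image_iff) (metis g(3), simp add: g(2))
  have "measure lebesgue (g ` box l u) = measure lebesgue (box l u)"
    by (intro measure_orthogonal_image g) auto
  moreover have "g ` box l u \<in> lmeasurable" by (intro measurable_orthogonal_image g) auto
  moreover have gb: "g ` box l u \<in> sets borel" unfolding v[symmetric]
    using measurable_sets_borel[of f borel "box l u"] by simp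
  moreover have "emeasure lborel (g ` box l u) = emeasure lebesgue (g ` box l u)"
    using gb by simp
  ultimately have "emeasure lborel (g ` box l u) = emeasure lborel (box l u)"
    using emeasure_eq_measure2[of "g ` box l u" lebesgue] emeasure_eq_measure2[of "box l u" lebesgue]
    by simp
  then show "emeasure (distr lborel borel f) (box l u) = ennreal (\<Prod>b\<in>Basis. (u - l) \<bullet> b)"
    using le by (simp add: emeasure_distr v inner_diff_left)
qed simp

text \<open>Lebesgue measure is invariant under rigid motions, so that double integrals may be computed in the coordinates
  along and across any line.\<close>

lemma lborel_distr_frame:
  assumes "norm n = 1" shows "distr lborel borel (frame a n) = lborel"
proof -
  let ?R = "\<lambda>x::real^2. x $ 1 *\<^sub>R perp n + x $ 2 *\<^sub>R n"
  have lin: "linear ?R"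
    by (rule linearI) (auto simp: algebra_simps)
  have orth: "orthogonal_transformation ?R"
    unfolding orthogonal_transformation_def
  proof (intro conjI lin allI)
    fix v w show "?R v \<bullet> ?R w = v \<bullet> w"
      using assms unfolding norm_1_2 by (simp add: inner_2) algebra
  qed
  have [measurable]: "?R \<in> borel_measurable borel"
    using lin by (simp add: borel_measurable_continuous_onI linear_continuous_on linear_conv_bounded_linear)
  have [measurable]: "(\<lambda>p::real\<times>real. vector [fst p, snd p] :: real^2) \<in> borel_measurable borel"
    using vector_2_continuous by (rule borel_measurable_continuous_onI)
  have "frame a n = (+) a \<circ> (?R \<circ> (\<lambda>p. vector [fst p, snd p]))"
    by (auto simp: frame_def)
  then have "distr lborel borel (frame a n) =
      distr (distr (distr lborel borel (\<lambda>p. vector [fst p, snd p])) borel ?R) borel ((+) a)"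
    by (simp add: distr_distr)
  then show ?thesis
    by (simp add: lborel_distr_vector_2 lborel_distr_orthogonal[OF orth] lborel_distr_plus)
qed

lemma integral_frame:
  fixes f :: "real^2 \<Rightarrow> real"
  assumes "norm n = 1" "integrable lborel f"
  shows "integrable (lborel \<Otimes>\<^sub>M lborel) (\<lambda>(s, t). f (a + s *\<^sub>R perp n + t *\<^sub>R n))"
    and "(LINT x|lborel. f x) = (LINT s|lborel. LINT t|lborel. f (a + s *\<^sub>R perp n + t *\<^sub>R n))"
    and "(LINT x|lborel. f x) = (LINT t|lborel. LINT s|lborel. f (a + s *\<^sub>R perp n + t *\<^sub>R n))"
proof -
  have [measurable]: "f \<in> borel_measurable borel" using assms(2) by auto
  have "integrable (distr lborel borel (frame a n)) f"
    using assms by (simp add: lborel_distr_frame)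
  then have i: "integrable lborel (\<lambda>p. f (frame a n p))"
    by (subst (asm) integrable_distr_eq) auto
  then show i': "integrable (lborel \<Otimes>\<^sub>M lborel) (\<lambda>(s, t). f (a + s *\<^sub>R perp n + t *\<^sub>R n))"
    unfolding lborel_prod frame_def case_prod_beta .
  have "(LINT x|lborel. f x) = (LINT p|lborel. f (frame a n p))"
    using assms integral_distr[of "frame a n" lborel borel f] by (simp add: lborel_distr_frame)
  then have e: "(LINT x|lborel. f x) = (LINT p|(lborel \<Otimes>\<^sub>M lborel). (\<lambda>(s, t). f (a + s *\<^sub>R perp n + t *\<^sub>R n)) p)"
    unfolding lborel_prod frame_def case_prod_beta .
  show "(LINT x|lborel. f x) = (LINT s|lborel. LINT t|lborel. f (a + s *\<^sub>R perp n + t *\<^sub>R n))"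
    using e lborel_pair.integral_fst'[OF i'] by simp
  show "(LINT x|lborel. f x) = (LINT t|lborel. LINT s|lborel. f (a + s *\<^sub>R perp n + t *\<^sub>R n))"
    using e lborel_pair.integral_snd[OF i'] by simp
qed

lemma pd_cong_eventually:
  assumes "\<forall>\<^sub>F y in nhds x. f y = g y" shows "pd i f x = pd i g x"
proof -
  have "(f has_derivative f') (at x) \<longleftrightarrow> (g has_derivative f') (at x)" for f'
  proof -
    have "f x = g x" using assms eventually_nhds_x_imp_x by fast
    moreover have "\<forall>\<^sub>F y in at x. f y = g y" using assms eventually_nhds_conv_at by blast
    ultimately show ?thesis
      using has_derivative_transform_eventually[of f f' x UNIV g]
        has_derivative_transform_eventually[of g f' x UNIV f]
      by (auto simp: eq_commute)
  qed
  then show ?thesis by (simp add: pd_def frechet_derivative_def)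
qed

lemma eventually_zero_off_support:
  assumes "x \<notin> closure {y. f y \<noteq> 0}" shows "\<forall>\<^sub>F y in nhds x. f y = (0::real)"
proof -
  have "\<forall>\<^sub>F y in nhds x. y \<in> - closure {y. f y \<noteq> 0}"
    using assms by (intro eventually_nhds_in_open) auto
  then show ?thesis by (rule eventually_mono) (meson ComplD closure_subset mem_Collect_eq subsetD)
qed

lemma pd_zero_off_support: "x \<notin> closure {y. f y \<noteq> 0} \<Longrightarrow> pd i f x = 0"
  using pd_cong_eventually[OF eventually_zero_off_support, of x f i] by simp

lemma bounded_support_pd:
  assumes "bounded {x. f x \<noteq> (0::real)}" shows "bounded {x. pd i f x \<noteq> 0}"
  using pd_zero_off_support by (intro bounded_subset[OF bounded_closure[OF assms]]) blast

lemma integrable_bounded_support: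
  fixes f :: "real^2 \<Rightarrow> real"
  assumes "continuous_on UNIV f" "bounded {x. f x \<noteq> 0}"
  shows "integrable lborel f"
proof -
  let ?S = "closure {x. f x \<noteq> 0}"
  have "integrable lborel (\<lambda>x. indicator ?S x *\<^sub>R f x)"
    using assms by (intro borel_integrable_compact) (auto intro: continuous_on_subset)
  moreover have "(\<lambda>x. indicator ?S x *\<^sub>R f x) = f"
    using closure_subset[of "{x. f x \<noteq> 0}"] by (auto simp: indicator_def fun_eq_iff)
  ultimately show ?thesis by simp
qed

lemma line_derivative:
  assumes "smooth f"
  shows "((\<lambda>t. f (p + t *\<^sub>R v)) has_real_derivative
    (\<Sum>i\<in>UNIV. pd i f (p + t *\<^sub>R v) * v $ i)) (at t)"
proof -
  have "((\<lambda>t. p + t *\<^sub>R v) has_derivative (\<lambda>h. h *\<^sub>R v)) (at t)"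
    by (auto intro!: derivative_eq_intros)
  from has_derivative_compose[OF this smooth_has_derivative[OF assms]]
  show ?thesis
    unfolding has_field_derivative_def
    by (rule has_derivative_eq_rhs) (simp add: sum_distrib_left fun_eq_iff mult_ac)
qed

lemma continuous_line:
  "smooth f \<Longrightarrow> continuous_on UNIV (\<lambda>t. f (p + t *\<^sub>R v))"
  by (intro continuous_on_compose2[OF smooth_continuous[of f UNIV]] continuous_intros) auto

lemma integral_derivative_half_line:
  fixes g :: "real \<Rightarrow> real"
  assumes "\<And>t. (g has_real_derivative g' t) (at t)" "continuous_on UNIV g'"
    and "\<And>t. \<bar>t\<bar> > B \<Longrightarrow> g t = 0" "\<And>t. \<bar>t\<bar> > B \<Longrightarrow> g' t = 0"
  shows "(LINT t|lborel. indicator {..0} t * g' t) = g 0"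
    and "(LINT t|lborel. g' t) = 0"
proof -
  let ?B = "\<bar>B\<bar> + 1"
  have z': "- ?B \<le> t \<and> t \<le> ?B" if "g' t \<noteq> 0" for t
    using assms(4)[of t] that by linarith
  have c: "isCont g' t" for t using assms(2) by (simp add: continuous_on_eq_continuous_at)
  have "(LINT t|lborel. g' t * indicator {-?B..0} t) = g 0 - g (-?B)"
    by (rule integral_FTC_Icc_real) (use assms(1) c in auto)
  moreover have "(\<lambda>t. g' t * indicator {-?B..0} t) = (\<lambda>t. indicator {..0} t * g' t)"
    using z' by (auto simp: indicator_def fun_eq_iff)
  ultimately show "(LINT t|lborel. indicator {..0} t * g' t) = g 0"
    using assms(3)[of "-?B"] by simp
  have "(LINT t|lborel. g' t * indicator {-?B..?B} t) = g ?B - g (-?B)"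
    by (rule integral_FTC_Icc_real) (use assms(1) c in auto)
  moreover have "(\<lambda>t. g' t * indicator {-?B..?B} t) = g'"
    using z' by (auto simp: indicator_def fun_eq_iff)
  ultimately show "(LINT t|lborel. g' t) = 0"
    using assms(3)[of "-?B"] assms(3)[of ?B] by simp
qed

definition half_plane :: "real^2 \<Rightarrow> real^2 \<Rightarrow> (real^2) set" where
  "half_plane a n = {x. (x - a) \<bullet> n \<le> 0}"

lemma half_plane_borel [measurable]: "half_plane a n \<in> sets borel"
proof -
  have "closed (half_plane a n)"
    unfolding half_plane_def by (intro closed_Collect_le continuous_intros)
  then show ?thesis by (rule borel_closed)
qed

lemma integral_tangential_derivative:
  assumes "smooth f" "bounded {x. f x \<noteq> 0}" "norm n = 1"
  shows "(LINT s|lborel. (\<Sum>i\<in>UNIV. pd i f (a + s *\<^sub>R perp n) * perp n $ i)) = 0"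
proof -
  obtain B where B: "\<And>x. x \<in> closure {x. f x \<noteq> 0} \<Longrightarrow> norm x \<le> B"
    using bounded_closure[OF assms(2)] unfolding bounded_iff by blast
  have n: "norm (a + s *\<^sub>R perp n) > B" if "\<bar>s\<bar> > B + norm a" for s
    using that norm_triangle_ineq2[of "s *\<^sub>R perp n" "- a"] assms(3) by (simp add: add.commute)
  have z: "f (a + s *\<^sub>R perp n) = 0" "pd i f (a + s *\<^sub>R perp n) = 0" if "\<bar>s\<bar> > B + norm a" for s i
  proof -
    have "a + s *\<^sub>R perp n \<notin> closure {x. f x \<noteq> 0}" using n[OF that] B by fastforce
    then show "f (a + s *\<^sub>R perp n) = 0" "pd i f (a + s *\<^sub>R perp n) = 0"
      using pd_zero_off_support closure_subset[of "{x. f x \<noteq> 0}"] by auto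
  qed
  have "smooth (\<lambda>x. \<Sum>i\<in>UNIV. pd i f x * perp n $ i)"
    by (intro smooth_sum smooth_mult smooth_const smooth_pd assms)
  note sm = this
  show ?thesis
  proof (rule integral_derivative_half_line(2))
    show "((\<lambda>s. f (a + s *\<^sub>R perp n)) has_real_derivative
        (\<Sum>i\<in>UNIV. pd i f (a + s *\<^sub>R perp n) * perp n $ i)) (at s)" for s
      by (rule line_derivative[OF assms(1)])
    show "continuous_on UNIV (\<lambda>s. \<Sum>i\<in>UNIV. pd i f (a + s *\<^sub>R perp n) * perp n $ i)"
      by (rule continuous_line[OF sm])
    fix s :: real assume "\<bar>s\<bar> > B + norm a"
    then show "f (a + s *\<^sub>R perp n) = 0" "(\<Sum>i\<in>UNIV. pd i f (a + s *\<^sub>R perp n) * perp n $ i) = 0"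
      using z by auto
  qed
qed


text \<open>The gradient is split into its normal and its tangential part. The normal part is integrated along the normals of the
  boundary line and leaves the value on the line; the tangential part integrates to zero along each parallel of the line.\<close>

lemma divergence_half_plane:
  assumes F: "smooth F" "bounded {x. F x \<noteq> 0}" and n: "norm n = 1"
  shows "integrable lborel (\<lambda>x. indicator (half_plane a n) x * pd k F x)"
    and "(LINT x|lborel. indicator (half_plane a n) x * pd k F x) =
      n $ k * (LINT s|lborel. F (a + s *\<^sub>R perp n))"
proof -
  have ib: "integrable lborel (\<lambda>x. indicator (half_plane a n) x * f x)"
    if "continuous_on UNIV f" "bounded {x. f x \<noteq> 0}" for f :: "real^2 \<Rightarrow> real"
    using integrable_mult_indicator[OF _ integrable_bounded_support[OF that], of "half_plane a n"] by simp
  have b: "bounded {x. pd i F x \<noteq> 0}" for i using bounded_support_pd F(2) by blast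
  show int: "integrable lborel (\<lambda>x. indicator (half_plane a n) x * pd k F x)" for k
    by (intro ib b smooth_continuous smooth_pd F)
  define D where "D v x = (\<Sum>i\<in>UNIV. pd i F x * v $ i)" for v x
  have Dint: "integrable lborel (\<lambda>x. indicator (half_plane a n) x * D v x)" for v
    unfolding D_def sum_distrib_left mult.assoc[symmetric]
    by (intro Bochner_Integration.integrable_sum integrable_mult_left int)
  have decomp: "pd k F x = n $ k * D n x + perp n $ k * D (perp n) x" for x
  proof -
    have n2: "n $ 1 * n $ 1 + n $ 2 * n $ 2 = 1" using n norm_1_2 by blast
    have "k = 1 \<or> k = 2" by (rule exhaust_2)
    then show ?thesis 
    proof
      assume k: "k = 1"
      have "n $ k * D n x + perp n $ k * D (perp n) x = pd k F x * (n $ 1 * n $ 1 + n $ 2 * n $ 2)"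
        unfolding D_def sum_2 k perp_nth by (simp add: algebra_simps)
      then show ?thesis using n2 by simp
    next
      assume k: "k = 2"
      have "n $ k * D n x + perp n $ k * D (perp n) x = pd k F x * (n $ 1 * n $ 1 + n $ 2 * n $ 2)"
        unfolding D_def sum_2 k perp_nth by (simp add: algebra_simps)
      then show ?thesis using n2 by simp
    qed
  qed
  obtain B where B: "\<And>x. norm x > B \<Longrightarrow> F x = 0" "\<And>x i. norm x > B \<Longrightarrow> pd i F x = 0"
  proof -
    have "bounded (closure {x. F x \<noteq> 0})" using F by auto
    then obtain B where B: "\<And>x. x \<in> closure {x. F x \<noteq> 0} \<Longrightarrow> norm x \<le> B"
      by (auto simp: bounded_iff)
    have "x \<notin> closure {x. F x \<noteq> 0}" if "norm x > B" for x using B[of x] that by auto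
    then show thesis
      using pd_zero_off_support closure_subset[of "{x. F x \<noteq> 0}"]
      by (intro that[of B]) (auto simp: subset_iff)
  qed
  let ?L = "\<lambda>s t. a + s *\<^sub>R perp n + t *\<^sub>R n"
  have nt: "\<bar>t\<bar> \<le> norm (?L s t) + norm a \<and> \<bar>s\<bar> \<le> norm (?L s t) + norm a" for s t
  proof -
    have "(?L s t - a) \<bullet> n = t" "(?L s t - a) \<bullet> perp n = s"
      using n by (simp_all add: inner_add_left norm_eq_1[symmetric])
    then have "\<bar>t\<bar> \<le> norm (?L s t - a)" "\<bar>s\<bar> \<le> norm (?L s t - a)"
      using Cauchy_Schwarz_ineq2[of "?L s t - a" n] Cauchy_Schwarz_ineq2[of "?L s t - a" "perp n"] n
      by simp_all
    then show ?thesis using norm_triangle_ineq4[of "?L s t" a] by linarith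
  qed
  have z: "F (?L s t) = 0 \<and> D v (?L s t) = 0" if "\<bar>t\<bar> > B + norm a \<or> \<bar>s\<bar> > B + norm a" for s t v
  proof -
    have "norm (?L s t) > B" using that nt[of t s] nt[of s t] by linarith
    then show ?thesis using B by (simp add: D_def)
  qed
  have hp: "indicator (half_plane a n) (?L s t) = (indicator {..0} t :: real)" for s t
    using n by (auto simp: half_plane_def indicator_def inner_add_left norm_eq_1)
  have Dc: "smooth (D v)" for v unfolding D_def by (intro smooth_sum smooth_mult smooth_const smooth_pd F)
  have "(LINT x|lborel. indicator (half_plane a n) x * D n x)
      = (LINT s|lborel. LINT t|lborel. indicator {..0} t * D n (?L s t))"
    by (subst integral_frame(2)[OF n Dint, of _ a]) (simp add: hp)
  also have "\<dots> = (LINT s|lborel. F (a + s *\<^sub>R perp n))"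
  proof (rule Bochner_Integration.integral_cong[OF refl])
    fix s
    show "(LINT t|lborel. indicator {..0} t * D n (?L s t)) = F (a + s *\<^sub>R perp n)"
      using integral_derivative_half_line(1)[where g = "\<lambda>t. F (?L s t)" and g' = "\<lambda>t. D n (?L s t)"
          and B = "B + norm a"] z line_derivative[OF F(1), of "a + s *\<^sub>R perp n" n]
        continuous_line[OF Dc, of n "a + s *\<^sub>R perp n" n]
      by (auto simp: D_def)
  qed
  finally have 1: "(LINT x|lborel. indicator (half_plane a n) x * D n x) = (LINT s|lborel. F (a + s *\<^sub>R perp n))" .
  have "(LINT x|lborel. indicator (half_plane a n) x * D (perp n) x)
      = (LINT t|lborel. indicator {..0} t * (LINT s|lborel. D (perp n) (?L s t)))"
    by (subst integral_frame(3)[OF n Dint, of _ a]) (simp add: hp)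
  also have "\<dots> = (LINT t|lborel. indicator {..0::real} t * (0::real))"
  proof (rule Bochner_Integration.integral_cong[OF refl])
    fix t
    have e: "?L s t = (a + t *\<^sub>R n) + s *\<^sub>R perp n" for s by simp
    have "(LINT s|lborel. D (perp n) (?L s t)) = 0"
      unfolding e D_def by (rule integral_tangential_derivative[OF F n])
    then show "indicator {..0} t * (LINT s|lborel. D (perp n) (?L s t)) = indicator {..0} t * (0::real)" by simp
  qed
  finally have 2: "(LINT x|lborel. indicator (half_plane a n) x * D (perp n) x) = 0" by simp
  have "(\<lambda>x. indicator (half_plane a n) x * pd k F x) =
      (\<lambda>x. n $ k * (indicator (half_plane a n) x * D n x) + perp n $ k * (indicator (half_plane a n) x * D (perp n) x))"
    unfolding decomp by (simp add: algebra_simps)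
  then show "(LINT x|lborel. indicator (half_plane a n) x * pd k F x) =
      n $ k * (LINT s|lborel. F (a + s *\<^sub>R perp n))"
    using Dint 1 2 by simp
qed

section \<open>Green formula for the plate operator\<close>

lemma curvature_nth: "curvature \<D> w x $ i $ j = - (1/2) * (\<D> j (\<D> i w) x + \<D> i (\<D> j w) x)"
  by (simp add: curvature_def sym_part_def transpose_def)

lemma moment_nth: "moment \<D> d Y \<nu> w x $ i $ j =
   (d ^ 3 / 12) * ((Y / (1 + \<nu>)) * (- (1/2) * (\<D> j (\<D> i w) x + \<D> i (\<D> j w) x)
      + ((\<nu> / (1 - \<nu>)) * (\<Sum>k\<in>UNIV. - (1/2) * (\<D> k (\<D> k w) x + \<D> k (\<D> k w) x))) * (if i = j then 1 else 0)))"
  by (simp only: moment_def elasticity_def trace_def mat_def vector_scaleR_component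
      vector_add_component curvature_nth vec_lambda_beta real_scaleR_def)

lemma smooth_moment [intro]: "smooth p \<Longrightarrow> smooth (\<lambda>x. moment pd d Y \<nu> p x $ i $ j)"
  unfolding moment_nth
  by (intro smooth_mult smooth_const smooth_sum smooth_pd smooth_add)

lemma moment_sym: "moment \<D> d Y \<nu> p x $ i $ j = moment \<D> d Y \<nu> p x $ j $ i"
  by (simp add: moment_nth add.commute)

lemma smooth_shear [intro]: "smooth p \<Longrightarrow> smooth (\<lambda>x. shear d Y \<nu> p x $ i)"
  unfolding shear_def by (simp, intro smooth_sum smooth_pd smooth_moment)

lemma smooth_plate_op [intro]: "smooth p \<Longrightarrow> smooth (plate_op d Y \<nu> p)"
  unfolding plate_op_def[abs_def] by (intro smooth_minus smooth_sum smooth_pd smooth_shear)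

lemma M_nn_eq: "M_nn d Y \<nu> n p x = (\<Sum>i\<in>UNIV. \<Sum>j\<in>UNIV. n $ i * n $ j * moment pd d Y \<nu> p x $ i $ j)"
  by (simp add: M_nn_def inner_2 matrix_vector_mult_def sum_2 algebra_simps)

lemma M_ns_eq: "M_ns d Y \<nu> n p x = (\<Sum>i\<in>UNIV. \<Sum>j\<in>UNIV. perp n $ i * n $ j * moment pd d Y \<nu> p x $ i $ j)"
  by (simp add: M_ns_def inner_2 matrix_vector_mult_def sum_2 algebra_simps)

lemma smooth_M_nn [intro]: "smooth p \<Longrightarrow> smooth (M_nn d Y \<nu> n p)"
  unfolding M_nn_eq[abs_def] by (intro smooth_sum smooth_mult smooth_const smooth_moment)

lemma smooth_M_ns [intro]: "smooth p \<Longrightarrow> smooth (M_ns d Y \<nu> n p)"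
  unfolding M_ns_eq[abs_def] by (intro smooth_sum smooth_mult smooth_const smooth_moment)

lemma V_n_eq:
  assumes "smooth p"
  shows "V_n d Y \<nu> n p x = (\<Sum>i\<in>UNIV. n $ i * shear d Y \<nu> p x $ i)
      + (\<Sum>i\<in>UNIV. pd i (M_ns d Y \<nu> n p) x * perp n $ i)"
proof -
  have "frechet_derivative (M_ns d Y \<nu> n p) (at x) = (\<lambda>h. \<Sum>i\<in>UNIV. pd i (M_ns d Y \<nu> n p) x * h $ i)"
    by (rule frechet_derivative_at[OF smooth_has_derivative[OF smooth_M_ns[OF assms]], symmetric])
  then show ?thesis by (simp add: V_n_def Q_n_def inner_2 sum_2 mult.commute)
qed

lemma smooth_V_n [intro]: "smooth p \<Longrightarrow> smooth (V_n d Y \<nu> n p)"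
  by (subst ext[where f = "V_n d Y \<nu> n p", OF V_n_eq], assumption)
    (intro smooth_add smooth_sum smooth_mult smooth_const smooth_shear smooth_pd smooth_M_ns)

lemma moment_curvature:
  "moment pd d Y \<nu> p x \<bullet> curvature pd w x =
     - (\<Sum>i\<in>UNIV. \<Sum>j\<in>UNIV. moment pd d Y \<nu> p x $ i $ j * pd j (pd i w) x)"
  using moment_sym[of pd d Y \<nu> p x 1 2]
  by (simp add: inner_vec_def curvature_nth sum_2) (simp add: field_simps)

lemma bounded_support_mult: "bounded {x. w x \<noteq> 0} \<Longrightarrow> bounded {x. f x * w x \<noteq> (0::real)}"
  by (rule bounded_subset) auto

lemma bounded_line_support:
  assumes "bounded {x::real^2. f x \<noteq> (0::real)}" "norm v = 1"
  shows "bounded {s. f (a + s *\<^sub>R v) \<noteq> 0}"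
proof -
  obtain B where B: "\<And>x. f x \<noteq> 0 \<Longrightarrow> norm x \<le> B" using assms(1) by (auto simp: bounded_iff)
  have "\<bar>s\<bar> \<le> B + norm a" if "f (a + s *\<^sub>R v) \<noteq> 0" for s
    using B[OF that] norm_triangle_ineq2[of "s *\<^sub>R v" "- a"] assms(2) by (simp add: add.commute)
  then show ?thesis unfolding bounded_iff by (intro exI[of _ "B + norm a"]) auto
qed

lemma integrable_line:
  assumes "smooth f" "bounded {x. f x \<noteq> 0}" "norm v = 1"
  shows "integrable lborel (\<lambda>s. f (a + s *\<^sub>R v))"
proof -
  let ?g = "\<lambda>s. f (a + s *\<^sub>R v)"
  let ?S = "closure {s. ?g s \<noteq> 0}"
  have "integrable lborel (\<lambda>s. indicator ?S s *\<^sub>R ?g s)"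
    using bounded_line_support[OF assms(2,3)] continuous_line[OF assms(1)]
    by (intro borel_integrable_compact) (auto intro: continuous_on_subset)
  moreover have "(\<lambda>s. indicator ?S s *\<^sub>R ?g s) = ?g"
    using closure_subset[of "{s. ?g s \<noteq> 0}"] by (auto simp: indicator_def fun_eq_iff)
  ultimately show ?thesis by simp
qed

text \<open>Two integrations by parts produce the boundary terms \<open>Q\<^sub>n w\<close> and \<open>(M n) \<bullet> \<nabla>w\<close>. In the latter the gradient is split into
  its tangential and its normal part, and the tangential part is integrated by parts along the boundary line. This moves the
  tangential derivative to \<open>M\<^sub>n\<^sub>s\<close> and completes \<open>Q\<^sub>n\<close> to the Kirchhoff shear force \<open>V\<^sub>n\<close>. A line has no end points, so there are
  no corner forces.\<close>

lemma plate_green: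
  fixes a :: "real^2"
  assumes p: "smooth p" and w: "smooth w" "bounded {x. w x \<noteq> 0}" and n: "norm n = 1"
  defines "\<gamma> \<equiv> \<lambda>s. a + s *\<^sub>R perp n"
  shows "(LINT x|lborel. indicator (half_plane a n) x * (moment pd d Y \<nu> p x \<bullet> curvature pd w x)) =
    (LINT x|lborel. indicator (half_plane a n) x * (plate_op d Y \<nu> p x * w x))
    + (LINT s|lborel. V_n d Y \<nu> n p (\<gamma> s) * w (\<gamma> s))
    - (LINT s|lborel. M_nn d Y \<nu> n p (\<gamma> s) * (\<Sum>i\<in>UNIV. pd i w (\<gamma> s) * n $ i))"
proof -
  let ?H = "\<lambda>x. indicator (half_plane a n) x :: real"
  let ?m = "\<lambda>i j x. moment pd d Y \<nu> p x $ i $ j"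
  let ?q = "\<lambda>i x. shear d Y \<nu> p x $ i"
  note sm = smooth_pd smooth_moment[OF p] smooth_shear[OF p] w(1) smooth_mult
  note bs = bounded_support_mult[OF w(2)] bounded_support_mult[OF bounded_support_pd[OF w(2)]]
  define F where "F i j x = ?m i j x * pd i w x" for i j x
  define G where "G i x = ?q i x * w x" for i x
  have F: "smooth (F i j)" "bounded {x. F i j x \<noteq> 0}" for i j
    unfolding F_def by (intro sm, rule bs)
  have G: "smooth (G i)" "bounded {x. G i x \<noteq> 0}" for i
    unfolding G_def by (intro sm, rule bs)
  have Aint: "integrable lborel (\<lambda>x. ?H x * (plate_op d Y \<nu> p x * w x))"
  proof -
    have "integrable lborel (\<lambda>x. plate_op d Y \<nu> p x * w x)"
      by (intro integrable_bounded_support smooth_continuous smooth_mult smooth_plate_op p w bs)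
    from integrable_mult_indicator[OF _ this, of "half_plane a n"] show ?thesis by simp
  qed
  \<comment> \<open>The integrand as a divergence, after both applications of the product rule.\<close>
  have pointwise: "moment pd d Y \<nu> p x \<bullet> curvature pd w x =
      plate_op d Y \<nu> p x * w x + (\<Sum>i\<in>UNIV. pd i (G i) x) - (\<Sum>i\<in>UNIV. \<Sum>j\<in>UNIV. pd j (F i j) x)" for x
  proof -
    have "pd j (F i j) x = pd j (?m i j) x * pd i w x + ?m i j x * pd j (pd i w) x" for i j
      unfolding F_def by (subst pd_mult) (auto intro: sm)
    moreover have "pd i (G i) x = pd i (?q i) x * w x + ?q i x * pd i w x" for i
      unfolding G_def by (subst pd_mult) (auto intro: sm)
    moreover have "?q i x = pd 1 (?m i 1) x + pd 2 (?m i 2) x" for i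
      by (simp add: shear_def sum_2)
    ultimately show ?thesis
      unfolding moment_curvature plate_op_def sum_2 by (simp add: algebra_simps)
  qed
  have lhs: "(LINT x|lborel. ?H x * (moment pd d Y \<nu> p x \<bullet> curvature pd w x)) =
      (LINT x|lborel. ?H x * (plate_op d Y \<nu> p x * w x))
      + (\<Sum>i\<in>UNIV. n $ i * (LINT s|lborel. G i (\<gamma> s)))
      - (\<Sum>i\<in>UNIV. \<Sum>j\<in>UNIV. n $ j * (LINT s|lborel. F i j (\<gamma> s)))"
  proof -
    have "(\<lambda>x. ?H x * (moment pd d Y \<nu> p x \<bullet> curvature pd w x)) =
        (\<lambda>x. ?H x * (plate_op d Y \<nu> p x * w x) + (\<Sum>i\<in>UNIV. ?H x * pd i (G i) x)
          - (\<Sum>i\<in>UNIV. \<Sum>j\<in>UNIV. ?H x * pd j (F i j) x))"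
      unfolding pointwise right_diff_distrib distrib_left sum_distrib_left ..
    moreover have "integrable lborel (\<lambda>x. \<Sum>i\<in>UNIV. ?H x * pd i (G i) x)"
      by (intro Bochner_Integration.integrable_sum divergence_half_plane(1) G n)
    moreover have "integrable lborel (\<lambda>x. \<Sum>i\<in>UNIV. \<Sum>j\<in>UNIV. ?H x * pd j (F i j) x)"
      by (intro Bochner_Integration.integrable_sum divergence_half_plane(1) F n)
    moreover have "(LINT x|lborel. (\<Sum>i\<in>UNIV. ?H x * pd i (G i) x)) = (\<Sum>i\<in>UNIV. n $ i * (LINT s|lborel. G i (\<gamma> s)))"
      unfolding \<gamma>_def divergence_half_plane(2)[OF G n, symmetric]
      by (intro Bochner_Integration.integral_sum divergence_half_plane(1) G n)
    moreover have "(LINT x|lborel. (\<Sum>i\<in>UNIV. \<Sum>j\<in>UNIV. ?H x * pd j (F i j) x)) =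
        (\<Sum>i\<in>UNIV. \<Sum>j\<in>UNIV. n $ j * (LINT s|lborel. F i j (\<gamma> s)))"
      unfolding \<gamma>_def divergence_half_plane(2)[OF F n, symmetric]
      by (subst Bochner_Integration.integral_sum;
          intro sum.cong refl Bochner_Integration.integral_sum Bochner_Integration.integrable_sum
            divergence_half_plane(1) F n)
    ultimately show ?thesis using Aint by simp
  qed
  define T where "T x = (\<Sum>i\<in>UNIV. pd i w x * perp n $ i)" for x
  define N where "N x = (\<Sum>i\<in>UNIV. pd i w x * n $ i)" for x
  have grad: "pd i w x = T x * perp n $ i + N x * n $ i" for i x
    using exhaust_2[of i] perp_expansion[OF n, of "\<chi> i. pd i w x"]
    unfolding T_def N_def vec_eq_2 inner_2 sum_2 by auto
  have bT: "bounded {x. T x \<noteq> 0}" "bounded {x. N x \<noteq> 0}"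
    unfolding T_def N_def
    by (rule bounded_subset[OF bounded_Un[THEN iffD2, OF conjI[OF bounded_support_pd[OF w(2), of 1] bounded_support_pd[OF w(2), of 2]]]];
        auto simp: sum_2)+
  have sT: "smooth T" "smooth N" unfolding T_def N_def by (intro smooth_sum sm smooth_const)+
  have li: "integrable lborel (\<lambda>s. f (\<gamma> s))"
    if "smooth f" "bounded {x. f x \<noteq> 0}" "norm (perp n) = 1" for f
    unfolding \<gamma>_def by (rule integrable_line[OF that])
  have n': "norm (perp n) = 1" using n by simp
  have i1: "integrable lborel (\<lambda>s. M_ns d Y \<nu> n p (\<gamma> s) * T (\<gamma> s))"
    by (rule li[where f = "\<lambda>x. M_ns d Y \<nu> n p x * T x", OF _ _ n']) (intro smooth_mult smooth_M_ns p sT, rule bounded_support_mult[OF bT(1)])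
  have i2: "integrable lborel (\<lambda>s. M_nn d Y \<nu> n p (\<gamma> s) * N (\<gamma> s))"
    by (rule li[where f = "\<lambda>x. M_nn d Y \<nu> n p x * N x", OF _ _ n']) (intro smooth_mult smooth_M_nn p sT, rule bounded_support_mult[OF bT(2)])
  have iF: "integrable lborel (\<lambda>s. F i j (\<gamma> s))" for i j by (rule li[OF F n'])
  have iG: "integrable lborel (\<lambda>s. G i (\<gamma> s))" for i by (rule li[OF G n'])
  have mF: "(\<Sum>i\<in>UNIV. \<Sum>j\<in>UNIV. n $ j * (LINT s|lborel. F i j (\<gamma> s))) =
      (LINT s|lborel. M_ns d Y \<nu> n p (\<gamma> s) * T (\<gamma> s)) + (LINT s|lborel. M_nn d Y \<nu> n p (\<gamma> s) * N (\<gamma> s))"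
  proof -
    have "(\<Sum>i\<in>UNIV. \<Sum>j\<in>UNIV. n $ j * (LINT s|lborel. F i j (\<gamma> s))) =
        (LINT s|lborel. (\<Sum>i\<in>UNIV. \<Sum>j\<in>UNIV. n $ j * F i j (\<gamma> s)))"
      by (simp add: integral_sum iF)
    also have "(\<lambda>s. \<Sum>i\<in>UNIV. \<Sum>j\<in>UNIV. n $ j * F i j (\<gamma> s)) =
        (\<lambda>s. M_ns d Y \<nu> n p (\<gamma> s) * T (\<gamma> s) + M_nn d Y \<nu> n p (\<gamma> s) * N (\<gamma> s))"
      unfolding F_def M_ns_eq M_nn_eq sum_2 grad by (simp add: algebra_simps)
    finally show ?thesis using i1 i2 by simp
  qed
  \<comment> \<open>Tangential integration by parts: the derivative of a function of bounded support integrates to zero.\<close>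
  have tang: "(LINT s|lborel. M_ns d Y \<nu> n p (\<gamma> s) * T (\<gamma> s)) =
      - (LINT s|lborel. (\<Sum>i\<in>UNIV. pd i (M_ns d Y \<nu> n p) (\<gamma> s) * perp n $ i) * w (\<gamma> s))"
    (is "_ = - (LINT s|lborel. ?t (\<gamma> s) * w (\<gamma> s))")
  proof -
    have st: "smooth ?t" by (intro smooth_sum smooth_mult smooth_const smooth_pd smooth_M_ns p)
    have i3: "integrable lborel (\<lambda>s. ?t (\<gamma> s) * w (\<gamma> s))"
      by (rule li[where f = "\<lambda>x. ?t x * w x", OF _ _ n']) (intro smooth_mult st w, rule bounded_support_mult[OF w(2)])
    let ?P = "\<lambda>x. M_ns d Y \<nu> n p x * w x"
    have "(LINT s|lborel. (\<Sum>i\<in>UNIV. pd i ?P (\<gamma> s) * perp n $ i)) = 0"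
      unfolding \<gamma>_def
      by (rule integral_tangential_derivative[OF _ _ n])
        (intro smooth_mult smooth_M_ns p w, rule bounded_support_mult[OF w(2)])
    also have "(\<lambda>s. \<Sum>i\<in>UNIV. pd i ?P (\<gamma> s) * perp n $ i) =
        (\<lambda>s. ?t (\<gamma> s) * w (\<gamma> s) + M_ns d Y \<nu> n p (\<gamma> s) * T (\<gamma> s))"
      unfolding pd_mult[OF smooth_M_ns[OF p] w(1)] T_def sum_2 by (simp add: algebra_simps)
    finally show ?thesis using i1 i3 by simp
  qed
  have sQ: "integrable lborel (\<lambda>s. (\<Sum>i\<in>UNIV. pd i (M_ns d Y \<nu> n p) (\<gamma> s) * perp n $ i) * w (\<gamma> s))"
    by (rule li[where f = "\<lambda>x. (\<Sum>i\<in>UNIV. pd i (M_ns d Y \<nu> n p) x * perp n $ i) * w x", OF _ _ n'])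
      (intro smooth_mult smooth_sum smooth_const smooth_pd smooth_M_ns p w, rule bounded_support_mult[OF w(2)])
  have V: "(LINT s|lborel. V_n d Y \<nu> n p (\<gamma> s) * w (\<gamma> s)) = (\<Sum>i\<in>UNIV. n $ i * (LINT s|lborel. G i (\<gamma> s)))
      + (LINT s|lborel. (\<Sum>i\<in>UNIV. pd i (M_ns d Y \<nu> n p) (\<gamma> s) * perp n $ i) * w (\<gamma> s))"
  proof -
    have "(\<lambda>s. V_n d Y \<nu> n p (\<gamma> s) * w (\<gamma> s)) = (\<lambda>s. (\<Sum>i\<in>UNIV. n $ i * G i (\<gamma> s))
        + (\<Sum>i\<in>UNIV. pd i (M_ns d Y \<nu> n p) (\<gamma> s) * perp n $ i) * w (\<gamma> s))"
      by (rule ext) (simp only: V_n_eq[OF p] G_def sum_distrib_left distrib_right sum_2 mult.assoc)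
    then show ?thesis using sQ iG by (simp add: integral_sum)
  qed
  show ?thesis using lhs mF tang V unfolding N_def by simp
qed

section \<open>Test functions and weak derivatives\<close>

text \<open>Boxes form an intersection stable generator of the Borel sets. Therefore the measures whose densities are the positive and
  the negative part of \<open>w\<close> coincide, and so do the densities.\<close>

lemma AE_zero_if_integral_boxes_zero:
  fixes w :: "real^2 \<Rightarrow> real"
  assumes "integrable lebesgue w"
    and "\<And>a b. (LINT x|lebesgue. indicator (box a b) x * w x) = 0"
  shows "AE x in lebesgue. w x = 0"
proof -
  obtain w' where w': "w' \<in> borel_measurable lborel" "AE x in lborel. w x = w' x"
    using completion_ex_borel_measurable_real[of w lborel] assms(1) by auto
  have wm [measurable]: "w \<in> borel_measurable lebesgue" using assms(1) by auto
  have w'm [measurable]: "w' \<in> borel_measurable borel" using w'(1) by simp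
  have ae: "AE x in lebesgue. w x = w' x" using w'(2) by (rule AE_completion)
  have "integrable lebesgue w'"
    using assms(1) ae by (subst integrable_cong_AE[where g = w]) (auto simp: measurable_completion)
  then have int: "integrable lborel w'" by (simp add: integrable_completion)
  have box: "(LINT x|lborel. indicator (box a b) x * w' x) = 0" for a b
  proof -
    have "(LINT x|lborel. indicator (box a b) x * w' x) = (LINT x|lebesgue. indicator (box a b) x * w' x)"
      by (rule integral_completion[symmetric]) simp
    also have "\<dots> = (LINT x|lebesgue. indicator (box a b) x * w x)"
    proof (rule integral_cong_AE)
      show "(\<lambda>x. indicator (box a b) x * w' x) \<in> borel_measurable lebesgue"
        "(\<lambda>x. indicator (box a b) x * w x) \<in> borel_measurable lebesgue"
        by (intro borel_measurable_times borel_measurable_indicator wm, auto simp: measurable_completion)+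
    qed (use ae in auto)
    finally show ?thesis using assms(2) by simp
  qed
  let ?p = "\<lambda>x. ennreal (max 0 (w' x))" and ?n = "\<lambda>x. ennreal (max 0 (- w' x))"
  have ip: "integrable lborel (\<lambda>x. indicator (box a b) x * max 0 (w' x))"
    and iN: "integrable lborel (\<lambda>x. indicator (box a b) x * max 0 (- w' x))" for a b
  proof -
    have "integrable lborel (\<lambda>x. max 0 (w' x))" "integrable lborel (\<lambda>x. max 0 (- w' x))"
      using int by auto
    from this[THEN integrable_mult_indicator[rotated, of _ _ "box a b"]]
    show "integrable lborel (\<lambda>x. indicator (box a b) x * max 0 (w' x))"
      "integrable lborel (\<lambda>x. indicator (box a b) x * max 0 (- w' x))" by simp_all
  qed
  have ep: "emeasure (density lborel ?p) (box a b) = ennreal (LINT x|lborel. indicator (box a b) x * max 0 (w' x))"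
    and en: "emeasure (density lborel ?n) (box a b) = ennreal (LINT x|lborel. indicator (box a b) x * max 0 (- w' x))" for a b
  proof -
    have "emeasure (density lborel (\<lambda>x. ennreal (max 0 (h x)))) (box a b) =
        ennreal (LINT x|lborel. indicator (box a b) x * max 0 (h x))"
      if "h \<in> borel_measurable borel" "integrable lborel (\<lambda>x. indicator (box a b) x * max 0 (h x))" for h
    proof -
      have [measurable]: "h \<in> borel_measurable borel" by fact
      have "emeasure (density lborel (\<lambda>x. ennreal (max 0 (h x)))) (box a b) =
          (\<integral>\<^sup>+x. ennreal (max 0 (h x)) * indicator (box a b) x \<partial>lborel)"
        by (simp add: emeasure_density)
      also have "\<dots> = (\<integral>\<^sup>+x. ennreal (indicator (box a b) x * max 0 (h x)) \<partial>lborel)"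
        by (intro nn_integral_cong) (auto simp: indicator_def)
      also have "\<dots> = ennreal (LINT x|lborel. indicator (box a b) x * max 0 (h x))"
        using that(2) by (intro nn_integral_eq_integral) auto
      finally show ?thesis .
    qed
    from this[of w'] this[of "\<lambda>x. - w' x"]
    show "emeasure (density lborel ?p) (box a b) = ennreal (LINT x|lborel. indicator (box a b) x * max 0 (w' x))"
      "emeasure (density lborel ?n) (box a b) = ennreal (LINT x|lborel. indicator (box a b) x * max 0 (- w' x))"
      using ip iN by auto
  qed
  have diff: "(LINT x|lborel. indicator (box a b) x * max 0 (w' x)) = (LINT x|lborel. indicator (box a b) x * max 0 (- w' x))" for a b
  proof -
    have "(\<lambda>x. indicator (box a b) x * w' x) = (\<lambda>x. indicator (box a b) x * max 0 (w' x) - indicator (box a b) x * max 0 (- w' x))"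
      by (auto simp: indicator_def fun_eq_iff)
    then show ?thesis using box[of a b] ip[of a b] iN[of a b] by simp
  qed
  have "density lborel ?p = density lborel ?n"
  proof (rule measure_eqI_generator_eq)
    let ?E = "range (\<lambda>(a, b). box a b::(real^2) set)"
    show "Int_stable ?E"
      by (auto simp: Int_stable_def box_Int_box)
    show "?E \<subseteq> Pow UNIV" "sets (density lborel ?p) = sigma_sets UNIV ?E" "sets (density lborel ?n) = sigma_sets UNIV ?E"
      by (simp_all add: borel_eq_box)
    let ?A = "\<lambda>n::nat. box (- (real n *\<^sub>R One)) (real n *\<^sub>R One) :: (real^2) set"
    show "range ?A \<subseteq> ?E" "(\<Union>i. ?A i) = UNIV"
      unfolding UN_box_eq_UNIV by auto
    show "emeasure (density lborel ?p) (?A i) \<noteq> \<infinity>" for i by (simp add: ep)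
    show "emeasure (density lborel ?p) X = emeasure (density lborel ?n) X" if "X \<in> ?E" for X
      using that by (auto simp: ep en diff)
  qed
  then have "AE x in lborel. ?p x = ?n x"
    by (subst (asm) sigma_finite_measure.density_unique_iff) (auto simp: sigma_finite_lborel)
  then have "AE x in lborel. w' x = 0"
    by eventually_elim (auto simp: max_def split: if_splits)
  then have "AE x in lebesgue. w' x = 0" by (rule AE_completion)
  with ae show ?thesis by eventually_elim simp
qed

lemma test_functionsD:
  assumes "\<phi> \<in> test_functions \<Omega>"
  shows "smooth \<phi>" "bounded {x. \<phi> x \<noteq> 0}" "closure {x. \<phi> x \<noteq> 0} \<subseteq> \<Omega>" "\<And>x. x \<notin> \<Omega> \<Longrightarrow> \<phi> x = 0"
  using assms closure_subset[of "{x. \<phi> x \<noteq> 0}"] unfolding test_functions_def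
  by (auto dest: compact_imp_bounded intro: bounded_subset)

lemma test_functions_pd:
  assumes "\<phi> \<in> test_functions \<Omega>" shows "pd i \<phi> \<in> test_functions \<Omega>"
proof -
  have sub: "closure {x. pd i \<phi> x \<noteq> 0} \<subseteq> closure {x. \<phi> x \<noteq> 0}"
    using pd_zero_off_support by (intro closure_minimal) auto
  then show ?thesis
    using assms smooth_pd unfolding test_functions_def
    by (auto simp: compact_eq_bounded_closed intro: bounded_subset)
qed

lemma test_functions_mono: "U \<subseteq> \<Omega> \<Longrightarrow> \<phi> \<in> test_functions U \<Longrightarrow> \<phi> \<in> test_functions \<Omega>"
  by (auto simp: test_functions_def)

text \<open>Test functions that increase to the indicator function of a box as \<open>k\<close> tends to infinity.\<close>

definition box_bump :: "real^2 \<Rightarrow> real^2 \<Rightarrow> nat \<Rightarrow> real^2 \<Rightarrow> real" where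
  "box_bump a b k x = (\<Prod>i\<in>UNIV. flat (real k * (x $ i - a $ i)) * flat (real k * (b $ i - x $ i)))"

lemma box_bump_zero: assumes "x \<notin> box a b" shows "box_bump a b k x = 0"
proof -
  obtain i where "x $ i \<le> a $ i \<or> b $ i \<le> x $ i" using assms by (auto simp: mem_box_cart not_less)
  then have "flat (real k * (x $ i - a $ i)) * flat (real k * (b $ i - x $ i)) = 0"
    by (auto simp: flat_zero mult_nonneg_nonpos)
  then show ?thesis unfolding box_bump_def by (intro prod_zero) auto
qed

lemma smooth_box_bump: "smooth (box_bump a b k)"
proof -
  have 1: "smooth (\<lambda>x. flat (real k * (x $ i - a $ i)))" for i
    using smooth_flat[of "real k *\<^sub>R axis i 1" "- real k * a $ i"]
    by (simp add: inner_axis' algebra_simps)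
  have 2: "smooth (\<lambda>x. flat (real k * (b $ i - x $ i)))" for i
    using smooth_flat[of "- real k *\<^sub>R axis i 1" "real k * b $ i"]
    by (simp add: inner_axis' algebra_simps)
  show ?thesis
    unfolding box_bump_def[abs_def] by (simp add: UNIV_2) (intro smooth_mult 1 2)
qed

lemma box_bump_test: assumes "cbox a b \<subseteq> U" shows "box_bump a b k \<in> test_functions U"
proof -
  have "{x. box_bump a b k x \<noteq> 0} \<subseteq> cbox a b"
    using box_bump_zero box_subset_cbox by blast
  then have "closure {x. box_bump a b k x \<noteq> 0} \<subseteq> cbox a b" by (intro closure_minimal closed_cbox)
  then show ?thesis using assms smooth_box_bump
    by (auto simp: test_functions_def compact_eq_bounded_closed intro: bounded_subset[OF bounded_cbox])
qed

lemma flat_tendsto: assumes "x > 0" shows "(\<lambda>k. flat (real k * x)) \<longlonglongrightarrow> 1"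
proof -
  have "(\<lambda>k. exp (- (inverse (real k) * (1 / x)))) \<longlonglongrightarrow> exp (- (0 * (1 / x)))"
    by (intro tendsto_intros lim_inverse_n)
  moreover have "\<forall>\<^sub>F k in sequentially. exp (- (inverse (real k) * (1 / x))) = flat (real k * x)"
    using eventually_gt_at_top[of 0]
    by eventually_elim (use assms in \<open>simp add: flat_def field_simps\<close>)
  ultimately show ?thesis using Lim_transform_eventually by force
qed

lemma box_bump_tendsto: "(\<lambda>k. box_bump a b k x) \<longlonglongrightarrow> indicator (box a b) x"
proof (cases "x \<in> box a b")
  case True
  have "(\<lambda>k. box_bump a b k x) \<longlonglongrightarrow> (\<Prod>i\<in>(UNIV::2 set). 1 * 1)"
    unfolding box_bump_def using True
    by (intro tendsto_prod tendsto_mult flat_tendsto) (auto simp: mem_box_cart)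
  then show ?thesis using True by simp
qed (simp add: box_bump_zero)

lemma box_bump_bounds: "0 \<le> box_bump a b k x" "box_bump a b k x \<le> 1"
  unfolding box_bump_def
  by (auto intro!: prod_nonneg prod_le_1 mult_le_one mult_nonneg_nonneg flat_bounds)

text \<open>Testing with the functions \<open>box_bump\<close>, dominated convergence shows that the integral of \<open>w\<close> vanishes over all boxes in \<open>U\<close>,
  and \<open>U\<close> is a countable union of such boxes.\<close>

lemma fundamental_lemma:
  fixes w :: "real^2 \<Rightarrow> real"
  assumes w: "integrable lebesgue w" and U: "open U"
    and z: "\<And>\<phi>. \<phi> \<in> test_functions U \<Longrightarrow> (LINT x|lebesgue. w x * \<phi> x) = 0"
  shows "AE x in lebesgue. x \<in> U \<longrightarrow> w x = 0"
proof -
  have [measurable]: "w \<in> borel_measurable lebesgue" using w by auto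
  have b: "(LINT x|lebesgue. indicator (box a b) x * w x) = 0" if "cbox a b \<subseteq> U" for a b
  proof -
    have "(\<lambda>k. LINT x|lebesgue. w x * box_bump a b k x) \<longlonglongrightarrow> (LINT x|lebesgue. w x * indicator (box a b) x)"
    proof (rule integral_dominated_convergence[where w = "\<lambda>x. norm (w x)"])
      show "AE x in lebesgue. (\<lambda>k. w x * box_bump a b k x) \<longlonglongrightarrow> w x * indicator (box a b) x"
        by (intro AE_I2 tendsto_mult tendsto_const box_bump_tendsto)
      show "AE x in lebesgue. norm (w x * box_bump a b k x) \<le> norm (w x)" for k
        using box_bump_bounds[of a b k] by (intro AE_I2) (auto simp: abs_mult intro!: mult_left_le)
      show "(\<lambda>x. w x * box_bump a b k x) \<in> borel_measurable lebesgue" for k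
        using measurable_completion[of "box_bump a b k" lborel borel] smooth_borel[OF smooth_box_bump, of a b k]
        by simp
      show "(\<lambda>x. w x * indicator (box a b) x) \<in> borel_measurable lebesgue"
        by (intro borel_measurable_times borel_measurable_indicator) auto
    qed (use w in auto)
    then have "(\<lambda>k. 0) \<longlonglongrightarrow> (LINT x|lebesgue. w x * indicator (box a b) x)"
      using z[OF box_bump_test[OF that]] by simp
    then have "(LINT x|lebesgue. w x * indicator (box a b) x) = 0"
      using LIMSEQ_unique tendsto_const by blast
    then show ?thesis by (simp add: mult.commute)
  qed
  have ae_box: "AE x in lebesgue. x \<in> cbox c d \<longrightarrow> w x = 0" if cd: "cbox c d \<subseteq> U" for c d
  proof -
    let ?w = "\<lambda>x. indicator (box c d) x * w x"
    have i: "integrable lebesgue ?w" using integrable_mult_indicator[OF _ w, of "box c d"] by simp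
    have "(LINT x|lebesgue. indicator (box a b) x * ?w x) = 0" for a b
    proof -
      obtain e f where ef: "box a b \<inter> box c d = box e f" using box_Int_box by blast
      let ?e = "\<Sum>i\<in>Basis. max (a\<bullet>i) (c\<bullet>i) *\<^sub>R i" and ?f = "\<Sum>i\<in>Basis. min (b\<bullet>i) (d\<bullet>i) *\<^sub>R i"
      have "cbox ?e ?f \<subseteq> cbox c d" unfolding Int_interval[symmetric] by blast
      then have "(LINT x|lebesgue. indicator (box ?e ?f) x * w x) = 0" using b cd by blast
      moreover have "(\<lambda>x. indicator (box a b) x * ?w x) = (\<lambda>x. indicator (box ?e ?f) x * w x)"
        unfolding box_Int_box[symmetric] by (auto simp: indicator_def fun_eq_iff)
      ultimately show ?thesis by simp
    qed
    then have "AE x in lebesgue. ?w x = 0" by (rule AE_zero_if_integral_boxes_zero[OF i])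
    moreover have "AE x in lebesgue. x \<notin> cbox c d - box c d"
      using negligible_frontier_interval[of c d] negligible_iff_null_sets AE_not_in by blast
    ultimately show ?thesis by eventually_elim (auto simp: indicator_def)
  qed
  obtain \<D> where D: "countable \<D>" "\<D> \<subseteq> Pow U" "\<And>X. X \<in> \<D> \<Longrightarrow> \<exists>a b. X = cbox a b" "\<Union>\<D> = U"
    using open_countable_Union_open_cbox[OF U] by metis
  have "AE x in lebesgue. \<forall>X\<in>\<D>. x \<in> X \<longrightarrow> w x = 0"
    using D ae_box by (subst AE_ball_countable) (auto, blast)
  then show ?thesis by eventually_elim (use D(4) in auto)
qed

text \<open>Smoothness on an open set, for functions that need not be smooth elsewhere: notably smooth functions on a patch of
  triangles extended by zero.\<close>

definition locally_smooth :: "(real^2) set \<Rightarrow> (real^2 \<Rightarrow> real) \<Rightarrow> bool" where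
  "locally_smooth \<Omega> v \<longleftrightarrow> (\<forall>x\<in>\<Omega>. \<exists>g. smooth g \<and> (\<forall>\<^sub>F y in nhds x. v y = g y))"

lemma smooth_imp_locally_smooth: "smooth v \<Longrightarrow> locally_smooth \<Omega> v"
  unfolding locally_smooth_def by (blast intro: always_eventually)

lemma locally_smooth_pd: "locally_smooth \<Omega> v \<Longrightarrow> locally_smooth \<Omega> (pd i v)"
  unfolding locally_smooth_def
proof
  fix x assume l: "\<forall>x\<in>\<Omega>. \<exists>g. smooth g \<and> (\<forall>\<^sub>F y in nhds x. v y = g y)" and "x \<in> \<Omega>"
  then obtain g where g: "smooth g" "\<forall>\<^sub>F y in nhds x. v y = g y" by blast
  have "\<forall>\<^sub>F y in nhds x. \<forall>\<^sub>F z in nhds y. v z = g z" using g(2) by (simp add: eventually_eventually)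
  then have "\<forall>\<^sub>F y in nhds x. pd i v y = pd i g y" by eventually_elim (rule pd_cong_eventually)
  then show "\<exists>g. smooth g \<and> (\<forall>\<^sub>F y in nhds x. pd i v y = g y)" using g(1) smooth_pd by blast
qed

lemma locally_smooth_differentiable:
  assumes "locally_smooth \<Omega> v" "x \<in> \<Omega>" shows "v differentiable (at x)"
proof -
  obtain g where g: "smooth g" "\<forall>\<^sub>F y in nhds x. v y = g y" using assms by (auto simp: locally_smooth_def)
  obtain g' where "(g has_derivative g') (at x)" using smooth_has_derivative[OF g(1)] by blast
  moreover have "g x = v x" using g(2) eventually_nhds_x_imp_x by force
  moreover have "\<forall>\<^sub>F y in at x. g y = v y" using g(2) by (auto simp: eventually_nhds_conv_at elim: eventually_mono)
  ultimately show ?thesis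
    unfolding differentiable_def using has_derivative_transform_eventually[of g g' x UNIV v] by auto
qed

lemma locally_smooth_continuous_on: "locally_smooth \<Omega> v \<Longrightarrow> continuous_on \<Omega> v"
  by (meson continuous_at_imp_continuous_on differentiable_imp_continuous_within locally_smooth_differentiable)

lemma locally_smooth_UNIV: "locally_smooth UNIV v \<Longrightarrow> smooth v"
  by (rule smooth_coinduct[where \<F> = "Collect (locally_smooth UNIV)"])
    (auto simp: differentiable_on_def locally_smooth_pd intro: locally_smooth_differentiable)

lemma mult_test_function:
  assumes v: "locally_smooth \<Omega> v" and \<phi>: "\<phi> \<in> test_functions \<Omega>"
  shows "smooth (\<lambda>x. v x * \<phi> x)" "bounded {x. v x * \<phi> x \<noteq> 0}"
    "pd i (\<lambda>x. v x * \<phi> x) = (\<lambda>x. pd i v x * \<phi> x + v x * pd i \<phi> x)"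
proof -
  note t = test_functionsD[OF \<phi>]
  have z: "\<forall>\<^sub>F y in nhds x. v y * \<phi> y = 0" if "x \<notin> \<Omega>" for x
  proof -
    have "\<forall>\<^sub>F y in nhds x. \<phi> y = 0" using t(3) that by (intro eventually_zero_off_support) auto
    then show ?thesis by eventually_elim simp
  qed
  have "locally_smooth UNIV (\<lambda>x. v x * \<phi> x)"
    unfolding locally_smooth_def
  proof
    fix x
    show "\<exists>g. smooth g \<and> (\<forall>\<^sub>F y in nhds x. v y * \<phi> y = g y)"
    proof (cases "x \<in> \<Omega>")
      case True
      then obtain g where g: "smooth g" "\<forall>\<^sub>F y in nhds x. v y = g y" using v by (auto simp: locally_smooth_def)
      then show ?thesis using t(1)
        by (intro exI[of _ "\<lambda>x. g x * \<phi> x"]) (auto intro: smooth_mult elim: eventually_mono)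
    next
      case False
      then show ?thesis using z by (intro exI[of _ "\<lambda>x. 0"]) auto
    qed
  qed
  then show "smooth (\<lambda>x. v x * \<phi> x)" by (rule locally_smooth_UNIV)
  show "bounded {x. v x * \<phi> x \<noteq> 0}" using t(2) by (rule bounded_support_mult)
  show "pd i (\<lambda>x. v x * \<phi> x) = (\<lambda>x. pd i v x * \<phi> x + v x * pd i \<phi> x)"
  proof
    fix x
    show "pd i (\<lambda>x. v x * \<phi> x) x = pd i v x * \<phi> x + v x * pd i \<phi> x"
    proof (cases "x \<in> \<Omega>")
      case True
      then show ?thesis
        using locally_smooth_differentiable[OF v] smooth_differentiable[OF t(1)] differentiable_pd_mult by blast
    next
      case False
      then show ?thesis
        using pd_cong_eventually[OF z[OF False]] test_functionsD(4)[OF \<phi> False]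
          test_functionsD(4)[OF test_functions_pd[OF \<phi>] False] by simp
    qed
  qed
qed

lemma divergence_plane:
  assumes F: "smooth F" "bounded {x. F x \<noteq> 0}"
  shows "(LINT x|lborel. pd k F x) = 0"
proof -
  obtain B where B: "\<And>x. x \<in> closure {x. F x \<noteq> 0} \<Longrightarrow> norm x \<le> B"
    using bounded_closure[OF F(2)] unfolding bounded_iff by blast
  let ?n = "axis 1 1 :: real^2"
  let ?a = "(\<bar>B\<bar> + 1) *\<^sub>R ?n"
  have n: "norm ?n = 1" by simp
  have "F (?a + s *\<^sub>R perp ?n) = 0" for s
  proof (rule ccontr)
    assume "F (?a + s *\<^sub>R perp ?n) \<noteq> 0"
    then have "?a + s *\<^sub>R perp ?n \<in> closure {x. F x \<noteq> 0}"
      using closure_subset[of "{x. F x \<noteq> 0}"] by (simp add: subset_iff)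
    then have "norm (?a + s *\<^sub>R perp ?n) \<le> B" by (rule B)
    moreover have "(?a + s *\<^sub>R perp ?n) $ 1 = \<bar>B\<bar> + 1" by (simp add: axis_def)
    ultimately show False using component_le_norm_cart[of "?a + s *\<^sub>R perp ?n" 1] by linarith
  qed
  moreover have pk: "indicator (half_plane ?a ?n) x * pd k F x = pd k F x" for x
  proof (cases "x \<in> closure {x. F x \<noteq> 0}")
    case True
    then have "x $ 1 \<le> B" using B[OF True] component_le_norm_cart[of x 1] by linarith
    then have "x \<in> half_plane ?a ?n" by (simp add: half_plane_def inner_axis)
    then show ?thesis by simp
  qed (simp add: pd_zero_off_support)
  ultimately show ?thesis using divergence_half_plane(2)[OF F n, of ?a k] unfolding pk by simp
qed

lemma integral_lebesgue_on_borel: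
  fixes h :: "real^2 \<Rightarrow> real"
  assumes "\<Omega> \<in> sets lebesgue" "h \<in> borel_measurable borel" "\<And>x. x \<notin> \<Omega> \<Longrightarrow> h x = 0"
  shows "(LINT x|lebesgue_on \<Omega>. h x) = (LINT x|lborel. h x)"
    and "integrable lborel h \<Longrightarrow> integrable (lebesgue_on \<Omega>) h"
proof -
  have e: "(\<lambda>x. indicator \<Omega> x * h x) = h" using assms(3) by (auto simp: indicator_def fun_eq_iff)
  show "(LINT x|lebesgue_on \<Omega>. h x) = (LINT x|lborel. h x)"
    using assms by (subst integral_restrict_space) (auto simp: e integral_completion)
  show "integrable (lebesgue_on \<Omega>) h" if "integrable lborel h"
    using assms that by (subst integrable_restrict_space) (auto simp: e integrable_completion)
qed

text \<open>Multiplied by a test function, a function that is smooth on \<open>\<Omega>\<close> becomes smooth on the plane, and its derivatives integrate to zero.\<close>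

lemma weak_pd_classical:
  assumes O: "open \<Omega>" and v: "locally_smooth \<Omega> v" and \<phi>: "\<phi> \<in> test_functions \<Omega>"
  shows "(LINT x|lebesgue_on \<Omega>. v x * pd i \<phi> x) = - (LINT x|lebesgue_on \<Omega>. pd i v x * \<phi> x)"
proof -
  have Om: "\<Omega> \<in> sets lebesgue" using O by simp
  note m1 = mult_test_function[OF v test_functions_pd[OF \<phi>, of i]]
  note m2 = mult_test_function[OF locally_smooth_pd[OF v, of i] \<phi>]
  note m = mult_test_function[OF v \<phi>]
  have i1: "integrable lborel (\<lambda>x. v x * pd i \<phi> x)" and i2: "integrable lborel (\<lambda>x. pd i v x * \<phi> x)"
    by (intro integrable_bounded_support smooth_continuous m1 m2)+
  have "0 = (LINT x|lborel. pd i v x * \<phi> x + v x * pd i \<phi> x)"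
    using divergence_plane[OF m(1,2), of i] m(3) by simp
  also have "\<dots> = (LINT x|lborel. pd i v x * \<phi> x) + (LINT x|lborel. v x * pd i \<phi> x)"
    using i1 i2 by simp
  finally show ?thesis
    using test_functionsD(4)[OF \<phi>] test_functionsD(4)[OF test_functions_pd[OF \<phi>]]
      smooth_borel[OF m1(1)] smooth_borel[OF m2(1)]
    by (simp add: integral_lebesgue_on_borel[OF Om])
qed

lemma L2_mult_integrable:
  assumes "f \<in> L2 M" "g \<in> L2 M" shows "integrable M (\<lambda>x. f x * g x)"
proof (rule Bochner_Integration.integrable_bound[where f = "\<lambda>x. (f x)\<^sup>2 + (g x)\<^sup>2"])
  show "integrable M (\<lambda>x. (f x)\<^sup>2 + (g x)\<^sup>2)" "(\<lambda>x. f x * g x) \<in> borel_measurable M"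
    using assms by (auto simp: L2_def)
  show "AE x in M. norm (f x * g x) \<le> norm ((f x)\<^sup>2 + (g x)\<^sup>2)"
  proof (rule AE_I2)
    fix x
    have "2 * \<bar>f x * g x\<bar> \<le> (f x)\<^sup>2 + (g x)\<^sup>2"
      using sum_squares_bound[of "\<bar>f x\<bar>" "\<bar>g x\<bar>"] by (simp add: abs_mult)
    then show "norm (f x * g x) \<le> norm ((f x)\<^sup>2 + (g x)\<^sup>2)" by simp
  qed
qed

lemma L2_add: assumes "f \<in> L2 M" "g \<in> L2 M" shows "(\<lambda>x. f x + g x) \<in> L2 M"
proof -
  have "integrable M (\<lambda>x. (f x)\<^sup>2 + (g x)\<^sup>2 + 2 * (f x * g x))"
    using assms L2_mult_integrable[OF assms] by (auto simp: L2_def)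
  then show ?thesis using assms by (auto simp: L2_def power2_sum mult.assoc)
qed

lemma L2_cmult: "f \<in> L2 M \<Longrightarrow> (\<lambda>x. c * f x) \<in> L2 M"
  by (auto simp: L2_def power_mult_distrib)

lemma L2_diff: "f \<in> L2 M \<Longrightarrow> g \<in> L2 M \<Longrightarrow> (\<lambda>x. f x - g x) \<in> L2 M"
  using L2_add[of f M "\<lambda>x. - 1 * g x"] L2_cmult[of g M "-1"] by simp

lemma L2_bounded:
  assumes "finite_measure M" "f \<in> borel_measurable M" "\<And>x. x \<in> space M \<Longrightarrow> \<bar>f x\<bar> \<le> B"
  shows "f \<in> L2 M"
proof -
  have "integrable M (\<lambda>x. (f x)\<^sup>2)"
    using assms by (intro finite_measure.integrable_const_bound[OF assms(1), where B = "B\<^sup>2"] AE_I2)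
      (auto simp: power2_le_iff_abs_le abs_le_square_iff[symmetric] intro: order_trans[OF _ abs_ge_self])
  then show ?thesis using assms by (simp add: L2_def)
qed

lemma L2norm_nonneg [simp]: "0 \<le> L2norm M f"
  by (simp add: L2norm_def)

lemma L2norm_sq: "(L2norm M f)\<^sup>2 = (LINT x|M. (f x)\<^sup>2)"
  by (simp add: L2norm_def)

lemma L2_Cauchy_Schwarz:
  assumes "f \<in> L2 M" "g \<in> L2 M" shows "\<bar>LINT x|M. f x * g x\<bar> \<le> L2norm M f * L2norm M g"
proof -
  let ?a = "L2norm M f" and ?b = "L2norm M g"
  have i: "integrable M (\<lambda>x. (f x)\<^sup>2)" "integrable M (\<lambda>x. (g x)\<^sup>2)" "integrable M (\<lambda>x. f x * g x)"
    using assms L2_mult_integrable by (auto simp: L2_def)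
  have key: "2 * s * t * \<bar>LINT x|M. f x * g x\<bar> \<le> s\<^sup>2 * ?a\<^sup>2 + t\<^sup>2 * ?b\<^sup>2" if "s \<ge> 0" "t \<ge> 0" for s t
  proof -
    have eq: "(LINT x|M. (s * f x + c * t * g x)\<^sup>2) =
        s\<^sup>2 * ?a\<^sup>2 + (c * t)\<^sup>2 * ?b\<^sup>2 + 2 * s * (c * t) * (LINT x|M. f x * g x)" for c
    proof -
      have "(\<lambda>x. (s * f x + c * t * g x)\<^sup>2) =
          (\<lambda>x. s\<^sup>2 * (f x)\<^sup>2 + (c * t)\<^sup>2 * (g x)\<^sup>2 + 2 * s * (c * t) * (f x * g x))"
        by (simp add: power2_eq_square algebra_simps)
      then show ?thesis using i by (simp add: L2norm_sq)
    qed
    have "0 \<le> (LINT x|M. (s * f x + c * t * g x)\<^sup>2)" for c by simp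
    from this[of 1] this[of "-1"] show ?thesis
      unfolding eq by (auto simp: abs_if)
  qed
  show ?thesis
  proof (cases "?a > 0 \<and> ?b > 0")
    case True
    then have "2 * ?b * ?a * \<bar>LINT x|M. f x * g x\<bar> \<le> 2 * ?b * ?a * (?a * ?b)"
      using key[of ?b ?a] by (simp add: power2_eq_square algebra_simps)
    then show ?thesis using True by (simp add: mult_le_cancel_left_pos)
  next
    case False
    then have "?a = 0 \<or> ?b = 0" using L2norm_nonneg[of M f] L2norm_nonneg[of M g] by linarith
    then have "\<bar>LINT x|M. f x * g x\<bar> \<le> 0"
    proof
      assume "?a = 0"
      then have "2 * s * \<bar>LINT x|M. f x * g x\<bar> \<le> ?b\<^sup>2" if "s \<ge> 0" for s
        using key[of s 1] that by simp
      from this[of "(?b\<^sup>2 + 1) / (2 * \<bar>LINT x|M. f x * g x\<bar>)"] show ?thesis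
        by (cases "(LINT x|M. f x * g x) = 0") auto
    next
      assume "?b = 0"
      then have "2 * s * \<bar>LINT x|M. f x * g x\<bar> \<le> ?a\<^sup>2" if "s \<ge> 0" for s
        using key[of 1 s] that by simp
      from this[of "(?a\<^sup>2 + 1) / (2 * \<bar>LINT x|M. f x * g x\<bar>)"] show ?thesis
        by (cases "(LINT x|M. f x * g x) = 0") auto
    qed
    then show ?thesis using \<open>?a = 0 \<or> ?b = 0\<close> by auto
  qed
qed

lemma L2norm_add_sq:
  assumes "f \<in> L2 M" "g \<in> L2 M"
  shows "(L2norm M (\<lambda>x. f x + g x))\<^sup>2 \<le> 2 * (L2norm M f)\<^sup>2 + 2 * (L2norm M g)\<^sup>2"
proof -
  have "(LINT x|M. (f x + g x)\<^sup>2) \<le> (LINT x|M. 2 * (f x)\<^sup>2 + 2 * (g x)\<^sup>2)"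
  proof (rule integral_mono)
    show "(f x + g x)\<^sup>2 \<le> 2 * (f x)\<^sup>2 + 2 * (g x)\<^sup>2" for x
      using sum_squares_bound[of "f x" "g x"] by (simp add: power2_sum)
  qed (use assms L2_add[OF assms] in \<open>auto simp: L2_def\<close>)
  then show ?thesis using assms by (simp add: L2norm_sq L2_def)
qed

section \<open>Arc length\<close>

text \<open>The end points that the arc length measure selects. Fixing them gives every segment an orientation and hence a
  unit tangent \<open>arc_dir\<close> and a parametrization by arc length \<open>arc_point\<close>.\<close>

definition arc_ends :: "(real^2) set \<Rightarrow> (real^2) \<times> (real^2)" where
  "arc_ends e = (SOME (a, b). e = closed_segment a b)"

definition arc_start :: "(real^2) set \<Rightarrow> real^2" where "arc_start e = fst (arc_ends e)"

definition arc_dir :: "(real^2) set \<Rightarrow> real^2" where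
  "arc_dir e = (snd (arc_ends e) - fst (arc_ends e)) /\<^sub>R dist (fst (arc_ends e)) (snd (arc_ends e))"

definition arc_point :: "(real^2) set \<Rightarrow> real \<Rightarrow> real^2" where
  "arc_point e t = arc_start e + t *\<^sub>R arc_dir e"

definition arc_borel :: "(real^2) set \<Rightarrow> (real^2) measure" where
  "arc_borel e = distr (restrict_space lborel {0..diameter e}) (restrict_space borel e) (arc_point e)"

lemma diameter_closed_segment:
  fixes a b :: "real^2" shows "diameter (closed_segment a b) = dist a b"
proof (rule antisym)
  have "bounded (closed_segment a b)" by (simp add: compact_imp_bounded)
  then show "dist a b \<le> diameter (closed_segment a b)" by (intro diameter_bounded_bound) auto
  show "diameter (closed_segment a b) \<le> dist a b"
  proof (rule diameter_le)
    fix x y assume "x \<in> closed_segment a b" "y \<in> closed_segment a b"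
    then obtain u v where u: "x = (1 - u) *\<^sub>R a + u *\<^sub>R b" "0 \<le> u" "u \<le> 1"
      and v: "y = (1 - v) *\<^sub>R a + v *\<^sub>R b" "0 \<le> v" "v \<le> 1" by (auto simp: closed_segment_def)
    have "x - y = (u - v) *\<^sub>R (b - a)" unfolding u v by (simp add: algebra_simps)
    then have "norm (x - y) = \<bar>u - v\<bar> * dist a b" by (simp add: dist_norm norm_minus_commute)
    also have "\<dots> \<le> 1 * dist a b" using u v by (intro mult_right_mono) auto
    finally show "norm (x - y) \<le> dist a b" by simp
  qed auto
qed

lemma segment_arc_ends:
  assumes "is_segment e"
  shows "e = closed_segment (fst (arc_ends e)) (snd (arc_ends e))" "fst (arc_ends e) \<noteq> snd (arc_ends e)"
    "dist (fst (arc_ends e)) (snd (arc_ends e)) = diameter e" "diameter e > 0"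
    "norm (arc_dir e) = 1"
proof -
  obtain p q where pq: "p \<noteq> q" "e = closed_segment p q" using assms is_segment_def by auto
  have "(\<lambda>(a, b). e = closed_segment a b) (arc_ends e)"
    unfolding arc_ends_def by (rule someI[of _ "(p, q)"]) (use pq in auto)
  then show e: "e = closed_segment (fst (arc_ends e)) (snd (arc_ends e))" by (simp add: case_prod_beta)
  show ne: "fst (arc_ends e) \<noteq> snd (arc_ends e)"
  proof
    assume "fst (arc_ends e) = snd (arc_ends e)"
    then have "e = {fst (arc_ends e)}" using e by simp
    then have "p = fst (arc_ends e)" "q = fst (arc_ends e)"
      using pq(2) ends_in_segment[of p q] by blast+
    then show False using pq(1) by simp
  qed
  show d: "dist (fst (arc_ends e)) (snd (arc_ends e)) = diameter e"
    using arg_cong[OF e, of diameter] unfolding diameter_closed_segment by (rule sym)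
  show "diameter e > 0" using ne d by (metis zero_less_dist_iff)
  show "norm (arc_dir e) = 1" using ne by (simp add: arc_dir_def dist_norm norm_minus_commute)
qed

lemma segment_eq_arc_points:
  assumes "is_segment e" shows "e = arc_point e ` {0..diameter e}"
proof -
  note s = segment_arc_ends[OF assms]
  let ?a = "fst (arc_ends e)" and ?b = "snd (arc_ends e)" and ?L = "diameter e"
  have g: "arc_point e t = ?a + (t / ?L) *\<^sub>R (?b - ?a)" for t
    by (simp add: arc_point_def arc_start_def arc_dir_def s(3) divide_inverse)
  have "e = (\<lambda>u. ?a + u *\<^sub>R (?b - ?a)) ` {0..1}"
    using s(1) by (simp add: closed_segment_image_interval algebra_simps)
  also have "{0..1} = (\<lambda>t. t / ?L) ` {0..?L}"
    using s(4) by (auto simp: image_iff field_simps intro!: bexI[of _ "_ * ?L"])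
  finally show ?thesis by (simp add: image_image g)
qed

lemma arc_point_continuous: "continuous_on S (arc_point e)"
  unfolding arc_point_def by (intro continuous_intros)

lemma arc_point_inj: "is_segment e \<Longrightarrow> arc_point e s = arc_point e t \<longleftrightarrow> s = t"
  using segment_arc_ends(5)[of e] by (auto simp: arc_point_def)

lemma arc_point_in: "is_segment e \<Longrightarrow> t \<in> {0..diameter e} \<Longrightarrow> arc_point e t \<in> e"
  using segment_eq_arc_points by blast

lemma segment_compact: "is_segment e \<Longrightarrow> compact e"
  by (auto simp: is_segment_def)

lemma segment_borel: "is_segment e \<Longrightarrow> e \<in> sets borel"
  using segment_compact compact_imp_closed borel_closed by blast

lemma arc_measure_eq:
  assumes "is_segment e" shows "arc_measure e = completion (arc_borel e)"
proof -
  note s = segment_arc_ends[OF assms]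
  have "arc_measure e = (case arc_ends e of (a, b) \<Rightarrow> completion
         (distr (restrict_space lborel {0..dist a b}) (restrict_space borel e)
           (\<lambda>t. a + (t / dist a b) *\<^sub>R (b - a))))"
    by (simp add: arc_measure_def arc_ends_def Let_def)
  also have "\<dots> = completion (arc_borel e)"
    by (simp add: case_prod_beta s(3) arc_borel_def arc_point_def[abs_def] arc_start_def arc_dir_def divide_inverse)
  finally show ?thesis .
qed

lemma arc_point_measurable [measurable]:
  assumes "is_segment e"
  shows "arc_point e \<in> restrict_space lborel {0..diameter e} \<rightarrow>\<^sub>M restrict_space borel e"
proof (rule measurable_restrict_space2)
  show "arc_point e \<in> space (restrict_space lborel {0..diameter e}) \<rightarrow> e"
    using arc_point_in[OF assms] by (auto simp: space_restrict_space)
  have "arc_point e \<in> borel_measurable borel"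
    by (intro borel_measurable_continuous_onI arc_point_continuous)
  then show "arc_point e \<in> borel_measurable (restrict_space lborel {0..diameter e})"
    by (intro measurable_restrict_space1) simp
qed

lemma space_arc [simp]: "space (arc_borel e) = e" "sets (arc_borel e) = sets (restrict_space borel e)"
  by (auto simp: arc_borel_def space_restrict_space)

lemma space_arc_measure: "is_segment e \<Longrightarrow> space (arc_measure e) = e"
  by (simp add: arc_measure_eq)

lemma finite_arc_borel: assumes "is_segment e" shows "finite_measure (arc_borel e)"
proof (rule finite_measureI)
  have "emeasure (arc_borel e) e = emeasure (restrict_space lborel {0..diameter e}) (arc_point e -` e \<inter> {0..diameter e})"
    unfolding arc_borel_def using arc_point_measurable[OF assms] segment_borel[OF assms]
    by (subst emeasure_distr) (auto simp: sets_restrict_space space_restrict_space)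
  also have "arc_point e -` e \<inter> {0..diameter e} = {0..diameter e}" using arc_point_in[OF assms] by auto
  finally show "emeasure (arc_borel e) (space (arc_borel e)) \<noteq> \<infinity>"
    using segment_arc_ends(4)[OF assms] by (simp add: emeasure_restrict_space)
qed

lemma finite_arc_measure: assumes "is_segment e" shows "finite_measure (arc_measure e)"
proof (rule finite_measureI)
  have "emeasure (arc_borel e) e \<noteq> \<infinity>"
    using finite_measure.emeasure_finite[OF finite_arc_borel[OF assms]] by auto
  moreover have "e \<in> sets (arc_borel e)" using sets.top[of "arc_borel e"] by simp
  ultimately show "emeasure (arc_measure e) (space (arc_measure e)) \<noteq> \<infinity>"
    using assms by (simp add: arc_measure_eq)
qed

lemma arc_measurable_continuous:
  assumes "is_segment e" "continuous_on e h" shows "h \<in> borel_measurable (arc_borel e)"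
  using borel_measurable_continuous_on_restrict[OF assms(2)]
  by (simp add: arc_borel_def)

lemma arc_measurable: "is_segment e \<Longrightarrow> h \<in> borel_measurable (arc_borel e) \<Longrightarrow> h \<in> borel_measurable (arc_measure e)"
  by (simp add: arc_measure_eq measurable_completion)

lemma arc_L2_continuous:
  fixes h :: "real^2 \<Rightarrow> real"
  assumes "is_segment e" "continuous_on e h" shows "h \<in> L2 (arc_measure e)"
proof -
  have "compact (h ` e)" using assms segment_compact compact_continuous_image by blast
  then obtain B where "\<And>x. x \<in> e \<Longrightarrow> \<bar>h x\<bar> \<le> B"
    using compact_imp_bounded[of "h ` e"] unfolding bounded_iff by auto
  then show ?thesis
    using assms by (intro L2_bounded[OF finite_arc_measure, where B = B] arc_measurable arc_measurable_continuous)
      (auto simp: space_arc_measure)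
qed

lemma arc_integral:
  fixes h :: "real^2 \<Rightarrow> real"
  assumes "is_segment e" "continuous_on e h"
  shows "(LINT x|arc_measure e. h x) = (LINT t|lborel. indicator {0..diameter e} t * h (arc_point e t))"
proof -
  note m = arc_measurable_continuous[OF assms]
  have m': "h \<in> borel_measurable (restrict_space borel e)" using m by (simp add: arc_borel_def)
  have "(LINT x|arc_measure e. h x) = (LINT x|arc_borel e. h x)"
    by (simp add: arc_measure_eq[OF assms(1)] integral_completion[OF m])
  also have "\<dots> = (LINT t|restrict_space lborel {0..diameter e}. h (arc_point e t))"
    unfolding arc_borel_def by (rule integral_distr[OF arc_point_measurable[OF assms(1)] m'])
  also have "\<dots> = (LINT t|lborel. indicator {0..diameter e} t * h (arc_point e t))"
    by (subst integral_restrict_space) auto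
  finally show ?thesis .
qed

text \<open>Points have arc length zero. Boundary conditions that are violated only at the end points of boundary
  parts are therefore satisfied almost everywhere.\<close>

lemma arc_AE_finite:
  assumes e: "is_segment e" and fin: "finite {x \<in> e. \<not> P x}" shows "AE x in arc_measure e. P x"
proof -
  let ?N = "{x \<in> e. \<not> P x}" and ?L = "diameter e"
  have sN: "?N \<in> sets (restrict_space borel e)"
    using fin segment_borel[OF e] by (auto simp: sets_restrict_space intro!: image_eqI[of _ _ ?N] finite_imp_closed borel_closed)
  have "finite (arc_point e -` ?N)"
    by (intro finite_vimageI fin injI) (simp add: arc_point_inj[OF e])
  then have "finite (arc_point e -` ?N \<inter> {0..?L})" by blast
  then have "emeasure lborel (arc_point e -` ?N \<inter> {0..?L}) = 0"
    by (intro emeasure_lborel_countable countable_finite)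
  then have "emeasure (arc_borel e) ?N = 0"
    unfolding arc_borel_def using arc_point_measurable[OF e] sN
    by (subst emeasure_distr) (auto simp: emeasure_restrict_space space_restrict_space)
  then have "AE x in arc_borel e. P x"
    using sN by (intro AE_I[where N = ?N]) auto
  then show ?thesis unfolding arc_measure_eq[OF e] by (rule AE_completion)
qed

lemma emeasure_lborel_affine_image:
  fixes A :: "real set"
  assumes "A \<in> sets borel" "c = 1 \<or> c = -1"
  shows "emeasure lborel ((\<lambda>t. s + c * t) -` A) = emeasure lborel A"
proof -
  have "lborel = density (distr lborel borel (\<lambda>x. s + c *\<^sub>R x)) (\<lambda>_. \<bar>c\<bar> ^ DIM(real))"
    using assms(2) by (intro lborel_affine) auto
  moreover have "\<bar>c\<bar> ^ DIM(real) = 1" using assms(2) by auto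
  ultimately have "lborel = distr lborel borel (\<lambda>x. s + c * x)"
    by (simp add: density_1 one_ennreal_def[symmetric])
  then have "emeasure lborel A = emeasure (distr lborel borel (\<lambda>x. s + c * x)) A" by simp
  then show ?thesis using assms(1) by (simp add: emeasure_distr)
qed

text \<open>Both parametrizations by arc length run along the same line with unit speed, so that they differ by a shift and possibly
  a reflection, and both preserve Lebesgue measure.\<close>

lemma arc_borel_subsegment:
  assumes e: "is_segment e" and S: "is_segment S" and sub: "e \<subseteq> S"
  shows "arc_borel e = restrict_space (arc_borel S) e"
proof (rule measure_eqI)
  have eS: "sets (restrict_space (arc_borel S) e) = sets (restrict_space borel e)"
    using sub by (simp add: sets_restrict_space image_image Int_absorb2 inf.assoc[symmetric] cong: image_cong_simp)
  then show "sets (arc_borel e) = sets (restrict_space (arc_borel S) e)" by simp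
  let ?L = "diameter e" and ?M = "diameter S"
  have dir: "\<exists>c. (c = 1 \<or> c = -1) \<and> arc_dir e = c *\<^sub>R arc_dir S"
  proof -
    have "arc_point e 0 \<in> S" "arc_point e ?L \<in> S"
      using arc_point_in[OF e] segment_arc_ends(4)[OF e] sub by auto
    then obtain s t where st: "arc_point e 0 = arc_point S s" "arc_point e ?L = arc_point S t"
      using segment_eq_arc_points[OF S] by (metis image_iff)
    have "arc_point e ?L - arc_point e 0 = (t - s) *\<^sub>R arc_dir S"
      unfolding st by (simp add: arc_point_def algebra_simps)
    then have 1: "?L *\<^sub>R arc_dir e = (t - s) *\<^sub>R arc_dir S" by (simp add: arc_point_def)
    have L: "?L > 0" using segment_arc_ends[OF e] by simp
    have "norm (?L *\<^sub>R arc_dir e) = norm ((t - s) *\<^sub>R arc_dir S)" using 1 by simp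
    then have "?L = \<bar>t - s\<bar>" using segment_arc_ends(5)[OF e] segment_arc_ends(5)[OF S] L by simp
    then have "(t - s) / ?L = 1 \<or> (t - s) / ?L = -1" 
      using L by (simp add: abs_if field_simps split: if_splits)
    moreover have "arc_dir e = ((t - s) / ?L) *\<^sub>R arc_dir S"
    proof -
      have "arc_dir e = (1 / ?L) *\<^sub>R (?L *\<^sub>R arc_dir e)" using L by simp
      also have "\<dots> = ((t - s) / ?L) *\<^sub>R arc_dir S" unfolding 1 by simp
      finally show ?thesis .
    qed
    ultimately show ?thesis by blast
  qed
  then obtain c where c: "c = 1 \<or> c = -1" "arc_dir e = c *\<^sub>R arc_dir S" by blast
  have "arc_start e \<in> S" using arc_point_in[OF e, of 0] segment_arc_ends(4)[OF e] sub by (auto simp: arc_point_def)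
  then obtain s0 where s0: "arc_start e = arc_point S s0" using segment_eq_arc_points[OF S] by (metis image_iff)
  have pt: "arc_point e t = arc_point S (s0 + c * t)" for t
    unfolding arc_point_def[of e] s0 c(2) by (simp add: arc_point_def algebra_simps)
  fix A assume "A \<in> sets (arc_borel e)"
  then have A: "A \<in> sets (restrict_space borel e)" by simp
  then have Ae: "A \<subseteq> e" "A \<in> sets borel" using segment_borel[OF e] by (auto simp: sets_restrict_space)
  have AS: "A \<in> sets (restrict_space borel S)"
    using Ae sub by (auto simp: sets_restrict_space intro!: image_eqI[of _ _ A])
  have em: "emeasure (arc_borel e') A = emeasure lborel (arc_point e' -` A)" 
    if "is_segment e'" "A \<in> sets (restrict_space borel e')" "A \<subseteq> e'" for e'
  proof -
    have sub0: "arc_point e' -` A \<subseteq> {0..diameter e'}"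
    proof
      fix t assume "t \<in> arc_point e' -` A"
      then have "arc_point e' t \<in> arc_point e' ` {0..diameter e'}" using that(3) segment_eq_arc_points[OF that(1)] by blast
      then show "t \<in> {0..diameter e'}" using arc_point_inj[OF that(1)] by auto
    qed
    from sub0 have "arc_point e' -` A \<inter> {0..diameter e'} = arc_point e' -` A" by blast
    then show ?thesis
      unfolding arc_borel_def using arc_point_measurable[OF that(1)] that(2)
      by (subst emeasure_distr) (use sub0 in \<open>simp_all add: emeasure_restrict_space space_restrict_space\<close>)
  qed
  have "arc_point S \<in> borel_measurable borel" by (intro borel_measurable_continuous_onI arc_point_continuous)
  then have b: "arc_point S -` A \<in> sets borel" using measurable_sets_borel Ae(2) by blast
  have "arc_point e -` A = (\<lambda>t. s0 + c * t) -` (arc_point S -` A)" by (auto simp: pt)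
  then have "emeasure (arc_borel e) A = emeasure (arc_borel S) A"
    using em[OF e A Ae(1)] em[OF S AS] Ae(1) sub emeasure_lborel_affine_image[OF b c(1)] by auto
  also have "\<dots> = emeasure (restrict_space (arc_borel S) e) A"
    using Ae segment_borel[OF e] sub
    by (subst emeasure_restrict_space) (auto simp: sets_restrict_space intro!: image_eqI[of _ _ e])
  finally show "emeasure (arc_borel e) A = emeasure (restrict_space (arc_borel S) e) A" .
qed

lemma measurable_completion_AE:
  fixes f :: "'a \<Rightarrow> real"
  assumes f': "f' \<in> borel_measurable M" and ae: "AE x in M. f x = f' x"
  shows "f \<in> borel_measurable (completion M)"
proof (rule measurableI)
  fix A :: "real set" assume A: "A \<in> sets borel"
  have "AE x in completion M. (x \<in> f' -` A \<inter> space M) \<longleftrightarrow> (x \<in> f -` A \<inter> space M)"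
    using AE_completion[OF ae] by eventually_elim auto
  moreover have "f' -` A \<inter> space M \<in> sets (completion M)"
    using measurable_sets[OF f' A] by auto
  ultimately show "f -` A \<inter> space (completion M) \<in> sets (completion M)"
    using completion.in_sets_AE[of "f' -` A \<inter> space M" "f -` A \<inter> space M"] by simp
qed simp

text \<open>The line load is given on \<open>S\<close>, but the edge residuals see it only on the single edges that make up \<open>S\<close>.\<close>

lemma arc_subsegment:
  fixes g w :: "real^2 \<Rightarrow> real"
  assumes e: "is_segment e" and S: "is_segment S" and sub: "e \<subseteq> S"
    and g: "g \<in> L2 (arc_measure S)"
  shows "g \<in> L2 (arc_measure e)"
    and "continuous_on S w \<Longrightarrow> (\<And>x. x \<in> S - e \<Longrightarrow> w x = 0) \<Longrightarrow>
      (LINT x|arc_measure S. g x * w x) = (LINT x|arc_measure e. g x * w x)"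
proof -
  have gS: "g \<in> borel_measurable (completion (arc_borel S))" "integrable (completion (arc_borel S)) (\<lambda>x. (g x)\<^sup>2)"
    using g by (auto simp: L2_def arc_measure_eq[OF S])
  obtain g' where g': "g' \<in> borel_measurable (arc_borel S)" "AE x in arc_borel S. g x = g' x"
    using completion_ex_borel_measurable_real[OF gS(1)] by blast
  have eb: "e \<inter> space (arc_borel S) \<in> sets (arc_borel S)"
    using sub segment_borel[OF e] by (auto simp: sets_restrict_space intro!: image_eqI[of _ _ e])
  have ae: "AE x in arc_borel e. g x = g' x"
    unfolding arc_borel_subsegment[OF e S sub] using eb g'(2)
    by (subst AE_restrict_space_iff) auto
  have g'e: "g' \<in> borel_measurable (arc_borel e)"
    unfolding arc_borel_subsegment[OF e S sub] by (rule measurable_restrict_space1[OF g'(1)])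
  have ge: "g \<in> borel_measurable (completion (arc_borel e))" by (rule measurable_completion_AE[OF g'e ae])
  have aeS': "AE x in completion (arc_borel S). g' x = g x"
    using AE_completion[OF g'(2)] by eventually_elim simp
  have aee': "AE x in completion (arc_borel e). g' x = g x"
    using AE_completion[OF ae] by eventually_elim simp
  have "integrable (completion (arc_borel S)) (\<lambda>x. (g' x)\<^sup>2)"
    by (rule integrable_cong_AE_imp[OF gS(2)])
      (use aeS' measurable_completion[OF g'(1)] in \<open>auto elim: eventually_mono\<close>)
  then have "integrable (arc_borel S) (\<lambda>x. (g' x)\<^sup>2)"
    using g'(1) by (simp add: integrable_completion)
  then have "integrable (arc_borel e) (\<lambda>x. (g' x)\<^sup>2)"
    unfolding arc_borel_subsegment[OF e S sub]
    using eb sub integrable_mult_indicator[of e "arc_borel S" "\<lambda>x. (g' x)\<^sup>2"]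
    by (subst integrable_restrict_space) (auto simp: Int_absorb2)
  then have "integrable (completion (arc_borel e)) (\<lambda>x. (g' x)\<^sup>2)"
    using g'e by (simp add: integrable_completion)
  then have "integrable (completion (arc_borel e)) (\<lambda>x. (g x)\<^sup>2)"
    by (rule integrable_cong_AE_imp) (use ge aee' in \<open>auto elim: eventually_mono\<close>)
  then show "g \<in> L2 (arc_measure e)" using ge by (simp add: L2_def arc_measure_eq[OF e])
  assume w: "continuous_on S w" and z: "\<And>x. x \<in> S - e \<Longrightarrow> w x = 0"
  have wS: "w \<in> borel_measurable (arc_borel S)" by (rule arc_measurable_continuous[OF S w])
  have we: "w \<in> borel_measurable (arc_borel e)"
    by (rule arc_measurable_continuous[OF e continuous_on_subset[OF w sub]])
  have "(LINT x|arc_measure S. g x * w x) = (LINT x|completion (arc_borel S). g' x * w x)"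
    unfolding arc_measure_eq[OF S]
    by (rule integral_cong_AE) (use aeS' gS(1) measurable_completion[OF wS] measurable_completion[OF g'(1)]
        in \<open>auto elim: eventually_mono\<close>)
  also have "\<dots> = (LINT x|arc_borel S. g' x * w x)" using g'(1) wS by (intro integral_completion) simp
  also have "\<dots> = (LINT x|arc_borel S. indicator e x *\<^sub>R (g' x * w x))"
    using z by (intro Bochner_Integration.integral_cong) (auto simp: indicator_def)
  also have "\<dots> = (LINT x|arc_borel e. g' x * w x)"
    unfolding arc_borel_subsegment[OF e S sub] using eb by (simp add: integral_restrict_space)
  also have "\<dots> = (LINT x|completion (arc_borel e). g' x * w x)"
    using g'e we by (intro integral_completion[symmetric]) simp
  also have "\<dots> = (LINT x|arc_measure e. g x * w x)"
    unfolding arc_measure_eq[OF e]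
    by (rule integral_cong_AE) (use aee' ge measurable_completion[OF we] measurable_completion[OF g'e]
        in \<open>auto elim: eventually_mono\<close>)
  finally show "(LINT x|arc_measure S. g x * w x) = (LINT x|arc_measure e. g x * w x)" .
qed

section \<open>Sobolev functions\<close>

lemma finite_lebesgue_on: "bounded S \<Longrightarrow> S \<in> sets lebesgue \<Longrightarrow> finite_measure (lebesgue_on S)"
  by (intro finite_measure_lebesgue_on bounded_set_imp_lmeasurable)

lemma L2_integrable: assumes "finite_measure M" "f \<in> L2 M" shows "integrable M f"
proof -
  have "(\<lambda>x. 1) \<in> L2 M" by (rule L2_bounded[OF assms(1), where B = 1]) auto
  from L2_mult_integrable[OF assms(2) this] show ?thesis by simp
qed

lemma L2_continuous:
  fixes f :: "real^2 \<Rightarrow> real"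
  assumes "bounded S" "S \<in> sets lebesgue" "continuous_on S f" "\<And>x. x \<in> S \<Longrightarrow> \<bar>f x\<bar> \<le> B"
  shows "f \<in> L2 (lebesgue_on S)"
  using assms by (intro L2_bounded[where B = B] finite_lebesgue_on continuous_imp_measurable_on_sets_lebesgue) auto

lemma L2_smooth:
  assumes "bounded S" "S \<in> sets lebesgue" "smooth f" shows "f \<in> L2 (lebesgue_on S)"
proof -
  have "compact (f ` closure S)"
    using assms by (intro compact_continuous_image smooth_continuous) auto
  then obtain B where "\<And>x. x \<in> closure S \<Longrightarrow> \<bar>f x\<bar> \<le> B"
    using compact_imp_bounded[of "f ` closure S"] unfolding bounded_iff by auto
  then show ?thesis
    using assms closure_subset by (intro L2_continuous[where B = B] smooth_continuous) auto
qed

locale bounded_open =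
  fixes \<Omega> :: "(real^2) set"
  assumes open_domain: "open \<Omega>" and bounded_domain: "bounded \<Omega>"
begin

lemma domain_measurable: "\<Omega> \<in> sets lebesgue" "\<Omega> \<inter> space lebesgue \<in> sets lebesgue"
  using open_domain by auto

lemma L2_test: "\<phi> \<in> test_functions \<Omega> \<Longrightarrow> \<phi> \<in> L2 (lebesgue_on \<Omega>)"
  using L2_smooth[OF bounded_domain domain_measurable(1)] test_functionsD(1) by blast

text \<open>The fundamental lemma for functions that are defined on \<open>\<Omega>\<close> only, localized to an open subset.\<close>

lemma AE_zero_if_orthogonal_to_tests:
  assumes w: "w \<in> L2 (lebesgue_on \<Omega>)" and U: "open U" "U \<subseteq> \<Omega>"
    and z: "\<And>\<phi>. \<phi> \<in> test_functions U \<Longrightarrow> (LINT x|lebesgue_on \<Omega>. w x * \<phi> x) = 0"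
  shows "AE x in lebesgue_on \<Omega>. x \<in> U \<longrightarrow> w x = 0"
proof -
  have "integrable (lebesgue_on \<Omega>) w"
    by (rule L2_integrable[OF finite_lebesgue_on w]) (use bounded_domain domain_measurable in auto)
  then have i: "integrable lebesgue (\<lambda>x. indicator \<Omega> x * w x)"
    using domain_measurable by (simp add: integrable_restrict_space)
  have "AE x in lebesgue. x \<in> U \<longrightarrow> indicator \<Omega> x * w x = 0"
  proof (rule fundamental_lemma[OF i U(1)])
    fix \<phi> assume "\<phi> \<in> test_functions U"
    then have "(LINT x|lebesgue_on \<Omega>. w x * \<phi> x) = 0" by (rule z)
    then show "(LINT x|lebesgue. indicator \<Omega> x * w x * \<phi> x) = 0"
      using domain_measurable by (simp add: integral_restrict_space mult.assoc)
  qed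
  then have "AE x in lebesgue. x \<in> \<Omega> \<longrightarrow> x \<in> U \<longrightarrow> w x = 0" by eventually_elim auto
  then show ?thesis using domain_measurable by (simp add: AE_restrict_space_iff)
qed

lemma weak_pd_L2: "has_weak_pd \<Omega> i w w' \<Longrightarrow> w' \<in> L2 (lebesgue_on \<Omega>)"
  by (simp add: has_weak_pd_def)

lemma weak_pd_unique:
  assumes "has_weak_pd \<Omega> i w w1" "has_weak_pd \<Omega> i w w2"
  shows "AE x in lebesgue_on \<Omega>. w1 x = w2 x"
proof -
  have "AE x in lebesgue_on \<Omega>. x \<in> \<Omega> \<longrightarrow> w1 x - w2 x = 0"
  proof (rule AE_zero_if_orthogonal_to_tests)
    show "(\<lambda>x. w1 x - w2 x) \<in> L2 (lebesgue_on \<Omega>)" using assms by (intro L2_diff weak_pd_L2)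
    fix \<phi> assume t: "\<phi> \<in> test_functions \<Omega>"
    have "(LINT x|lebesgue_on \<Omega>. (w1 x - w2 x) * \<phi> x) =
        (LINT x|lebesgue_on \<Omega>. w1 x * \<phi> x) - (LINT x|lebesgue_on \<Omega>. w2 x * \<phi> x)"
      using L2_mult_integrable[OF weak_pd_L2[OF assms(1)] L2_test[OF t]]
        L2_mult_integrable[OF weak_pd_L2[OF assms(2)] L2_test[OF t]]
      by (simp add: left_diff_distrib)
    then show "(LINT x|lebesgue_on \<Omega>. (w1 x - w2 x) * \<phi> x) = 0"
      using assms t unfolding has_weak_pd_def by force
  qed (use open_domain in auto)
  then show ?thesis by (rule AE_mp) (auto intro!: AE_I2 simp: space_restrict_space)
qed

lemma weak_pd_cong:
  assumes "has_weak_pd \<Omega> i w w'" "w \<in> L2 (lebesgue_on \<Omega>)" "v \<in> L2 (lebesgue_on \<Omega>)" "v' \<in> L2 (lebesgue_on \<Omega>)"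
    "AE x in lebesgue_on \<Omega>. v x = w x" "AE x in lebesgue_on \<Omega>. v' x = w' x"
  shows "has_weak_pd \<Omega> i v v'"
  unfolding has_weak_pd_def
proof (intro conjI assms ballI)
  fix \<phi> assume t: "\<phi> \<in> test_functions \<Omega>"
  have m: "f \<in> borel_measurable (lebesgue_on \<Omega>)" if "f \<in> L2 (lebesgue_on \<Omega>)" for f :: "real^2 \<Rightarrow> real"
    using that by (simp add: L2_def)
  note ms = m[OF assms(2)] m[OF assms(3)] m[OF assms(4)] m[OF weak_pd_L2[OF assms(1)]]
    m[OF L2_test[OF t]] m[OF L2_test[OF test_functions_pd[OF t]], of i]
  have "(LINT x|lebesgue_on \<Omega>. v x * pd i \<phi> x) = (LINT x|lebesgue_on \<Omega>. w x * pd i \<phi> x)"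
    by (rule integral_cong_AE) (use ms assms(5) in \<open>auto elim: eventually_mono\<close>)
  also have "\<dots> = - (LINT x|lebesgue_on \<Omega>. w' x * \<phi> x)"
    using assms(1) t by (simp add: has_weak_pd_def)
  also have "(LINT x|lebesgue_on \<Omega>. w' x * \<phi> x) = (LINT x|lebesgue_on \<Omega>. v' x * \<phi> x)"
    by (rule integral_cong_AE) (use ms assms(6) in \<open>auto elim: eventually_mono\<close>)
  finally show "(LINT x|lebesgue_on \<Omega>. v x * pd i \<phi> x) = - (LINT x|lebesgue_on \<Omega>. v' x * \<phi> x)" .
qed

lemma weak_pd_diff:
  assumes "has_weak_pd \<Omega> i v v'" "has_weak_pd \<Omega> i w w'" "v \<in> L2 (lebesgue_on \<Omega>)" "w \<in> L2 (lebesgue_on \<Omega>)"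
  shows "has_weak_pd \<Omega> i (\<lambda>x. v x - w x) (\<lambda>x. v' x - w' x)"
  unfolding has_weak_pd_def
proof (intro conjI ballI L2_diff weak_pd_L2[OF assms(1)] weak_pd_L2[OF assms(2)])
  fix \<phi> assume t: "\<phi> \<in> test_functions \<Omega>"
  note i = L2_mult_integrable[OF _ L2_test[OF t]] L2_mult_integrable[OF _ L2_test[OF test_functions_pd[OF t, of i]]]
  have "(LINT x|lebesgue_on \<Omega>. (v x - w x) * pd i \<phi> x) =
      (LINT x|lebesgue_on \<Omega>. v x * pd i \<phi> x) - (LINT x|lebesgue_on \<Omega>. w x * pd i \<phi> x)"
    using i(2)[OF assms(3)] i(2)[OF assms(4)] by (simp add: left_diff_distrib)
  moreover have "(LINT x|lebesgue_on \<Omega>. (v' x - w' x) * \<phi> x) =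
      (LINT x|lebesgue_on \<Omega>. v' x * \<phi> x) - (LINT x|lebesgue_on \<Omega>. w' x * \<phi> x)"
    using i(1)[OF weak_pd_L2[OF assms(1)]] i(1)[OF weak_pd_L2[OF assms(2)]] by (simp add: left_diff_distrib)
  ultimately show "(LINT x|lebesgue_on \<Omega>. (v x - w x) * pd i \<phi> x) = - (LINT x|lebesgue_on \<Omega>. (v' x - w' x) * \<phi> x)"
    using assms(1,2) t by (simp add: has_weak_pd_def)
qed

lemma wpd_weak_pd: "has_weak_pd \<Omega> i w w' \<Longrightarrow> has_weak_pd \<Omega> i w (wpd \<Omega> i w)"
  unfolding wpd_def by (rule someI[of "has_weak_pd \<Omega> i w"])

lemma wpd_AE: "has_weak_pd \<Omega> i w w' \<Longrightarrow> AE x in lebesgue_on \<Omega>. wpd \<Omega> i w x = w' x"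
  using weak_pd_unique[OF wpd_weak_pd] by blast

lemma H1D:
  assumes "w \<in> H1 \<Omega>"
  shows "w \<in> L2 (lebesgue_on \<Omega>)" "has_weak_pd \<Omega> i w (wpd \<Omega> i w)" "wpd \<Omega> i w \<in> L2 (lebesgue_on \<Omega>)"
  using assms wpd_weak_pd weak_pd_L2 unfolding H1_def by blast+

lemma H2D:
  assumes "w \<in> H2 \<Omega>"
  shows "w \<in> H1 \<Omega>" "wpd \<Omega> i w \<in> H1 \<Omega>"
    "wpd \<Omega> j (wpd \<Omega> i w) \<in> L2 (lebesgue_on \<Omega>)" "w \<in> L2 (lebesgue_on \<Omega>)"
  using assms H1D unfolding H2_def by blast+

lemma wpd2_diff:
  assumes "u \<in> H2 \<Omega>" "w \<in> H2 \<Omega>"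
  shows "AE x in lebesgue_on \<Omega>. wpd \<Omega> j (wpd \<Omega> i (\<lambda>x. u x - w x)) x =
    wpd \<Omega> j (wpd \<Omega> i u) x - wpd \<Omega> j (wpd \<Omega> i w) x"
    and "wpd \<Omega> j (wpd \<Omega> i (\<lambda>x. u x - w x)) \<in> L2 (lebesgue_on \<Omega>)"
proof -
  note u = H2D[OF assms(1)] and w = H2D[OF assms(2)]
  have 1: "has_weak_pd \<Omega> i (\<lambda>x. u x - w x) (\<lambda>x. wpd \<Omega> i u x - wpd \<Omega> i w x)"
    by (intro weak_pd_diff H1D u w)
  have 2: "has_weak_pd \<Omega> j (\<lambda>x. wpd \<Omega> i u x - wpd \<Omega> i w x) (\<lambda>x. wpd \<Omega> j (wpd \<Omega> i u) x - wpd \<Omega> j (wpd \<Omega> i w) x)"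
    by (intro weak_pd_diff H1D u w)
  have 3: "has_weak_pd \<Omega> j (wpd \<Omega> i (\<lambda>x. u x - w x)) (\<lambda>x. wpd \<Omega> j (wpd \<Omega> i u) x - wpd \<Omega> j (wpd \<Omega> i w) x)"
    by (rule weak_pd_cong[OF 2])
      (use wpd_AE[OF 1] weak_pd_L2[OF wpd_weak_pd[OF 1]] u(3) w(3) H1D(3)[OF u(1)] H1D(3)[OF w(1)]
        in \<open>auto intro!: L2_diff\<close>)
  show "AE x in lebesgue_on \<Omega>. wpd \<Omega> j (wpd \<Omega> i (\<lambda>x. u x - w x)) x =
    wpd \<Omega> j (wpd \<Omega> i u) x - wpd \<Omega> j (wpd \<Omega> i w) x" by (rule wpd_AE[OF 3])
  show "wpd \<Omega> j (wpd \<Omega> i (\<lambda>x. u x - w x)) \<in> L2 (lebesgue_on \<Omega>)" by (rule weak_pd_L2[OF wpd_weak_pd[OF 3]])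
qed

text \<open>The selected weak derivatives of a Sobolev function agree on \<open>U\<close> with the classical ones of any smooth function that it
  equals there. This makes the bilinear form of a piecewise polynomial function computable.\<close>

lemma wpd2_local:
  assumes w: "w \<in> H2 \<Omega>" and U: "open U" "U \<subseteq> \<Omega>" and p: "smooth p" "\<And>x. x \<in> U \<Longrightarrow> w x = p x"
  shows "AE x in lebesgue_on \<Omega>. x \<in> U \<longrightarrow> wpd \<Omega> j (wpd \<Omega> i w) x = pd j (pd i p) x"
proof -
  note ww = H2D[OF w]
  note L2s = L2_smooth[OF bounded_domain domain_measurable(1)]
  have "AE x in lebesgue_on \<Omega>. x \<in> U \<longrightarrow> wpd \<Omega> j (wpd \<Omega> i w) x - pd j (pd i p) x = 0"
  proof (rule AE_zero_if_orthogonal_to_tests[OF _ U])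
    show "(\<lambda>x. wpd \<Omega> j (wpd \<Omega> i w) x - pd j (pd i p) x) \<in> L2 (lebesgue_on \<Omega>)"
      by (intro L2_diff ww L2s smooth_pd p)
    fix \<phi> assume "\<phi> \<in> test_functions U"
    then have t: "\<phi> \<in> test_functions \<Omega>" and tU: "\<phi> \<in> test_functions U" using test_functions_mono[OF U(2)] by auto
    note t1 = test_functions_pd[OF t, of j] and t2 = test_functions_pd[OF test_functions_pd[OF tU, of j], of i]
    have "(LINT x|lebesgue_on \<Omega>. wpd \<Omega> j (wpd \<Omega> i w) x * \<phi> x) = - (LINT x|lebesgue_on \<Omega>. wpd \<Omega> i w x * pd j \<phi> x)"
      using H1D(2)[OF ww(2)] t by (simp add: has_weak_pd_def)
    also have "\<dots> = (LINT x|lebesgue_on \<Omega>. w x * pd i (pd j \<phi>) x)"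
      using H1D(2)[OF ww(1)] t1 by (simp add: has_weak_pd_def)
    also have "\<dots> = (LINT x|lebesgue_on \<Omega>. p x * pd i (pd j \<phi>) x)"
      using p(2) test_functionsD(4)[OF t2] by (intro Bochner_Integration.integral_cong) (metis mult_eq_0_iff refl)+
    also have "\<dots> = (LINT x|lebesgue_on \<Omega>. pd j (pd i p) x * \<phi> x)"
      using weak_pd_classical[OF open_domain smooth_imp_locally_smooth[OF p(1)] t1, of i]
        weak_pd_classical[OF open_domain smooth_imp_locally_smooth[OF smooth_pd[OF p(1)]] t, of i j] by simp
    finally show "(LINT x|lebesgue_on \<Omega>. (wpd \<Omega> j (wpd \<Omega> i w) x - pd j (pd i p) x) * \<phi> x) = 0"
      using L2_mult_integrable[OF ww(3) L2_test[OF t]]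
        L2_mult_integrable[OF L2s L2_test[OF t], of "pd j (pd i p)"] smooth_pd p(1)
      by (simp add: left_diff_distrib)
  qed
  then show ?thesis by eventually_elim simp
qed

lemma classical_weak_pd:
  assumes v: "locally_smooth \<Omega> v" and b: "\<And>x. x \<in> \<Omega> \<Longrightarrow> \<bar>pd i v x\<bar> \<le> B"
  shows "has_weak_pd \<Omega> i v (pd i v)"
  using weak_pd_classical[OF open_domain v] bounded_domain domain_measurable b
  by (auto simp: has_weak_pd_def intro!: L2_continuous[where B = B] locally_smooth_continuous_on locally_smooth_pd v)

text \<open>Bounded derivatives are square integrable since \<open>\<Omega>\<close> is bounded. Regularity up to the boundary is not assumed.\<close>

lemma classical_H2:
  assumes v: "locally_smooth \<Omega> v" and b: "\<And>x. x \<in> \<Omega> \<Longrightarrow> \<bar>v x\<bar> \<le> B" "\<And>x i. x \<in> \<Omega> \<Longrightarrow> \<bar>pd i v x\<bar> \<le> B"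
    "\<And>x i j. x \<in> \<Omega> \<Longrightarrow> \<bar>pd j (pd i v) x\<bar> \<le> B"
  shows "v \<in> H2 \<Omega>" "pd i v \<in> H1 \<Omega>" "AE x in lebesgue_on \<Omega>. wpd \<Omega> i v x = pd i v x"
    "AE x in lebesgue_on \<Omega>. wpd \<Omega> j (wpd \<Omega> i v) x = pd j (pd i v) x"
proof -
  note ls = locally_smooth_pd[OF v]
  have L2: "v \<in> L2 (lebesgue_on \<Omega>)" "pd i v \<in> L2 (lebesgue_on \<Omega>)" "pd j (pd i v) \<in> L2 (lebesgue_on \<Omega>)" for i j
    using b by (intro L2_continuous[where B = B] bounded_domain domain_measurable
        locally_smooth_continuous_on v ls locally_smooth_pd; simp)+
  have w1: "has_weak_pd \<Omega> i v (pd i v)" for i using b by (intro classical_weak_pd[where B = B] v) auto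
  have w2: "has_weak_pd \<Omega> j (pd i v) (pd j (pd i v))" for i j using b by (intro classical_weak_pd[where B = B] ls) auto
  have w3: "has_weak_pd \<Omega> j (wpd \<Omega> i v) (pd j (pd i v))" for i j
    by (rule weak_pd_cong[OF w2])
      (use wpd_AE[OF w1] weak_pd_L2[OF wpd_weak_pd[OF w1]] L2 in auto)
  have H1: "v \<in> H1 \<Omega>" unfolding H1_def using L2 w1 by blast
  have "wpd \<Omega> i v \<in> H1 \<Omega>" for i
    unfolding H1_def using weak_pd_L2[OF wpd_weak_pd[OF w1]] w3 by blast
  with H1 show "v \<in> H2 \<Omega>" by (simp add: H2_def)
  show "pd i v \<in> H1 \<Omega>" unfolding H1_def using L2 w2 by blast
  show "AE x in lebesgue_on \<Omega>. wpd \<Omega> i v x = pd i v x" by (rule wpd_AE[OF w1])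
  show "AE x in lebesgue_on \<Omega>. wpd \<Omega> j (wpd \<Omega> i v) x = pd j (pd i v) x" by (rule wpd_AE[OF w3])
qed

lemma H1norm_zero:
  assumes "h \<in> L2 (lebesgue_on \<Omega>)" "AE x in lebesgue_on \<Omega>. h x = 0"
  shows "H1norm \<Omega> h = 0"
proof -
  have z: "L2norm (lebesgue_on \<Omega>) k = 0" if "AE x in lebesgue_on \<Omega>. k x = 0" for k
    unfolding L2norm_def using that
    by (subst integral_eq_zero_AE) (auto elim: eventually_mono)
  have l0: "(\<lambda>x. 0) \<in> L2 (lebesgue_on \<Omega>)" by (simp add: L2_def)
  have "has_weak_pd \<Omega> i (\<lambda>x. 0) (\<lambda>x. 0)" for i using l0 by (simp add: has_weak_pd_def)
  then have "has_weak_pd \<Omega> i h (\<lambda>x. 0)" for i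
    by (rule weak_pd_cong) (use assms l0 in auto)
  then show ?thesis using wpd_AE z assms(2) by (simp add: H1norm_def)
qed

text \<open>For a function with a continuous representative, the constant sequence shows that this representative is a trace.\<close>

lemma has_trace_continuous:
  assumes w: "w \<in> H1 \<Omega>" and c: "continuous_on (closure \<Omega>) c" "c \<in> H1 \<Omega>" and ae: "AE x in lebesgue_on \<Omega>. w x = c x"
  shows "has_trace \<Omega> w c"
  unfolding has_trace_def
proof (intro conjI w exI[of _ "\<lambda>k. c"] allI impI c)
  have "H1norm \<Omega> (\<lambda>x. c x - w x) = 0"
    by (intro H1norm_zero L2_diff H1D(1) w c) (use ae in \<open>auto elim: eventually_mono\<close>)
  then show "(\<lambda>k::nat. H1norm \<Omega> (\<lambda>x. c x - w x)) \<longlonglongrightarrow> 0" by simp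
  fix e assume e: "is_segment e \<and> e \<subseteq> frontier \<Omega>"
  show "c \<in> L2 (arc_measure e)"
    using e c(1) by (intro arc_L2_continuous) (auto intro: continuous_on_subset simp: frontier_def)
  show "(\<lambda>k::nat. L2norm (arc_measure e) (\<lambda>x. c x - c x)) \<longlonglongrightarrow> 0" by (simp add: L2norm_def)
qed

lemma cont_rep_continuous:
  assumes c: "continuous_on (closure \<Omega>) c" and x: "x \<in> closure \<Omega>" shows "cont_rep \<Omega> c x = c x"
proof -
  let ?w = "cont_rep \<Omega> c"
  have "continuous_on (closure \<Omega>) ?w \<and> (AE x in lebesgue_on \<Omega>. ?w x = c x)"
    unfolding cont_rep_def by (rule someI[of _ c]) (use c in auto)
  then have w: "continuous_on (closure \<Omega>) ?w" "AE x in lebesgue_on \<Omega>. ?w x = c x" by auto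
  have "?w x = c x" if "x \<in> \<Omega>" for x
  proof (rule ccontr)
    assume ne: "?w x \<noteq> c x"
    have "continuous_on \<Omega> (\<lambda>x. ?w x - c x)"
      using w(1) c closure_subset by (intro continuous_intros) (blast intro: continuous_on_subset)+
    then have o: "open (\<Omega> \<inter> (\<lambda>x. ?w x - c x) -` (- {0}))"
      by (intro continuous_open_preimage open_domain) auto
    have "AE x in lebesgue. x \<in> \<Omega> \<longrightarrow> ?w x = c x"
      using w(2) domain_measurable by (simp add: AE_restrict_space_iff)
    then have "AE x in lebesgue. x \<notin> \<Omega> \<inter> (\<lambda>x. ?w x - c x) -` (- {0})"
      by eventually_elim auto
    moreover have "\<Omega> \<inter> (\<lambda>x. ?w x - c x) -` (- {0}) \<in> sets lebesgue" using o by simp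
    ultimately have "negligible (\<Omega> \<inter> (\<lambda>x. ?w x - c x) -` (- {0}))"
      by (simp add: negligible_iff_null_sets completion.null_sets_iff_AE)
    moreover have "x \<in> \<Omega> \<inter> (\<lambda>x. ?w x - c x) -` (- {0})" using that ne by simp
    ultimately show False using open_not_negligible[OF o] by force
  qed
  then have z: "?w y - c y = 0" if "y \<in> \<Omega>" for y using that by simp
  have "continuous_on (closure \<Omega>) (\<lambda>x. ?w x - c x)" by (intro continuous_on_diff w(1) c)
  from continuous_constant_on_closure[OF this z x] show ?thesis by simp
qed

end

section \<open>Polynomials and inverse estimates\<close>

text \<open>Polynomials in two variables of total degree at most \<open>n\<close>, generated by affine factors instead of monomials. This form makes the
  invariance under affine substitutions and the restriction to lines immediate by induction.\<close>

inductive polyfun :: "nat \<Rightarrow> (real^2 \<Rightarrow> real) \<Rightarrow> bool" where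
  const: "polyfun n (\<lambda>x. c)"
| add: "polyfun n f \<Longrightarrow> polyfun n g \<Longrightarrow> polyfun n (\<lambda>x. f x + g x)"
| affine_mult: "polyfun n f \<Longrightarrow> polyfun (Suc n) (\<lambda>x. (c \<bullet> x + d) * f x)"
| Suc: "polyfun n f \<Longrightarrow> polyfun (Suc n) f"

lemma polyfun_mono: "polyfun n f \<Longrightarrow> n \<le> m \<Longrightarrow> polyfun m f"
  by (induction m) (auto simp: le_Suc_eq intro: polyfun.Suc)

lemma smooth_polyfun: "polyfun n f \<Longrightarrow> smooth f"
  by (induction rule: polyfun.induct) (auto intro: smooth_mult smooth_affine)

lemma polyfun_cmult: "polyfun n f \<Longrightarrow> polyfun n (\<lambda>x. a * f x)"
proof (induction rule: polyfun.induct)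
  case (add n f g) then show ?case using polyfun.add[OF add.IH] by (simp add: distrib_left)
next
  case (affine_mult n f c d)
  then show ?case using polyfun.affine_mult[OF affine_mult.IH, of c d] by (simp add: mult.left_commute)
qed (auto intro: polyfun.intros)

lemma polyfun_diff: "polyfun n f \<Longrightarrow> polyfun n g \<Longrightarrow> polyfun n (\<lambda>x. f x - g x)"
  using polyfun.add[OF _ polyfun_cmult[of n g "-1"], of f] by simp

lemma polyfun_uminus: "polyfun n f \<Longrightarrow> polyfun n (\<lambda>x. - f x)"
  using polyfun_cmult[of n f "-1"] by simp

lemma polyfun_sum: "(\<And>k. k \<in> A \<Longrightarrow> polyfun n (f k)) \<Longrightarrow> polyfun n (\<lambda>x. \<Sum>k\<in>A. f k x)"
  by (induction A rule: infinite_finite_induct) (auto intro: polyfun.intros)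

lemma polyfun_pd: "polyfun n f \<Longrightarrow> polyfun n (pd i f)"
proof (induction rule: polyfun.induct)
  case (add n f g)
  then show ?case by (simp add: pd_add[OF smooth_polyfun smooth_polyfun] polyfun.add)
next
  case (affine_mult n f c d)
  have "pd i (\<lambda>x. (c \<bullet> x + d) * f x) = (\<lambda>x. c $ i * f x + (c \<bullet> x + d) * pd i f x)"
    by (simp add: pd_mult[OF smooth_affine smooth_polyfun[OF affine_mult.hyps]] pd_affine)
  then show ?case
    using polyfun.add[OF polyfun.Suc[OF polyfun_cmult[OF affine_mult.hyps, of "c $ i"]]
        polyfun.affine_mult[OF affine_mult.IH, of c d]] by simp
qed (auto intro: polyfun.intros)

lemma polyfun_affine: "polyfun n f \<Longrightarrow> polyfun n (\<lambda>x. f (A *v x + b))"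
proof (induction rule: polyfun.induct)
  case (affine_mult n f c d)
  have "c \<bullet> (A *v x + b) + d = (transpose A *v c) \<bullet> x + (c \<bullet> b + d)" for x
    by (simp add: inner_add_right dot_lmul_matrix transpose_matrix_vector)
  then show ?case using polyfun.affine_mult[OF affine_mult.IH, of "transpose A *v c" "c \<bullet> b + d"]
    by (simp only:)
qed (auto intro: polyfun.intros)

lemma polyfun_line: "polyfun n f \<Longrightarrow> \<exists>q. degree q \<le> n \<and> (\<forall>t. f (a + t *\<^sub>R v) = poly q t)"
proof (induction rule: polyfun.induct)
  case (const n c) then show ?case by (intro exI[of _ "[:c:]"]) auto
next
  case (add n f g)
  then obtain p q where "degree p \<le> n" "\<forall>t. f (a + t *\<^sub>R v) = poly p t" "degree q \<le> n" "\<forall>t. g (a + t *\<^sub>R v) = poly q t"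
    by blast
  then show ?case by (intro exI[of _ "p + q"]) (auto intro: degree_add_le)
next
  case (affine_mult n f c d)
  then obtain q where q: "degree q \<le> n" "\<forall>t. f (a + t *\<^sub>R v) = poly q t" by blast
  have "degree ([:c \<bullet> a + d, c \<bullet> v:] * q) \<le> 1 + n"
    using q(1) by (intro order_trans[OF degree_mult_le] add_mono) auto
  then show ?case using q by (intro exI[of _ "[:c \<bullet> a + d, c \<bullet> v:] * q"]) (auto simp: inner_add_right algebra_simps)
next
  case (Suc n f) then show ?case by (meson le_SucI)
qed

lemma polyfun_monomial: "polyfun (i + j) (\<lambda>x. c * (x $ 1) ^ i * (x $ 2) ^ j)"
proof (induction i)
  case 0
  show ?case
  proof (induction j)
    case (Suc j)
    then show ?case using polyfun.affine_mult[OF Suc, of "axis 2 1" 0] by (simp add: inner_axis' mult_ac)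
  qed (auto intro: polyfun.const)
next
  case (Suc i)
  then show ?case using polyfun.affine_mult[OF Suc, of "axis 1 1" 0] by (simp add: inner_axis' mult_ac)
qed

lemma poly_of_degree_polyfun:
  assumes "poly_of_degree r p" shows "polyfun r p"
proof -
  obtain c where "\<forall>x. p x = (\<Sum>i\<le>r. \<Sum>j\<le>r - i. c i j * (x $ 1) ^ i * (x $ 2) ^ j)"
    using assms poly_of_degree_def by blast
  then have "p = (\<lambda>x. \<Sum>i\<le>r. \<Sum>j\<le>r - i. c i j * (x $ 1) ^ i * (x $ 2) ^ j)" by blast
  then show ?thesis
    by (auto intro!: polyfun_sum polyfun_mono[OF polyfun_monomial])
qed

text \<open>On every line through \<open>c\<close> the restriction is a polynomial in one variable with infinitely many zeros.\<close>

lemma polyfun_zero: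
  assumes f: "polyfun n f" and U: "open U" "c \<in> U" "\<And>x. x \<in> U \<Longrightarrow> f x = 0"
  shows "f x = 0"
proof -
  obtain q where q: "\<forall>t. f (c + t *\<^sub>R (x - c)) = poly q t" using polyfun_line[OF f] by blast
  have "((\<lambda>t. c + t *\<^sub>R (x - c)) \<longlongrightarrow> c + 0 *\<^sub>R (x - c)) (at_right 0)" by (intro tendsto_intros)
  then have "\<forall>\<^sub>F t in at_right 0. c + t *\<^sub>R (x - c) \<in> U"
    using U by (intro topological_tendstoD) auto
  then obtain e where e: "e > 0" "\<And>t. 0 < t \<Longrightarrow> t < e \<Longrightarrow> c + t *\<^sub>R (x - c) \<in> U"
    unfolding eventually_at_right_field by auto
  then have "{0<..<e} \<subseteq> {t. poly q t = 0}" using U(3) q by (auto simp flip: q[rule_format])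
  moreover have "infinite {0<..<e}" using e(1) infinite_Ioo by blast
  ultimately have "infinite {t. poly q t = 0}" using infinite_super by blast
  then have "q = 0" using poly_roots_finite by blast
  then show ?thesis using q[rule_format, of 1] by simp
qed

text \<open>The triangle has interior points, so the polynomial on it is unique and the choice in \<open>piece\<close> is forced.\<close>

lemma piece_eq:
  assumes K: "interior K \<noteq> {}" and p: "poly_of_degree r p" "\<And>x. x \<in> K \<Longrightarrow> v x = p x"
  shows "piece K v = p"
proof -
  have "(\<exists>r. poly_of_degree r (piece K v)) \<and> (\<forall>x\<in>K. v x = piece K v x)"
    unfolding piece_def by (rule someI[of _ p]) (use p in auto)
  then obtain r' where r': "poly_of_degree r' (piece K v)" "\<And>x. x \<in> K \<Longrightarrow> v x = piece K v x" by blast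
  have "polyfun (max r r') (\<lambda>x. piece K v x - p x)"
    by (intro polyfun_diff polyfun_mono[OF poly_of_degree_polyfun[OF p(1)]]
        polyfun_mono[OF poly_of_degree_polyfun[OF r'(1)]]) auto
  moreover obtain c where "c \<in> interior K" using K by blast
  moreover have "piece K v x - p x = 0" if "x \<in> interior K" for x
    using that interior_subset r'(2) p(2) by fastforce
  ultimately have "piece K v x - p x = 0" for x using polyfun_zero[OF _ open_interior] by blast
  then show ?thesis by (simp add: fun_eq_iff)
qed

lemma polyfun_moment: "polyfun n p \<Longrightarrow> polyfun n (\<lambda>x. moment pd d Y \<nu> p x $ i $ j)"
  unfolding moment_nth mult.commute[of _ "if i = j then 1 else 0"]
  by (intro polyfun_cmult polyfun.add polyfun_sum polyfun_pd)

lemma polyfun_shear: "polyfun n p \<Longrightarrow> polyfun n (\<lambda>x. shear d Y \<nu> p x $ i)"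
  unfolding shear_def by (simp, intro polyfun_sum polyfun_pd polyfun_moment)

lemma polyfun_plate_op: "polyfun n p \<Longrightarrow> polyfun n (plate_op d Y \<nu> p)"
  unfolding plate_op_def[abs_def] by (intro polyfun_uminus polyfun_sum polyfun_pd polyfun_shear)

lemma polyfun_M_nn: "polyfun n p \<Longrightarrow> polyfun n (M_nn d Y \<nu> v p)"
  unfolding M_nn_eq[abs_def] by (intro polyfun_sum polyfun_cmult polyfun_moment)

lemma polyfun_M_ns: "polyfun n p \<Longrightarrow> polyfun n (M_ns d Y \<nu> v p)"
  unfolding M_ns_eq[abs_def] by (intro polyfun_sum polyfun_cmult polyfun_moment)

lemma polyfun_V_n: assumes "polyfun n p" shows "polyfun n (V_n d Y \<nu> v p)"
proof -
  have "V_n d Y \<nu> v p = (\<lambda>x. (\<Sum>i\<in>UNIV. v $ i * shear d Y \<nu> p x $ i)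
      + (\<Sum>i\<in>UNIV. perp v $ i * pd i (M_ns d Y \<nu> v p) x))"
    by (rule ext) (simp add: V_n_eq[OF smooth_polyfun[OF assms]] mult.commute)
  then show ?thesis
    using assms by (auto intro!: polyfun.add polyfun_sum polyfun_cmult polyfun_shear polyfun_pd polyfun_M_ns)
qed

text \<open>Interpolation in a quantitative form: if the nodes are separated by \<open>\<delta>\<close>, the values at the nodes control the polynomial and its
  derivative. The induction divides out the factor that belongs to the last node; the quotient has lower degree, and
  its values at the other nodes are difference quotients, at most \<open>2M/\<delta>\<close>.\<close>

lemma polynomial_bound_by_nodes:
  fixes R \<delta> :: real
  assumes R: "R \<ge> 0" and \<delta>: "\<delta> > 0"
  shows "\<exists>C\<ge>0. \<forall>q M (x :: nat \<Rightarrow> real).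
    degree q \<le> N \<and> (\<forall>i\<le>N. \<bar>x i\<bar> \<le> R \<and> \<bar>poly q (x i)\<bar> \<le> M) \<and> (\<forall>i\<le>N. \<forall>j<i. \<delta> \<le> \<bar>x i - x j\<bar>) \<longrightarrow>
    (\<forall>y. \<bar>y\<bar> \<le> R \<longrightarrow> \<bar>poly q y\<bar> \<le> C * M \<and> \<bar>poly (pderiv q) y\<bar> \<le> C * M)"
proof (induction N)
  case 0
  show ?case
  proof (intro exI[of _ 1] conjI allI impI)
    fix q :: "real poly" and M and x :: "nat \<Rightarrow> real" and y :: real
    assume a: "degree q \<le> 0 \<and> (\<forall>i\<le>0. \<bar>x i\<bar> \<le> R \<and> \<bar>poly q (x i)\<bar> \<le> M) \<and> (\<forall>i\<le>0. \<forall>j<i. \<delta> \<le> \<bar>x i - x j\<bar>)"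
    then obtain c where "q = [:c:]" using degree_eq_zeroE by blast
    then show "\<bar>poly q y\<bar> \<le> 1 * M" "\<bar>poly (pderiv q) y\<bar> \<le> 1 * M" using a by auto
  qed auto
next
  case (Suc N)
  then obtain C where C: "C \<ge> 0" "\<And>q M x y. degree q \<le> N \<Longrightarrow> (\<forall>i\<le>N. \<bar>x i\<bar> \<le> R \<and> \<bar>poly q (x i)\<bar> \<le> M) \<Longrightarrow>
      (\<forall>i\<le>N. \<forall>j<i. \<delta> \<le> \<bar>x i - x j\<bar>) \<Longrightarrow> \<bar>y\<bar> \<le> R \<Longrightarrow> \<bar>poly q y\<bar> \<le> C * M \<and> \<bar>poly (pderiv q) y\<bar> \<le> C * M"
    by blast
  let ?C = "1 + (1 + 2 * R) * (C * (2 / \<delta>))"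
  show ?case
  proof (intro exI[of _ ?C] conjI allI impI)
    show "0 \<le> ?C" using R \<delta> C(1) by simp
    fix q :: "real poly" and M and x :: "nat \<Rightarrow> real" and y :: real
    assume a: "degree q \<le> Suc N \<and> (\<forall>i\<le>Suc N. \<bar>x i\<bar> \<le> R \<and> \<bar>poly q (x i)\<bar> \<le> M) \<and>
        (\<forall>i\<le>Suc N. \<forall>j<i. \<delta> \<le> \<bar>x i - x j\<bar>)" and y: "\<bar>y\<bar> \<le> R"
    let ?z = "x (Suc N)"
    define q1 where "q1 = synthetic_div q ?z"
    have q: "q = [:- ?z, 1:] * q1 + [:poly q ?z:]" unfolding q1_def by (simp only: synthetic_div_correct')
    have M: "\<bar>poly q ?z\<bar> \<le> M" using a by auto
    have pq: "poly q t = (t - ?z) * poly q1 t + poly q ?z" for t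
      by (subst q) (simp add: algebra_simps)
    have dq: "poly (pderiv q) t = (t - ?z) * poly (pderiv q1) t + poly q1 t" for t
    proof -
      have "pderiv q = pderiv ([:- ?z, 1:] * q1 + [:poly q ?z:])" using q by simp
      also have "\<dots> = [:- ?z, 1:] * pderiv q1 + q1" by (simp only: pderiv_add pderiv_mult) (simp add: pderiv_pCons)
      finally have "poly (pderiv q) t = poly ([:- ?z, 1:] * pderiv q1 + q1) t" by (rule arg_cong)
      also have "\<dots> = (t - ?z) * poly (pderiv q1) t + poly q1 t" by (simp add: algebra_simps)
      finally show ?thesis .
    qed
    have b: "\<bar>poly q1 (x j)\<bar> \<le> (2 / \<delta>) * M" if "j \<le> N" for j
    proof -
      have d: "\<delta> \<le> \<bar>x j - ?z\<bar>" using a that by (auto simp: abs_minus_commute)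
      have "\<delta> * \<bar>poly q1 (x j)\<bar> \<le> \<bar>x j - ?z\<bar> * \<bar>poly q1 (x j)\<bar>" using d by (intro mult_right_mono) auto
      also have "\<dots> = \<bar>poly q (x j) - poly q ?z\<bar>" by (simp add: pq[of "x j"] abs_mult)
      also have "\<dots> \<le> 2 * M" using a that M by (smt (verit) le_SucI)
      finally show ?thesis using \<delta> by (simp add: field_simps)
    qed
    have "degree q1 \<le> N" unfolding q1_def using a[THEN conjunct1] by (simp add: degree_synthetic_div)
    then have IH: "\<bar>poly q1 y\<bar> \<le> C * ((2 / \<delta>) * M) \<and> \<bar>poly (pderiv q1) y\<bar> \<le> C * ((2 / \<delta>) * M)"
      using a b y by (intro C(2)[of q1 x]) auto
    have yz: "\<bar>y - ?z\<bar> \<le> 2 * R" using a y by (smt (verit) order_refl)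
    let ?D = "C * ((2 / \<delta>) * M)"
    have D: "?D \<ge> 0" using IH by linarith
    have "?C * M = M + (1 + 2 * R) * ?D" by (simp add: algebra_simps)
    then have CM: "?C * M = M + ?D + 2 * R * ?D" unfolding distrib_right by simp
    have "\<bar>poly q y\<bar> \<le> \<bar>y - ?z\<bar> * \<bar>poly q1 y\<bar> + M"
      using M by (subst pq) (auto simp: abs_mult[symmetric])
    also have "\<dots> \<le> 2 * R * ?D + M" using IH yz by (intro add_mono mult_mono) auto
    also have "\<dots> \<le> ?C * M" unfolding CM using D by linarith
    finally show "\<bar>poly q y\<bar> \<le> ?C * M" .
    have "\<bar>poly (pderiv q) y\<bar> \<le> \<bar>y - ?z\<bar> * \<bar>poly (pderiv q1) y\<bar> + \<bar>poly q1 y\<bar>"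
      by (subst dq) (metis abs_mult abs_triangle_ineq)
    also have "\<dots> \<le> 2 * R * ?D + ?D" using IH yz by (intro add_mono mult_mono) auto
    also have "\<dots> \<le> ?C * M" unfolding CM using M by linarith
    finally show "\<bar>poly (pderiv q) y\<bar> \<le> ?C * M" .
  qed
qed

lemma integrable_bump_mult:
  fixes g :: "real \<Rightarrow> real"
  assumes "continuous_on UNIV g" shows "integrable lborel (\<lambda>s. bump s * g s)"
proof -
  have "integrable lborel (\<lambda>s. indicator {0..1} s *\<^sub>R (bump s * g s))"
    by (intro borel_integrable_compact continuous_on_mult bump_continuous continuous_on_subset[OF assms]) auto
  moreover have "(\<lambda>s. indicator {0..1} s *\<^sub>R (bump s * g s)) = (\<lambda>s. bump s * g s)"
    by (rule ext) (auto simp: indicator_def intro!: bump_zero)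
  ultimately show ?thesis by simp
qed

text \<open>The minimum of \<open>q\<^sup>2\<close> over an interval is controlled by the weighted integral.\<close>

lemma node_in_interval:
  fixes q :: "real poly"
  assumes b: "\<And>s. s \<in> {\<alpha>..\<beta>} \<Longrightarrow> b0 \<le> bump s" "b0 > 0" and ab: "\<alpha> \<le> \<beta>"
  shows "\<exists>x\<in>{\<alpha>..\<beta>}. (\<beta> - \<alpha>) * b0 * (poly q x)\<^sup>2 \<le> (LINT s|lborel. bump s * (poly q s)\<^sup>2)"
proof -
  have "continuous_on {\<alpha>..\<beta>} (\<lambda>s. (poly q s)\<^sup>2)" by (intro continuous_intros)
  then obtain x where x: "x \<in> {\<alpha>..\<beta>}" "\<And>s. s \<in> {\<alpha>..\<beta>} \<Longrightarrow> (poly q x)\<^sup>2 \<le> (poly q s)\<^sup>2"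
    using continuous_attains_inf[of "{\<alpha>..\<beta>}" "\<lambda>s. (poly q s)\<^sup>2"] ab by auto
  have "(\<beta> - \<alpha>) * b0 * (poly q x)\<^sup>2 = (LINT s|lborel. indicator {\<alpha>..\<beta>} s * (b0 * (poly q x)\<^sup>2))"
    using ab by simp
  also have "\<dots> \<le> (LINT s|lborel. bump s * (poly q s)\<^sup>2)"
  proof (rule integral_mono)
    show "integrable lborel (\<lambda>s. bump s * (poly q s)\<^sup>2)" by (intro integrable_bump_mult continuous_intros)
    show "integrable lborel (\<lambda>s. indicator {\<alpha>..\<beta>} s * (b0 * (poly q x)\<^sup>2))"
      using ab by (intro integrable_mult_left integrable_real_indicator) auto
    show "indicator {\<alpha>..\<beta>} s * (b0 * (poly q x)\<^sup>2) \<le> bump s * (poly q s)\<^sup>2" for s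
      using b x(2)[of s] bump_bounds[of s] by (auto simp: indicator_def intro!: mult_mono)
  qed
  finally show ?thesis using x(1) by blast
qed

text \<open>Equivalence of norms on polynomials of bounded degree, with a constructive proof: the middle part of the
  interval, where the bump is bounded from below, is divided so that \<open>N + 1\<close> disjoint pieces of length \<open>h\<close> have distances at least
  \<open>h\<close>. Each piece contains a node at which the polynomial is controlled by the weighted integral, and \<open>N + 1\<close> separated nodes
  control the polynomial.\<close>

lemma inverse_estimate_interval:
  fixes R :: real
  assumes R: "R \<ge> 1"
  shows "\<exists>C>0. \<forall>q y. degree q \<le> N \<and> \<bar>y\<bar> \<le> R \<longrightarrow>
     (poly q y)\<^sup>2 \<le> C * (LINT s|lborel. bump s * (poly q s)\<^sup>2) \<and>
     (poly (pderiv q) y)\<^sup>2 \<le> C * (LINT s|lborel. bump s * (poly q s)\<^sup>2)"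
proof -
  have "\<exists>x\<in>{3/8..5/8}. \<forall>s\<in>{3/8..5/8::real}. bump x \<le> bump s"
    by (intro continuous_attains_inf bump_continuous) auto
  then obtain x0 :: real where "x0 \<in> {3/8..5/8}" and x0: "\<And>s. s \<in> {3/8..5/8} \<Longrightarrow> bump x0 \<le> bump s"
    by blast
  then have "bump x0 > 0" by (intro bump_pos) auto
  then obtain b0 where b0: "b0 > 0" "\<And>s. s \<in> {3/8..5/8} \<Longrightarrow> b0 \<le> bump s" using x0 by blast
  \<comment> \<open>There are \<open>N + 1\<close> pieces and \<open>N\<close> gaps of length \<open>h\<close>, which fill the interval of length \<open>1/4\<close>.\<close>
  define h where "h = 1 / (4 * (2 * real N + 1))"
  have h: "h > 0" "(2 * real N + 1) * h = 1 / 4" by (simp_all add: h_def field_simps)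
  define I where "I i = {3/8 + 2 * real i * h .. 3/8 + (2 * real i + 1) * h}" for i :: nat
  have I: "I i \<subseteq> {3/8..5/8}" if "i \<le> N" for i
  proof -
    have "(2 * real i + 1) * h \<le> 1/4" unfolding h(2)[symmetric] using that h(1) by (intro mult_right_mono) auto
    moreover have "0 \<le> 2 * real i * h" using h(1) by simp
    ultimately have "3/8 \<le> 3/8 + 2 * real i * h" "3/8 + (2 * real i + 1) * h \<le> 5/8" by linarith+
    then show ?thesis unfolding I_def atLeastatMost_subset_iff by blast
  qed
  have R0: "R \<ge> 0" using R by simp
  obtain C where C0: "C \<ge> 0" and C1: "\<forall>q M (x :: nat \<Rightarrow> real).
    degree q \<le> N \<and> (\<forall>i\<le>N. \<bar>x i\<bar> \<le> R \<and> \<bar>poly q (x i)\<bar> \<le> M) \<and> (\<forall>i\<le>N. \<forall>j<i. h \<le> \<bar>x i - x j\<bar>) \<longrightarrow>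
    (\<forall>y. \<bar>y\<bar> \<le> R \<longrightarrow> \<bar>poly q y\<bar> \<le> C * M \<and> \<bar>poly (pderiv q) y\<bar> \<le> C * M)"
    using polynomial_bound_by_nodes[OF R0 h(1), of N] by - (erule exE, erule conjE, rule that)
  let ?D = "C\<^sup>2 / (h * b0) + 1"
  show ?thesis
  proof (intro exI[of _ ?D] conjI allI impI)
    show "?D > 0" using h(1) b0(1) by (simp add: add_nonneg_pos)
    fix q :: "real poly" and y :: real assume a: "degree q \<le> N \<and> \<bar>y\<bar> \<le> R"
    let ?m = "LINT s|lborel. bump s * (poly q s)\<^sup>2"
    have m: "?m \<ge> 0" by (intro Bochner_Integration.integral_nonneg) (simp add: bump_bounds)
    have "\<exists>x\<in>I i. h * b0 * (poly q x)\<^sup>2 \<le> ?m" if "i \<le> N" for i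
    proof -
      have len: "3/8 + (2 * real i + 1) * h - (3/8 + 2 * real i * h) = h" by (simp add: algebra_simps)
      have "\<exists>x\<in>{3/8 + 2 * real i * h .. 3/8 + (2 * real i + 1) * h}.
          (3/8 + (2 * real i + 1) * h - (3/8 + 2 * real i * h)) * b0 * (poly q x)\<^sup>2 \<le> ?m"
      proof (rule node_in_interval)
        show "b0 \<le> bump s" if "s \<in> {3/8 + 2 * real i * h .. 3/8 + (2 * real i + 1) * h}" for s
          using b0(2) I[OF \<open>i \<le> N\<close>] that unfolding I_def by blast
        show "3/8 + 2 * real i * h \<le> 3/8 + (2 * real i + 1) * h" using len h(1) by linarith
      qed (rule b0(1))
      then show ?thesis unfolding len I_def .
    qed
    then obtain x where x: "\<And>i. i \<le> N \<Longrightarrow> x i \<in> I i \<and> h * b0 * (poly q (x i))\<^sup>2 \<le> ?m" by metis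
    let ?M = "sqrt (?m / (h * b0))"
    have "\<bar>poly q (x i)\<bar> \<le> ?M" if "i \<le> N" for i
      using x[OF that] h(1) b0(1) by (intro real_le_rsqrt) (simp add: field_simps)
    moreover have "\<bar>x i\<bar> \<le> R" if "i \<le> N" for i using x[OF that] I[OF that] R by fastforce
    moreover have "h \<le> \<bar>x i - x j\<bar>" if "i \<le> N" "j < i" for i j
    proof -
      have "(2 * real j + 2) * h \<le> 2 * real i * h" using that h(1) by (intro mult_right_mono) auto
      then show ?thesis using x[of i] x[of j] that unfolding I_def by (auto simp: algebra_simps)
    qed
    ultimately have "degree q \<le> N \<and> (\<forall>i\<le>N. \<bar>x i\<bar> \<le> R \<and> \<bar>poly q (x i)\<bar> \<le> ?M) \<and> (\<forall>i\<le>N. \<forall>j<i. h \<le> \<bar>x i - x j\<bar>)"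
      using a by blast
    then have "\<bar>poly q y\<bar> \<le> C * ?M \<and> \<bar>poly (pderiv q) y\<bar> \<le> C * ?M"
      using C1 a by blast
    then have "(poly q y)\<^sup>2 \<le> (C * ?M)\<^sup>2 \<and> (poly (pderiv q) y)\<^sup>2 \<le> (C * ?M)\<^sup>2"
      by (simp add: abs_le_square_iff[symmetric]) (meson abs_ge_self order_trans)
    moreover have "(C * ?M)\<^sup>2 \<le> ?D * ?m"
      using m h(1) b0(1) by (simp add: power_mult_distrib algebra_simps)
    ultimately show "(poly q y)\<^sup>2 \<le> ?D * ?m" "(poly (pderiv q) y)\<^sup>2 \<le> ?D * ?m" by auto
  qed
qed

lemma derivative_estimate_interval:
  fixes R :: real
  assumes R: "R \<ge> 1"
  shows "\<exists>C>0. \<forall>q y M. degree q \<le> N \<and> \<bar>y\<bar> \<le> R \<and> (\<forall>t. \<bar>t\<bar> \<le> R \<longrightarrow> \<bar>poly q t\<bar> \<le> M) \<longrightarrow> \<bar>poly (pderiv q) y\<bar> \<le> C * M"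
proof -
  obtain C where C: "C > 0" "\<And>q y. degree q \<le> N \<Longrightarrow> \<bar>y\<bar> \<le> R \<Longrightarrow>
     (poly (pderiv q) y)\<^sup>2 \<le> C * (LINT s|lborel. bump s * (poly q s)\<^sup>2)"
    using inverse_estimate_interval[OF R, of N] by metis
  show ?thesis
  proof (intro exI[of _ "sqrt C"] conjI allI impI)
    show "sqrt C > 0" using C by simp
    fix q :: "real poly" and y M :: real
    assume a: "degree q \<le> N \<and> \<bar>y\<bar> \<le> R \<and> (\<forall>t. \<bar>t\<bar> \<le> R \<longrightarrow> \<bar>poly q t\<bar> \<le> M)"
    then have M: "M \<ge> 0" by (metis abs_ge_zero order_trans)
    have "(LINT s|lborel. bump s * (poly q s)\<^sup>2) \<le> (LINT s|lborel. indicator {0..1::real} s * M\<^sup>2)"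
    proof (rule integral_mono)
      show "integrable lborel (\<lambda>s. bump s * (poly q s)\<^sup>2)" by (intro integrable_bump_mult continuous_intros)
      show "bump s * (poly q s)\<^sup>2 \<le> indicator {0..1} s * M\<^sup>2" for s
      proof (cases "s \<in> {0..1}")
        case True
        then have "\<bar>poly q s\<bar> \<le> M" using a R by auto
        then have "(poly q s)\<^sup>2 \<le> M\<^sup>2" using M by (simp add: abs_le_square_iff[symmetric])
        then have "bump s * (poly q s)\<^sup>2 \<le> 1 * M\<^sup>2" using bump_bounds[of s] by (intro mult_mono) auto
        then show ?thesis using True by simp
      qed (use bump_zero in auto)
    qed auto
    then have "(LINT s|lborel. bump s * (poly q s)\<^sup>2) \<le> M\<^sup>2" by simp
    then have "(poly (pderiv q) y)\<^sup>2 \<le> C * M\<^sup>2" using C(2)[of q y] a C(1) by (smt (verit) mult_left_mono)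
    then have "\<bar>poly (pderiv q) y\<bar> \<le> sqrt (C * M\<^sup>2)" by (intro real_le_rsqrt) simp
    then show "\<bar>poly (pderiv q) y\<bar> \<le> sqrt C * M" using M by (simp add: real_sqrt_mult)
  qed
qed

definition ref_box :: "real \<Rightarrow> (real^2) set" where "ref_box R = {z. \<forall>i. \<bar>z $ i\<bar> \<le> R}"

lemma ref_box_cbox: "ref_box R = cbox (\<chi> i. - R) (\<chi> i. R)"
  by (auto simp: ref_box_def mem_box_cart abs_le_iff) (metis minus_le_iff)+

lemma closed_ref_box: "closed (ref_box R)" and bounded_ref_box: "bounded (ref_box R)"
  unfolding ref_box_cbox by auto

lemma pd_polyfun_line:
  assumes Q: "polyfun N Q" and q: "\<forall>t. Q (p + t *\<^sub>R axis i 1) = poly q t"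
  shows "pd i Q (p + t *\<^sub>R axis i 1) = poly (pderiv q) t"
proof -
  have "((\<lambda>t. Q (p + t *\<^sub>R axis i 1)) has_real_derivative pd i Q (p + t *\<^sub>R axis i 1)) (at t)"
    using line_derivative[OF smooth_polyfun[OF Q], of p "axis i 1" t] by (simp add: axis_def if_distrib cong: if_cong)
  then have "(poly q has_real_derivative pd i Q (p + t *\<^sub>R axis i 1)) (at t)"
    unfolding q[rule_format] by simp
  then show ?thesis using poly_DERIV[of q t] by (rule DERIV_unique)
qed

lemma derivative_estimate_box:
  fixes R :: real
  assumes R: "R \<ge> 1"
  shows "\<exists>C>0. \<forall>Q M. polyfun N Q \<and> (\<forall>z\<in>ref_box R. \<bar>Q z\<bar> \<le> M) \<longrightarrow> (\<forall>i. \<forall>z\<in>ref_box R. \<bar>pd i Q z\<bar> \<le> C * M)"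
proof -
  obtain C where C: "C > 0" "\<And>q y M. degree q \<le> N \<Longrightarrow> \<bar>y\<bar> \<le> R \<Longrightarrow> (\<forall>t. \<bar>t\<bar> \<le> R \<longrightarrow> \<bar>poly q t\<bar> \<le> M) \<Longrightarrow> \<bar>poly (pderiv q) y\<bar> \<le> C * M"
    using derivative_estimate_interval[OF R, of N] by metis
  show ?thesis
  proof (intro exI[of _ C] conjI C(1) allI impI ballI)
    fix Q M i z assume a: "polyfun N Q \<and> (\<forall>z\<in>ref_box R. \<bar>Q z\<bar> \<le> M)" and z: "z \<in> ref_box R"
    let ?p = "z - (z $ i) *\<^sub>R axis i 1"
    obtain q where q: "degree q \<le> N" "\<forall>t. Q (?p + t *\<^sub>R axis i 1) = poly q t" using polyfun_line a by metis
    have in_box: "?p + t *\<^sub>R axis i 1 \<in> ref_box R" if "\<bar>t\<bar> \<le> R" for t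
      using z that by (auto simp: ref_box_def axis_def)
    have "\<bar>poly q t\<bar> \<le> M" if "\<bar>t\<bar> \<le> R" for t
      using a in_box[OF that] unfolding q(2)[rule_format, symmetric] by blast
    then have "\<bar>poly (pderiv q) (z $ i)\<bar> \<le> C * M"
      using z q(1) by (intro C(2)[of q]) (auto simp: ref_box_def)
    then show "\<bar>pd i Q z\<bar> \<le> C * M" using pd_polyfun_line[of N Q ?p i q "z $ i"] a q(2) by simp
  qed
qed

text \<open>The estimate on an interval is applied twice, along horizontal and along vertical lines.\<close>

lemma inverse_estimate_box:
  fixes R :: real
  assumes R: "R \<ge> 1"
  shows "\<exists>C>0. \<forall>Q. polyfun N Q \<longrightarrow> (\<forall>z\<in>ref_box R. (Q z)\<^sup>2 \<le> C * (LINT z|lborel. bump (z $ 1) * bump (z $ 2) * (Q z)\<^sup>2))"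
proof -
  obtain C where C: "C > 0" "\<And>q y. degree q \<le> N \<Longrightarrow> \<bar>y\<bar> \<le> R \<Longrightarrow>
     (poly q y)\<^sup>2 \<le> C * (LINT s|lborel. bump s * (poly q s)\<^sup>2)"
    using inverse_estimate_interval[OF R, of N] by metis
  show ?thesis
  proof (intro exI[of _ "C * C"] conjI allI impI ballI)
    show "C * C > 0" using C by simp
    fix Q z assume Q: "polyfun N Q" and z: "z \<in> ref_box R"
    let ?e1 = "axis 1 1 :: real^2" and ?e2 = "axis 2 1 :: real^2"
    define P where "P s t = Q (0 + s *\<^sub>R perp ?e1 + t *\<^sub>R ?e1)" for s t
    have pe: "perp ?e1 = ?e2" by (simp add: vec_eq_2 axis_def)
    let ?f = "\<lambda>z. bump (z $ 1) * bump (z $ 2) * (Q z)\<^sup>2"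
    have zero: "?f z = 0" if "z \<notin> ref_box 1" for z
    proof -
      have "\<not> (\<bar>z $ 1\<bar> \<le> 1 \<and> \<bar>z $ 2\<bar> \<le> 1)" using that by (auto simp: ref_box_def forall_2)
      then have "bump (z $ 1) = 0 \<or> bump (z $ 2) = 0" by (auto intro!: bump_zero)
      then show ?thesis by auto
    qed
    have cont: "continuous_on UNIV ?f"
      by (intro continuous_on_mult continuous_on_power smooth_continuous[OF smooth_polyfun[OF Q]]
          continuous_on_compose2[OF bump_continuous[of UNIV]] smooth_continuous[OF smooth_coord]) auto
    have int: "integrable lborel ?f"
      by (intro integrable_bounded_support cont bounded_subset[OF bounded_ref_box[of 1]]) (use zero in auto)
    have ev: "?f (0 + s *\<^sub>R perp ?e1 + t *\<^sub>R ?e1) = bump s * (bump t * (P s t)\<^sup>2)" for s t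
      by (simp add: P_def pe axis_def mult_ac)
    have n: "norm ?e1 = 1" by simp
    note fr = integral_frame[OF n int, of 0, unfolded ev]
    have line_t: "\<exists>q. degree q \<le> N \<and> (\<forall>t. P s t = poly q t)" for s unfolding P_def by (rule polyfun_line[OF Q])
    have line_s: "\<exists>q. degree q \<le> N \<and> (\<forall>s. P s t = poly q s)" for t
    proof -
      have "P s t = Q (t *\<^sub>R ?e1 + s *\<^sub>R perp ?e1)" for s by (simp add: P_def add.commute)
      then show ?thesis using polyfun_line[OF Q, of "t *\<^sub>R ?e1" "perp ?e1"] by simp
    qed
    let ?t = "z $ 1" and ?s = "z $ 2"
    have zt: "\<bar>?t\<bar> \<le> R" "\<bar>?s\<bar> \<le> R" using z by (auto simp: ref_box_def)
    have 1: "(P s ?t)\<^sup>2 \<le> C * (LINT t|lborel. bump t * (P s t)\<^sup>2)" for s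
      using line_t[of s] C(2)[OF _ zt(1)] by fastforce
    have 2: "(P ?s ?t)\<^sup>2 \<le> C * (LINT s|lborel. bump s * (P s ?t)\<^sup>2)"
      using line_s[of ?t] C(2)[OF _ zt(2)] by fastforce
    have i1: "integrable lborel (\<lambda>s. bump s * (P s ?t)\<^sup>2)"
    proof -
      obtain q where q: "\<forall>s. P s ?t = poly q s" using line_s by blast
      show ?thesis unfolding q[rule_format] by (intro integrable_bump_mult continuous_intros)
    qed
    have i2: "integrable lborel (\<lambda>s. bump s * (C * (LINT t|lborel. bump t * (P s t)\<^sup>2)))"
      using lborel_pair.integrable_fst'[OF fr(1)] by (simp add: mult.left_commute)
    have "(LINT s|lborel. bump s * (P s ?t)\<^sup>2) \<le> (LINT s|lborel. bump s * (C * (LINT t|lborel. bump t * (P s t)\<^sup>2)))"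
      by (rule integral_mono[OF i1 i2]) (intro mult_left_mono 1 bump_bounds)
    also have "\<dots> = C * (LINT z|lborel. ?f z)"
      unfolding fr(2) by (simp add: mult.left_commute)
    finally have "(P ?s ?t)\<^sup>2 \<le> C * (C * (LINT z|lborel. ?f z))"
      using 2 C(1) by (smt (verit) mult_left_mono)
    moreover have "P ?s ?t = Q z"
    proof -
      have "0 + ?s *\<^sub>R perp ?e1 + ?t *\<^sub>R ?e1 = z" unfolding pe by (simp add: vec_eq_2 axis_def)
      then show ?thesis by (simp add: P_def)
    qed
    ultimately show "(Q z)\<^sup>2 \<le> C * C * (LINT z|lborel. ?f z)" by simp
  qed
qed

lemma smooth_bounded:
  assumes "smooth f" "bounded {x. f x \<noteq> 0}" shows "\<exists>B>0. \<forall>x. \<bar>f x\<bar> \<le> B"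
proof -
  have "compact (f ` closure {x. f x \<noteq> 0})"
    using assms by (intro compact_continuous_image smooth_continuous) auto
  then obtain B where B: "\<And>x. x \<in> closure {x. f x \<noteq> 0} \<Longrightarrow> \<bar>f x\<bar> \<le> B"
    using compact_imp_bounded[of "f ` closure {x. f x \<noteq> 0}"] unfolding bounded_iff by auto
  have "\<bar>f x\<bar> \<le> \<bar>B\<bar> + 1" for x
    using B[of x] closure_subset[of "{x. f x \<noteq> 0}"] by (cases "f x = 0") (force simp: subset_iff)+
  then show ?thesis by (intro exI[of _ "\<bar>B\<bar> + 1"]) auto
qed

text \<open>On the reference square, second derivatives of the product are bounded by the maximum of the polynomial, since the
  derivatives of polynomials of bounded degree are.\<close>

lemma bump_polynomial_bounds:
  assumes b: "smooth b" "\<And>z. z \<notin> ref_box 1 \<Longrightarrow> b z = 0"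
  shows "\<exists>C>0. \<forall>Q M. polyfun N Q \<and> (\<forall>z\<in>ref_box 1. \<bar>Q z\<bar> \<le> M) \<longrightarrow>
    (\<forall>z. \<bar>b z * Q z\<bar> \<le> C * M \<and> (\<forall>i j. \<bar>pd j (pd i (\<lambda>z. b z * Q z)) z\<bar> \<le> C * M))"
proof -
  obtain C where C: "C > 0" "\<And>Q M i z. polyfun N Q \<Longrightarrow> (\<And>z. z\<in>ref_box 1 \<Longrightarrow> \<bar>Q z\<bar> \<le> M) \<Longrightarrow> z \<in> ref_box 1 \<Longrightarrow> \<bar>pd i Q z\<bar> \<le> C * M"
    using derivative_estimate_box[of 1 N] by (metis order_refl)
  have bs: "bounded {z. b z \<noteq> 0}" using b(2) by (intro bounded_subset[OF bounded_ref_box[of 1]]) auto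
  have "\<exists>B>0. \<forall>x. \<bar>b x\<bar> \<le> B \<and> (\<forall>i. \<bar>pd i b x\<bar> \<le> B \<and> (\<forall>j. \<bar>pd j (pd i b) x\<bar> \<le> B))"
  proof -
    obtain B0 where B0: "B0 > 0" "\<And>x. \<bar>b x\<bar> \<le> B0" using smooth_bounded[OF b(1) bs] by blast
    obtain B1 where B1: "\<And>i x. \<bar>pd i b x\<bar> \<le> B1 i"
      using smooth_bounded[OF smooth_pd[OF b(1)] bounded_support_pd[OF bs]] by metis
    obtain B2 where B2: "\<And>i j x. \<bar>pd j (pd i b) x\<bar> \<le> B2 i j"
    proof -
      have "\<forall>i j. \<exists>B. \<forall>x. \<bar>pd j (pd i b) x\<bar> \<le> B"
        using smooth_bounded[OF smooth_pd[OF smooth_pd[OF b(1)]] bounded_support_pd[OF bounded_support_pd[OF bs]]] by blast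
      then obtain B2 where "\<forall>i j x. \<bar>pd j (pd i b) x\<bar> \<le> B2 i j" by metis
      then show thesis by (intro that) blast
    qed
    let ?B = "B0 + (\<Sum>i\<in>UNIV. \<bar>B1 i\<bar>) + (\<Sum>i\<in>UNIV. \<Sum>j\<in>UNIV. \<bar>B2 i j\<bar>)"
    have "\<bar>B1 i\<bar> \<le> (\<Sum>i\<in>UNIV. \<bar>B1 i\<bar>)" for i by (rule member_le_sum) auto
    moreover have "\<bar>B2 i j\<bar> \<le> (\<Sum>i\<in>UNIV. \<Sum>j\<in>UNIV. \<bar>B2 i j\<bar>)" for i j
      by (rule order_trans[OF member_le_sum[of j UNIV "\<lambda>j. \<bar>B2 i j\<bar>"] member_le_sum[of i UNIV "\<lambda>i. \<Sum>j\<in>UNIV. \<bar>B2 i j\<bar>"]])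
        (auto intro: sum_nonneg)
    moreover have "0 \<le> (\<Sum>i\<in>UNIV. \<bar>B1 i\<bar>)" "0 \<le> (\<Sum>i\<in>UNIV. \<Sum>j\<in>UNIV. \<bar>B2 i j\<bar>)" by (auto intro!: sum_nonneg)
    ultimately show ?thesis
      using B0 B1 B2 by (intro exI[of _ ?B]) (smt (verit))
  qed
  then obtain B where B: "B > 0" "\<And>x. \<bar>b x\<bar> \<le> B" "\<And>i x. \<bar>pd i b x\<bar> \<le> B" "\<And>i j x. \<bar>pd j (pd i b) x\<bar> \<le> B" by blast
  let ?C = "B * (1 + C) * (1 + C)"
  show ?thesis
  proof (intro exI[of _ ?C] conjI allI impI)
    show "?C > 0" using B C by simp
    fix Q M z i j
    assume a: "polyfun N Q \<and> (\<forall>z\<in>ref_box 1. \<bar>Q z\<bar> \<le> M)"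
    have sQ: "smooth Q" using a smooth_polyfun by blast
    have "0 \<in> ref_box 1" by (simp add: ref_box_def)
    then have M: "M \<ge> 0" using a by force
    have MC: "M \<le> (1 + C) * M" "(1 + C) * M \<le> (1 + C) * ((1 + C) * M)"
      using M C(1) by (simp_all add: mult_le_cancel_right1 algebra_simps)
    show "\<bar>b z * Q z\<bar> \<le> ?C * M"
    proof (cases "z \<in> ref_box 1")
      case True
      then have "\<bar>b z * Q z\<bar> \<le> B * ((1 + C) * ((1 + C) * M))"
        using a B MC unfolding abs_mult by (intro mult_mono) force+
      then show ?thesis by (simp add: mult.assoc)
    qed (use b B C M in simp)
    show "\<bar>pd j (pd i (\<lambda>z. b z * Q z)) z\<bar> \<le> ?C * M"
    proof (cases "z \<in> ref_box 1")
      case True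
      have d1: "\<bar>pd k Q y\<bar> \<le> C * M" if "y \<in> ref_box 1" for k y using C(2) a that by blast
      have d2: "\<bar>pd l (pd k Q) y\<bar> \<le> C * (C * M)" if "y \<in> ref_box 1" for k l y
        by (rule C(2)[OF polyfun_pd _ that]) (use a d1 in auto)
      have e: "pd j (pd i (\<lambda>z. b z * Q z)) = (\<lambda>z. pd j (pd i b) z * Q z + pd i b z * pd j Q z + (pd j b z * pd i Q z + b z * pd j (pd i Q) z))"
        by (simp add: pd_mult pd_add b(1) sQ smooth_pd smooth_mult)
      have "\<bar>pd j (pd i (\<lambda>z. b z * Q z)) z\<bar> \<le> \<bar>pd j (pd i b) z\<bar> * \<bar>Q z\<bar> + \<bar>pd i b z\<bar> * \<bar>pd j Q z\<bar>
          + (\<bar>pd j b z\<bar> * \<bar>pd i Q z\<bar> + \<bar>b z\<bar> * \<bar>pd j (pd i Q) z\<bar>)"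
        unfolding e by (intro order_trans[OF abs_triangle_ineq] add_mono) (simp_all add: abs_mult)
      also have "\<dots> \<le> B * M + B * (C * M) + (B * (C * M) + B * (C * (C * M)))"
        using B d1 d2 a True C M by (intro add_mono mult_mono) auto
      also have "\<dots> = ?C * M" by (simp add: algebra_simps)
      finally show ?thesis .
    next
      case False
      have "{z. b z * Q z \<noteq> 0} \<subseteq> ref_box 1" using b(2) by auto
      then have "closure {z. b z * Q z \<noteq> 0} \<subseteq> ref_box 1" by (intro closure_minimal closed_ref_box)
      moreover have "closure {z. pd i (\<lambda>z. b z * Q z) z \<noteq> 0} \<subseteq> closure {z. b z * Q z \<noteq> 0}"
        using pd_zero_off_support[of _ "\<lambda>z. b z * Q z"] by (intro closure_minimal) (blast, simp)
      ultimately have "pd j (pd i (\<lambda>z. b z * Q z)) z = 0" using False by (intro pd_zero_off_support) blast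
      then show ?thesis using B C M by simp
    qed
  qed
qed

text \<open>The scaling of second derivatives under affine transformations: each derivative contributes a factor of the size of the matrix.
  The factor 4 counts the terms in the chain rule.\<close>

lemma second_pd_comp_bound:
  assumes W: "smooth W" "\<And>i j z. \<bar>pd j (pd i W) z\<bar> \<le> D" and A: "\<And>k i. \<bar>A $ k $ i\<bar> \<le> a"
  shows "\<bar>pd j (pd i (\<lambda>x. W (A *v x + b))) x\<bar> \<le> 4 * (a\<^sup>2 * D)"
proof -
  have a: "a \<ge> 0" using A[of 1 1] by linarith
  have s: "smooth (\<lambda>x. pd k W (A *v x + b))" for k by (intro smooth_comp smooth_pd W)
  have "pd j (pd i (\<lambda>x. W (A *v x + b))) x =
      (\<Sum>k\<in>UNIV. A $ k $ i * (\<Sum>l\<in>UNIV. A $ l $ j * pd l (pd k W) (A *v x + b)))"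
    by (simp add: pd_comp[OF W(1)] pd_sum smooth_mult s pd_cmult pd_comp[OF smooth_pd[OF W(1)]])
  also have "\<bar>\<dots>\<bar> \<le> (\<Sum>k\<in>(UNIV::2 set). \<Sum>l\<in>(UNIV::2 set). a * (a * D))"
    unfolding sum_distrib_left
    by (intro order_trans[OF sum_abs] sum_mono) (auto simp: abs_mult intro!: mult_mono A W a)
  also have "\<dots> = 4 * (a\<^sup>2 * D)" by (simp add: power2_eq_square)
  finally show ?thesis .
qed

section \<open>Mesh geometry\<close>

text \<open>A domain may in general touch parts of its boundary from both sides. For a Lipschitz domain this is impossible: above the graph
  that locally bounds the domain there are no points of its closure.\<close>

lemma lipschitz_frontier:
  assumes "lipschitz_domain \<Omega>" "x \<in> frontier \<Omega>" shows "x \<notin> interior (closure \<Omega>)"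
proof
  assume "x \<in> interior (closure \<Omega>)"
  then obtain r1 where r1: "r1 > 0" "ball x r1 \<subseteq> closure \<Omega>" by (meson mem_interior)
  obtain r n L and \<gamma> :: "real \<Rightarrow> real" where r: "r > 0" "norm n = 1" "L-lipschitz_on UNIV \<gamma>"
      "\<Omega> \<inter> ball x r = {y \<in> ball x r. y \<bullet> n < \<gamma> (y \<bullet> perp n)}"
    using assms unfolding lipschitz_domain_def by blast
  have "open \<Omega>" using assms(1) by (simp add: lipschitz_domain_def)
  then have "x \<notin> \<Omega>" using assms(2) by (simp add: frontier_def interior_open)
  then have x: "\<gamma> (x \<bullet> perp n) \<le> x \<bullet> n" using r by force
  have cg: "continuous_on UNIV \<gamma>" using r(3) lipschitz_on_continuous_on by blast
  let ?U = "ball x r \<inter> {y. \<gamma> (y \<bullet> perp n) < y \<bullet> n}"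
  have "open {y. \<gamma> (y \<bullet> perp n) < y \<bullet> n}"
    by (intro open_Collect_less continuous_on_compose2[OF cg] continuous_intros) auto
  then have U: "open ?U" by blast
  have "y \<bullet> n < \<gamma> (y \<bullet> perp n)" if "y \<in> ball x r" "y \<in> \<Omega>" for y
    using equalityD1[OF r(4)] that by blast
  then have "?U \<inter> \<Omega> = {}" by force
  then have Uc: "?U \<inter> closure \<Omega> = {}" using U by (simp add: open_Int_closure_eq_empty)
  let ?y = "x + (min r r1 / 2) *\<^sub>R n"
  have "dist x ?y = min r r1 / 2" using r(1,2) r1(1) by (simp add: dist_norm)
  then have "?y \<in> ball x r" "?y \<in> ball x r1" using r(1) r1(1) by auto
  moreover have "?y \<in> {y. \<gamma> (y \<bullet> perp n) < y \<bullet> n}"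
    using x r(1,2) r1(1) by (simp add: inner_add_left norm_eq_1)
  ultimately show False using Uc r1(2) by blast
qed

text \<open>The half-thickness of the test boxes relative to the length of the edge. It is chosen so small that the box does not reach the other
  two edges of a triangle whose diameter is at most \<open>\<kappa>\<close> times its inradius.\<close>

definition thickness :: "real \<Rightarrow> real" where "thickness \<kappa> = 1 / (32 * max 1 \<kappa>)"

lemma thickness: "0 < thickness \<kappa>" "thickness \<kappa> \<le> 1 / 32" "thickness \<kappa> * \<kappa> \<le> 1 / 32"
  by (auto simp: thickness_def field_simps max_def)

locale kirchhoff_mesh =
  fixes \<Omega> \<Gamma>c \<Gamma>s \<Gamma>f :: "(real^2) set" and \<kappa> :: real and \<T> :: "(real^2) set set"
  assumes lipschitz: "lipschitz_domain \<Omega>"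
    and partition: "boundary_partition \<Omega> \<Gamma>c \<Gamma>s \<Gamma>f"
    and mesh: "plate_mesh \<Omega> \<Gamma>c \<Gamma>s \<Gamma>f \<kappa> \<T>"
begin

sublocale bounded_open \<Omega>
  using lipschitz by unfold_locales (auto simp: lipschitz_domain_def)

lemma finite_mesh: "finite \<T>"
  using mesh by (simp add: plate_mesh_def triangulation_def)

lemma Union_mesh: "\<Union>\<T> = closure \<Omega>"
  using mesh by (simp add: plate_mesh_def)

lemma mesh_Int_face:
  assumes "K \<in> \<T>" "K' \<in> \<T>" shows "K \<inter> K' face_of K" "K \<inter> K' face_of K'"
proof -
  have f: "\<forall>T T'. T \<in> \<T> \<and> T' \<in> \<T> \<longrightarrow> (T \<inter> T') face_of T"
    using mesh by (simp add: plate_mesh_def triangulation_def)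
  then show "K \<inter> K' face_of K" using assms by simp
  have "K' \<inter> K face_of K'" using f assms by simp
  then show "K \<inter> K' face_of K'" by (simp only: Int_commute)
qed

lemma triangle:
  assumes "K \<in> \<T>"
  shows "2 simplex K" "convex K" "compact K" "closed K" "polyhedron K" "interior K \<noteq> {}" "aff_dim K = 2"
    "K \<subseteq> closure \<Omega>" "bounded K" "rel_interior K = interior K"
proof -
  show s: "2 simplex K" using mesh assms by (simp add: plate_mesh_def)
  show "convex K" "polyhedron K" "aff_dim K = 2" using s convex_simplex simplex_imp_polyhedron aff_dim_simplex by blast+
  show c: "compact K" using s simplex_imp_polytope polytope_imp_compact by blast
  then show "closed K" "bounded K" by (auto simp: compact_imp_closed compact_imp_bounded)
  obtain x \<rho> where "\<rho> > 0" "ball x \<rho> \<subseteq> K" using mesh assms unfolding plate_mesh_def by blast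
  then have "x \<in> interior K" using mem_interior by blast
  then show i: "interior K \<noteq> {}" by blast
  then show "rel_interior K = interior K" by (rule rel_interior_nonempty_interior)
  show "K \<subseteq> closure \<Omega>" using assms Union_mesh by blast
qed

lemma inscribed_ball:
  assumes "K \<in> \<T>"
  obtains c \<rho> where "\<rho> > 0" "ball c \<rho> \<subseteq> K" "diameter K \<le> \<kappa> * \<rho>"
  using mesh assms unfolding plate_mesh_def by blast

text \<open>In a conforming mesh, a face that meets the relative interior of another face contains it: the intersection of the two
  triangles is a common face, and in a single convex set this is a standard property of faces.\<close>

lemma mesh_face_subset:
  assumes "K \<in> \<T>" "K' \<in> \<T>" "e face_of K" "F face_of K'" "x \<in> rel_interior e" "x \<in> F"
  shows "e \<subseteq> F"
proof -
  have "F \<inter> K face_of K' \<inter> K" using assms(1,4) triangle(2) by (intro face_of_slice)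
  moreover have "K' \<inter> K face_of K" using mesh_Int_face assms by blast
  ultimately have "F \<inter> K face_of K" by (rule face_of_trans)
  moreover have "e \<subseteq> K" using assms(3) by (rule face_of_imp_subset)
  moreover have "(F \<inter> K) \<inter> rel_interior e \<noteq> {}"
    using assms(5,6) \<open>e \<subseteq> K\<close> rel_interior_subset[of e] by blast
  ultimately have "e \<subseteq> F \<inter> K" by (rule subset_of_face_of)
  then show ?thesis by blast
qed

lemma mesh_subset_eq:
  assumes "K \<in> \<T>" "K' \<in> \<T>" "K \<subseteq> K'" shows "K = K'"
proof (rule ccontr)
  assume "K \<noteq> K'"
  have "K \<inter> K' face_of K'" using mesh_Int_face assms by blast
  then have "K face_of K'" using assms(3) by (simp add: Int_absorb2)
  then have "aff_dim K < aff_dim K'" using \<open>K \<noteq> K'\<close> face_of_aff_dim_lt triangle(2)[OF assms(2)] by blast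
  then show False using triangle(7) assms by simp
qed

lemma interior_disjoint_face:
  assumes "K \<in> \<T>" "K' \<in> \<T>" "F face_of K'" "x \<in> interior K" "x \<in> F" shows "F = K \<and> K' = K"
proof -
  have "K \<subseteq> F"
    using mesh_face_subset[of K K' K F x] assms triangle[of K] face_of_refl by auto
  moreover have "F \<subseteq> K'" using assms(3) by (rule face_of_imp_subset)
  ultimately show ?thesis using mesh_subset_eq[OF assms(1,2)] by blast
qed

lemma edge_of_subset_mesh:
  assumes "K \<in> \<T>" "K' \<in> \<T>" "e edge_of K" "e \<subseteq> K'" shows "e edge_of K'"
proof -
  have "e face_of K" "aff_dim e = 1" using assms(3) by (auto simp: edge_of_def)
  then have "e face_of K \<inter> K'" using face_of_subset[of e K "K \<inter> K'"] assms(4) face_of_imp_subset by blast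
  then have "e face_of K'" using mesh_Int_face[OF assms(1,2)] face_of_trans by blast
  then show ?thesis using \<open>aff_dim e = 1\<close> by (simp add: edge_of_def)
qed

lemma edge_segment:
  assumes "K \<in> \<T>" "e edge_of K"
  shows "is_segment e" "e \<subseteq> K" "e face_of K" "rel_interior e = arc_point e ` {0<..<diameter e}"
    "diameter e \<le> diameter K"
proof -
  show f: "e face_of K" using assms by (simp add: edge_of_def)
  have d: "aff_dim e = 1" using assms by (simp add: edge_of_def)
  show s: "e \<subseteq> K" using f by (rule face_of_imp_subset)
  have "e \<noteq> {}" using d by auto
  moreover have "compact e" "convex e" using f triangle(2,3)[OF assms(1)] face_of_imp_compact face_of_imp_convex by blast+
  moreover have "collinear e" using d by (simp add: collinear_aff_dim)
  ultimately obtain a b where ab: "e = closed_segment a b" using compact_convex_collinear_segment by blast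
  have "a \<noteq> b" using d ab by auto
  then show seg: "is_segment e" using ab is_segment_def by blast
  note se = segment_arc_ends[OF seg]
  let ?a = "fst (arc_ends e)" and ?b = "snd (arc_ends e)" and ?L = "diameter e"
  have g: "arc_point e t = ?a + (t / ?L) *\<^sub>R (?b - ?a)" for t
    by (simp add: arc_point_def arc_start_def arc_dir_def se(3) divide_inverse)
  have "rel_interior e = open_segment ?a ?b"
    using se(2) by (subst se(1)) (simp add: rel_interior_closed_segment)
  also have "\<dots> = (\<lambda>u. ?a + u *\<^sub>R (?b - ?a)) ` {0<..<1}"
    using se(2) by (simp add: open_segment_image_interval algebra_simps)
  also have "{0<..<1} = (\<lambda>t. t / ?L) ` {0<..<?L}"
    using se(4) by (auto simp: image_iff field_simps intro!: bexI[of _ "_ * ?L"])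
  finally show "rel_interior e = arc_point e ` {0<..<?L}" by (simp add: image_image g)
  show "?L \<le> diameter K" by (intro diameter_subset s triangle(9) assms)
qed

lemma kappa_pos: assumes "K \<in> \<T>" shows "\<kappa> > 0"
proof -
  obtain c \<rho> where c: "\<rho> > 0" "ball c \<rho> \<subseteq> K" "diameter K \<le> \<kappa> * \<rho>" by (rule inscribed_ball[OF assms])
  have p: "c \<in> K" "c + (\<rho> / 2) *\<^sub>R axis 1 1 \<in> K" using c(1,2) by (auto simp: subset_iff dist_norm)
  have "dist c (c + (\<rho> / 2) *\<^sub>R axis 1 1) \<le> diameter K"
    by (rule diameter_bounded_bound[OF triangle(9)[OF assms] p])
  then have "0 < \<kappa> * \<rho>" using c by (simp add: dist_norm)
  then show ?thesis using c(1) by (simp add: zero_less_mult_iff)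
qed

definition edge_perp :: "(real^2) set \<Rightarrow> real^2" where "edge_perp e = perp (arc_dir e)"

text \<open>The line through an edge supports the triangle. The outward normal is unique because the triangle has interior points, so the
  definite description in \<open>edge_normal\<close> denotes.\<close>

lemma edge_normal_exists:
  assumes "K \<in> \<T>" "e edge_of K"
  shows "norm (edge_normal K e) = 1 \<and> (edge_normal K e = edge_perp e \<or> edge_normal K e = - edge_perp e) \<and>
    K \<subseteq> half_plane (arc_start e) (edge_normal K e)"
proof -
  note e = edge_segment[OF assms] and se = segment_arc_ends[OF edge_segment(1)[OF assms]]
  let ?\<tau> = "arc_dir e" and ?a = "arc_start e" and ?L = "diameter e"
  let ?P = "\<lambda>n. norm n = 1 \<and> (\<forall>x\<in>K. \<forall>y\<in>e. (x - y) \<bullet> n \<le> 0)"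
  have aL: "?a \<in> e" "?a + ?L *\<^sub>R ?\<tau> \<in> e"
    using arc_point_in[OF e(1), of 0] arc_point_in[OF e(1), of ?L] se(4) by (auto simp: arc_point_def)
  have N1: "norm (edge_perp e) = 1" using se(5) by (simp add: edge_perp_def)
  have N: "h = (h \<bullet> edge_perp e) *\<^sub>R edge_perp e" if "h \<bullet> ?\<tau> = 0" for h
    using perp_expansion[OF se(5), of h] that by (simp add: edge_perp_def)
  have pm: "n = edge_perp e \<or> n = - edge_perp e" if "?P n" for n
  proof -
    have "(?a + ?L *\<^sub>R ?\<tau> - ?a) \<bullet> n \<le> 0" "(?a - (?a + ?L *\<^sub>R ?\<tau>)) \<bullet> n \<le> 0" using that aL e(2) by blast+
    then have "?L * (?\<tau> \<bullet> n) = 0" by simp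
    then have "n \<bullet> ?\<tau> = 0" using se(4) by (simp add: inner_commute)
    then have n: "n = (n \<bullet> edge_perp e) *\<^sub>R edge_perp e" by (rule N)
    then have "\<bar>n \<bullet> edge_perp e\<bar> = 1" using that N1 by (metis norm_scaleR mult.right_neutral)
    then have "n \<bullet> edge_perp e = 1 \<or> n \<bullet> edge_perp e = -1" by linarith
    then show ?thesis using n by (metis scaleR_one scaleR_minus1_left)
  qed
  have unique: "n = m" if "?P n" "?P m" for n m
  proof (rule ccontr)
    assume ne: "n \<noteq> m"
    then have m: "m = - n" using pm[OF that(1)] pm[OF that(2)] by auto
    obtain c where "c \<in> interior K" using triangle(6)[OF assms(1)] by blast
    then obtain r where r: "r > 0" "ball c r \<subseteq> K" by (meson mem_interior)
    have z: "(x - ?a) \<bullet> n = 0" if "x \<in> K" for x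
    proof -
      have "(x - ?a) \<bullet> n \<le> 0" "(x - ?a) \<bullet> m \<le> 0" using \<open>?P n\<close> \<open>?P m\<close> that aL by blast+
      then show ?thesis using m by simp
    qed
    have "c \<in> K" "c + (r / 2) *\<^sub>R n \<in> K" using r that(1) by (auto simp: subset_iff dist_norm)
    from z[OF this(1)] z[OF this(2)] have "(r / 2) * (n \<bullet> n) = 0" by (simp add: inner_add_left inner_diff_left)
    then show False using r(1) that(1) by (auto simp: norm_eq_1)
  qed
  have ex: "\<exists>n. ?P n"
  proof -
    have "e exposed_face_of K" using e(3) triangle(5)[OF assms(1)] by (simp add: exposed_face_of_polyhedron)
    then obtain w b where w: "K \<subseteq> {x. w \<bullet> x \<le> b}" "e = K \<inter> {x. w \<bullet> x = b}" by (auto simp: exposed_face_of_def)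
    have "w \<noteq> 0"
    proof
      assume "w = 0"
      then have "e = K" using w aL by auto
      then show False using assms triangle(7) by (simp add: edge_of_def)
    qed
    have "?P (w /\<^sub>R norm w)"
    proof (intro conjI ballI)
      show "norm (w /\<^sub>R norm w) = 1" using \<open>w \<noteq> 0\<close> by simp
      fix x y assume "x \<in> K" "y \<in> e"
      then have "w \<bullet> x \<le> b" "w \<bullet> y = b" using w by auto
      moreover have "(x - y) \<bullet> w = w \<bullet> x - w \<bullet> y"
        by (simp add: inner_commute[of "x - y" w] inner_diff_right)
      ultimately have "(x - y) \<bullet> w \<le> 0" by linarith
      then show "(x - y) \<bullet> (w /\<^sub>R norm w) \<le> 0"
        by (simp add: mult_nonneg_nonpos)
    qed
    then show ?thesis by blast
  qed
  have "?P (edge_normal K e)"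
    unfolding edge_normal_def by (rule theI') (use ex unique in blast)
  then show ?thesis using pm aL unfolding half_plane_def by blast
qed

lemmas edge_normal_norm = edge_normal_exists[THEN conjunct1]
lemmas edge_normal_pm = edge_normal_exists[THEN conjunct2, THEN conjunct1]
lemmas triangle_half_plane = edge_normal_exists[THEN conjunct2, THEN conjunct2]

text \<open>The triangle contains all points between the edge and the centre \<open>c\<close> of the inscribed ball. The point \<open>x\<close> at distance \<open>t\<close> from the edge
  is the image of a point of the edge under the contraction towards \<open>c\<close> by the small factor \<open>\<mu> = t/T\<close>, where \<open>T\<close> is the distance of \<open>c\<close> from
  the line of the edge. Solving for the parameter \<open>\<sigma>\<close> of that point, shape regularity shows that it stays on the edge.\<close>

lemma half_box_in_triangle:
  assumes K: "K \<in> \<T>" "e edge_of K" and s: "diameter e / 8 \<le> s" "s \<le> 7 * diameter e / 8"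
    and t: "0 \<le> t" "t \<le> thickness \<kappa> * diameter e"
  defines "x \<equiv> arc_point e s - t *\<^sub>R edge_normal K e"
  shows "t > 0 \<Longrightarrow> x \<in> interior K" and "t = 0 \<Longrightarrow> x \<in> rel_interior e"
proof -
  note e = edge_segment[OF K] and se = segment_arc_ends[OF edge_segment(1)[OF K]]
  let ?n = "edge_normal K e" and ?\<tau> = "arc_dir e" and ?a = "arc_start e" and ?L = "diameter e"
  have n1: "?n \<bullet> ?n = 1" "?\<tau> \<bullet> ?\<tau> = 1" using edge_normal_norm[OF K] se(5) by (simp_all add: norm_eq_1)
  have nt: "?n \<bullet> ?\<tau> = 0" "?\<tau> \<bullet> ?n = 0" using edge_normal_pm[OF K] by (auto simp: edge_perp_def)
  show "t = 0 \<Longrightarrow> x \<in> rel_interior e" unfolding x_def e(4) using s se(4) by auto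
  assume t0: "t > 0"
  obtain c \<rho> where c: "\<rho> > 0" "ball c \<rho> \<subseteq> K" "diameter K \<le> \<kappa> * \<rho>" by (rule inscribed_ball[OF K(1)])
  have ci: "c \<in> interior K" using c mem_interior by blast
  have cK: "c \<in> K" using ci interior_subset by blast
  have k: "\<kappa> > 0" using kappa_pos[OF K(1)] .
  \<comment> \<open>Coordinates of \<open>c\<close> with respect to the edge: distance \<open>T\<close> from its line, foot point \<open>S\<close> along it.\<close>
  define T where "T = - ((c - ?a) \<bullet> ?n)"
  define S where "S = (c - ?a) \<bullet> ?\<tau>"
  have T: "\<rho> \<le> T"
  proof (rule dense_le_bounded[of 0])
    show "0 < \<rho>" by (rule c(1))
    fix r assume r: "0 < r" "r < \<rho>"
    have "dist c (c + r *\<^sub>R ?n) < \<rho>" using r edge_normal_norm[OF K] by (simp add: dist_norm)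
    then have "c + r *\<^sub>R ?n \<in> K" using c(2) by (meson mem_ball subsetD)
    then have "(c + r *\<^sub>R ?n - ?a) \<bullet> ?n \<le> 0" using triangle_half_plane[OF K] by (auto simp: half_plane_def)
    then show "r \<le> T" using n1 by (simp add: T_def inner_add_left inner_diff_left)
  qed
  have aK: "?a \<in> K" using arc_point_in[OF e(1), of 0] se(4) e(2) by (auto simp: arc_point_def)
  have "norm (c - ?a) \<le> \<kappa> * \<rho>"
    using diameter_bounded_bound[OF triangle(9)[OF K(1)] cK aK] c(3) by (simp add: dist_norm)
  then have S: "\<bar>S\<bar> \<le> \<kappa> * \<rho>"
    using Cauchy_Schwarz_ineq2[of "c - ?a" ?\<tau>] se(5) by (simp add: S_def)
  have Lk: "?L \<le> \<kappa> * \<rho>" using e(5) c(3) by linarith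
  have cdec: "c = ?a + S *\<^sub>R ?\<tau> - T *\<^sub>R ?n"
  proof -
    have "c - ?a = ((c - ?a) \<bullet> edge_perp e) *\<^sub>R edge_perp e + S *\<^sub>R ?\<tau>"
      using perp_expansion[OF se(5), of "c - ?a"] by (simp add: S_def edge_perp_def)
    also have "((c - ?a) \<bullet> edge_perp e) *\<^sub>R edge_perp e = - (T *\<^sub>R ?n)"
      using edge_normal_pm[OF K] by (auto simp: T_def)
    finally show ?thesis by (simp add: algebra_simps)
  qed
  define \<mu> where "\<mu> = t / T"
  have Tp: "T > 0" using T c(1) by linarith
  have mu0: "\<mu> > 0" using t0 Tp by (simp add: \<mu>_def)
  have tl: "t \<le> \<rho> / 32"
  proof -
    have "t \<le> thickness \<kappa> * (\<kappa> * \<rho>)" using t(2) Lk thickness(1)[of \<kappa>] by (smt (verit) mult_left_mono)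
    also have "\<dots> = (thickness \<kappa> * \<kappa>) * \<rho>" by simp
    also have "\<dots> \<le> 1/32 * \<rho>" using thickness(3)[of \<kappa>] c(1) by (intro mult_right_mono) auto
    finally show ?thesis by simp
  qed
  have mu1: "\<mu> \<le> 1/32" using tl T Tp by (simp add: \<mu>_def field_simps)
  have muS: "\<bar>\<mu> * S\<bar> \<le> ?L / 32"
  proof -
    have "\<mu> \<le> t / \<rho>" unfolding \<mu>_def using T c(1) t(1) Tp by (intro divide_left_mono) auto
    then have "\<bar>\<mu> * S\<bar> \<le> t / \<rho> * (\<kappa> * \<rho>)"
      using S mu0 unfolding abs_mult by (intro mult_mono) auto
    also have "\<dots> = t * \<kappa>" using c(1) by simp
    also have "\<dots> \<le> thickness \<kappa> * ?L * \<kappa>" using t(2) k by (intro mult_right_mono) auto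
    also have "\<dots> = (thickness \<kappa> * \<kappa>) * ?L" by simp
    also have "\<dots> \<le> 1/32 * ?L" using thickness(3)[of \<kappa>] se(4) by (intro mult_right_mono) auto
    finally show ?thesis by simp
  qed
  define \<sigma> where "\<sigma> = (s - \<mu> * S) / (1 - \<mu>)"
  have sb: "0 < s - \<mu> * S" "s - \<mu> * S \<le> 29 / 32 * ?L" using s muS se(4) by (auto simp: abs_le_iff)
  have "\<sigma> > 0" using sb mu1 by (simp add: \<sigma>_def)
  moreover have "\<sigma> < ?L"
  proof -
    have "29/32 * ?L < (1 - \<mu>) * ?L" using mu1 se(4) by (intro mult_strict_right_mono) auto
    then have "s - \<mu> * S < (1 - \<mu>) * ?L" using sb(2) by linarith
    then have "s - \<mu> * S < ?L * (1 - \<mu>)" by (simp only: mult.commute)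
    then show ?thesis using mu1 by (simp add: \<sigma>_def pos_divide_less_eq)
  qed
  ultimately have yK: "arc_point e \<sigma> \<in> K" using arc_point_in[OF e(1), of \<sigma>] e(2) by auto
  have sig: "(1 - \<mu>) * \<sigma> = s - \<mu> * S" using mu1 by (simp add: \<sigma>_def)
  have "arc_point e \<sigma> - \<mu> *\<^sub>R (arc_point e \<sigma> - c) = (1 - \<mu>) *\<^sub>R arc_point e \<sigma> + \<mu> *\<^sub>R c" by (simp add: algebra_simps)
  also have "\<dots> = ?a + ((1 - \<mu>) * \<sigma> + \<mu> * S) *\<^sub>R ?\<tau> - (\<mu> * T) *\<^sub>R ?n"
    unfolding cdec arc_point_def by (simp add: algebra_simps)
  also have "\<dots> = x" using sig Tp by (simp add: x_def arc_point_def \<mu>_def)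
  finally have "arc_point e \<sigma> - \<mu> *\<^sub>R (arc_point e \<sigma> - c) = x" .
  then show "x \<in> interior K"
    using mem_interior_convex_shrink[OF triangle(2)[OF K(1)] ci yK mu0] mu1 by simp
qed

definition patch :: "(real^2) set \<Rightarrow> (real^2) set set" where "patch e = {K \<in> \<T>. e edge_of K}"

text \<open>The support of the edge test functions. It stays away from the end points of the edge, so that it meets no other edge.\<close>

definition edge_box :: "(real^2) set \<Rightarrow> (real^2) set" where
  "edge_box e = {x. diameter e / 4 \<le> (x - arc_start e) \<bullet> arc_dir e \<and> (x - arc_start e) \<bullet> arc_dir e \<le> 3 * diameter e / 4 \<and>
     \<bar>(x - arc_start e) \<bullet> edge_perp e\<bar> \<le> thickness \<kappa> * diameter e}"

lemma closed_edge_box: "closed (edge_box e)"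
  unfolding edge_box_def by (intro closed_Collect_conj closed_Collect_le continuous_intros)

lemma edge_box_half:
  assumes K: "K \<in> patch e" and x: "x \<in> edge_box e" "x \<in> half_plane (arc_start e) (edge_normal K e)"
  shows "x \<in> interior K \<or> x \<in> rel_interior e" and "x \<in> K"
    and "(x - arc_start e) \<bullet> edge_perp e \<noteq> 0 \<Longrightarrow> x \<in> interior K"
proof -
  have K': "K \<in> \<T>" "e edge_of K" using K by (auto simp: patch_def)
  note e = edge_segment[OF K'] and se = segment_arc_ends[OF edge_segment(1)[OF K']]
  define s where "s = (x - arc_start e) \<bullet> arc_dir e"
  define t where "t = - ((x - arc_start e) \<bullet> edge_normal K e)"
  have at: "\<bar>t\<bar> = \<bar>(x - arc_start e) \<bullet> edge_perp e\<bar>" using edge_normal_pm[OF K'] by (auto simp: t_def)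
  have t: "0 \<le> t" "t \<le> thickness \<kappa> * diameter e"
    using x at by (auto simp: half_plane_def edge_box_def t_def)
  have "x - arc_start e = ((x - arc_start e) \<bullet> edge_perp e) *\<^sub>R edge_perp e + s *\<^sub>R arc_dir e"
    using perp_expansion[OF se(5), of "x - arc_start e"] by (simp add: s_def edge_perp_def)
  also have "((x - arc_start e) \<bullet> edge_perp e) *\<^sub>R edge_perp e = - (t *\<^sub>R edge_normal K e)"
    using edge_normal_pm[OF K'] by (auto simp: t_def)
  finally have xe: "x = arc_point e s - t *\<^sub>R edge_normal K e"
    by (simp add: arc_point_def algebra_simps)
  have sb: "diameter e / 8 \<le> s" "s \<le> 7 * diameter e / 8"
    using x(1) se(4) by (auto simp: edge_box_def s_def)
  note hb = half_box_in_triangle[OF K' sb t, folded xe]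
  show "x \<in> interior K \<or> x \<in> rel_interior e" using hb t(1) by fastforce
  then show "x \<in> K" using interior_subset rel_interior_subset e(2) by blast
  show "x \<in> interior K" if "(x - arc_start e) \<bullet> edge_perp e \<noteq> 0" using hb(1) at t(1) that by linarith
qed

lemma edge_box_in_patch_triangle:
  assumes K: "K \<in> patch e" and x: "x \<in> edge_box e" "x \<in> K"
  shows "x \<in> interior K \<or> x \<in> rel_interior e"
  using edge_box_half(1)[OF K x(1)] triangle_half_plane K x(2) by (auto simp: patch_def)

text \<open>Points of the box in a triangle at the edge are interior points of the triangle or of the edge, and those lie only in triangles that
  contain the edge.\<close>

lemma edge_box_outside_patch:
  assumes K: "K \<in> patch e" and K': "K' \<in> \<T> - patch e" and x: "x \<in> edge_box e" "x \<in> K" shows "x \<notin> K'"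
proof
  assume xK': "x \<in> K'"
  have KT: "K \<in> \<T>" "e edge_of K" "K' \<in> \<T>" using K K' by (auto simp: patch_def)
  have f: "K' face_of K'" using triangle(2)[OF KT(3)] face_of_refl by blast
  consider "x \<in> interior K" | "x \<in> rel_interior e" using edge_box_in_patch_triangle[OF K x] by blast
  then show False
  proof cases
    case 1
    then have "K' = K" using interior_disjoint_face[OF KT(1,3) f] xK' by blast
    then show False using K K' by blast
  next
    case 2
    then have "e \<subseteq> K'" using mesh_face_subset[OF KT(1,3) edge_segment(3)[OF KT(1,2)] f _ xK'] by blast
    then have "e edge_of K'" using edge_of_subset_mesh KT by blast
    then show False using K' KT(3) by (simp add: patch_def)
  qed
qed

lemma same_normal_eq:
  assumes "K \<in> patch e" "K' \<in> patch e" "edge_normal K e = edge_normal K' e" shows "K = K'"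
proof -
  have K: "K \<in> \<T>" "e edge_of K" "K' \<in> \<T>" "e edge_of K'" using assms by (auto simp: patch_def)
  have L: "diameter e > 0" using segment_arc_ends(4)[OF edge_segment(1)[OF K(1,2)]] .
  let ?x = "arc_point e (diameter e / 2) - (thickness \<kappa> * diameter e) *\<^sub>R edge_normal K e"
  have "?x \<in> interior K"
    using half_box_in_triangle(1)[OF K(1,2), of "diameter e / 2" "thickness \<kappa> * diameter e"] L thickness(1)[of \<kappa>] by simp
  moreover have "?x \<in> interior K'"
    using half_box_in_triangle(1)[OF K(3,4), of "diameter e / 2" "thickness \<kappa> * diameter e"] L thickness(1)[of \<kappa>] assms(3) by simp
  ultimately show ?thesis
    using interior_disjoint_face[OF K(1,3), of K' ?x] triangle(2)[OF K(3)] interior_subset face_of_refl by blast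
qed

lemma opposite_normals:
  assumes "K \<in> patch e" "K' \<in> patch e" "K \<noteq> K'" shows "edge_normal K' e = - edge_normal K e" "patch e = {K, K'}"
proof -
  have pm: "edge_normal M e = edge_perp e \<or> edge_normal M e = - edge_perp e" if "M \<in> patch e" for M
    using edge_normal_pm that by (auto simp: patch_def)
  have ne: "edge_normal M e \<noteq> edge_normal M' e" if "M \<in> patch e" "M' \<in> patch e" "M \<noteq> M'" for M M'
    using same_normal_eq that by blast
  show o: "edge_normal K' e = - edge_normal K e"
    using pm[OF assms(1)] pm[OF assms(2)] ne[OF assms] by auto
  have "M = K \<or> M = K'" if "M \<in> patch e" for M
    using pm[OF assms(1)] pm[OF that] ne[OF that assms(1)] ne[OF that assms(2)] o by fastforce
  then show "patch e = {K, K'}" using assms by blast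
qed

lemma interior_triangle_domain: "K \<in> \<T> \<Longrightarrow> interior K \<subseteq> \<Omega>"
proof
  fix x assume K: "K \<in> \<T>" and x: "x \<in> interior K"
  have i: "x \<in> interior (closure \<Omega>)" using interior_mono[OF triangle(8)[OF K]] x by blast
  then have "x \<notin> frontier \<Omega>" using lipschitz_frontier[OF lipschitz] by blast
  moreover have "x \<in> closure \<Omega>" using i interior_subset by blast
  ultimately show "x \<in> \<Omega>" by (simp add: frontier_def interior_open[OF open_domain])
qed

text \<open>If two triangles meet at the edge, the two halves of a slightly larger open box lie in one of them each. Thus the point is in
  the interior of the closure of \<open>\<Omega>\<close>, and it is not a boundary point since \<open>\<Omega>\<close> is a Lipschitz domain.\<close>

lemma edge_box_two_sided:
  assumes K: "K \<in> patch e" "K' \<in> patch e" "K \<noteq> K'" and x: "x \<in> edge_box e" "x \<in> rel_interior e"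
  shows "x \<in> \<Omega>"
proof -
  have KT: "K \<in> \<T>" "e edge_of K" "K' \<in> \<T>" "e edge_of K'" using K by (auto simp: patch_def)
  note e = edge_segment[OF KT(1,2)] and se = segment_arc_ends[OF edge_segment(1)[OF KT(1,2)]]
  let ?U = "{y. diameter e / 8 < (y - arc_start e) \<bullet> arc_dir e \<and> (y - arc_start e) \<bullet> arc_dir e < 7 * diameter e / 8 \<and>
     \<bar>(y - arc_start e) \<bullet> edge_perp e\<bar> < thickness \<kappa> * diameter e}"
  have "open ?U" by (intro open_Collect_conj open_Collect_less continuous_intros)
  moreover have "x \<in> ?U"
  proof -
    obtain s where s: "x = arc_point e s" using x(2) e(4) by blast
    have "(x - arc_start e) \<bullet> edge_perp e = 0" by (simp add: s arc_point_def edge_perp_def)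
    moreover have "0 < thickness \<kappa> * diameter e" using thickness(1)[of \<kappa>] se(4) by simp
    ultimately show ?thesis using x(1) se(4) by (auto simp: edge_box_def)
  qed
  moreover have "?U \<subseteq> closure \<Omega>"
  proof
    fix y assume y: "y \<in> ?U"
    have "(y - arc_start e) \<bullet> edge_normal K e \<le> 0 \<or> (y - arc_start e) \<bullet> edge_normal K' e \<le> 0"
      using opposite_normals(1)[OF K] by (simp add: linear)
    moreover have "y \<in> M" if M: "M \<in> \<T>" "e edge_of M" and h: "(y - arc_start e) \<bullet> edge_normal M e \<le> 0" for M
    proof -
      define s where "s = (y - arc_start e) \<bullet> arc_dir e"
      define t where "t = - ((y - arc_start e) \<bullet> edge_normal M e)"
      have at: "\<bar>t\<bar> = \<bar>(y - arc_start e) \<bullet> edge_perp e\<bar>" using edge_normal_pm[OF M] by (auto simp: t_def)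
      have t: "0 \<le> t" "t \<le> thickness \<kappa> * diameter e" using y h at by (auto simp: t_def)
      have "y - arc_start e = ((y - arc_start e) \<bullet> edge_perp e) *\<^sub>R edge_perp e + s *\<^sub>R arc_dir e"
        using perp_expansion[OF se(5), of "y - arc_start e"] by (simp add: s_def edge_perp_def)
      also have "((y - arc_start e) \<bullet> edge_perp e) *\<^sub>R edge_perp e = - (t *\<^sub>R edge_normal M e)"
        using edge_normal_pm[OF M] by (auto simp: t_def)
      finally have ye: "y = arc_point e s - t *\<^sub>R edge_normal M e"
        by (simp add: arc_point_def algebra_simps)
      have sb: "diameter e / 8 \<le> s" "s \<le> 7 * diameter e / 8" using y by (auto simp: s_def)
      note hb = half_box_in_triangle[OF M sb t, folded ye]
      then show ?thesis using t(1) interior_subset rel_interior_subset edge_segment(2)[OF M] by fastforce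
    qed
    ultimately have "y \<in> K \<or> y \<in> K'" using KT by blast
    then show "y \<in> closure \<Omega>" using triangle(8) KT by blast
  qed
  ultimately have i: "x \<in> interior (closure \<Omega>)" by (meson interior_maximal subsetD)
  then have "x \<notin> frontier \<Omega>" using lipschitz_frontier[OF lipschitz] by blast
  moreover have "x \<in> closure \<Omega>" using i interior_subset by blast
  ultimately show "x \<in> \<Omega>" by (simp add: frontier_def interior_open[OF open_domain])
qed

text \<open>By \<open>edge_box_two_sided\<close>, an edge with two triangles has a midpoint inside \<open>\<Omega>\<close>.\<close>

lemma boundary_edge_patch:
  assumes e: "e \<in> edges \<T>" "e \<subseteq> frontier \<Omega>"
  shows "adjacent \<T> e \<in> patch e" "patch e = {adjacent \<T> e}"
proof -
  obtain K where K: "K \<in> \<T>" "e edge_of K" using e(1) by (auto simp: edges_def)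
  have "K' = K" if "K' \<in> \<T>" "e edge_of K'" for K'
  proof (rule ccontr)
    assume ne: "K' \<noteq> K"
    note es = edge_segment[OF K] and se = segment_arc_ends[OF edge_segment(1)[OF K]]
    let ?x = "arc_point e (diameter e / 2)"
    have p: "K \<in> patch e" "K' \<in> patch e" using K that by (auto simp: patch_def)
    have "(?x - arc_start e) \<bullet> arc_dir e = diameter e / 2" "(?x - arc_start e) \<bullet> edge_perp e = 0"
      using se(5) by (simp_all add: arc_point_def edge_perp_def norm_eq_1)
    then have "?x \<in> edge_box e" using se(4) thickness(1)[of \<kappa>] by (simp add: edge_box_def)
    moreover have r: "?x \<in> rel_interior e" using es(4) se(4) by auto
    ultimately have "?x \<in> \<Omega>" using edge_box_two_sided[OF p ne[symmetric]] by blast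
    moreover have "?x \<in> frontier \<Omega>" using r rel_interior_subset e(2) by blast
    ultimately show False using open_domain by (simp add: frontier_def interior_open)
  qed
  then have u: "\<exists>!K. K \<in> \<T> \<and> e edge_of K" using K by blast
  then have "adjacent \<T> e \<in> \<T> \<and> e edge_of adjacent \<T> e" unfolding adjacent_def by (rule theI')
  then show "adjacent \<T> e \<in> patch e" "patch e = {adjacent \<T> e}" using u by (auto simp: patch_def)
qed

lemma interior_edge_pair:
  assumes "e \<in> interior_edges \<T>"
  obtains K K' where "adjacent_pair \<T> e = (K, K')" "K \<in> patch e" "K' \<in> patch e" "K \<noteq> K'"
    "patch e = {K, K'}" "edge_normal K' e = - edge_normal K e"
proof -
  let ?P = "\<lambda>(K, K'). K \<in> \<T> \<and> K' \<in> \<T> \<and> K \<noteq> K' \<and> e edge_of K \<and> e edge_of K'"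
  obtain p where "?P p" using assms by (auto simp: interior_edges_def)
  then have "?P (adjacent_pair \<T> e)" unfolding adjacent_pair_def by (rule someI[of ?P])
  then obtain K K' where "adjacent_pair \<T> e = (K, K')" "K \<in> patch e" "K' \<in> patch e" "K \<noteq> K'"
    by (cases "adjacent_pair \<T> e") (auto simp: patch_def)
  then show thesis using opposite_normals that by metis
qed

lemma AE_in_interior: "AE x in lebesgue. \<forall>K\<in>\<T>. x \<in> K \<longrightarrow> x \<in> interior K"
proof -
  have "AE x in lebesgue. x \<in> K \<longrightarrow> x \<in> interior K" if "K \<in> \<T>" for K
  proof -
    have "negligible (frontier K)" using triangle(2)[OF that] by (rule negligible_convex_frontier)
    then have "AE x in lebesgue. x \<notin> frontier K" using negligible_iff_null_sets AE_not_in by blast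
    then show ?thesis
      by eventually_elim (use triangle(4)[OF that] in \<open>auto simp: frontier_def\<close>)
  qed
  then show ?thesis using finite_mesh by (simp add: AE_finite_all)
qed

text \<open>Edges are convex hulls of subsets of the three vertices. The crude count 8 of these subsets suffices.\<close>

lemma card_edges_of_triangle: assumes "K \<in> \<T>" shows "finite {e. e edge_of K}" "card {e. e edge_of K} \<le> 8"
proof -
  obtain C where C: "\<not> affine_dependent C" "int (card C) = 2 + 1" "K = convex hull C"
    using triangle(1)[OF assms] by (auto simp: simplex_def)
  have f: "finite C" using C(1) aff_independent_finite by blast
  have sub: "{e. e edge_of K} \<subseteq> (\<lambda>c. convex hull c) ` Pow C"
    using face_of_convex_hull_affine_independent[OF C(1)] C(3) by (auto simp: edge_of_def)
  then show "finite {e. e edge_of K}" using f finite_subset by blast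
  have "card {e. e edge_of K} \<le> card ((\<lambda>c. convex hull c) ` Pow C)" using sub f by (intro card_mono) auto
  also have "\<dots> \<le> card (Pow C)" using f by (intro card_image_le) auto
  also have "\<dots> = 8" using f C(2) by (simp add: card_Pow)
  finally show "card {e. e edge_of K} \<le> 8" .
qed

lemma finite_edges: "finite (edges \<T>)"
proof -
  have "edges \<T> = (\<Union>K\<in>\<T>. {e. e edge_of K})" by (auto simp: edges_def)
  then show ?thesis using finite_mesh card_edges_of_triangle(1) by simp
qed

end

section \<open>Test functions on patches of triangles\<close>

lemma lebesgue_measurable_AE:
  fixes f g :: "real^2 \<Rightarrow> real"
  assumes "f \<in> borel_measurable lebesgue" "AE x in lebesgue. f x = g x"
  shows "g \<in> borel_measurable lebesgue"
proof -
  obtain f' where f': "f' \<in> borel_measurable lborel" "AE x in lborel. f x = f' x"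
    using completion_ex_borel_measurable_real[OF assms(1)] by blast
  have "AE x in lborel. f x = g x" using assms(2) by (simp add: AE_completion_iff)
  with f'(2) have "AE x in lborel. g x = f' x" by eventually_elim simp
  then show ?thesis by (rule measurable_completion_AE[OF f'(1)])
qed

context kirchhoff_mesh
begin

lemma AE_on_domain:
  "(AE x in lebesgue_on \<Omega>. P x) \<longleftrightarrow> (AE x in lebesgue. x \<in> \<Omega> \<longrightarrow> P x)"
  using domain_measurable by (intro AE_restrict_space_iff) auto

lemma triangle_measurable: "K \<in> \<T> \<Longrightarrow> K \<in> sets lebesgue" "K \<in> \<T> \<Longrightarrow> K \<inter> space lebesgue \<in> sets lebesgue"
  using triangle(4) by (auto intro: lborelD)

lemma AE_on_triangle:
  "K \<in> \<T> \<Longrightarrow> (AE x in lebesgue_on K. P x) \<longleftrightarrow> (AE x in lebesgue. x \<in> K \<longrightarrow> P x)"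
  using triangle_measurable by (intro AE_restrict_space_iff) auto

lemma AE_domain_triangle:
  assumes "K \<in> \<T>" "AE x in lebesgue_on \<Omega>. P x" shows "AE x in lebesgue_on K. P x"
  using assms(2) AE_in_interior interior_triangle_domain[OF assms(1)] assms(1)
  unfolding AE_on_domain AE_on_triangle[OF assms(1)]
  by (rule_tac AE_mp[OF AE_in_interior]) (auto elim!: eventually_mono)

lemma measurable_on_triangle:
  fixes h :: "real^2 \<Rightarrow> real"
  assumes K: "K \<in> \<T>" and h: "h \<in> borel_measurable (lebesgue_on \<Omega>)"
  shows "h \<in> borel_measurable (lebesgue_on K)"
proof -
  have m: "(\<lambda>x. indicator \<Omega> x * h x) \<in> borel_measurable lebesgue"
    using h domain_measurable by (simp add: borel_measurable_restrict_space_iff mult.commute)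
  have "(\<lambda>x. indicator K x * (indicator \<Omega> x * h x)) \<in> borel_measurable lebesgue"
    by (intro borel_measurable_times m borel_measurable_indicator triangle_measurable K)
  moreover have "AE x in lebesgue. indicator K x * (indicator \<Omega> x * h x) = indicator K x * h x"
    using AE_in_interior by eventually_elim (use K interior_triangle_domain[OF K] in \<open>auto simp: indicator_def\<close>)
  ultimately have "(\<lambda>x. indicator K x * h x) \<in> borel_measurable lebesgue" by (rule lebesgue_measurable_AE)
  then show ?thesis using triangle_measurable[OF K] by (simp add: borel_measurable_restrict_space_iff mult.commute)
qed

lemma integral_over_triangles:
  fixes h :: "real^2 \<Rightarrow> real"
  assumes h: "integrable (lebesgue_on \<Omega>) h" and P: "\<P> \<subseteq> \<T>"
    and z: "AE x in lebesgue_on \<Omega>. x \<notin> \<Union>\<P> \<longrightarrow> h x = 0"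
  shows "K \<in> \<T> \<Longrightarrow> integrable (lebesgue_on K) h"
    and "(LINT x|lebesgue_on \<Omega>. h x) = (\<Sum>K\<in>\<P>. LINT x|lebesgue_on K. h x)"
proof -
  have i: "integrable lebesgue (\<lambda>x. indicator \<Omega> x * h x)"
    using h domain_measurable by (simp add: integrable_restrict_space)
  have iK: "integrable lebesgue (\<lambda>x. indicator K x * h x)" if K: "K \<in> \<T>" for K
  proof -
    have "integrable lebesgue (\<lambda>x. indicator K x *\<^sub>R (indicator \<Omega> x * h x))"
      by (intro integrable_mult_indicator i triangle_measurable K)
    moreover have "AE x in lebesgue. indicator K x *\<^sub>R (indicator \<Omega> x * h x) = indicator K x * h x"
      using AE_in_interior by eventually_elim (use K interior_triangle_domain[OF K] in \<open>auto simp: indicator_def\<close>)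
    moreover have "(\<lambda>x. indicator K x * h x) \<in> borel_measurable lebesgue"
      using measurable_on_triangle[OF K borel_measurable_integrable[OF h]] triangle_measurable[OF K]
      by (simp add: borel_measurable_restrict_space_iff mult.commute)
    ultimately show ?thesis using integrable_cong_AE_imp by blast
  qed
  then show "integrable (lebesgue_on K) h" if "K \<in> \<T>" 
    using that triangle_measurable[OF that] by (simp add: integrable_restrict_space)
  have fin: "finite \<P>" using P finite_mesh finite_subset by blast
  have "AE x in lebesgue. x \<in> \<Omega> \<longrightarrow> x \<notin> \<Union>\<P> \<longrightarrow> h x = 0" using z by (simp add: AE_on_domain)
  with AE_in_interior have ae: "AE x in lebesgue. indicator \<Omega> x * h x = (\<Sum>K\<in>\<P>. indicator K x * h x)"
  proof eventually_elim
    case (elim x)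
    show ?case
    proof (cases "\<exists>K\<in>\<P>. x \<in> K")
      case True
      then obtain K where K: "K \<in> \<P>" "x \<in> K" by blast
      then have KT: "K \<in> \<T>" "x \<in> interior K" using elim(1) P by auto
      have "x \<notin> K'" if "K' \<in> \<P> - {K}" for K'
        using interior_disjoint_face[OF KT(1), of K' K' x] KT(2) that P triangle(2) face_of_refl by blast
      then have "(\<Sum>K'\<in>\<P> - {K}. indicator K' x * h x) = 0" by (intro sum.neutral) auto
      then have "(\<Sum>K'\<in>\<P>. indicator K' x * h x) = indicator K x * h x"
        using sum.remove[OF fin K(1), of "\<lambda>K'. indicator K' x * h x"] by linarith
      then show ?thesis using KT interior_triangle_domain K(2) by (auto simp: indicator_def)
    next
      case False
      then have "(\<Sum>K\<in>\<P>. indicator K x * h x) = 0" by (intro sum.neutral) auto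
      then show ?thesis using False elim(2) by (auto simp: indicator_def)
    qed
  qed
  have "(LINT x|lebesgue_on \<Omega>. h x) = (LINT x|lebesgue. indicator \<Omega> x * h x)"
    using domain_measurable by (simp add: integral_restrict_space)
  also have "\<dots> = (LINT x|lebesgue. (\<Sum>K\<in>\<P>. indicator K x * h x))"
    using i iK P by (intro integral_cong_AE ae borel_measurable_sum borel_measurable_integrable) auto
  also have "\<dots> = (\<Sum>K\<in>\<P>. LINT x|lebesgue. indicator K x * h x)"
    using iK P by (intro Bochner_Integration.integral_sum) auto
  also have "\<dots> = (\<Sum>K\<in>\<P>. LINT x|lebesgue_on K. h x)"
    using P triangle_measurable by (intro sum.cong) (auto simp: integral_restrict_space)
  finally show "(LINT x|lebesgue_on \<Omega>. h x) = (\<Sum>K\<in>\<P>. LINT x|lebesgue_on K. h x)" .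
qed

lemma AE_mesh: "AE x in lebesgue_on \<Omega>. x \<notin> \<Union>\<T> \<longrightarrow> P x"
proof (rule AE_I2, rule impI)
  fix x assume "x \<in> space (lebesgue_on \<Omega>)" "x \<notin> \<Union>\<T>"
  then show "P x" using Union_mesh closure_subset[of \<Omega>] by (simp add: space_restrict_space subset_iff)
qed

lemma L2_on_triangle:
  assumes "K \<in> \<T>" "h \<in> L2 (lebesgue_on \<Omega>)" shows "h \<in> L2 (lebesgue_on K)"
proof -
  have "integrable (lebesgue_on K) (\<lambda>x. (h x)\<^sup>2)"
    by (rule integral_over_triangles(1)[OF _ order_refl AE_mesh assms(1)]) (use assms(2) in \<open>unfold L2_def, blast\<close>)
  moreover have "h \<in> borel_measurable (lebesgue_on \<Omega>)" using assms(2) unfolding L2_def by blast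
  ultimately show ?thesis using measurable_on_triangle[OF assms(1)] unfolding L2_def by blast
qed

lemma L2norm_over_triangles:
  assumes "h \<in> L2 (lebesgue_on \<Omega>)"
  shows "(L2norm (lebesgue_on \<Omega>) h)\<^sup>2 = (\<Sum>K\<in>\<T>. (L2norm (lebesgue_on K) h)\<^sup>2)"
proof -
  show ?thesis
    unfolding L2norm_sq
    by (rule integral_over_triangles(2)[OF _ order_refl AE_mesh]) (use assms in \<open>unfold L2_def, blast\<close>)
qed

lemma L2_smooth_triangle: "K \<in> \<T> \<Longrightarrow> smooth h \<Longrightarrow> h \<in> L2 (lebesgue_on K)"
  using L2_smooth triangle(9) triangle_measurable by blast

text \<open>Test functions are smooth functions on the plane that are set to zero outside a patch. The function to be cut need not vanish
  outside the patch, so a plane bump can be used even where it reaches across \<open>\<partial>\<Omega>\<close>.\<close>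

definition cut :: "(real^2) set set \<Rightarrow> (real^2 \<Rightarrow> real) \<Rightarrow> real^2 \<Rightarrow> real" where
  "cut \<P> w x = (if x \<in> \<Union>\<P> then w x else 0)"

text \<open>The last condition says that the support does not touch the interface between the patch and the rest of the mesh, so that cutting does
  not create singularities inside \<open>\<Omega>\<close>.\<close>

definition supported_in_patch :: "(real^2) set set \<Rightarrow> (real^2 \<Rightarrow> real) \<Rightarrow> bool" where
  "supported_in_patch \<P> w \<longleftrightarrow> \<P> \<subseteq> \<T> \<and> smooth w \<and> bounded {x. w x \<noteq> 0} \<and>
     (\<forall>K\<in>\<P>. \<forall>K'\<in>\<T> - \<P>. closure {x. w x \<noteq> 0} \<inter> K \<inter> K' = {})"

lemma supported_in_patch_pd:
  assumes "supported_in_patch \<P> w" shows "supported_in_patch \<P> (pd i w)"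
proof -
  have "{x. pd i w x \<noteq> 0} \<subseteq> closure {x. w x \<noteq> 0}"
    using pd_zero_off_support[of _ w i] by auto
  then have c: "closure {x. pd i w x \<noteq> 0} \<subseteq> closure {x. w x \<noteq> 0}"
    by (intro closure_minimal) auto
  show ?thesis unfolding supported_in_patch_def
  proof (intro conjI ballI)
    show "\<P> \<subseteq> \<T>" "smooth (pd i w)" "bounded {x. pd i w x \<noteq> 0}"
      using assms by (auto simp: supported_in_patch_def intro: smooth_pd bounded_support_pd)
    fix K K' assume "K \<in> \<P>" "K' \<in> \<T> - \<P>"
    then have "closure {x. w x \<noteq> 0} \<inter> K \<inter> K' = {}" using assms by (simp add: supported_in_patch_def)
    then show "closure {x. pd i w x \<noteq> 0} \<inter> K \<inter> K' = {}" using c by blast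
  qed
qed

lemma closed_patch_Union: "\<P> \<subseteq> \<T> \<Longrightarrow> closed (\<Union>\<P>)"
  using finite_mesh triangle(4) by (intro closed_Union) (auto intro: finite_subset)

text \<open>Near a point of the patch in the support, all points of \<open>\<Omega>\<close> belong to the patch, because the triangles outside it form a
  closed set that does not contain the point. Near all other points the cut function vanishes.\<close>

lemma cut_locally:
  assumes w: "supported_in_patch \<P> w" and x: "x \<in> \<Omega>"
  shows "(\<forall>\<^sub>F y in nhds x. cut \<P> w y = w y) \<or> ((\<forall>\<^sub>F y in nhds x. cut \<P> w y = 0) \<and> (x \<notin> closure {x. w x \<noteq> 0} \<or> x \<notin> \<Union>\<P>))"
proof (cases "x \<in> closure {x. w x \<noteq> 0} \<and> x \<in> \<Union>\<P>")
  case True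
  have P: "\<P> \<subseteq> \<T>" using w by (simp add: supported_in_patch_def)
  have "x \<notin> \<Union>(\<T> - \<P>)" using True w unfolding supported_in_patch_def by blast
  moreover have "closed (\<Union>(\<T> - \<P>))" by (intro closed_patch_Union) auto
  ultimately have "\<forall>\<^sub>F y in nhds x. y \<in> \<Omega> - \<Union>(\<T> - \<P>)"
    using x open_domain by (intro eventually_nhds_in_open open_Diff) auto
  then have "\<forall>\<^sub>F y in nhds x. cut \<P> w y = w y"
  proof eventually_elim
    case (elim y)
    then have "y \<in> \<Union>\<T>" using Union_mesh closure_subset by blast
    then have "y \<in> \<Union>\<P>" using elim by blast
    then show ?case by (simp add: cut_def)
  qed
  then show ?thesis by blast
next
  case False
  have P: "\<P> \<subseteq> \<T>" using w by (simp add: supported_in_patch_def)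
  have "\<forall>\<^sub>F y in nhds x. cut \<P> w y = 0"
  proof (cases "x \<in> \<Union>\<P>")
    case True
    then have "\<forall>\<^sub>F y in nhds x. w y = 0" using False eventually_zero_off_support by blast
    then show ?thesis by eventually_elim (simp add: cut_def)
  next
    case False
    have "\<forall>\<^sub>F y in nhds x. y \<in> - \<Union>\<P>"
      using False closed_patch_Union[OF P] by (intro eventually_nhds_in_open) auto
    then show ?thesis by eventually_elim (auto simp: cut_def)
  qed
  then show ?thesis using False by blast
qed

lemma cut_locally_smooth: "supported_in_patch \<P> w \<Longrightarrow> locally_smooth \<Omega> (cut \<P> w)"
  unfolding locally_smooth_def
proof
  fix x assume w: "supported_in_patch \<P> w" and x: "x \<in> \<Omega>"
  have "smooth w" "smooth (\<lambda>x::real^2. 0)" using w by (auto simp: supported_in_patch_def)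
  then show "\<exists>g. smooth g \<and> (\<forall>\<^sub>F y in nhds x. cut \<P> w y = g y)" using cut_locally[OF w x] by blast
qed

lemma pd_cut:
  assumes w: "supported_in_patch \<P> w" and x: "x \<in> \<Omega>"
  shows "pd i (cut \<P> w) x = cut \<P> (pd i w) x"
  using cut_locally[OF w x]
proof (elim disjE conjE)
  assume e: "\<forall>\<^sub>F y in nhds x. cut \<P> w y = w y"
  show ?thesis
  proof (cases "x \<in> \<Union>\<P>")
    case True
    then have "cut \<P> (pd i w) x = pd i w x" by (simp add: cut_def)
    then show ?thesis using pd_cong_eventually[OF e, of i] by simp
  next
    case False
    have "\<forall>\<^sub>F y in nhds x. y \<in> - \<Union>\<P>"
      using False closed_patch_Union w by (intro eventually_nhds_in_open) (auto simp: supported_in_patch_def)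
    then have "\<forall>\<^sub>F y in nhds x. cut \<P> w y = 0" by eventually_elim (auto simp: cut_def)
    then have "pd i (cut \<P> w) x = 0" using pd_cong_eventually[of "cut \<P> w" "\<lambda>x. 0" x i] by simp
    then show ?thesis using False by (auto simp: cut_def)
  qed
next
  assume e: "\<forall>\<^sub>F y in nhds x. cut \<P> w y = 0"
  then have z: "pd i (cut \<P> w) x = 0" using pd_cong_eventually[of "cut \<P> w" "\<lambda>x. 0" x i] by simp
  { assume "x \<notin> closure {x. w x \<noteq> 0}"
    then show ?thesis using z pd_zero_off_support[of x w i] by (simp add: cut_def) }
  { assume "x \<notin> \<Union>\<P>" then show ?thesis using z by (auto simp: cut_def) }
qed

lemma cut_continuous:
  assumes w: "supported_in_patch \<P> w" shows "continuous_on (closure \<Omega>) (cut \<P> w)"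
proof -
  have P: "\<P> \<subseteq> \<T>" "smooth w" using w by (auto simp: supported_in_patch_def)
  have z: "w x = 0" if "x \<in> \<Union>\<P>" "x \<in> \<Union>(\<T> - \<P>)" for x
    using w that closure_subset[of "{x. w x \<noteq> 0}"] unfolding supported_in_patch_def by blast
  have "continuous_on (\<Union>\<P>) (cut \<P> w)"
    by (rule continuous_on_eq[OF smooth_continuous[OF P(2)]]) (simp add: cut_def)
  moreover have "continuous_on (\<Union>(\<T> - \<P>)) (cut \<P> w)"
    by (rule continuous_on_eq[of _ "\<lambda>x. 0"]) (use z in \<open>auto simp: cut_def\<close>)
  ultimately have "continuous_on (\<Union>\<P> \<union> \<Union>(\<T> - \<P>)) (cut \<P> w)"
    using P by (intro continuous_on_closed_Un closed_patch_Union) auto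
  moreover have "\<Union>\<P> \<union> \<Union>(\<T> - \<P>) = closure \<Omega>" using P Union_mesh by blast
  ultimately show ?thesis by simp
qed

lemma cut_bounded: "supported_in_patch \<P> w \<Longrightarrow> \<exists>B. \<forall>x. \<bar>cut \<P> w x\<bar> \<le> B"
proof -
  assume w: "supported_in_patch \<P> w"
  then have "smooth w" "bounded {x. w x \<noteq> 0}" by (auto simp: supported_in_patch_def)
  from smooth_bounded[OF this] obtain B where B: "B > 0" "\<forall>x. \<bar>w x\<bar> \<le> B" by blast
  then have "\<forall>x. \<bar>cut \<P> w x\<bar> \<le> B" by (auto simp: cut_def less_imp_le)
  then show ?thesis by blast
qed

lemma cut_H2:
  assumes w: "supported_in_patch \<P> w"
  shows "cut \<P> w \<in> H2 \<Omega>"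
    "AE x in lebesgue_on \<Omega>. wpd \<Omega> i (cut \<P> w) x = cut \<P> (pd i w) x"
    "AE x in lebesgue_on \<Omega>. wpd \<Omega> j (wpd \<Omega> i (cut \<P> w)) x = cut \<P> (pd j (pd i w)) x"
proof -
  note w1 = supported_in_patch_pd[OF w] and w2 = supported_in_patch_pd[OF supported_in_patch_pd[OF w]]
  have p1: "pd i (cut \<P> w) x = cut \<P> (pd i w) x" if "x \<in> \<Omega>" for i x by (rule pd_cut[OF w that])
  have p2: "pd j (pd i (cut \<P> w)) x = cut \<P> (pd j (pd i w)) x" if "x \<in> \<Omega>" for i j x
  proof -
    have "\<forall>\<^sub>F y in nhds x. y \<in> \<Omega>" using that open_domain by (intro eventually_nhds_in_open)
    then have "\<forall>\<^sub>F y in nhds x. pd i (cut \<P> w) y = cut \<P> (pd i w) y" by eventually_elim (rule p1)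
    then show ?thesis using pd_cong_eventually pd_cut[OF w1 that] by metis
  qed
  obtain B0 where B0: "\<And>x. \<bar>cut \<P> w x\<bar> \<le> B0" using cut_bounded[OF w] by blast
  obtain B1 where B1: "\<And>i x. \<bar>cut \<P> (pd i w) x\<bar> \<le> B1 i" using cut_bounded[OF w1] by metis
  have "\<forall>i j. \<exists>B. \<forall>x. \<bar>cut \<P> (pd j (pd i w)) x\<bar> \<le> B" using cut_bounded[OF w2] by blast
  then obtain B2 where B2: "\<And>i j x. \<bar>cut \<P> (pd j (pd i w)) x\<bar> \<le> B2 i j" by metis
  let ?B = "\<bar>B0\<bar> + (\<Sum>i\<in>UNIV. \<bar>B1 i\<bar>) + (\<Sum>i\<in>UNIV. \<Sum>j\<in>UNIV. \<bar>B2 i j\<bar>)"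
  have m1: "\<bar>B1 i\<bar> \<le> (\<Sum>i\<in>UNIV. \<bar>B1 i\<bar>)" for i by (rule member_le_sum) auto
  have m2: "\<bar>B2 i j\<bar> \<le> (\<Sum>i\<in>UNIV. \<Sum>j\<in>UNIV. \<bar>B2 i j\<bar>)" for i j
    by (rule order_trans[OF member_le_sum[of j UNIV "\<lambda>j. \<bar>B2 i j\<bar>"] member_le_sum[of i UNIV "\<lambda>i. \<Sum>j\<in>UNIV. \<bar>B2 i j\<bar>"]])
      (auto intro: sum_nonneg)
  have nn: "0 \<le> (\<Sum>i\<in>UNIV. \<bar>B1 i\<bar>)" "0 \<le> (\<Sum>i\<in>UNIV. \<Sum>j\<in>UNIV. \<bar>B2 i j\<bar>)" by (auto intro!: sum_nonneg)
  have b0: "\<bar>cut \<P> w x\<bar> \<le> ?B" for x using B0[of x] nn by linarith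
  have b1: "\<bar>pd i (cut \<P> w) x\<bar> \<le> ?B" if "x \<in> \<Omega>" for i x using B1[of i x] m1[of i] nn p1[OF that, of i] by linarith
  have b2: "\<bar>pd j (pd i (cut \<P> w)) x\<bar> \<le> ?B" if "x \<in> \<Omega>" for i j x
    using B2[of j i x] m2[of i j] nn p2[OF that, of j i] by linarith
  have c: "cut \<P> w \<in> H2 \<Omega>" "AE x in lebesgue_on \<Omega>. wpd \<Omega> i (cut \<P> w) x = pd i (cut \<P> w) x"
    "AE x in lebesgue_on \<Omega>. wpd \<Omega> j (wpd \<Omega> i (cut \<P> w)) x = pd j (pd i (cut \<P> w)) x"
    using b0 b1 b2 by (rule_tac classical_H2[where B = ?B, OF cut_locally_smooth[OF w]]; simp)+
  show "cut \<P> w \<in> H2 \<Omega>" by (rule c)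
  show "AE x in lebesgue_on \<Omega>. wpd \<Omega> i (cut \<P> w) x = cut \<P> (pd i w) x"
    using c(2) unfolding AE_on_domain by eventually_elim (simp add: p1)
  show "AE x in lebesgue_on \<Omega>. wpd \<Omega> j (wpd \<Omega> i (cut \<P> w)) x = cut \<P> (pd j (pd i w)) x"
    using c(3) unfolding AE_on_domain by eventually_elim (simp add: p2)
qed

text \<open>The boundary conditions may fail at finitely many points. This is needed because the boundary parts share end points.\<close>

lemma cut_plate_space:
  assumes w: "supported_in_patch \<P> w"
    and bv: "finite {x \<in> \<Gamma>c \<union> \<Gamma>s. cut \<P> w x \<noteq> 0}" and bg: "\<And>i. finite {x \<in> \<Gamma>c. cut \<P> (pd i w) x \<noteq> 0}"
  shows "cut \<P> w \<in> plate_space \<Omega> \<Gamma>c \<Gamma>s"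
proof -
  note w1 = supported_in_patch_pd[OF w]
  note h = cut_H2[OF w]
  have t0: "has_trace \<Omega> (cut \<P> w) (cut \<P> w)"
    using H2D(1)[OF h(1)] by (intro has_trace_continuous cut_continuous[OF w]) auto
  have t1: "has_trace \<Omega> (wpd \<Omega> i (cut \<P> w)) (cut \<P> (pd i w))" for i
    by (intro has_trace_continuous H2D(2)[OF h(1)] cut_continuous[OF w1] H2D(1)[OF cut_H2(1)[OF w1]] h(2))
  show ?thesis
    unfolding plate_space_def
  proof (intro CollectI conjI h(1) exI[of _ "cut \<P> w"] exI[of _ "\<lambda>x. \<chi> i. cut \<P> (pd i w) x"] allI impI t0)
    fix e assume e: "is_segment e \<and> e \<subseteq> \<Gamma>c \<union> \<Gamma>s"
    show "AE x in arc_measure e. cut \<P> w x = 0"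
      using e by (intro arc_AE_finite finite_subset[OF _ bv]) auto
  next
    fix i show "has_trace \<Omega> (wpd \<Omega> i (cut \<P> w)) (\<lambda>x. (\<chi> i. cut \<P> (pd i w) x) $ i)" using t1 by simp
  next
    fix e assume e: "is_segment e \<and> e \<subseteq> \<Gamma>c"
    have "finite (\<Union>i. {x \<in> \<Gamma>c. cut \<P> (pd i w) x \<noteq> 0})" using bg by simp
    moreover have "{x \<in> e. (\<chi> i. cut \<P> (pd i w) x) \<bullet> boundary_normal \<Omega> x \<noteq> 0} \<subseteq> (\<Union>i. {x \<in> \<Gamma>c. cut \<P> (pd i w) x \<noteq> 0})"
    proof
      fix x assume x: "x \<in> {x \<in> e. (\<chi> i. cut \<P> (pd i w) x) \<bullet> boundary_normal \<Omega> x \<noteq> 0}"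
      then have "cut \<P> (pd 1 w) x \<noteq> 0 \<or> cut \<P> (pd 2 w) x \<noteq> 0" by (auto simp: inner_2)
      moreover have "x \<in> \<Gamma>c" using x e by blast
      ultimately show "x \<in> (\<Union>i. {x \<in> \<Gamma>c. cut \<P> (pd i w) x \<noteq> 0})" by blast
    qed
    ultimately show "AE x in arc_measure e. (\<chi> i. cut \<P> (pd i w) x) \<bullet> boundary_normal \<Omega> x = 0"
      using e by (intro arc_AE_finite) (auto intro: finite_subset)
  qed
qed

end

section \<open>The discrete problem\<close>

locale plate_problem = kirchhoff_mesh +
  fixes d Y \<nu> :: real and r m :: nat and S :: "(real^2) set" and x0 :: "real^2"
    and f g :: "real^2 \<Rightarrow> real" and F :: real and Vh :: "(real^2 \<Rightarrow> real) set"
    and u uh fh :: "real^2 \<Rightarrow> real" and gh :: "(real^2) set \<Rightarrow> real^2 \<Rightarrow> real"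
  assumes S_segment: "\<exists>p q. p \<noteq> q \<and> S = closed_segment p q \<and> open_segment p q \<subseteq> \<Omega>"
    and S_edges: "S = \<Union>(edges_S \<T> S)"
    and x0: "x0 \<in> \<Omega>" "\<exists>K\<in>\<T>. x0 extreme_point_of K"
    and f: "f \<in> L2 (lebesgue_on \<Omega>)" and g: "g \<in> L2 (arc_measure S)"
    and Vh: "fe_space \<Omega> \<Gamma>c \<Gamma>s \<T> r Vh"
    and u: "u \<in> plate_space \<Omega> \<Gamma>c \<Gamma>s"
      "\<And>v. v \<in> plate_space \<Omega> \<Gamma>c \<Gamma>s \<Longrightarrow> plate_form \<Omega> d Y \<nu> u v = plate_load \<Omega> S x0 f g F v"
    and uh: "uh \<in> Vh" and fh: "fh \<in> Vh"
    and gh: "\<And>e. e \<in> edges_S \<T> S \<Longrightarrow> \<exists>p. poly_of_degree m p \<and> (\<forall>x\<in>e. gh e x = p x)"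
begin

lemma is_segment_S: "is_segment S" using S_segment is_segment_def by blast

lemma piece_Vh:
  assumes "v \<in> Vh" "K \<in> \<T>"
  shows "polyfun r (piece K v)" "\<And>x. x \<in> K \<Longrightarrow> v x = piece K v x" "smooth (piece K v)"
proof -
  have "\<forall>v\<in>Vh. \<forall>K\<in>\<T>. \<exists>p. poly_of_degree r p \<and> (\<forall>x\<in>K. v x = p x)"
    using Vh unfolding fe_space_def by simp
  then obtain p where p: "poly_of_degree r p" "\<forall>x\<in>K. v x = p x" using assms by meson
  then have "piece K v = p" using triangle(6)[OF assms(2)] by (intro piece_eq) auto
  then show "polyfun r (piece K v)" "\<And>x. x \<in> K \<Longrightarrow> v x = piece K v x" using p poly_of_degree_polyfun by auto
  then show "smooth (piece K v)" using smooth_polyfun by blast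
qed

lemma u_H2: "u \<in> H2 \<Omega>" "uh \<in> H2 \<Omega>"
  using u uh Vh by (auto simp: plate_space_def fe_space_def)

definition hessian_error :: "2 \<Rightarrow> 2 \<Rightarrow> real^2 \<Rightarrow> real" where
  "hessian_error i j x = wpd \<Omega> j (wpd \<Omega> i u) x - wpd \<Omega> j (wpd \<Omega> i uh) x"

text \<open>The contribution of one triangle to the squared \<open>H\<^sup>2\<close> seminorm of the error. It uses the difference of the weak derivatives, which is
  additive over triangles and agrees almost everywhere with the weak derivatives of the difference.\<close>

definition local_error :: "(real^2) set \<Rightarrow> real" where
  "local_error K = (\<Sum>i\<in>UNIV. \<Sum>j\<in>UNIV. (L2norm (lebesgue_on K) (hessian_error i j))\<^sup>2)"

lemma hessian_error_L2: "hessian_error i j \<in> L2 (lebesgue_on \<Omega>)"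
  unfolding hessian_error_def using u_H2 by (intro L2_diff H2D(3))

lemma local_error_nonneg: "0 \<le> local_error K"
  unfolding local_error_def by (intro sum_nonneg) auto

lemma sum_local_error: "(\<Sum>K\<in>\<T>. local_error K) \<le> (H2norm \<Omega> (\<lambda>x. u x - uh x))\<^sup>2"
proof -
  let ?n = "L2norm (lebesgue_on \<Omega>)"
  have eq: "(?n (hessian_error i j))\<^sup>2 = (?n (wpd \<Omega> j (wpd \<Omega> i (\<lambda>x. u x - uh x))))\<^sup>2" for i j
  proof -
    note w = wpd2_diff[OF u_H2, of j i]
    have "(LINT x|lebesgue_on \<Omega>. (hessian_error i j x)\<^sup>2) = (LINT x|lebesgue_on \<Omega>. (wpd \<Omega> j (wpd \<Omega> i (\<lambda>x. u x - uh x)) x)\<^sup>2)"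
      using hessian_error_L2[of i j] w by (intro integral_cong_AE) (auto simp: L2_def hessian_error_def elim: eventually_mono)
    then show ?thesis by (simp add: L2norm_sq)
  qed
  have "(\<Sum>K\<in>\<T>. local_error K) = (\<Sum>i\<in>UNIV. \<Sum>j\<in>UNIV. \<Sum>K\<in>\<T>. (L2norm (lebesgue_on K) (hessian_error i j))\<^sup>2)"
    unfolding local_error_def by (simp add: sum_2 sum.distrib)
  also have "\<dots> = (\<Sum>i\<in>UNIV. \<Sum>j\<in>UNIV. (?n (wpd \<Omega> j (wpd \<Omega> i (\<lambda>x. u x - uh x))))\<^sup>2)"
    by (simp add: L2norm_over_triangles[OF hessian_error_L2, symmetric] eq)
  also have "\<dots> \<le> (H2norm \<Omega> (\<lambda>x. u x - uh x))\<^sup>2"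
    unfolding H2norm_def by (subst real_sqrt_pow2) (simp_all add: add_nonneg_nonneg sum_nonneg)
  finally show ?thesis .
qed

end

section \<open>The residual identity\<close>

definition moment_const :: "real \<Rightarrow> real \<Rightarrow> real \<Rightarrow> real" where
  "moment_const d Y \<nu> = \<bar>d ^ 3 / 12\<bar> * (\<bar>Y / (1 + \<nu>)\<bar> * (1 + \<bar>\<nu> / (1 - \<nu>)\<bar>))"

lemma moment_cong:
  assumes "\<And>i j. \<D> j (\<D> i w) x = \<D>' j (\<D>' i w') x"
  shows "moment \<D> d Y \<nu> w x = moment \<D>' d Y \<nu> w' x" "curvature \<D> w x = curvature \<D>' w' x"
  by (simp_all add: vec_eq_iff moment_nth curvature_nth assms)

text \<open>The moment tensor depends linearly on the second derivatives. Differences are estimated because the weak derivatives of a difference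
  agree with the differences of weak derivatives only almost everywhere.\<close>

lemma moment_diff_bound:
  "\<bar>moment \<D> d Y \<nu> w x $ i $ j - moment \<D>' d Y \<nu> w' x $ i $ j\<bar> \<le>
    moment_const d Y \<nu> * (\<Sum>k\<in>UNIV. \<Sum>l\<in>UNIV. \<bar>\<D> l (\<D> k w) x - \<D>' l (\<D>' k w') x\<bar>)"
proof -
  define \<epsilon> where "\<epsilon> k l = \<D> l (\<D> k w) x - \<D>' l (\<D>' k w') x" for k l
  let ?s = "\<Sum>k\<in>UNIV. \<Sum>l\<in>UNIV. \<bar>\<epsilon> k l\<bar>"
  have s0: "0 \<le> ?s" by (intro sum_nonneg) auto
  have e: "\<bar>\<epsilon> k l\<bar> \<le> ?s" for k l
    by (rule order_trans[OF member_le_sum[of l UNIV "\<lambda>l. \<bar>\<epsilon> k l\<bar>"] member_le_sum[of k UNIV "\<lambda>k. \<Sum>l\<in>UNIV. \<bar>\<epsilon> k l\<bar>"]])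
      (auto intro: sum_nonneg)
  define t where "t = - (1/2) * (\<epsilon> i j + \<epsilon> j i)"
  define tr where "tr = (if i = j then - (\<epsilon> 1 1 + \<epsilon> 2 2) else 0)"
  have t: "\<bar>t\<bar> \<le> ?s" using e[of i j] e[of j i] by (simp add: t_def)
  have tr: "\<bar>tr\<bar> \<le> ?s" 
  proof (cases "i = j")
    case True
    show ?thesis unfolding tr_def sum_2 if_P[OF True] by linarith
  next
    case False
    show ?thesis unfolding tr_def if_not_P[OF False] using s0 by simp
  qed
  have "moment \<D> d Y \<nu> w x $ i $ j - moment \<D>' d Y \<nu> w' x $ i $ j =
      (d ^ 3 / 12) * ((Y / (1 + \<nu>)) * (t + (\<nu> / (1 - \<nu>)) * tr))"
  proof -
    have ring: "A * (B * (y + (C * z) * \<delta>)) - A * (B * (y' + (C * z') * \<delta>)) = A * (B * ((y - y') + C * ((z - z') * \<delta>)))"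
      for A B C y y' z z' \<delta> :: real by (simp add: algebra_simps)
    have yt: "- (1/2) * (\<D> j (\<D> i w) x + \<D> i (\<D> j w) x) - - (1/2) * (\<D>' j (\<D>' i w') x + \<D>' i (\<D>' j w') x) = t"
      by (simp add: t_def \<epsilon>_def field_simps)
    have zt: "((\<Sum>k\<in>UNIV. - (1/2) * (\<D> k (\<D> k w) x + \<D> k (\<D> k w) x)) -
        (\<Sum>k\<in>UNIV. - (1/2) * (\<D>' k (\<D>' k w') x + \<D>' k (\<D>' k w') x))) * (if i = j then 1 else 0) = tr"
      by (simp add: tr_def \<epsilon>_def sum_2)
    show ?thesis unfolding moment_nth ring yt zt ..
  qed
  also have "\<bar>\<dots>\<bar> = \<bar>d ^ 3 / 12\<bar> * (\<bar>Y / (1 + \<nu>)\<bar> * \<bar>t + (\<nu> / (1 - \<nu>)) * tr\<bar>)" by (simp only: abs_mult)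
  also have "\<dots> \<le> \<bar>d ^ 3 / 12\<bar> * (\<bar>Y / (1 + \<nu>)\<bar> * ((1 + \<bar>\<nu> / (1 - \<nu>)\<bar>) * ?s))"
  proof (intro mult_left_mono abs_ge_zero)
    have "\<bar>t + (\<nu> / (1 - \<nu>)) * tr\<bar> \<le> \<bar>t\<bar> + \<bar>\<nu> / (1 - \<nu>)\<bar> * \<bar>tr\<bar>" by (metis abs_mult abs_triangle_ineq)
    also have "\<dots> \<le> ?s + \<bar>\<nu> / (1 - \<nu>)\<bar> * ?s" by (intro add_mono mult_left_mono t tr) auto
    finally show "\<bar>t + (\<nu> / (1 - \<nu>)) * tr\<bar> \<le> (1 + \<bar>\<nu> / (1 - \<nu>)\<bar>) * ?s" by (simp add: distrib_right)
  qed
  finally show ?thesis unfolding moment_const_def \<epsilon>_def by (simp only: mult.assoc)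
qed

context plate_problem
begin

lemma moment_L2: assumes "w \<in> H2 \<Omega>" shows "(\<lambda>x. moment (wpd \<Omega>) d Y \<nu> w x $ i $ j) \<in> L2 (lebesgue_on \<Omega>)"
  unfolding moment_nth sum_2 mult.commute[of _ "if i = j then 1 else (0::real)"]
  by (intro L2_cmult L2_add H2D(3)[OF assms])

lemma curvature_L2: assumes "w \<in> H2 \<Omega>" shows "(\<lambda>x. curvature (wpd \<Omega>) w x $ i $ j) \<in> L2 (lebesgue_on \<Omega>)"
  unfolding curvature_nth by (intro L2_cmult L2_add H2D(3)[OF assms])

lemma inner_matrix_2: "(A::real^2^2) \<bullet> B = (\<Sum>i\<in>UNIV. \<Sum>j\<in>UNIV. A $ i $ j * B $ i $ j)"
  by (simp add: inner_vec_def)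

lemma moment_curvature_integrable:
  assumes "w \<in> H2 \<Omega>" "v \<in> H2 \<Omega>"
  shows "integrable (lebesgue_on \<Omega>) (\<lambda>x. moment (wpd \<Omega>) d Y \<nu> w x \<bullet> curvature (wpd \<Omega>) v x)"
  unfolding inner_matrix_2
  by (intro Bochner_Integration.integrable_sum L2_mult_integrable moment_L2 curvature_L2 assms)

lemma curvature_cut:
  assumes w: "supported_in_patch \<P> w"
  shows "AE x in lebesgue_on \<Omega>. curvature (wpd \<Omega>) (cut \<P> w) x = (if x \<in> \<Union>\<P> then curvature pd w x else 0)"
proof -
  have "AE x in lebesgue_on \<Omega>. \<forall>i j. wpd \<Omega> j (wpd \<Omega> i (cut \<P> w)) x = cut \<P> (pd j (pd i w)) x"
    using cut_H2(3)[OF w] by (simp add: AE_all_countable)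
  then show ?thesis
    by eventually_elim (auto simp: vec_eq_iff curvature_nth cut_def)
qed

lemma moment_uh_triangle:
  assumes "K \<in> \<T>"
  shows "AE x in lebesgue_on K. moment (wpd \<Omega>) d Y \<nu> uh x = moment pd d Y \<nu> (piece K uh) x"
proof -
  have "AE x in lebesgue_on \<Omega>. x \<in> interior K \<longrightarrow> wpd \<Omega> j (wpd \<Omega> i uh) x = pd j (pd i (piece K uh)) x" for i j
    using piece_Vh[OF uh assms] interior_subset
    by (intro wpd2_local u_H2 interior_triangle_domain assms open_interior) blast+
  then have "AE x in lebesgue_on \<Omega>. \<forall>i j. x \<in> interior K \<longrightarrow> wpd \<Omega> j (wpd \<Omega> i uh) x = pd j (pd i (piece K uh)) x"
    unfolding AE_all_countable by blast
  then have "AE x in lebesgue_on K. \<forall>i j. x \<in> interior K \<longrightarrow> wpd \<Omega> j (wpd \<Omega> i uh) x = pd j (pd i (piece K uh)) x"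
    by (rule AE_domain_triangle[OF assms])
  moreover have "AE x in lebesgue_on K. x \<in> interior K"
    unfolding AE_on_triangle[OF assms] using AE_in_interior by eventually_elim (use assms in auto)
  ultimately show ?thesis
    by eventually_elim (intro moment_cong(1), blast)
qed

lemma measure_subset_cball:
  assumes "B \<in> sets lebesgue" "B \<subseteq> cball (c::real^2) R" "R \<ge> 0" shows "measure lebesgue B \<le> (2 * R)\<^sup>2" "B \<in> lmeasurable"
proof -
  have sub: "cball c R \<subseteq> cbox (c - (\<chi> i. R)) (c + (\<chi> i. R))"
  proof
    fix x assume "x \<in> cball c R"
    then have n: "norm (x - c) \<le> R" by (simp add: dist_norm norm_minus_commute)
    have "\<bar>x $ i - c $ i\<bar> \<le> R" for i using component_le_norm_cart[of "x - c" i] n by simp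
    then show "x \<in> cbox (c - (\<chi> i. R)) (c + (\<chi> i. R))" by (auto simp: mem_box_cart abs_le_iff) (smt (verit))+
  qed
  have "measure lebesgue B \<le> measure lebesgue (cbox (c - (\<chi> i. R)) (c + (\<chi> i. R)))"
    using assms sub by (intro measure_mono_fmeasurable) auto
  also have "\<dots> = (2 * R)\<^sup>2"
  proof -
    have "c \<in> cbox (c - (\<chi> i. R)) (c + (\<chi> i. R))" using assms(3) by (simp add: mem_box_cart)
    then have "cbox (c - (\<chi> i. R)) (c + (\<chi> i. R)) \<noteq> {}" by blast
    then show ?thesis by (simp add: content_cbox_cart UNIV_2 power2_eq_square)
  qed
  finally show "measure lebesgue B \<le> (2 * R)\<^sup>2" .
  show "B \<in> lmeasurable" using assms bounded_set_imp_lmeasurable bounded_subset bounded_cball by blast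
qed

lemma L2norm_indicator_triangle:
  assumes K: "K \<in> \<T>" and B: "closed B" "B \<subseteq> cball c R" "R \<ge> 0"
  shows "indicator B \<in> L2 (lebesgue_on K)" "L2norm (lebesgue_on K) (indicator B) \<le> 2 * R"
proof -
  have Bs: "B \<in> sets lebesgue" using B(1) by (auto intro: lborelD)
  have fin: "finite_measure (lebesgue_on K)" by (intro finite_lebesgue_on triangle(9) triangle_measurable K)
  have m: "(indicator B :: real^2 \<Rightarrow> real) \<in> borel_measurable (lebesgue_on K)"
    by (intro measurable_restrict_space1 borel_measurable_indicator Bs)
  show "indicator B \<in> L2 (lebesgue_on K)" by (rule L2_bounded[OF fin m, of 1]) (auto simp: indicator_def)
  have "(LINT x|lebesgue_on K. (indicator B x :: real)\<^sup>2) = (LINT x|lebesgue. indicator K x * (indicator B x)\<^sup>2)"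
    using triangle_measurable[OF K] by (subst integral_restrict_space) auto
  also have "\<dots> = (LINT x|lebesgue. indicator (K \<inter> B) x)"
    by (intro Bochner_Integration.integral_cong) (auto simp: indicator_def)
  also have "\<dots> = measure lebesgue (K \<inter> B)" by simp
  also have "\<dots> \<le> measure lebesgue B"
    using measure_subset_cball[OF Bs B(2,3)] triangle_measurable[OF K] Bs by (intro measure_mono_fmeasurable) auto
  also have "\<dots> \<le> (2 * R)\<^sup>2" by (rule measure_subset_cball[OF Bs B(2,3)])
  finally have "(L2norm (lebesgue_on K) (indicator B))\<^sup>2 \<le> (2 * R)\<^sup>2" by (simp add: L2norm_sq)
  then show "L2norm (lebesgue_on K) (indicator B) \<le> 2 * R" by (rule power2_le_imp_le) (use B(3) in simp)
qed

text \<open>Cauchy-Schwarz inequality, with the measure of the support estimated by that of a square of side \<open>2R\<close>.\<close>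

lemma weighted_integral_bound:
  assumes K: "K \<in> \<T>" and h: "h \<in> L2 (lebesgue_on K)" and w: "smooth w" "\<And>x. \<bar>w x\<bar> \<le> M * indicator B x"
    and B: "closed B" "B \<subseteq> cball c R" "R \<ge> 0" and M: "M \<ge> 0"
  shows "\<bar>LINT x|lebesgue_on K. h x * w x\<bar> \<le> M * (2 * R) * L2norm (lebesgue_on K) h"
proof -
  note iB = L2norm_indicator_triangle[OF K B]
  have w2: "w \<in> L2 (lebesgue_on K)" by (rule L2_smooth_triangle[OF K w(1)])
  have "L2norm (lebesgue_on K) w \<le> M * (2 * R)"
  proof -
    have "(LINT x|lebesgue_on K. (w x)\<^sup>2) \<le> (LINT x|lebesgue_on K. M\<^sup>2 * (indicator B x)\<^sup>2)"
    proof (rule integral_mono)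
      show "(w x)\<^sup>2 \<le> M\<^sup>2 * (indicator B x)\<^sup>2" for x
        using w(2)[of x] M by (simp add: power_mult_distrib[symmetric] abs_le_square_iff[symmetric])
    qed (use w2 iB(1) in \<open>auto simp: L2_def\<close>)
    then have "(L2norm (lebesgue_on K) w)\<^sup>2 \<le> M\<^sup>2 * (L2norm (lebesgue_on K) (indicator B))\<^sup>2"
      by (simp add: L2norm_sq)
    also have "\<dots> \<le> M\<^sup>2 * (2 * R)\<^sup>2" using iB(2) by (intro mult_left_mono power_mono) auto
    finally have "(L2norm (lebesgue_on K) w)\<^sup>2 \<le> (M * (2 * R))\<^sup>2" by (simp add: power_mult_distrib)
    then show ?thesis by (rule power2_le_imp_le) (use M B(3) in simp)
  qed
  then have "L2norm (lebesgue_on K) h * L2norm (lebesgue_on K) w \<le> L2norm (lebesgue_on K) h * (M * (2 * R))"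
    by (intro mult_left_mono) auto
  then show ?thesis using L2_Cauchy_Schwarz[OF h w2] by (simp add: mult_ac)
qed

definition stress_const :: real where "stress_const = 16 * moment_const d Y \<nu>"

lemma moment_const_nonneg: "0 \<le> moment_const d Y \<nu>"
  by (simp add: moment_const_def)

lemma stress_integral_bound:
  assumes K: "K \<in> \<T>" and w: "smooth w" "\<And>i j x. \<bar>pd j (pd i w) x\<bar> \<le> D * indicator B x"
    and B: "closed B" "B \<subseteq> cball c R" "R \<ge> 0" and D: "D \<ge> 0"
  shows "\<bar>LINT x|lebesgue_on K. (moment (wpd \<Omega>) d Y \<nu> u x - moment (wpd \<Omega>) d Y \<nu> uh x) \<bullet> curvature pd w x\<bar> \<le>
    stress_const * (D * R) * sqrt (local_error K)"
proof -
  let ?E = "\<lambda>k l. L2norm (lebesgue_on K) (hessian_error k l)"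
  note iB = L2norm_indicator_triangle[OF K B]
  have eK: "hessian_error k l \<in> L2 (lebesgue_on K)" for k l by (rule L2_on_triangle[OF K hessian_error_L2])
  have eA: "(\<lambda>x. \<bar>hessian_error k l x\<bar>) \<in> L2 (lebesgue_on K)" for k l using eK[of k l] by (auto simp: L2_def)
  let ?m = "moment_const d Y \<nu>"
  let ?bnd = "\<lambda>x. \<Sum>k\<in>UNIV. \<Sum>l\<in>UNIV. (4 * ?m * D) * (\<bar>hessian_error k l x\<bar> * indicator B x)"
  have pw: "\<bar>(moment (wpd \<Omega>) d Y \<nu> u x - moment (wpd \<Omega>) d Y \<nu> uh x) \<bullet> curvature pd w x\<bar> \<le> ?bnd x" for x
  proof -
    let ?s = "\<Sum>k\<in>UNIV. \<Sum>l\<in>UNIV. \<bar>hessian_error k l x\<bar>"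
    have c: "\<bar>curvature pd w x $ i $ j\<bar> \<le> D * indicator B x" for i j
    proof -
      have "\<bar>curvature pd w x $ i $ j\<bar> \<le> 1/2 * (\<bar>pd j (pd i w) x\<bar> + \<bar>pd i (pd j w) x\<bar>)"
        unfolding curvature_nth abs_mult by simp
      also have "\<dots> \<le> 1/2 * (D * indicator B x + D * indicator B x)" by (intro mult_left_mono add_mono w) auto
      finally show ?thesis by simp
    qed
    have "\<bar>(moment (wpd \<Omega>) d Y \<nu> u x - moment (wpd \<Omega>) d Y \<nu> uh x) \<bullet> curvature pd w x\<bar> \<le>
        (\<Sum>i\<in>(UNIV::2 set). \<Sum>j\<in>(UNIV::2 set). (?m * ?s) * (D * indicator B x))"
      unfolding inner_matrix_2
      by (intro order_trans[OF sum_abs] sum_mono)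
        (auto simp: abs_mult hessian_error_def intro!: mult_mono c moment_diff_bound mult_nonneg_nonneg moment_const_nonneg sum_nonneg D)
    also have "\<dots> = ?bnd x" by (simp add: sum_distrib_left sum_2 algebra_simps)
    finally show ?thesis .
  qed
  have ib: "integrable (lebesgue_on K) ?bnd"
    by (intro Bochner_Integration.integrable_sum integrable_mult_right L2_mult_integrable eA iB)
  have "\<bar>LINT x|lebesgue_on K. (moment (wpd \<Omega>) d Y \<nu> u x - moment (wpd \<Omega>) d Y \<nu> uh x) \<bullet> curvature pd w x\<bar> \<le> (LINT x|lebesgue_on K. ?bnd x)"
  proof (cases "integrable (lebesgue_on K) (\<lambda>x. (moment (wpd \<Omega>) d Y \<nu> u x - moment (wpd \<Omega>) d Y \<nu> uh x) \<bullet> curvature pd w x)")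
    case True
    have "\<bar>LINT x|lebesgue_on K. (moment (wpd \<Omega>) d Y \<nu> u x - moment (wpd \<Omega>) d Y \<nu> uh x) \<bullet> curvature pd w x\<bar>
      \<le> (LINT x|lebesgue_on K. \<bar>(moment (wpd \<Omega>) d Y \<nu> u x - moment (wpd \<Omega>) d Y \<nu> uh x) \<bullet> curvature pd w x\<bar>)"
      by (rule integral_abs_bound)
    also have "\<dots> \<le> (LINT x|lebesgue_on K. ?bnd x)" using True ib pw by (intro integral_mono) auto
    finally show ?thesis .
  next
    case False
    have "0 \<le> ?bnd x" for x using pw[of x] by linarith
    then show ?thesis using False by (simp add: not_integrable_integral_eq Bochner_Integration.integral_nonneg)
  qed
  also have "\<dots> = (\<Sum>k\<in>UNIV. \<Sum>l\<in>UNIV. (4 * ?m * D) * (LINT x|lebesgue_on K. \<bar>hessian_error k l x\<bar> * indicator B x))"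
    using L2_mult_integrable[OF eA iB(1)]
    by (simp add: Bochner_Integration.integral_sum)
  also have "\<dots> \<le> (\<Sum>k\<in>UNIV. \<Sum>l\<in>UNIV. (4 * ?m * D) * (?E k l * (2 * R)))"
  proof (intro sum_mono mult_left_mono)
    fix k l :: 2
    have "(LINT x|lebesgue_on K. \<bar>hessian_error k l x\<bar> * indicator B x) \<le> L2norm (lebesgue_on K) (\<lambda>x. \<bar>hessian_error k l x\<bar>) * L2norm (lebesgue_on K) (indicator B)"
      using L2_Cauchy_Schwarz[OF eA[of k l] iB(1)] by linarith
    also have "L2norm (lebesgue_on K) (\<lambda>x. \<bar>hessian_error k l x\<bar>) = ?E k l" by (simp add: L2norm_def)
    also have "?E k l * L2norm (lebesgue_on K) (indicator B) \<le> ?E k l * (2 * R)" using iB(2) by (intro mult_left_mono) auto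
    finally show "(LINT x|lebesgue_on K. \<bar>hessian_error k l x\<bar> * indicator B x) \<le> ?E k l * (2 * R)" .
  qed (use D moment_const_nonneg in auto)
  also have "\<dots> = (8 * ?m * (D * R)) * (\<Sum>k\<in>UNIV. \<Sum>l\<in>UNIV. ?E k l)"
    by (simp add: sum_distrib_left sum_2 algebra_simps)
  also have "\<dots> \<le> (8 * ?m * (D * R)) * (2 * sqrt (local_error K))"
  proof (intro mult_left_mono)
    have "(\<Sum>k\<in>UNIV. \<Sum>l\<in>UNIV. ?E k l)\<^sup>2 \<le> 4 * local_error K"
    proof -
      define a where "a = ?E 1 1" define b where "b = ?E 1 2" define c where "c = ?E 2 1" define e where "e = ?E 2 2"
      have "0 \<le> (a - b)\<^sup>2 + (a - c)\<^sup>2 + (a - e)\<^sup>2 + (b - c)\<^sup>2 + (b - e)\<^sup>2 + (c - e)\<^sup>2" by simp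
      then have "(a + b + c + e)\<^sup>2 \<le> 4 * (a\<^sup>2 + b\<^sup>2 + c\<^sup>2 + e\<^sup>2)" by (simp add: power2_eq_square algebra_simps)
      then show ?thesis by (simp add: local_error_def sum_2 a_def b_def c_def e_def add.assoc)
    qed
    then have "(\<Sum>k\<in>UNIV. \<Sum>l\<in>UNIV. ?E k l) \<le> sqrt (4 * local_error K)" by (rule real_le_rsqrt)
    then show "(\<Sum>k\<in>UNIV. \<Sum>l\<in>UNIV. ?E k l) \<le> 2 * sqrt (local_error K)" by (simp add: real_sqrt_mult)
  qed (use D B(3) moment_const_nonneg in auto)
  finally show ?thesis by (simp add: stress_const_def)
qed

text \<open>The boundary terms of Green's formula on the line through \<open>a\<close> with normal \<open>n\<close>, for the polynomial of \<open>u\<^sub>h\<close> on \<open>K\<close>. Integrating over the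
  whole line is harmless because the test functions vanish on the line outside the edge.\<close>

definition line_residual :: "(real^2) set \<Rightarrow> real^2 \<Rightarrow> real^2 \<Rightarrow> (real^2 \<Rightarrow> real) \<Rightarrow> real" where
  "line_residual K a n w =
     (LINT s|lborel. V_n d Y \<nu> n (piece K uh) (a + s *\<^sub>R perp n) * w (a + s *\<^sub>R perp n))
     - (LINT s|lborel. M_nn d Y \<nu> n (piece K uh) (a + s *\<^sub>R perp n) * (\<Sum>i\<in>UNIV. pd i w (a + s *\<^sub>R perp n) * n $ i))"

definition element_residual :: "(real^2) set \<Rightarrow> real^2 \<Rightarrow> real" where
  "element_residual K x = plate_op d Y \<nu> (piece K uh) x - f x"

lemma element_residual_L2: assumes "K \<in> \<T>" shows "element_residual K \<in> L2 (lebesgue_on K)"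
proof -
  have "element_residual K = (\<lambda>x. plate_op d Y \<nu> (piece K uh) x - f x)"
    by (rule ext) (simp add: element_residual_def)
  then show ?thesis
    using L2_diff[OF L2_smooth_triangle[OF assms smooth_plate_op[OF piece_Vh(3)[OF uh assms]]] L2_on_triangle[OF assms f]]
    by simp
qed

text \<open>If the support of the test function cuts out the same part from the triangle as from a half-plane, the triangle may be replaced by the
  half-plane, for which Green's formula has no corner terms.\<close>

lemma integral_triangle_half_plane:
  fixes h :: "real^2 \<Rightarrow> real"
  assumes K: "K \<in> \<T>" "K \<subseteq> half_plane a n" and h: "h \<in> borel_measurable borel"
    and z: "\<And>x. x \<in> half_plane a n \<Longrightarrow> x \<notin> K \<Longrightarrow> h x = 0"
  shows "(LINT x|lebesgue_on K. h x) = (LINT x|lborel. indicator (half_plane a n) x * h x)"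
proof -
  have "(LINT x|lebesgue_on K. h x) = (LINT x|lebesgue. indicator K x * h x)"
    using triangle_measurable[OF K(1)] by (simp add: integral_restrict_space)
  also have "\<dots> = (LINT x|lebesgue. indicator (half_plane a n) x * h x)"
    using K(2) z by (intro Bochner_Integration.integral_cong) (auto simp: indicator_def)
  also have "\<dots> = (LINT x|lborel. indicator (half_plane a n) x * h x)"
    using h by (intro integral_completion) simp
  finally show ?thesis .
qed

text \<open>Both \<open>a(u, v)\<close> and \<open>a(u\<^sub>h, v)\<close> are computed for the cut function \<open>v\<close>: the former is the load, since \<open>v\<close> is admissible, the latter follows
  from Green's formula on each triangle. The difference of the results is the residual, and it equals \<open>a(u\<^sub>h - u, v)\<close>, which the
  Cauchy-Schwarz inequality bounds by the local errors. Only one line per triangle is allowed to meet the support.\<close>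

lemma residual_bound:
  assumes w: "supported_in_patch \<P> w" and v: "cut \<P> w \<in> plate_space \<Omega> \<Gamma>c \<Gamma>s"
    and hp: "\<And>K. K \<in> \<P> \<Longrightarrow> norm (n K) = 1 \<and> K \<subseteq> half_plane (a K) (n K)"
    and sp: "\<And>K x. K \<in> \<P> \<Longrightarrow> x \<in> half_plane (a K) (n K) \<Longrightarrow> x \<in> closure {x. w x \<noteq> 0} \<Longrightarrow> x \<in> K"
    and D: "\<And>i j x. \<bar>pd j (pd i w) x\<bar> \<le> D * indicator B x"
    and B: "closed B" "B \<subseteq> cball c R" "R \<ge> 0" and D0: "D \<ge> 0"
  shows "\<bar>(\<Sum>K\<in>\<P>. line_residual K (a K) (n K) w) + (\<Sum>K\<in>\<P>. LINT x|lebesgue_on K. element_residual K x * w x)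
      - (LINT x|arc_measure S. g x * cut \<P> w x) - F * cut \<P> w x0\<bar>
    \<le> stress_const * (D * R) * (\<Sum>K\<in>\<P>. sqrt (local_error K))"
proof -
  let ?v = "cut \<P> w"
  have P: "\<P> \<subseteq> \<T>" "smooth w" "bounded {x. w x \<noteq> 0}" using w by (auto simp: supported_in_patch_def)
  note vH = cut_H2(1)[OF w]
  note cc = curvature_cut[OF w]
  have ccK: "AE x in lebesgue_on K. curvature (wpd \<Omega>) ?v x = curvature pd w x" if "K \<in> \<P>" for K
  proof -
    have K: "K \<in> \<T>" using that P by blast
    have "AE x in lebesgue_on K. x \<in> K" unfolding AE_on_triangle[OF K] by simp
    with AE_domain_triangle[OF K cc] show ?thesis by eventually_elim (use that in auto)
  qed
  have inner_curvature_measurable: "(\<lambda>x. h x \<bullet> curvature pd w x) \<in> borel_measurable M"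
    if "\<And>i j. (\<lambda>x. h x $ i $ j) \<in> borel_measurable M" "\<And>i j. (\<lambda>x. curvature pd w x $ i $ j) \<in> borel_measurable M"
    for h :: "real^2 \<Rightarrow> real^2^2" and M unfolding inner_matrix_2 using that by measurable
  have sc: "smooth (\<lambda>x. curvature pd w x $ i $ j)" for i j
    unfolding curvature_nth by (intro smooth_mult smooth_const smooth_add smooth_pd P)
  have scK: "(\<lambda>x. curvature pd w x $ i $ j) \<in> borel_measurable (lebesgue_on K)" if "K \<in> \<T>" for i j K
    using L2_smooth_triangle[OF that sc, of i j] by (simp add: L2_def)
  \<comment> \<open>Green's formula for \<open>u\<^sub>h\<close>, whose weak second derivatives are those of its polynomial pieces.\<close>
  have uhK: "(LINT x|lebesgue_on K. moment (wpd \<Omega>) d Y \<nu> uh x \<bullet> curvature (wpd \<Omega>) ?v x) =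
      (LINT x|lebesgue_on K. plate_op d Y \<nu> (piece K uh) x * w x) + line_residual K (a K) (n K) w" if KP: "K \<in> \<P>" for K
  proof -
    have K: "K \<in> \<T>" using KP P by blast
    note p = piece_Vh[OF uh K]
    have sm: "smooth (\<lambda>x. moment pd d Y \<nu> (piece K uh) x \<bullet> curvature pd w x)"
      unfolding inner_matrix_2 by (intro smooth_sum smooth_mult smooth_moment p sc)
    have "(LINT x|lebesgue_on K. moment (wpd \<Omega>) d Y \<nu> uh x \<bullet> curvature (wpd \<Omega>) ?v x) =
        (LINT x|lebesgue_on K. moment pd d Y \<nu> (piece K uh) x \<bullet> curvature pd w x)"
    proof (rule integral_cong_AE)
      show "(\<lambda>x. moment (wpd \<Omega>) d Y \<nu> uh x \<bullet> curvature (wpd \<Omega>) ?v x) \<in> borel_measurable (lebesgue_on K)"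
        by (intro measurable_on_triangle[OF K] borel_measurable_integrable moment_curvature_integrable u_H2 vH)
      show "(\<lambda>x. moment pd d Y \<nu> (piece K uh) x \<bullet> curvature pd w x) \<in> borel_measurable (lebesgue_on K)"
        using L2_smooth_triangle[OF K sm] by (simp add: L2_def)
      show "AE x in lebesgue_on K. moment (wpd \<Omega>) d Y \<nu> uh x \<bullet> curvature (wpd \<Omega>) ?v x =
          moment pd d Y \<nu> (piece K uh) x \<bullet> curvature pd w x"
        using moment_uh_triangle[OF K] ccK[OF KP] by eventually_elim simp
    qed
    also have "\<dots> = (LINT x|lborel. indicator (half_plane (a K) (n K)) x * (moment pd d Y \<nu> (piece K uh) x \<bullet> curvature pd w x))"
    proof (rule integral_triangle_half_plane[OF K])
      show "K \<subseteq> half_plane (a K) (n K)" using hp[OF KP] by blast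
      show "(\<lambda>x. moment pd d Y \<nu> (piece K uh) x \<bullet> curvature pd w x) \<in> borel_measurable borel" by (rule smooth_borel[OF sm])
      fix x assume "x \<in> half_plane (a K) (n K)" "x \<notin> K"
      then have xs: "x \<notin> closure {x. w x \<noteq> 0}" using sp[OF KP] by blast
      have "pd j (pd i w) x = 0" for i j
      proof -
        have "{x. pd i w x \<noteq> 0} \<subseteq> closure {x. w x \<noteq> 0}" using pd_zero_off_support[of _ w i] by auto
        then have "closure {x. pd i w x \<noteq> 0} \<subseteq> closure {x. w x \<noteq> 0}" by (intro closure_minimal) auto
        then show ?thesis using xs by (intro pd_zero_off_support) blast
      qed
      then show "moment pd d Y \<nu> (piece K uh) x \<bullet> curvature pd w x = 0" by (simp add: moment_curvature)
    qed
    also have "\<dots> = (LINT x|lborel. indicator (half_plane (a K) (n K)) x * (plate_op d Y \<nu> (piece K uh) x * w x)) + line_residual K (a K) (n K) w"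
      using plate_green[OF p(3) P(2,3), of "n K" "a K" d Y \<nu>] hp[OF KP] by (simp add: line_residual_def)
    also have "(LINT x|lborel. indicator (half_plane (a K) (n K)) x * (plate_op d Y \<nu> (piece K uh) x * w x)) =
        (LINT x|lebesgue_on K. plate_op d Y \<nu> (piece K uh) x * w x)"
    proof (rule integral_triangle_half_plane[OF K, symmetric])
      show "K \<subseteq> half_plane (a K) (n K)" using hp[OF KP] by blast
      show "(\<lambda>x. plate_op d Y \<nu> (piece K uh) x * w x) \<in> borel_measurable borel"
        by (intro smooth_borel smooth_mult smooth_plate_op p P)
      fix x assume "x \<in> half_plane (a K) (n K)" "x \<notin> K"
      then have "x \<notin> closure {x. w x \<noteq> 0}" using sp[OF KP] by blast
      then have "w x = 0" using closure_subset[of "{x. w x \<noteq> 0}"] by (simp add: subset_iff) blast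
      then show "plate_op d Y \<nu> (piece K uh) x * w x = 0" by simp
    qed
    finally show ?thesis .
  qed
  have zero_off: "AE x in lebesgue_on \<Omega>. x \<notin> \<Union>\<P> \<longrightarrow> h x \<bullet> curvature (wpd \<Omega>) ?v x = 0" for h :: "real^2 \<Rightarrow> real^2^2"
    using cc by eventually_elim auto
  have form_uh: "plate_form \<Omega> d Y \<nu> uh ?v = (\<Sum>K\<in>\<P>. (LINT x|lebesgue_on K. plate_op d Y \<nu> (piece K uh) x * w x) + line_residual K (a K) (n K) w)"
    unfolding plate_form_def integral_over_triangles(2)[OF moment_curvature_integrable[OF u_H2(2) vH] P(1) zero_off]
    by (intro sum.cong refl uhK)
  \<comment> \<open>The stress of the error tested with the curvature of the test function, triangle by triangle.\<close>
  have "plate_form \<Omega> d Y \<nu> u ?v - plate_form \<Omega> d Y \<nu> uh ?v =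
      (LINT x|lebesgue_on \<Omega>. (moment (wpd \<Omega>) d Y \<nu> u x - moment (wpd \<Omega>) d Y \<nu> uh x) \<bullet> curvature (wpd \<Omega>) ?v x)"
    unfolding plate_form_def using moment_curvature_integrable[OF u_H2(1) vH] moment_curvature_integrable[OF u_H2(2) vH]
    by (simp add: inner_diff_left)
  also have "\<dots> = (\<Sum>K\<in>\<P>. LINT x|lebesgue_on K. (moment (wpd \<Omega>) d Y \<nu> u x - moment (wpd \<Omega>) d Y \<nu> uh x) \<bullet> curvature (wpd \<Omega>) ?v x)"
    by (intro integral_over_triangles(2) P zero_off)
      (use moment_curvature_integrable[OF u_H2(1) vH] moment_curvature_integrable[OF u_H2(2) vH] in \<open>simp add: inner_diff_left\<close>)
  also have "\<dots> = (\<Sum>K\<in>\<P>. LINT x|lebesgue_on K. (moment (wpd \<Omega>) d Y \<nu> u x - moment (wpd \<Omega>) d Y \<nu> uh x) \<bullet> curvature pd w x)"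
  proof (intro sum.cong refl integral_cong_AE)
    fix K assume KP: "K \<in> \<P>"
    then have K: "K \<in> \<T>" using P by blast
    show "(\<lambda>x. (moment (wpd \<Omega>) d Y \<nu> u x - moment (wpd \<Omega>) d Y \<nu> uh x) \<bullet> curvature (wpd \<Omega>) ?v x) \<in> borel_measurable (lebesgue_on K)"
      by (intro measurable_on_triangle[OF K] borel_measurable_integrable)
       (use moment_curvature_integrable[OF u_H2(1) vH] moment_curvature_integrable[OF u_H2(2) vH] in \<open>simp add: inner_diff_left\<close>)
    show "(\<lambda>x. (moment (wpd \<Omega>) d Y \<nu> u x - moment (wpd \<Omega>) d Y \<nu> uh x) \<bullet> curvature pd w x) \<in> borel_measurable (lebesgue_on K)"
    proof (rule inner_curvature_measurable[OF _ scK[OF K]])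
      fix i j
      show "(\<lambda>x. (moment (wpd \<Omega>) d Y \<nu> u x - moment (wpd \<Omega>) d Y \<nu> uh x) $ i $ j) \<in> borel_measurable (lebesgue_on K)"
        using L2_on_triangle[OF K L2_diff[OF moment_L2[OF u_H2(1), of i j] moment_L2[OF u_H2(2), of i j]]] by (simp add: L2_def)
    qed
    show "AE x in lebesgue_on K. (moment (wpd \<Omega>) d Y \<nu> u x - moment (wpd \<Omega>) d Y \<nu> uh x) \<bullet> curvature (wpd \<Omega>) ?v x =
        (moment (wpd \<Omega>) d Y \<nu> u x - moment (wpd \<Omega>) d Y \<nu> uh x) \<bullet> curvature pd w x"
      using ccK[OF KP] by eventually_elim simp
  qed
  finally have eq: "plate_form \<Omega> d Y \<nu> u ?v - plate_form \<Omega> d Y \<nu> uh ?v =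
      (\<Sum>K\<in>\<P>. LINT x|lebesgue_on K. (moment (wpd \<Omega>) d Y \<nu> u x - moment (wpd \<Omega>) d Y \<nu> uh x) \<bullet> curvature pd w x)" .
  have "\<bar>plate_form \<Omega> d Y \<nu> u ?v - plate_form \<Omega> d Y \<nu> uh ?v\<bar> \<le> (\<Sum>K\<in>\<P>. stress_const * (D * R) * sqrt (local_error K))"
    unfolding eq using P(1) by (intro order_trans[OF sum_abs] sum_mono stress_integral_bound[OF _ P(2) D B D0]) blast
  then have err: "\<bar>plate_form \<Omega> d Y \<nu> u ?v - plate_form \<Omega> d Y \<nu> uh ?v\<bar> \<le> stress_const * (D * R) * (\<Sum>K\<in>\<P>. sqrt (local_error K))"
    by (simp add: sum_distrib_left)
  \<comment> \<open>The test function is its own continuous representative, so the line and the point load evaluate it directly.\<close>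
  have vL2: "?v \<in> L2 (lebesgue_on \<Omega>)" using H2D(4)[OF vH] .
  have SO: "S \<subseteq> closure \<Omega>"
  proof -
    have "e \<subseteq> closure \<Omega>" if "e \<in> edges_S \<T> S" for e
    proof -
      obtain K where "K \<in> \<T>" "e edge_of K" using \<open>e \<in> edges_S \<T> S\<close> by (auto simp: edges_S_def interior_edges_def)
      then show ?thesis using edge_segment(2) triangle(8) by blast
    qed
    then have "\<Union>(edges_S \<T> S) \<subseteq> closure \<Omega>" by blast
    then show ?thesis using S_edges by simp
  qed
  have "plate_form \<Omega> d Y \<nu> u ?v = plate_load \<Omega> S x0 f g F ?v" by (rule u(2)[OF v])
  also have "\<dots> = (LINT x|lebesgue_on \<Omega>. f x * ?v x) + (LINT x|arc_measure S. g x * ?v x) + F * ?v x0"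
  proof -
    have "(LINT x|arc_measure S. g x * cont_rep \<Omega> ?v x) = (LINT x|arc_measure S. g x * ?v x)"
      using SO cont_rep_continuous[OF cut_continuous[OF w]] space_arc_measure[OF is_segment_S]
      by (intro Bochner_Integration.integral_cong) auto
    moreover have "cont_rep \<Omega> ?v x0 = ?v x0"
      using x0(1) closure_subset by (intro cont_rep_continuous cut_continuous w) blast
    ultimately show ?thesis by (simp add: plate_load_def)
  qed
  also have "(LINT x|lebesgue_on \<Omega>. f x * ?v x) = (\<Sum>K\<in>\<P>. LINT x|lebesgue_on K. f x * ?v x)"
    by (intro integral_over_triangles(2) L2_mult_integrable f vL2 P AE_I2) (auto simp: cut_def)
  also have "\<dots> = (\<Sum>K\<in>\<P>. LINT x|lebesgue_on K. f x * w x)"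
    by (intro sum.cong refl Bochner_Integration.integral_cong) (auto simp: cut_def space_restrict_space)
  finally have load: "plate_form \<Omega> d Y \<nu> u ?v = (\<Sum>K\<in>\<P>. LINT x|lebesgue_on K. f x * w x) + (LINT x|arc_measure S. g x * ?v x) + F * ?v x0" .
  have er: "(LINT x|lebesgue_on K. element_residual K x * w x) = (LINT x|lebesgue_on K. plate_op d Y \<nu> (piece K uh) x * w x)
      - (LINT x|lebesgue_on K. f x * w x)" if "K \<in> \<P>" for K
  proof -
    have K: "K \<in> \<T>" using that P by blast
    have wL: "w \<in> L2 (lebesgue_on K)" by (rule L2_smooth_triangle[OF K P(2)])
    have pL: "plate_op d Y \<nu> (piece K uh) \<in> L2 (lebesgue_on K)"
      by (intro L2_smooth_triangle K smooth_plate_op piece_Vh uh)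
    show ?thesis
      unfolding element_residual_def left_diff_distrib
      by (intro Bochner_Integration.integral_diff L2_mult_integrable pL wL L2_on_triangle[OF K f])
  qed
  have "(\<Sum>K\<in>\<P>. line_residual K (a K) (n K) w) + (\<Sum>K\<in>\<P>. LINT x|lebesgue_on K. element_residual K x * w x)
      - (LINT x|arc_measure S. g x * ?v x) - F * ?v x0 = plate_form \<Omega> d Y \<nu> uh ?v - plate_form \<Omega> d Y \<nu> u ?v"
    unfolding form_uh load by (simp add: er sum.distrib sum_subtractf)
  then show ?thesis using err by (simp add: abs_minus_commute)
qed

end

section \<open>Element estimate\<close>

definition square_bump :: "real^2 \<Rightarrow> real" where "square_bump z = bump (z $ 1) * bump (z $ 2)"

lemma smooth_square_bump: "smooth square_bump"
proof -
  have "smooth (\<lambda>z. bump (axis 1 1 \<bullet> z + 0) * bump (axis 2 1 \<bullet> z + 0))" by (intro smooth_mult smooth_bump)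
  then show ?thesis by (simp add: square_bump_def[abs_def] inner_axis')
qed

lemma square_bump_nonzero: "square_bump z \<noteq> 0 \<Longrightarrow> 1/4 < z $ i \<and> z $ i < 3/4"
  using bump_zero[of "z $ 1"] bump_zero[of "z $ 2"] exhaust_2[of i] unfolding square_bump_def by auto

text \<open>A bound for the test function of a polynomial \<open>Q\<close> on the reference square. The maximum of \<open>Q\<close> is taken over a larger box because a
  triangle exceeds its inscribed ball by a factor up to \<open>\<kappa>\<close>.\<close>

definition square_reference_bound :: "real \<Rightarrow> nat \<Rightarrow> real \<Rightarrow> bool" where
  "square_reference_bound R N C \<longleftrightarrow> C > 0 \<and> (\<forall>Q. polyfun N Q \<longrightarrow>
    (\<forall>z\<in>ref_box R. (Q z)\<^sup>2 \<le> C * (LINT z|lborel. square_bump z * (Q z)\<^sup>2)) \<and>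
    (\<forall>z. \<bar>square_bump z * Q z\<bar> \<le> C * sqrt (LINT z|lborel. square_bump z * (Q z)\<^sup>2) \<and>
      (\<forall>i j. \<bar>pd j (pd i (\<lambda>z. square_bump z * Q z)) z\<bar> \<le> C * sqrt (LINT z|lborel. square_bump z * (Q z)\<^sup>2))))"

definition element_const :: "real \<Rightarrow> real \<Rightarrow> real \<Rightarrow> real" where
  "element_const \<kappa> s C = 8 * C * \<kappa> ^ 6 * (32 * s\<^sup>2 * C\<^sup>2 + 128 * C\<^sup>2) + 2"

lemma square_bump_reference:
  fixes R :: real
  assumes R: "R \<ge> 1"
  shows "\<exists>C. square_reference_bound R N C"
proof -
  obtain C1 where C1: "C1 > 0" "\<And>Q z. polyfun N Q \<Longrightarrow> z \<in> ref_box R \<Longrightarrow> (Q z)\<^sup>2 \<le> C1 * (LINT z|lborel. square_bump z * (Q z)\<^sup>2)"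
    using inverse_estimate_box[OF R, of N] unfolding square_bump_def by meson
  have z0: "square_bump z = 0" if "z \<notin> ref_box 1" for z
  proof (rule ccontr)
    assume n: "square_bump z \<noteq> 0"
    have "\<bar>z $ i\<bar> \<le> 1" for i using square_bump_nonzero[OF n, of i] by linarith
    then show False using that by (simp add: ref_box_def)
  qed
  obtain C2 where C2: "C2 > 0" "\<And>Q M. polyfun N Q \<Longrightarrow> (\<forall>z\<in>ref_box 1. \<bar>Q z\<bar> \<le> M) \<Longrightarrow>
      (\<forall>z. \<bar>square_bump z * Q z\<bar> \<le> C2 * M \<and> (\<forall>i j. \<bar>pd j (pd i (\<lambda>z. square_bump z * Q z)) z\<bar> \<le> C2 * M))"
    using bump_polynomial_bounds[OF smooth_square_bump z0, of N] by meson
  let ?C = "C1 + C2 * sqrt C1"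
  show ?thesis unfolding square_reference_bound_def
  proof (intro exI[of _ ?C] conjI allI impI ballI)
    show "?C > 0" using C1 C2 by (simp add: add_pos_nonneg)
    fix Q assume Q: "polyfun N Q"
    let ?m = "LINT z|lborel. square_bump z * (Q z)\<^sup>2"
    have m: "?m \<ge> 0" by (intro Bochner_Integration.integral_nonneg) (simp add: square_bump_def bump_bounds)
    have le: "C1 \<le> ?C" "C2 * sqrt C1 \<le> ?C" using C1 C2 by simp_all
    show "(Q z)\<^sup>2 \<le> ?C * ?m" if "z \<in> ref_box R" for z
      using C1(2)[OF Q that] mult_right_mono[OF le(1) m] by linarith
    have "\<bar>Q z\<bar> \<le> sqrt C1 * sqrt ?m" if "z \<in> ref_box 1" for z
    proof -
      have "z \<in> ref_box R" using that R unfolding ref_box_def by (auto intro: order_trans)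
      then have "\<bar>Q z\<bar> \<le> sqrt (C1 * ?m)" using C1(2)[OF Q] by (intro real_le_rsqrt) simp
      then show ?thesis by (simp add: real_sqrt_mult)
    qed
    then have b: "\<forall>z. \<bar>square_bump z * Q z\<bar> \<le> C2 * (sqrt C1 * sqrt ?m) \<and>
        (\<forall>i j. \<bar>pd j (pd i (\<lambda>z. square_bump z * Q z)) z\<bar> \<le> C2 * (sqrt C1 * sqrt ?m))"
      by (intro C2(2)[OF Q]) blast
    have l2: "C2 * (sqrt C1 * sqrt ?m) \<le> ?C * sqrt ?m" using mult_right_mono[OF le(2), of "sqrt ?m"] m by (simp add: mult.assoc)
    show "\<bar>square_bump z * Q z\<bar> \<le> ?C * sqrt ?m" for z using b l2 by (meson order_trans)
    show "\<bar>pd j (pd i (\<lambda>z. square_bump z * Q z)) z\<bar> \<le> ?C * sqrt ?m" for i j z using b l2 by (meson order_trans)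
  qed
qed

lemma integral_scaled:
  fixes h :: "real^2 \<Rightarrow> real"
  assumes "\<rho> > 0" "h \<in> borel_measurable borel"
  shows "(LINT x|lborel. h ((1 / \<rho>) *\<^sub>R x + t)) = \<rho>\<^sup>2 * (LINT z|lborel. h z)"
proof -
  have "(lborel :: (real^2) measure) = density (distr lborel borel (\<lambda>x. t + (1 / \<rho>) *\<^sub>R x)) (\<lambda>_. ennreal (\<bar>1 / \<rho>\<bar> ^ DIM(real^2)))"
    using assms(1) by (intro lborel_affine) auto
  then have "(LINT z|lborel. h z) = (LINT z|density (distr lborel borel (\<lambda>x. t + (1 / \<rho>) *\<^sub>R x)) (\<lambda>_. ennreal (\<bar>1 / \<rho>\<bar> ^ DIM(real^2))). h z)"
    by simp
  also have "\<dots> = (1 / \<rho>)\<^sup>2 * (LINT x|lborel. h (t + (1 / \<rho>) *\<^sub>R x))"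
    using assms by (subst integral_density) (auto simp: integral_distr)
  finally show ?thesis using assms(1) by (simp add: power_divide add.commute)
qed

lemma pd_zero_outside_closed:
  assumes "closed B" "\<And>x. x \<notin> B \<Longrightarrow> w x = 0" "x \<notin> B"
  shows "pd i w x = 0" "pd j (pd i w) x = 0"
proof -
  have c: "closure {x. w x \<noteq> 0} \<subseteq> B" using assms(1,2) by (intro closure_minimal) auto
  have z: "pd i w x = 0" if "x \<notin> B" for x using c that by (intro pd_zero_off_support) blast
  then show "pd i w x = 0" using assms(3) by blast
  have "closure {x. pd i w x \<noteq> 0} \<subseteq> B" using assms(1) z by (intro closure_minimal) auto
  then show "pd j (pd i w) x = 0" using assms(3) by (intro pd_zero_off_support) blast
qed

context kirchhoff_mesh
begin

lemma boundary_parts: "\<Gamma>c \<subseteq> frontier \<Omega>" "\<Gamma>s \<subseteq> frontier \<Omega>" "\<Gamma>f \<subseteq> frontier \<Omega>"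
  "finite (\<Gamma>c \<inter> \<Gamma>s)" "finite (\<Gamma>c \<inter> \<Gamma>f)" "finite (\<Gamma>s \<inter> \<Gamma>f)"
  using partition by (auto simp: boundary_partition_def)

lemma domain_frontier_disjoint: "x \<in> \<Omega> \<Longrightarrow> x \<notin> frontier \<Omega>"
  by (simp add: frontier_def interior_open open_domain)

end

context plate_problem
begin

text \<open>\<open>S\<close> is a union of edges. Therefore the line load is not seen by test functions supported inside a triangle.\<close>

lemma S_not_interior: "K \<in> \<T> \<Longrightarrow> x \<in> interior K \<Longrightarrow> x \<notin> S"
proof
  assume K: "K \<in> \<T>" "x \<in> interior K" and "x \<in> S"
  then obtain e where e: "e \<in> edges_S \<T> S" "x \<in> e" using S_edges by blast
  then obtain K' where K': "K' \<in> \<T>" "e edge_of K'" by (auto simp: edges_S_def interior_edges_def)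
  then have "e = K \<and> K' = K" using interior_disjoint_face[OF K(1) K'(1) _ K(2) e(2)] by (simp add: edge_of_def)
  then show False using K'(2) triangle(7)[OF K(1)] by (simp add: edge_of_def)
qed

lemma x0_not_interior: "K \<in> \<T> \<Longrightarrow> x0 \<notin> interior K"
proof
  assume K: "K \<in> \<T>" "x0 \<in> interior K"
  obtain K' where K': "K' \<in> \<T>" "{x0} face_of K'" using x0(2) by (auto simp: face_of_singleton)
  then have "{x0} = K" using interior_disjoint_face[OF K(1) K'(1) K'(2) K(2)] by simp
  then show False using triangle(7)[OF K(1)] by auto
qed

text \<open>What the error and the data oscillation contribute in one triangle to the right-hand side.\<close>

definition local_bound :: "(real^2) set \<Rightarrow> real" where
  "local_bound K = local_error K + diameter K ^ 4 * (L2norm (lebesgue_on K) (\<lambda>x. f x - fh x))\<^sup>2"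

text \<open>The test function is \<open>w = b q\<close>, where \<open>q = \<A>(u\<^sub>h) - f\<^sub>h\<close> is a polynomial and \<open>b\<close> a bump in the inscribed ball of radius \<open>\<rho>\<close>. Its second derivatives are
  of size \<open>\<mu>/\<rho>\<^sup>2\<close>, where \<open>\<mu>\<close> is the weighted norm of \<open>q\<close> on the reference square. Thus \<open>\<rho>\<^sup>2 \<mu>\<^sup>2 = \<integral> q w\<close> is at most a constant times
  \<open>\<mu>/\<rho>\<close> times the local error plus \<open>\<rho> \<mu>\<close> times the norm of \<open>f - f\<^sub>h\<close>; dividing by \<open>\<mu>\<close> gives the claim for \<open>q\<close>.\<close>

lemma element_estimate:
  assumes rb: "square_reference_bound (max 1 \<kappa> + 1) r C" and K: "K \<in> \<T>"
  shows "diameter K ^ 4 * (L2norm (lebesgue_on K) (element_residual K))\<^sup>2 \<le> element_const \<kappa> stress_const C * local_bound K"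
proof -
  define X where "X = diameter K ^ 4 * (L2norm (lebesgue_on K) (\<lambda>x. f x - fh x))\<^sup>2"
  have C: "C > 0" using rb by (simp add: square_reference_bound_def)
  note ref = rb[unfolded square_reference_bound_def, THEN conjunct2, THEN spec, THEN mp]
  obtain c \<rho> where c: "\<rho> > 0" "ball c \<rho> \<subseteq> K" "diameter K \<le> \<kappa> * \<rho>" by (rule inscribed_ball[OF K])
  let ?h = "diameter K" and ?n = "L2norm (lebesgue_on K)"
  have k: "\<kappa> > 0" using kappa_pos[OF K] .
  have cK: "c \<in> K" using c by auto
  have hr: "\<rho> \<le> 2 * ?h"
  proof -
    have "c + (\<rho> / 2) *\<^sub>R axis 1 1 \<in> K" using c(1,2) by (auto simp: subset_iff dist_norm)
    from diameter_bounded_bound[OF triangle(9)[OF K] cK this] show ?thesis using c(1) by (simp add: dist_norm)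
  qed
  define pK where "pK = piece K uh"
  define q where "q x = plate_op d Y \<nu> pK x - piece K fh x" for x
  have q: "polyfun r q" unfolding q_def pK_def
    by (intro polyfun_diff polyfun_plate_op piece_Vh(1) uh fh K)
  \<comment> \<open>The affine map to the reference square takes the centre \<open>c\<close> to the centre of the square.\<close>
  let ?t = "(\<chi> i. 1/2) - (1 / \<rho>) *\<^sub>R c :: real^2"
  let ?T = "\<lambda>x. (1 / \<rho>) *\<^sub>R x + ?t"
  define A :: "real^2^2" where "A = (1 / \<rho>) *\<^sub>R mat 1"
  have A: "A *v x = (1 / \<rho>) *\<^sub>R x" for x unfolding A_def by (simp add: scaleR_matrix_vector_assoc[symmetric])
  have Ab: "\<bar>A $ k $ i\<bar> \<le> 1 / \<rho>" for k i using c(1) by (simp add: A_def mat_def)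
  define Q where "Q z = q ((\<rho> *\<^sub>R mat 1) *v z + (c - \<rho> *\<^sub>R (\<chi> i. 1/2)))" for z
  have Q: "polyfun r Q" unfolding Q_def by (rule polyfun_affine[OF q])
  have QT: "Q (?T x) = q x" for x
  proof -
    have "(\<rho> *\<^sub>R mat 1) *v ?T x + (c - \<rho> *\<^sub>R (\<chi> i. 1/2)) = x"
      using c(1) by (simp add: scaleR_matrix_vector_assoc[symmetric] scaleR_add_right scaleR_diff_right)
    then show ?thesis by (simp only: Q_def)
  qed
  let ?m2 = "LINT z|lborel. square_bump z * (Q z)\<^sup>2"
  define \<mu> where "\<mu> = sqrt ?m2"
  have m2: "?m2 \<ge> 0" by (intro Bochner_Integration.integral_nonneg) (simp add: square_bump_def bump_bounds)
  have mu: "\<mu> \<ge> 0" "\<mu>\<^sup>2 = ?m2" using m2 by (simp_all add: \<mu>_def)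
  note refQ = ref[OF Q, folded \<mu>_def mu(2)]
  define W where "W z = square_bump z * Q z" for z
  have sW: "smooth W" unfolding W_def by (intro smooth_mult smooth_square_bump smooth_polyfun[OF Q])
  define w where "w x = W (A *v x + ?t)" for x
  have wT: "w x = W (?T x)" for x by (simp add: w_def A)
  have sw: "smooth w" unfolding w_def by (rule smooth_comp[OF sW])
  let ?B = "cball c (\<rho> / 2)"
  have zero: "w x = 0" if "x \<notin> ?B" for x
  proof (rule ccontr)
    assume "w x \<noteq> 0"
    then have "square_bump (?T x) \<noteq> 0" by (simp add: wT W_def)
    then have "\<bar>(x - c) $ i\<bar> \<le> \<rho> / 4" for i
    proof -
      have e: "?T x $ i = (x - c) $ i / \<rho> + 1/2" by (simp add: diff_divide_distrib)
      have "\<bar>(x - c) $ i / \<rho>\<bar> \<le> 1/4" using square_bump_nonzero[OF \<open>square_bump (?T x) \<noteq> 0\<close>, of i] unfolding e by linarith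
      then show ?thesis using c(1) by (simp add: abs_divide field_simps)
    qed
    then have "\<bar>(x - c) $ 1\<bar> + \<bar>(x - c) $ 2\<bar> \<le> \<rho> / 2" using add_mono[of "\<bar>(x - c) $ 1\<bar>" "\<rho>/4" "\<bar>(x - c) $ 2\<bar>" "\<rho>/4"] by simp
    moreover have "norm (x - c) \<le> \<bar>(x - c) $ 1\<bar> + \<bar>(x - c) $ 2\<bar>" using norm_le_l1_cart[of "x - c"] by (simp add: sum_2)
    ultimately show False using that by (simp add: dist_norm norm_minus_commute)
  qed
  have wsub: "{x. w x \<noteq> 0} \<subseteq> ?B" using zero by blast
  then have clB: "closure {x. w x \<noteq> 0} \<subseteq> ?B" by (intro closure_minimal) auto
  have Bi: "?B \<subseteq> interior K"
  proof -
    have "?B \<subseteq> ball c \<rho>" using c(1) by auto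
    then show ?thesis using c(2) by (meson interior_maximal open_ball order_trans)
  qed
  have ssK: "supported_in_patch {K} w"
    unfolding supported_in_patch_def
  proof (intro conjI ballI)
    show "{K} \<subseteq> \<T>" using K by simp
    show "smooth w" by (rule sw)
    show "bounded {x. w x \<noteq> 0}" by (rule bounded_subset[OF bounded_cball wsub])
    fix K1 K' assume K1: "K1 \<in> {K}" "K' \<in> \<T> - {K}"
    show "closure {x. w x \<noteq> 0} \<inter> K1 \<inter> K' = {}"
    proof (rule ccontr)
      assume "closure {x. w x \<noteq> 0} \<inter> K1 \<inter> K' \<noteq> {}"
      then obtain x where x: "x \<in> interior K" "x \<in> K'" using clB Bi by blast
      then have "K' = K" using interior_disjoint_face[OF K, of K' K' x] K1 triangle(2) face_of_refl by blast
      then show False using K1 by blast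
    qed
  qed
  have nz: "x \<in> interior K" if "cut {K} p x \<noteq> 0" "\<And>x. x \<notin> ?B \<Longrightarrow> p x = 0" for p x
  proof -
    have "p x \<noteq> 0" using that(1) by (auto simp: cut_def split: if_splits)
    then have "x \<in> ?B" using that(2) by blast
    then show ?thesis using Bi by blast
  qed
  have offF: "cut {K} p x = 0" if "x \<in> frontier \<Omega>" "\<And>x. x \<notin> ?B \<Longrightarrow> p x = 0" for p x
  proof (rule ccontr)
    assume "cut {K} p x \<noteq> 0"
    then have "x \<in> interior K" using that(2) by (rule nz)
    then show False using that(1) interior_triangle_domain[OF K] domain_frontier_disjoint by blast
  qed
  have ps: "cut {K} w \<in> plate_space \<Omega> \<Gamma>c \<Gamma>s"
  proof (rule cut_plate_space[OF ssK])
    have "cut {K} w x = 0" if "x \<in> \<Gamma>c \<union> \<Gamma>s" for x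
      by (rule offF[OF _ zero]) (use that boundary_parts in blast)+
    then have "{x \<in> \<Gamma>c \<union> \<Gamma>s. cut {K} w x \<noteq> 0} = {}" by blast
    then show "finite {x \<in> \<Gamma>c \<union> \<Gamma>s. cut {K} w x \<noteq> 0}" by (simp only: finite.emptyI)
    have "cut {K} (pd i w) x = 0" if "x \<in> \<Gamma>c" for i x
    proof (rule offF)
      show "x \<in> frontier \<Omega>" using that boundary_parts by blast
      show "pd i w y = 0" if "y \<notin> ?B" for y by (rule pd_zero_outside_closed(1)[OF closed_cball zero that])
    qed
    then have "{x \<in> \<Gamma>c. cut {K} (pd i w) x \<noteq> 0} = {}" for i by blast
    then show "finite {x \<in> \<Gamma>c. cut {K} (pd i w) x \<noteq> 0}" for i by (simp only: finite.emptyI)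
  qed
  \<comment> \<open>Any line that misses the support serves in the residual identity, since there are no boundary terms.\<close>
  let ?e = "axis 1 1 :: real^2"
  let ?a = "c + (?h + \<rho>) *\<^sub>R ?e"
  have line0: "?a + s *\<^sub>R perp ?e \<notin> ?B" for s
  proof
    assume "?a + s *\<^sub>R perp ?e \<in> ?B"
    then have "norm (?a + s *\<^sub>R perp ?e - c) \<le> \<rho> / 2" by (simp only: mem_cball dist_commute[of c "?a + s *\<^sub>R perp ?e"]) (simp only: dist_norm)
    moreover have "(?a + s *\<^sub>R perp ?e - c) $ 1 = ?h + \<rho>" by (simp add: axis_def)
    ultimately show False using component_le_norm_cart[of "?a + s *\<^sub>R perp ?e - c" 1] c(1) diameter_ge_0[OF triangle(9)[OF K]] by linarith
  qed
  have lr: "line_residual K ?a ?e w = 0"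
    unfolding line_residual_def using zero[OF line0] pd_zero_outside_closed(1)[OF closed_cball zero line0] by simp
  have hpl: "K \<subseteq> half_plane ?a ?e"
  proof
    fix x assume "x \<in> K"
    then have "norm (x - c) \<le> ?h" using diameter_bounded_bound[OF triangle(9)[OF K] _ cK, of x] by (simp add: dist_norm)
    then have "(x - c) $ 1 \<le> ?h" using component_le_norm_cart[of "x - c" 1] by linarith
    then show "x \<in> half_plane ?a ?e" using c(1) by (simp add: half_plane_def inner_axis)
  qed
  define D where "D = 4 * ((1 / \<rho>)\<^sup>2 * (C * \<mu>))"
  have D0: "D \<ge> 0" using C mu by (simp add: D_def)
  have Db: "\<bar>pd j (pd i w) x\<bar> \<le> D * indicator ?B x" for i j x
  proof (cases "x \<in> ?B")
    case True
    have "\<bar>pd j (pd i w) x\<bar> \<le> D" unfolding D_def w_def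
      by (rule second_pd_comp_bound[OF sW _ Ab]) (use refQ in \<open>simp add: W_def[abs_def]\<close>)
    then show ?thesis using True by simp
  next
    case False
    have "pd j (pd i w) x = 0" by (rule pd_zero_outside_closed(2)[OF closed_cball zero False])
    then show ?thesis using D0 by simp
  qed
  have wb: "\<bar>w x\<bar> \<le> (C * \<mu>) * indicator ?B x" for x
    using refQ zero[of x] by (cases "x \<in> ?B") (auto simp: wT W_def)
  have ballR: "?B \<subseteq> cball c \<rho>" "\<rho> \<ge> 0" using c(1) by auto
  have gS: "(LINT x|arc_measure S. g x * cut {K} w x) = 0"
  proof -
    have "cut {K} w x = 0" if "x \<in> S" for x using nz[of w x, OF _ zero] S_not_interior[OF K] that by blast
    then have "(LINT x|arc_measure S. g x * cut {K} w x) = (LINT x|arc_measure S. 0)"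
      using space_arc_measure[OF is_segment_S] by (intro Bochner_Integration.integral_cong) auto
    then show ?thesis by simp
  qed
  have gx: "cut {K} w x0 = 0" using nz[of w x0, OF _ zero] x0_not_interior[OF K] by blast
  let ?le = "sqrt (local_error K)" and ?F = "?n (\<lambda>x. f x - fh x)"
  have "\<bar>(\<Sum>K\<in>{K}. line_residual K ?a ?e w) + (\<Sum>K\<in>{K}. LINT x|lebesgue_on K. element_residual K x * w x)
      - (LINT x|arc_measure S. g x * cut {K} w x) - F * cut {K} w x0\<bar>
    \<le> stress_const * (D * \<rho>) * (\<Sum>K\<in>{K}. sqrt (local_error K))"
  proof (rule residual_bound[OF ssK ps _ _ Db closed_cball ballR D0])
    show "norm ?e = 1 \<and> K' \<subseteq> half_plane ?a ?e" if "K' \<in> {K}" for K' using that hpl by simp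
    show "x \<in> K'" if "K' \<in> {K}" "x \<in> closure {x. w x \<noteq> 0}" for K' x using that clB Bi interior_subset by blast
  qed
  then have 1: "\<bar>LINT x|lebesgue_on K. element_residual K x * w x\<bar> \<le> stress_const * (D * \<rho>) * ?le"
    by (simp add: lr gS gx)
  have fhL: "fh \<in> L2 (lebesgue_on \<Omega>)"
  proof -
    have "Vh \<subseteq> plate_space \<Omega> \<Gamma>c \<Gamma>s" using Vh by (simp add: fe_space_def)
    then have "fh \<in> H2 \<Omega>" using fh by (auto simp: plate_space_def)
    then show ?thesis by (simp add: H2_def H1_def)
  qed
  have fL: "(\<lambda>x. f x - fh x) \<in> L2 (lebesgue_on K)" by (rule L2_on_triangle[OF K L2_diff[OF f fhL]])
  have 2: "\<bar>LINT x|lebesgue_on K. (f x - fh x) * w x\<bar> \<le> (C * \<mu>) * (2 * \<rho>) * ?F"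
    by (rule weighted_integral_bound[OF K fL sw wb closed_cball ballR]) (use C mu in simp)
  have qK: "q x = element_residual K x + (f x - fh x)" if "x \<in> K" for x
    using piece_Vh(2)[OF fh K that] by (simp add: q_def element_residual_def pK_def)
  have wL: "w \<in> L2 (lebesgue_on K)" by (rule L2_smooth_triangle[OF K sw])
  have "(LINT x|lebesgue_on K. q x * w x) = (LINT x|lebesgue_on K. element_residual K x * w x + (f x - fh x) * w x)"
    using qK by (intro Bochner_Integration.integral_cong) (auto simp: space_restrict_space distrib_right)
  also have "\<dots> = (LINT x|lebesgue_on K. element_residual K x * w x) + (LINT x|lebesgue_on K. (f x - fh x) * w x)"
    by (intro Bochner_Integration.integral_add L2_mult_integrable element_residual_L2 K wL fL)
  finally have 3: "(LINT x|lebesgue_on K. q x * w x) \<le> stress_const * (D * \<rho>) * ?le + (C * \<mu>) * (2 * \<rho>) * ?F"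
    using 1 2 by linarith
  have "(LINT x|lebesgue_on K. q x * w x) = (LINT x|lborel. q x * w x)"
  proof (rule integral_lebesgue_on_borel(1))
    show "K \<in> sets lebesgue" using triangle_measurable[OF K] by blast
    show "(\<lambda>x. q x * w x) \<in> borel_measurable borel"
      by (rule smooth_borel[OF smooth_mult[OF smooth_polyfun[OF q] sw]])
    show "q x * w x = 0" if "x \<notin> K" for x
    proof -
      have "x \<notin> ?B" using that Bi interior_subset[of K] by blast
      from zero[OF this] show ?thesis by simp
    qed
  qed
  also have "\<dots> = (LINT x|lborel. (\<lambda>z. square_bump z * (Q z)\<^sup>2) (?T x))"
    by (intro Bochner_Integration.integral_cong refl) (simp only: wT W_def QT power2_eq_square mult_ac)
  also have "\<dots> = \<rho>\<^sup>2 * \<mu>\<^sup>2"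
    unfolding mu(2) using c(1)
    by (intro integral_scaled borel_measurable_times borel_measurable_power smooth_borel smooth_square_bump smooth_polyfun[OF Q])
  finally have 4: "\<rho>\<^sup>2 * \<mu>\<^sup>2 \<le> \<mu> * (4 * stress_const * C / \<rho> * ?le + 2 * C * \<rho> * ?F)"
    using 3 c(1) by (simp add: D_def power2_eq_square field_simps)
  have sc: "0 \<le> stress_const" using moment_const_nonneg by (simp add: stress_const_def)
  have 5: "\<rho> ^ 3 * \<mu> \<le> 4 * stress_const * C * ?le + 2 * C * (\<rho>\<^sup>2 * ?F)"
  proof (cases "\<mu> = 0")
    case True then show ?thesis using sc C local_error_nonneg[of K] by simp
  next
    case False
    then have mp: "\<mu> > 0" using mu by simp
    have "\<mu> * (\<rho>\<^sup>2 * \<mu>) \<le> \<mu> * (4 * stress_const * C / \<rho> * ?le + 2 * C * \<rho> * ?F)" using 4 by (simp add: power2_eq_square mult_ac)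
    then have "\<rho>\<^sup>2 * \<mu> \<le> 4 * stress_const * C / \<rho> * ?le + 2 * C * \<rho> * ?F" using mp by (simp only: mult_le_cancel_left_pos)
    then have "\<rho> * (\<rho>\<^sup>2 * \<mu>) \<le> \<rho> * (4 * stress_const * C / \<rho> * ?le + 2 * C * \<rho> * ?F)" using c(1) by (intro mult_left_mono) auto
    moreover have "\<rho> * (4 * stress_const * C / \<rho> * ?le + 2 * C * \<rho> * ?F) = 4 * stress_const * C * ?le + 2 * C * (\<rho>\<^sup>2 * ?F)"
      using c(1) by (simp add: power2_eq_square distrib_left)
    ultimately show ?thesis by (simp add: power2_eq_square power3_eq_cube mult.assoc)
  qed
  have Kball: "K \<subseteq> cball c (\<kappa> * \<rho>)"
  proof
    fix x assume "x \<in> K"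
    then have "dist c x \<le> ?h" using diameter_bounded_bound[OF triangle(9)[OF K] cK] by blast
    then show "x \<in> cball c (\<kappa> * \<rho>)" using c(3) by simp
  qed
  have Ks: "K \<in> sets lebesgue" using triangle_measurable[OF K] by blast
  have kr: "\<kappa> * \<rho> \<ge> 0" using k c(1) by simp
  have qs: "(q x)\<^sup>2 \<le> C * \<mu>\<^sup>2" if "x \<in> K" for x
  proof -
    have "norm (x - c) \<le> \<kappa> * \<rho>" using Kball that by (auto simp: dist_norm norm_minus_commute)
    then have "\<bar>(x - c) $ i\<bar> \<le> \<kappa> * \<rho>" for i using component_le_norm_cart[of "x - c" i] by linarith
    then have "\<bar>(x - c) $ i / \<rho>\<bar> \<le> \<kappa>" for i using c(1) by (simp add: abs_divide field_simps)
    then have "\<bar>?T x $ i\<bar> \<le> max 1 \<kappa> + 1" for i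
    proof -
      have "?T x $ i = (x - c) $ i / \<rho> + 1/2" by (simp add: diff_divide_distrib)
      then show ?thesis using \<open>\<And>i. \<bar>(x - c) $ i / \<rho>\<bar> \<le> \<kappa>\<close>[of i] by linarith
    qed
    then have "?T x \<in> ref_box (max 1 \<kappa> + 1)" by (simp add: ref_box_def)
    then show ?thesis using refQ QT[of x] by metis
  qed
  have qL: "q \<in> L2 (lebesgue_on K)" by (rule L2_smooth_triangle[OF K smooth_polyfun[OF q]])
  have 6: "(?n q)\<^sup>2 \<le> C * \<mu>\<^sup>2 * (2 * (\<kappa> * \<rho>))\<^sup>2"
  proof -
    have "(?n q)\<^sup>2 = (LINT x|lebesgue_on K. (q x)\<^sup>2)" by (simp add: L2norm_sq)
    also have "\<dots> \<le> (LINT x|lebesgue_on K. C * \<mu>\<^sup>2)"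
      using qL qs finite_measure.integrable_const[OF finite_lebesgue_on[OF triangle(9)[OF K] Ks]]
      by (intro integral_mono) (auto simp: L2_def space_restrict_space)
    also have "\<dots> = C * \<mu>\<^sup>2 * measure lebesgue K"
      using Ks by (simp add: measure_restrict_space space_restrict_space)
    also have "\<dots> \<le> C * \<mu>\<^sup>2 * (2 * (\<kappa> * \<rho>))\<^sup>2"
      using measure_subset_cball(1)[OF Ks Kball kr] C by (intro mult_left_mono) auto
    finally show ?thesis .
  qed
  have 7: "(?n (element_residual K))\<^sup>2 \<le> 2 * (?n q)\<^sup>2 + 2 * ?F\<^sup>2"
  proof -
    have fL': "(\<lambda>x. -1 * (f x - fh x)) \<in> L2 (lebesgue_on K)" by (rule L2_cmult[OF fL])
    have "(?n (element_residual K))\<^sup>2 = (?n (\<lambda>x. q x + -1 * (f x - fh x)))\<^sup>2"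
      unfolding L2norm_sq using qK by (intro Bochner_Integration.integral_cong) (auto simp: space_restrict_space)
    also have "\<dots> \<le> 2 * (?n q)\<^sup>2 + 2 * (?n (\<lambda>x. -1 * (f x - fh x)))\<^sup>2" by (rule L2norm_add_sq[OF qL fL'])
    also have "(?n (\<lambda>x. -1 * (f x - fh x)))\<^sup>2 = ?F\<^sup>2" by (simp add: L2norm_sq power2_commute)
    finally show ?thesis .
  qed
  have X: "\<rho> ^ 4 * ?F\<^sup>2 \<le> 16 * X"
  proof -
    have "\<rho> ^ 4 \<le> (2 * ?h) ^ 4" using hr c(1) by (intro power_mono) auto
    then have "\<rho> ^ 4 * ?F\<^sup>2 \<le> (2 * ?h) ^ 4 * ?F\<^sup>2" by (intro mult_right_mono) auto
    then show ?thesis by (simp add: X_def power_mult_distrib)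
  qed
  have 8: "(\<rho> ^ 3 * \<mu>)\<^sup>2 \<le> 32 * stress_const\<^sup>2 * C\<^sup>2 * local_error K + 128 * C\<^sup>2 * X"
  proof -
    let ?x = "4 * stress_const * C * ?le" and ?y = "2 * C * (\<rho>\<^sup>2 * ?F)"
    have "(\<rho> ^ 3 * \<mu>)\<^sup>2 \<le> (?x + ?y)\<^sup>2" using 5 c(1) mu by (intro power_mono) auto
    also have "\<dots> \<le> 2 * ?x\<^sup>2 + 2 * ?y\<^sup>2" using sum_squares_bound[of ?x ?y] by (simp add: power2_sum)
    also have "?x\<^sup>2 = 16 * stress_const\<^sup>2 * C\<^sup>2 * local_error K" using local_error_nonneg[of K] by (simp add: power_mult_distrib)
    also have "?y\<^sup>2 = 4 * C\<^sup>2 * (\<rho> ^ 4 * ?F\<^sup>2)" by (simp add: power_mult_distrib flip: power_mult)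
    finally show ?thesis using mult_left_mono[OF X, of "8 * C\<^sup>2"] by (simp add: mult_ac)
  qed
  have X0: "X \<ge> 0" by (simp add: X_def)
  have h4: "?h ^ 4 \<le> (\<kappa> * \<rho>) ^ 4" using c(3) diameter_ge_0[OF triangle(9)[OF K]] by (intro power_mono) auto
  have "?h ^ 4 * (?n q)\<^sup>2 \<le> (\<kappa> * \<rho>) ^ 4 * (C * \<mu>\<^sup>2 * (2 * (\<kappa> * \<rho>))\<^sup>2)"
    using h4 6 by (intro mult_mono) auto
  also have "\<dots> = 4 * C * \<kappa> ^ 6 * (\<rho> ^ 3 * \<mu>)\<^sup>2" by (simp add: power_mult_distrib power2_eq_square power3_eq_cube eval_nat_numeral)
  also have "\<dots> \<le> 4 * C * \<kappa> ^ 6 * (32 * stress_const\<^sup>2 * C\<^sup>2 * local_error K + 128 * C\<^sup>2 * X)"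
    using 8 C by (intro mult_left_mono) auto
  also have "\<dots> \<le> 4 * C * \<kappa> ^ 6 * ((32 * stress_const\<^sup>2 * C\<^sup>2 + 128 * C\<^sup>2) * (local_error K + X))"
  proof (intro mult_left_mono)
    have "0 \<le> 32 * stress_const\<^sup>2 * C\<^sup>2 * X" "0 \<le> 128 * C\<^sup>2 * local_error K" using X0 local_error_nonneg[of K] by simp_all
    then show "32 * stress_const\<^sup>2 * C\<^sup>2 * local_error K + 128 * C\<^sup>2 * X \<le> (32 * stress_const\<^sup>2 * C\<^sup>2 + 128 * C\<^sup>2) * (local_error K + X)"
      by (simp add: algebra_simps)
  qed (use C in simp)
  finally have 9: "?h ^ 4 * (?n q)\<^sup>2 \<le> 4 * C * \<kappa> ^ 6 * ((32 * stress_const\<^sup>2 * C\<^sup>2 + 128 * C\<^sup>2) * (local_error K + X))" .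
  have "?h ^ 4 * (?n (element_residual K))\<^sup>2 \<le> ?h ^ 4 * (2 * (?n q)\<^sup>2 + 2 * ?F\<^sup>2)" using 7 by (intro mult_left_mono) auto
  also have "\<dots> = 2 * (?h ^ 4 * (?n q)\<^sup>2) + 2 * X" by (simp add: X_def algebra_simps)
  also have "\<dots> \<le> 2 * (4 * C * \<kappa> ^ 6 * ((32 * stress_const\<^sup>2 * C\<^sup>2 + 128 * C\<^sup>2) * (local_error K + X))) + 2 * (local_error K + X)"
    using local_error_nonneg[of K] by (intro add_mono mult_left_mono 9) auto
  also have "\<dots> = (8 * C * \<kappa> ^ 6 * (32 * stress_const\<^sup>2 * C\<^sup>2 + 128 * C\<^sup>2) + 2) * (local_error K + X)" by (simp add: algebra_simps)
  finally show ?thesis by (simp only: element_const_def local_bound_def X_def)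
qed

end

section \<open>Test functions at edges\<close>

text \<open>In the reference coordinates of an edge, the first coordinate runs along the edge and the second one across it. The second factor is even in
  \<open>z $ 2\<close> for \<open>k = 0\<close> and odd for \<open>k = 1\<close>.\<close>

definition edge_bump :: "real \<Rightarrow> nat \<Rightarrow> real^2 \<Rightarrow> real" where
  "edge_bump \<delta> k z = bump (z $ 1) * ((z $ 2) ^ k * bump (1/2 + z $ 2 / (4 * \<delta>)))"

lemma smooth_power: "smooth f \<Longrightarrow> smooth (\<lambda>x. f x ^ k)"
  by (induction k) (auto intro: smooth_mult)

lemma smooth_edge_bump: "smooth (edge_bump \<delta> k)"
proof -
  have 1: "smooth (\<lambda>z. bump (axis 1 1 \<bullet> z + 0))" by (rule smooth_bump)
  have 2: "smooth (\<lambda>z. bump (((1 / (4 * \<delta>)) *\<^sub>R axis 2 1) \<bullet> z + 1/2))" by (rule smooth_bump)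
  have 3: "smooth (\<lambda>z. (z $ 2) ^ k)" by (intro smooth_power smooth_coord)
  have "smooth (\<lambda>z. bump (axis 1 1 \<bullet> z + 0) * ((z $ 2) ^ k * bump (((1 / (4 * \<delta>)) *\<^sub>R axis 2 1) \<bullet> z + 1/2)))"
    by (intro smooth_mult 1 2 3)
  then show ?thesis by (simp add: edge_bump_def[abs_def] inner_axis' add.commute)
qed

lemma edge_bump_nonzero:
  assumes "edge_bump \<delta> k z \<noteq> 0" "\<delta> > 0"
  shows "1/4 < z $ 1 \<and> z $ 1 < 3/4 \<and> \<bar>z $ 2\<bar> < \<delta>"
proof -
  have "bump (z $ 1) \<noteq> 0" "bump (1/2 + z $ 2 / (4 * \<delta>)) \<noteq> 0" using assms(1) by (auto simp: edge_bump_def)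
  then have "1/4 < z $ 1 \<and> z $ 1 < 3/4" "1/4 < 1/2 + z $ 2 / (4 * \<delta>) \<and> 1/2 + z $ 2 / (4 * \<delta>) < 3/4"
    using bump_zero by blast+
  moreover have "- (1/4) < z $ 2 / (4 * \<delta>)" "z $ 2 / (4 * \<delta>) < 1/4" using calculation by linarith+
  ultimately show ?thesis using assms(2) by (simp add: abs_less_iff field_simps)
qed

text \<open>The polynomial \<open>Q\<close> extends a polynomial \<open>q\<close> on the edge constantly in normal direction.\<close>

definition edge_reference_bound :: "real \<Rightarrow> nat \<Rightarrow> nat \<Rightarrow> real \<Rightarrow> bool" where
  "edge_reference_bound \<delta> k N C \<longleftrightarrow> C > 0 \<and> (\<forall>Q q. polyfun N Q \<and> degree q \<le> N \<and> (\<forall>z. Q z = poly q (z $ 1)) \<longrightarrow>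
    (\<forall>y. \<bar>y\<bar> \<le> 1 \<longrightarrow> (poly q y)\<^sup>2 \<le> C * (LINT s|lborel. bump s * (poly q s)\<^sup>2)) \<and>
    (\<forall>z. \<bar>edge_bump \<delta> k z * Q z\<bar> \<le> C * sqrt (LINT s|lborel. bump s * (poly q s)\<^sup>2) \<and>
      (\<forall>i j. \<bar>pd j (pd i (\<lambda>z. edge_bump \<delta> k z * Q z)) z\<bar> \<le> C * sqrt (LINT s|lborel. bump s * (poly q s)\<^sup>2))))"

lemma edge_bump_reference:
  assumes \<delta>: "0 < \<delta>" "\<delta> \<le> 1"
  shows "\<exists>C. edge_reference_bound \<delta> k N C"
proof -
  have "(1::real) \<ge> 1" by simp
  from inverse_estimate_interval[OF this, of N] obtain C1 where C1: "C1 > 0" "\<And>q y. degree q \<le> N \<Longrightarrow> \<bar>y\<bar> \<le> 1 \<Longrightarrow>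
     (poly q y)\<^sup>2 \<le> C1 * (LINT s|lborel. bump s * (poly q s)\<^sup>2)" by meson
  have z0: "edge_bump \<delta> k z = 0" if "z \<notin> ref_box 1" for z
  proof (rule ccontr)
    assume n: "edge_bump \<delta> k z \<noteq> 0"
    have "\<bar>z $ i\<bar> \<le> 1" for i using edge_bump_nonzero[OF n \<delta>(1)] \<delta>(2) exhaust_2[of i] by auto
    then show False using that by (simp add: ref_box_def)
  qed
  obtain C2 where C2: "C2 > 0" "\<And>Q M. polyfun N Q \<Longrightarrow> (\<forall>z\<in>ref_box 1. \<bar>Q z\<bar> \<le> M) \<Longrightarrow>
      (\<forall>z. \<bar>edge_bump \<delta> k z * Q z\<bar> \<le> C2 * M \<and> (\<forall>i j. \<bar>pd j (pd i (\<lambda>z. edge_bump \<delta> k z * Q z)) z\<bar> \<le> C2 * M))"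
    using bump_polynomial_bounds[OF smooth_edge_bump z0, of N] by meson
  let ?C = "C1 + C2 * sqrt C1"
  show ?thesis unfolding edge_reference_bound_def
  proof (intro exI[of _ ?C] conjI allI impI)
    show "?C > 0" using C1 C2 by (simp add: add_pos_nonneg)
    fix Q q assume Qq: "polyfun N Q \<and> degree q \<le> N \<and> (\<forall>z. Q z = poly q (z $ 1))"
    let ?m = "LINT s|lborel. bump s * (poly q s)\<^sup>2"
    have m: "?m \<ge> 0" by (intro Bochner_Integration.integral_nonneg) (simp add: bump_bounds)
    have le: "C1 \<le> ?C" "C2 * sqrt C1 \<le> ?C" using C1 C2 by simp_all
    show "(poly q y)\<^sup>2 \<le> ?C * ?m" if "\<bar>y\<bar> \<le> 1" for y
      using C1(2)[of q y] Qq that mult_right_mono[OF le(1) m] by linarith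
    have "\<bar>Q z\<bar> \<le> sqrt C1 * sqrt ?m" if "z \<in> ref_box 1" for z
    proof -
      have "\<bar>z $ 1\<bar> \<le> 1" using that by (simp add: ref_box_def)
      then have "(Q z)\<^sup>2 \<le> C1 * ?m" using C1(2)[of q "z $ 1"] Qq by simp
      then have "\<bar>Q z\<bar> \<le> sqrt (C1 * ?m)" by (intro real_le_rsqrt) simp
      then show ?thesis by (simp add: real_sqrt_mult)
    qed
    then have b: "\<forall>z. \<bar>edge_bump \<delta> k z * Q z\<bar> \<le> C2 * (sqrt C1 * sqrt ?m) \<and>
        (\<forall>i j. \<bar>pd j (pd i (\<lambda>z. edge_bump \<delta> k z * Q z)) z\<bar> \<le> C2 * (sqrt C1 * sqrt ?m))"
      using Qq by (intro C2(2)) blast+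
    have l2: "C2 * (sqrt C1 * sqrt ?m) \<le> ?C * sqrt ?m" using mult_right_mono[OF le(2), of "sqrt ?m"] m by (simp add: mult.assoc)
    show "\<bar>edge_bump \<delta> k z * Q z\<bar> \<le> ?C * sqrt ?m" for z using b l2 by (meson order_trans)
    show "\<bar>pd j (pd i (\<lambda>z. edge_bump \<delta> k z * Q z)) z\<bar> \<le> ?C * sqrt ?m" for i j z using b l2 by (meson order_trans)
  qed
qed

lemma DERIV_even_zero:
  fixes h :: "real \<Rightarrow> real"
  assumes "\<And>t. h (- t) = h t" "(h has_real_derivative D) (at 0)" shows "D = 0"
proof -
  have "((\<lambda>t. h (- t)) has_real_derivative D * (- 1)) (at 0)"
    by (rule DERIV_chain2[of h D uminus]) (use assms(2) in \<open>auto intro!: derivative_eq_intros\<close>)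
  then have "(h has_real_derivative - D) (at 0)" using assms(1) by simp
  then show ?thesis using assms(2) DERIV_unique by fastforce
qed

text \<open>Differentiability of \<open>h\<close> is not required, since the other factor vanishes at 0.\<close>

lemma DERIV_mult_id:
  fixes h :: "real \<Rightarrow> real"
  assumes "isCont h 0" shows "((\<lambda>t. t * h t) has_real_derivative h 0) (at 0)"
proof -
  have "((\<lambda>t. (t * h t - 0 * h 0) / (t - 0)) \<longlongrightarrow> h 0) (at 0)"
    by (rule Lim_transform_eventually[OF assms[unfolded isCont_def]]) (auto simp: eventually_at_filter)
  then show ?thesis by (simp add: has_field_derivative_iff)
qed

context kirchhoff_mesh
begin

definition edge_map :: "(real^2) set \<Rightarrow> real^2^2" where
  "edge_map e = (\<chi> k i. (if k = 1 then arc_dir e $ i else edge_perp e $ i) / diameter e)"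

definition edge_coord :: "(real^2) set \<Rightarrow> real^2 \<Rightarrow> real^2" where
  "edge_coord e x = edge_map e *v x + (- (edge_map e *v arc_start e))"

text \<open>The bump times \<open>Q\<close> in edge coordinates. The factor \<open>diameter e ^ k\<close> makes the normal derivative for \<open>k = 1\<close> independent of the size of the edge.\<close>

definition edge_test :: "(real^2) set \<Rightarrow> nat \<Rightarrow> (real^2 \<Rightarrow> real) \<Rightarrow> real^2 \<Rightarrow> real" where
  "edge_test e k Q x = diameter e ^ k * (edge_bump (thickness \<kappa>) k (edge_coord e x) * Q (edge_coord e x))"

text \<open>Orientation of the outward normal of \<open>K\<close> relative to a normal of the edge that does not depend on the triangle.\<close>

definition patch_sign :: "(real^2) set \<Rightarrow> (real^2) set \<Rightarrow> real" where
  "patch_sign e K = (if edge_normal K e = edge_perp e then 1 else -1)"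

lemma edge_coord_nth:
  "edge_coord e x $ 1 = ((x - arc_start e) \<bullet> arc_dir e) / diameter e"
  "edge_coord e x $ 2 = ((x - arc_start e) \<bullet> edge_perp e) / diameter e"
  by (simp_all add: edge_coord_def edge_map_def matrix_vector_mult_def sum_2 inner_2 field_simps
      add_divide_distrib diff_divide_distrib)

lemma smooth_edge_test: "smooth Q \<Longrightarrow> smooth (edge_test e k Q)"
proof -
  assume Q: "smooth Q"
  have "smooth (\<lambda>x. (\<lambda>z. edge_bump (thickness \<kappa>) k z * Q z) (edge_map e *v x + (- (edge_map e *v arc_start e))))"
    by (rule smooth_comp) (intro smooth_mult smooth_edge_bump Q)
  then show ?thesis unfolding edge_test_def[abs_def] edge_coord_def by (rule smooth_mult[OF smooth_const])
qed

lemma patchD: "K \<in> patch e \<Longrightarrow> K \<in> \<T>" "K \<in> patch e \<Longrightarrow> e edge_of K" by (auto simp: patch_def)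

lemma patch_segment: "K \<in> patch e \<Longrightarrow> is_segment e" using edge_segment(1) patchD by blast

lemma edge_test_nonzero:
  assumes "K \<in> patch e" "edge_test e k Q x \<noteq> 0" shows "x \<in> edge_box e"
proof -
  have L: "diameter e > 0" using segment_arc_ends(4)[OF patch_segment[OF assms(1)]] .
  have "edge_bump (thickness \<kappa>) k (edge_coord e x) \<noteq> 0" using assms(2) by (auto simp: edge_test_def)
  from edge_bump_nonzero[OF this thickness(1)]
  have "1/4 < ((x - arc_start e) \<bullet> arc_dir e) / diameter e" "((x - arc_start e) \<bullet> arc_dir e) / diameter e < 3/4"
    "\<bar>((x - arc_start e) \<bullet> edge_perp e) / diameter e\<bar> < thickness \<kappa>" unfolding edge_coord_nth by auto
  then show ?thesis using L by (simp add: edge_box_def abs_divide field_simps)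
qed

lemma edge_box_cball:
  assumes "K \<in> patch e" shows "edge_box e \<subseteq> cball (arc_start e) (diameter e)"
proof
  fix x assume x: "x \<in> edge_box e"
  note se = segment_arc_ends[OF patch_segment[OF assms]]
  let ?s = "(x - arc_start e) \<bullet> arc_dir e" and ?t = "(x - arc_start e) \<bullet> edge_perp e"
  have "x - arc_start e = ?t *\<^sub>R edge_perp e + ?s *\<^sub>R arc_dir e"
    using perp_expansion[OF se(5), of "x - arc_start e"] by (simp add: edge_perp_def)
  then have "norm (x - arc_start e) \<le> \<bar>?t\<bar> + \<bar>?s\<bar>"
    using norm_triangle_ineq[of "?t *\<^sub>R edge_perp e" "?s *\<^sub>R arc_dir e"] se(5) by (simp add: edge_perp_def)
  moreover have "\<bar>?s\<bar> \<le> 3 / 4 * diameter e" using x se(4) by (auto simp: edge_box_def)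
  moreover have "\<bar>?t\<bar> \<le> 1/32 * diameter e"
  proof -
    have "\<bar>?t\<bar> \<le> thickness \<kappa> * diameter e" using x by (simp add: edge_box_def)
    also have "\<dots> \<le> 1/32 * diameter e" using thickness(2)[of \<kappa>] se(4) by (intro mult_right_mono) auto
    finally show ?thesis .
  qed
  ultimately have "norm (x - arc_start e) \<le> diameter e" using se(4) by linarith
  then show "x \<in> cball (arc_start e) (diameter e)" by (simp add: dist_norm norm_minus_commute)
qed

text \<open>At a boundary edge the box may reach other triangles beyond the boundary, but it does not contain the points that they share with the
  patch.\<close>

lemma edge_test_supported:
  assumes K: "K \<in> patch e" and Q: "smooth Q" shows "supported_in_patch (patch e) (edge_test e k Q)"
    and "closure {x. edge_test e k Q x \<noteq> 0} \<subseteq> edge_box e"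
proof -
  have sub: "{x. edge_test e k Q x \<noteq> 0} \<subseteq> edge_box e" using edge_test_nonzero[OF K] by blast
  then show c: "closure {x. edge_test e k Q x \<noteq> 0} \<subseteq> edge_box e" by (intro closure_minimal closed_edge_box)
  show "supported_in_patch (patch e) (edge_test e k Q)"
    unfolding supported_in_patch_def
  proof (intro conjI ballI)
    show "patch e \<subseteq> \<T>" by (auto simp: patch_def)
    show "smooth (edge_test e k Q)" by (rule smooth_edge_test[OF Q])
    show "bounded {x. edge_test e k Q x \<noteq> 0}"
      using sub edge_box_cball[OF K] bounded_subset[OF bounded_cball] by blast
    fix K1 K' assume "K1 \<in> patch e" "K' \<in> \<T> - patch e"
    then show "closure {x. edge_test e k Q x \<noteq> 0} \<inter> K1 \<inter> K' = {}"
      using edge_box_outside_patch c by blast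
  qed
qed

text \<open>The edges at which test functions of parity \<open>k\<close> are admissible. On a simply supported edge the function has to vanish, which is the case for
  \<open>k = 1\<close> only.\<close>

definition test_edge :: "nat \<Rightarrow> (real^2) set \<Rightarrow> bool" where
  "test_edge k e \<longleftrightarrow> patch e \<noteq> {} \<and> (e \<in> interior_edges \<T> \<or> e \<subseteq> \<Gamma>f \<or> (k = 1 \<and> e \<subseteq> \<Gamma>s))"

lemma edge_coord_line:
  assumes "K \<in> patch e" shows "edge_coord e (arc_point e s + t *\<^sub>R edge_perp e) $ 1 = s / diameter e"
    "edge_coord e (arc_point e s + t *\<^sub>R edge_perp e) $ 2 = t / diameter e"
  using segment_arc_ends(5)[OF patch_segment[OF assms]]
  by (simp_all add: edge_coord_nth arc_point_def inner_add_left edge_perp_def norm_eq_1[symmetric])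

lemma edge_test_line:
  assumes K: "K \<in> patch e" and Q: "\<And>z. Q z = poly q (z $ 1)"
  shows "edge_test e k Q (arc_point e s + t *\<^sub>R edge_perp e) =
    bump (s / diameter e) * poly q (s / diameter e) * (t ^ k * bump (1/2 + t / (4 * thickness \<kappa> * diameter e)))"
proof -
  have L: "diameter e > 0" using segment_arc_ends(4)[OF patch_segment[OF K]] .
  show ?thesis
    unfolding edge_test_def edge_bump_def Q edge_coord_line[OF K]
    using L by (simp add: power_divide mult_ac)
qed

text \<open>For \<open>k = 0\<close> the function is even across the edge, so that its normal derivative vanishes on the edge.\<close>

lemma edge_test_normal_derivative:
  assumes K: "K \<in> patch e" and Q: "\<And>z. Q z = poly q (z $ 1)" "smooth Q"
  shows "(\<Sum>i\<in>UNIV. pd i (edge_test e 0 Q) (arc_point e s) * edge_perp e $ i) = 0"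
    and "(\<Sum>i\<in>UNIV. pd i (edge_test e 1 Q) (arc_point e s) * edge_perp e $ i) =
      bump (1/2) * bump (s / diameter e) * poly q (s / diameter e)"
proof -
  let ?h = "\<lambda>t. bump (1/2 + t / (4 * thickness \<kappa> * diameter e))"
  let ?c = "bump (s / diameter e) * poly q (s / diameter e)"
  have d: "((\<lambda>t. ?c * (t ^ k * ?h t)) has_real_derivative
      (\<Sum>i\<in>UNIV. pd i (edge_test e k Q) (arc_point e s) * edge_perp e $ i)) (at 0)" for k
    using line_derivative[OF smooth_edge_test[OF Q(2)], of e k "arc_point e s" "edge_perp e" 0]
    unfolding edge_test_line[OF K Q(1)] by simp
  show "(\<Sum>i\<in>UNIV. pd i (edge_test e 0 Q) (arc_point e s) * edge_perp e $ i) = 0"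
  proof (rule DERIV_even_zero[OF _ d[of 0]])
    show "?c * ((- t) ^ 0 * ?h (- t)) = ?c * (t ^ 0 * ?h t)" for t
      using bump_sym[of "t / (4 * thickness \<kappa> * diameter e)"] by simp
  qed
  have "continuous_on UNIV (\<lambda>t. 1/2 + t / (4 * thickness \<kappa> * diameter e))"
    unfolding divide_inverse by (intro continuous_intros)
  then have "continuous_on UNIV ?h" by (rule continuous_on_compose2[OF bump_continuous[of UNIV]]) (rule subset_UNIV)
  then have "isCont ?h 0" by (simp add: continuous_on_eq_continuous_at)
  then have "((\<lambda>t. t * ?h t) has_real_derivative ?h 0) (at 0)" by (rule DERIV_mult_id)
  then have "((\<lambda>t. ?c * (t ^ 1 * ?h t)) has_real_derivative ?c * ?h 0) (at 0)"
    unfolding power_one_right by (rule DERIV_cmult)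
  then have "(\<Sum>i\<in>UNIV. pd i (edge_test e 1 Q) (arc_point e s) * edge_perp e $ i) = ?c * ?h 0"
    using d[of 1] by (rule DERIV_unique[rotated])
  then show "(\<Sum>i\<in>UNIV. pd i (edge_test e 1 Q) (arc_point e s) * edge_perp e $ i) =
      bump (1/2) * bump (s / diameter e) * poly q (s / diameter e)" by simp
qed

lemma cut_in_edge_box:
  assumes "cut (patch e) p x \<noteq> 0" "\<And>x. x \<notin> edge_box e \<Longrightarrow> p x = 0"
  obtains K where "K \<in> patch e" "x \<in> K" "x \<in> edge_box e" "x \<in> interior K \<or> x \<in> rel_interior e" "p x \<noteq> 0"
proof -
  have "x \<in> \<Union>(patch e)" "p x \<noteq> 0" using assms(1) by (auto simp: cut_def split: if_splits)
  moreover have "x \<in> edge_box e" using assms(2) \<open>p x \<noteq> 0\<close> by blast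
  ultimately show thesis using that edge_box_in_patch_triangle by blast
qed

lemma cut_frontier:
  assumes e: "test_edge k e" and x: "x \<in> frontier \<Omega>" and p: "cut (patch e) p x \<noteq> 0" "\<And>x. x \<notin> edge_box e \<Longrightarrow> p x = 0"
  shows "x \<in> rel_interior e" "x \<in> e" "p x \<noteq> 0" "e \<subseteq> \<Gamma>f \<or> (k = 1 \<and> e \<subseteq> \<Gamma>s)"
proof -
  obtain K where K: "K \<in> patch e" "x \<in> K" "x \<in> edge_box e" "x \<in> interior K \<or> x \<in> rel_interior e" "p x \<noteq> 0"
    by (rule cut_in_edge_box[OF p])
  have nO: "x \<notin> \<Omega>" using x domain_frontier_disjoint by blast
  then show r: "x \<in> rel_interior e" using K(1,4) interior_triangle_domain patchD by blast
  then show "x \<in> e" using rel_interior_subset by blast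
  show "p x \<noteq> 0" by (rule K(5))
  have "e \<notin> interior_edges \<T>"
  proof
    assume "e \<in> interior_edges \<T>"
    then obtain K1 K2 where "K1 \<in> patch e" "K2 \<in> patch e" "K1 \<noteq> K2" using interior_edge_pair by metis
    then show False using edge_box_two_sided[of K1 e K2 x] K(3) r nO by blast
  qed
  then show "e \<subseteq> \<Gamma>f \<or> (k = 1 \<and> e \<subseteq> \<Gamma>s)" using e by (auto simp: test_edge_def)
qed

text \<open>On the boundary the cut function can be nonzero only in the interior of \<open>e\<close>, and \<open>e\<close> lies on the free part or, for \<open>k = 1\<close>, where the function vanishes
  on \<open>e\<close>, on the simply supported part. Different boundary parts have only finitely many common points.\<close>

lemma edge_test_plate_space:
  assumes e: "test_edge k e" and K: "K \<in> patch e" and Q: "smooth Q"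
  shows "cut (patch e) (edge_test e k Q) \<in> plate_space \<Omega> \<Gamma>c \<Gamma>s"
proof -
  let ?w = "edge_test e k Q"
  note sp = edge_test_supported(1)[OF K Q, of k]
  have z: "?w x = 0" if "x \<notin> edge_box e" for x using edge_test_nonzero[OF K] that by blast
  have zp: "pd i ?w x = 0" if "x \<notin> edge_box e" for i x
    by (rule pd_zero_outside_closed(1)[OF closed_edge_box z that])
  show ?thesis
  proof (rule cut_plate_space[OF sp])
    have "{x \<in> \<Gamma>c \<union> \<Gamma>s. cut (patch e) ?w x \<noteq> 0} \<subseteq> (\<Gamma>c \<inter> \<Gamma>f) \<union> (\<Gamma>s \<inter> \<Gamma>f)"
    proof
      fix x assume x: "x \<in> {x \<in> \<Gamma>c \<union> \<Gamma>s. cut (patch e) ?w x \<noteq> 0}"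
      then have xf: "x \<in> frontier \<Omega>" and cx: "cut (patch e) ?w x \<noteq> 0" using boundary_parts by blast+
      note c' = cut_frontier[where p = ?w, OF e xf cx z]
      have "\<not> k = 1"
      proof
        assume k: "k = 1"
        obtain s where "x = arc_point e s" using c'(1) edge_segment(4)[OF patchD[OF K]] by blast
        then have "(x - arc_start e) \<bullet> edge_perp e = 0" by (simp add: arc_point_def edge_perp_def)
        then have "edge_coord e x $ 2 = 0" by (simp add: edge_coord_nth)
        then have "?w x = 0" using k by (simp add: edge_test_def edge_bump_def)
        then show False using c'(3) by blast
      qed
      then show "x \<in> (\<Gamma>c \<inter> \<Gamma>f) \<union> (\<Gamma>s \<inter> \<Gamma>f)" using c' x by blast
    qed
    then show "finite {x \<in> \<Gamma>c \<union> \<Gamma>s. cut (patch e) ?w x \<noteq> 0}" using boundary_parts(5,6) finite_subset by blast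
    fix i
    have "{x \<in> \<Gamma>c. cut (patch e) (pd i ?w) x \<noteq> 0} \<subseteq> (\<Gamma>c \<inter> \<Gamma>f) \<union> (\<Gamma>c \<inter> \<Gamma>s)"
    proof
      fix x assume x: "x \<in> {x \<in> \<Gamma>c. cut (patch e) (pd i ?w) x \<noteq> 0}"
      then have xf: "x \<in> frontier \<Omega>" and cx: "cut (patch e) (pd i ?w) x \<noteq> 0" using boundary_parts by blast+
      from cut_frontier(2,4)[where p = "pd i ?w", OF e xf cx zp] show "x \<in> (\<Gamma>c \<inter> \<Gamma>f) \<union> (\<Gamma>c \<inter> \<Gamma>s)" using x by blast
    qed
    then show "finite {x \<in> \<Gamma>c. cut (patch e) (pd i ?w) x \<noteq> 0}" using boundary_parts(4,5) finite_subset by blast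
  qed
qed

text \<open>The parametrizations of the line by outward normals of the two triangles have opposite directions.\<close>

lemma integral_edge_line:
  assumes K: "K \<in> patch e"
  shows "(LINT s|lborel. G (arc_start e + s *\<^sub>R perp (edge_normal K e))) = (LINT s|lborel. (G (arc_point e s) :: real))"
proof -
  have pp: "perp (edge_perp e) = - arc_dir e" "perp (- edge_perp e) = arc_dir e"
    by (simp_all add: edge_perp_def vec_eq_2)
  from edge_normal_pm[OF patchD[OF K]] show ?thesis
  proof
    assume n: "edge_normal K e = edge_perp e"
    have "(LINT s|lborel. G (arc_point e s)) = (LINT s|lborel. G (arc_point e (- s)))"
      using lborel_integral_real_affine[of "-1" "\<lambda>s. G (arc_point e s)" 0] by simp
    then show ?thesis unfolding n pp by (simp add: arc_point_def)
  next
    assume n: "edge_normal K e = - edge_perp e"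
    show ?thesis unfolding n pp by (simp add: arc_point_def)
  qed
qed

lemma edge_normal_sign: "K \<in> patch e \<Longrightarrow> edge_normal K e = patch_sign e K *\<^sub>R edge_perp e" "\<bar>patch_sign e K\<bar> = 1"
  using edge_normal_pm patchD by (fastforce simp: patch_sign_def)+

end

context plate_problem
begin

lemma line_residual_edge:
  assumes K: "K \<in> patch e"
  shows "line_residual K (arc_start e) (edge_normal K e) w =
    (LINT s|lborel. V_n d Y \<nu> (edge_normal K e) (piece K uh) (arc_point e s) * w (arc_point e s))
    - (LINT s|lborel. patch_sign e K * M_nn d Y \<nu> (edge_normal K e) (piece K uh) (arc_point e s)
        * (\<Sum>i\<in>UNIV. pd i w (arc_point e s) * edge_perp e $ i))"
proof -
  let ?n = "edge_normal K e"
  have sg: "(\<Sum>i\<in>UNIV. pd i w x * ?n $ i) = patch_sign e K * (\<Sum>i\<in>UNIV. pd i w x * edge_perp e $ i)" for x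
    by (subst edge_normal_sign(1)[OF K]) (simp add: sum_distrib_left mult_ac)
  show ?thesis
    unfolding line_residual_def sg
    using integral_edge_line[OF K, of "\<lambda>x. V_n d Y \<nu> ?n (piece K uh) x * w x"]
      integral_edge_line[OF K, of "\<lambda>x. M_nn d Y \<nu> ?n (piece K uh) x * (patch_sign e K * (\<Sum>i\<in>UNIV. pd i w x * edge_perp e $ i))"]
    by (simp add: mult_ac)
qed

text \<open>If the box of an edge meets \<open>S\<close>, it meets it in interior points of the edge. Such a point lies on an edge contained in \<open>S\<close>, and conformity makes
  the two edges equal. Boundary edges are excluded, because the interior of \<open>S\<close> lies inside \<open>\<Omega>\<close>.\<close>

lemma cut_on_S:
  assumes e: "test_edge k e" and x: "x \<in> S" "cut (patch e) p x \<noteq> 0" and p: "\<And>x. x \<notin> edge_box e \<Longrightarrow> p x = 0"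
  shows "x \<in> rel_interior e \<and> e \<in> edges_S \<T> S"
proof -
  obtain K where K: "K \<in> patch e" "x \<in> interior K \<or> x \<in> rel_interior e"
    using cut_in_edge_box[OF x(2) p] by metis
  have r: "x \<in> rel_interior e" using K S_not_interior x(1) patchD by blast
  obtain e' where e': "e' \<in> edges_S \<T> S" "x \<in> e'" using S_edges x(1) by blast
  then obtain K' where K': "K' \<in> \<T>" "e' edge_of K'" by (auto simp: edges_S_def interior_edges_def)
  have "e \<subseteq> e'"
    using mesh_face_subset[OF patchD(1)[OF K(1)] K'(1) _ _ r e'(2)] patchD(2)[OF K(1)] K'(2) by (auto simp: edge_of_def)
  then have eS: "e \<subseteq> S" using e'(1) by (auto simp: edges_S_def)
  have "e \<in> interior_edges \<T>"
  proof (rule ccontr)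
    assume "e \<notin> interior_edges \<T>"
    then have ef: "e \<subseteq> frontier \<Omega>" using e boundary_parts by (auto simp: test_edge_def)
    obtain p q where pq: "S = closed_segment p q" "open_segment p q \<subseteq> \<Omega>" using S_segment by blast
    have "e \<subseteq> {p, q}"
      using eS ef pq domain_frontier_disjoint by (auto simp: open_segment_def)
    then have "finite e" by (rule finite_subset) auto
    moreover have "infinite e"
    proof -
      note seg = patch_segment[OF K(1)]
      have "inj_on (arc_point e) {0..diameter e}" using arc_point_inj[OF seg] by (auto simp: inj_on_def)
      moreover have "infinite {0..diameter e}" using segment_arc_ends(4)[OF seg] by (simp add: infinite_Icc)
      ultimately have "infinite (arc_point e ` {0..diameter e})" using finite_imageD by blast
      then show ?thesis using segment_eq_arc_points[OF seg] by simp
    qed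
    ultimately show False by blast
  qed
  then show ?thesis using r eS by (simp add: edges_S_def)
qed

lemma cut_at_x0:
  assumes p: "\<And>x. x \<notin> edge_box e \<Longrightarrow> p x = 0" shows "cut (patch e) p x0 = 0"
proof (rule ccontr)
  assume nz: "cut (patch e) p x0 \<noteq> 0"
  obtain K where K: "K \<in> patch e" "x0 \<in> interior K \<or> x0 \<in> rel_interior e"
    by (rule cut_in_edge_box[OF nz p])
  then have r: "x0 \<in> rel_interior e" using x0_not_interior patchD by blast
  obtain K' where K': "K' \<in> \<T>" "{x0} face_of K'" using x0(2) by (auto simp: face_of_singleton)
  have "e \<subseteq> {x0}" using mesh_face_subset[OF patchD(1)[OF K(1)] K'(1) _ K'(2) r] patchD(2)[OF K(1)] by (auto simp: edge_of_def)
  then have "aff_dim e \<le> aff_dim {x0}" by (rule aff_dim_subset)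
  then show False using patchD(2)[OF K(1)] by (simp add: edge_of_def)
qed

text \<open>The element residual enters with the weight \<open>diameter e ^ 4\<close>; it is eliminated later by \<open>element_estimate\<close>.\<close>

definition edge_error :: "(real^2) set \<Rightarrow> (real^2) set \<Rightarrow> real" where
  "edge_error e K = local_error K + diameter e ^ 4 * (L2norm (lebesgue_on K) (element_residual K))\<^sup>2"

lemma edge_error_nonneg: "0 \<le> edge_error e K"
  using local_error_nonneg by (simp add: edge_error_def)

lemma sum_patch_sqrt: assumes "K \<in> patch e" shows "(\<Sum>K\<in>patch e. sqrt (edge_error e K))\<^sup>2 \<le> 2 * (\<Sum>K\<in>patch e. edge_error e K)"
proof (cases "\<exists>K'\<in>patch e. K' \<noteq> K")
  case True
  then obtain K' where K': "K' \<in> patch e" "K' \<noteq> K" by blast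
  have p: "patch e = {K, K'}" using opposite_normals(2)[OF assms K'(1)] K'(2) by simp
  have "(sqrt (edge_error e K) + sqrt (edge_error e K'))\<^sup>2 \<le> 2 * (sqrt (edge_error e K))\<^sup>2 + 2 * (sqrt (edge_error e K'))\<^sup>2"
    using sum_squares_bound[of "sqrt (edge_error e K)" "sqrt (edge_error e K')"] by (simp add: power2_sum)
  then show ?thesis using K' edge_error_nonneg by (simp add: p)
next
  case False
  then have "patch e = {K}" using assms by blast
  then show ?thesis using edge_error_nonneg[of e K] by simp
qed

text \<open>The residual identity for an edge test function. The second derivatives of \<open>w\<close> are of size \<open>L ^ k M / L\<^sup>2\<close> on a box of size \<open>L\<close>; the point load drops
  out because its point of application is a vertex, where \<open>w\<close> vanishes.\<close>

lemma edge_residual_bound: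
  assumes e: "test_edge k e" and K: "K \<in> patch e" and Q: "smooth Q" and M: "M \<ge> 0"
    and b: "\<And>z. \<bar>edge_bump (thickness \<kappa>) k z * Q z\<bar> \<le> M"
      "\<And>i j z. \<bar>pd j (pd i (\<lambda>z. edge_bump (thickness \<kappa>) k z * Q z)) z\<bar> \<le> M"
  defines "w \<equiv> edge_test e k Q" and "L \<equiv> diameter e"
  shows "\<bar>(\<Sum>K\<in>patch e. line_residual K (arc_start e) (edge_normal K e) w) - (LINT x|arc_measure S. g x * cut (patch e) w x)\<bar>
    \<le> L ^ k * M / L * (4 * stress_const + 2) * (\<Sum>K\<in>patch e. sqrt (edge_error e K))"
proof -
  note seg = patch_segment[OF K]
  note se = segment_arc_ends[OF seg]
  have L: "L > 0" using se(4) by (simp add: L_def)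
  define W where "W z = edge_bump (thickness \<kappa>) k z * Q z" for z
  have sW: "smooth W" unfolding W_def by (intro smooth_mult smooth_edge_bump Q)
  have z: "w x = 0" if "x \<notin> edge_box e" for x using edge_test_nonzero[OF K] that by (auto simp: w_def)
  have sw: "smooth w" unfolding w_def by (rule smooth_edge_test[OF Q])
  have wW: "w = (\<lambda>x. L ^ k * (\<lambda>x. W (edge_map e *v x + (- (edge_map e *v arc_start e)))) x)"
    by (rule ext) (simp add: w_def edge_test_def W_def edge_coord_def L_def)
  define D where "D = L ^ k * (4 * ((1 / L)\<^sup>2 * M))"
  have D0: "D \<ge> 0" using M L by (simp add: D_def)
  have mb: "\<bar>edge_map e $ l $ i\<bar> \<le> 1 / L" for l i
  proof -
    have "\<bar>arc_dir e $ i\<bar> \<le> 1" "\<bar>edge_perp e $ i\<bar> \<le> 1"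
      using component_le_norm_cart[of "arc_dir e" i] component_le_norm_cart[of "edge_perp e" i] se(5) by (simp_all add: edge_perp_def)
    then show ?thesis using L by (simp add: edge_map_def L_def abs_divide divide_right_mono)
  qed
  have Db: "\<bar>pd j (pd i w) x\<bar> \<le> D * indicator (edge_box e) x" for i j x
  proof (cases "x \<in> edge_box e")
    case True
    let ?u = "\<lambda>x. W (edge_map e *v x + (- (edge_map e *v arc_start e)))"
    have su: "smooth ?u" by (rule smooth_comp[OF sW])
    have "\<bar>pd j (pd i ?u) x\<bar> \<le> 4 * ((1 / L)\<^sup>2 * M)"
      by (rule second_pd_comp_bound[OF sW _ mb]) (use b(2) in \<open>simp add: W_def[abs_def]\<close>)
    then have "L ^ k * \<bar>pd j (pd i ?u) x\<bar> \<le> D" unfolding D_def using L by (intro mult_left_mono) auto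
    moreover have "pd j (pd i w) x = L ^ k * pd j (pd i ?u) x"
      unfolding wW by (simp only: pd_cmult[OF su] pd_cmult[OF smooth_pd[OF su]])
    ultimately show ?thesis using True L by (simp add: abs_mult)
  qed (simp add: pd_zero_outside_closed(2)[OF closed_edge_box z])
  have wb: "\<bar>w x\<bar> \<le> (L ^ k * M) * indicator (edge_box e) x" for x
  proof (cases "x \<in> edge_box e")
    case True
    have "\<bar>w x\<bar> = L ^ k * \<bar>W (edge_map e *v x + (- (edge_map e *v arc_start e)))\<bar>" using L by (simp add: wW abs_mult)
    also have "\<dots> \<le> L ^ k * M" using b(1) L by (intro mult_left_mono) (auto simp: W_def)
    finally show ?thesis using True by simp
  qed (simp add: z)
  let ?X = "\<Sum>K\<in>patch e. sqrt (edge_error e K)"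
  have sc: "0 \<le> stress_const" using moment_const_nonneg by (simp add: stress_const_def)
  have sup: "supported_in_patch (patch e) w" unfolding w_def by (rule edge_test_supported(1)[OF K Q])
  have bx: "edge_box e \<subseteq> cball (arc_start e) L" unfolding L_def by (rule edge_box_cball[OF K])
  have Ln: "L \<ge> 0" using L by simp
  have cx0: "cut (patch e) w x0 = 0" by (rule cut_at_x0[where p = w, OF z])
  have "\<bar>(\<Sum>K\<in>patch e. line_residual K (arc_start e) (edge_normal K e) w) + (\<Sum>K\<in>patch e. LINT x|lebesgue_on K. element_residual K x * w x)
      - (LINT x|arc_measure S. g x * cut (patch e) w x) - F * cut (patch e) w x0\<bar>
    \<le> stress_const * (D * L) * (\<Sum>K\<in>patch e. sqrt (local_error K))"
  proof (rule residual_bound[OF sup _ _ _ Db closed_edge_box bx Ln D0])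
    show "cut (patch e) w \<in> plate_space \<Omega> \<Gamma>c \<Gamma>s" unfolding w_def by (rule edge_test_plate_space[OF e K Q])
    show "norm (edge_normal K' e) = 1 \<and> K' \<subseteq> half_plane (arc_start e) (edge_normal K' e)" if "K' \<in> patch e" for K'
      using edge_normal_exists[OF patchD[OF that]] by blast
    show "x \<in> K'" if "K' \<in> patch e" "x \<in> half_plane (arc_start e) (edge_normal K' e)" "x \<in> closure {x. w x \<noteq> 0}" for K' x
      using edge_box_half(2)[OF that(1) _ that(2)] edge_test_supported(2)[OF K Q, of k] that(3) unfolding w_def by blast
  qed
  then have "\<bar>(\<Sum>K\<in>patch e. line_residual K (arc_start e) (edge_normal K e) w) + (\<Sum>K\<in>patch e. LINT x|lebesgue_on K. element_residual K x * w x)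
      - (LINT x|arc_measure S. g x * cut (patch e) w x)\<bar>
    \<le> stress_const * (D * L) * (\<Sum>K\<in>patch e. sqrt (local_error K))" by (simp add: cx0)
  moreover have "\<bar>\<Sum>K\<in>patch e. LINT x|lebesgue_on K. element_residual K x * w x\<bar> \<le>
      (\<Sum>K\<in>patch e. (L ^ k * M) * (2 * L) * L2norm (lebesgue_on K) (element_residual K))"
    using M L by (intro order_trans[OF sum_abs] sum_mono weighted_integral_bound[OF _ _ sw wb closed_edge_box bx Ln]
        element_residual_L2 patchD) auto
  ultimately have "\<bar>(\<Sum>K\<in>patch e. line_residual K (arc_start e) (edge_normal K e) w) - (LINT x|arc_measure S. g x * cut (patch e) w x)\<bar>
     \<le> stress_const * (D * L) * (\<Sum>K\<in>patch e. sqrt (local_error K)) +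
      (\<Sum>K\<in>patch e. (L ^ k * M) * (2 * L) * L2norm (lebesgue_on K) (element_residual K))" by linarith
  also have "\<dots> = (\<Sum>K\<in>patch e. L ^ k * M / L * (4 * stress_const * sqrt (local_error K) + 2 * (L\<^sup>2 * L2norm (lebesgue_on K) (element_residual K))))"
    unfolding sum_distrib_left sum.distrib[symmetric] D_def
    using L by (intro sum.cong refl) (simp add: power2_eq_square field_simps)
  also have "\<dots> \<le> (\<Sum>K\<in>patch e. L ^ k * M / L * ((4 * stress_const + 2) * sqrt (edge_error e K)))"
  proof (intro sum_mono mult_left_mono)
    fix K assume "K \<in> patch e"
    have 1: "sqrt (local_error K) \<le> sqrt (edge_error e K)" by (simp add: edge_error_def)
    have "L\<^sup>2 * L2norm (lebesgue_on K) (element_residual K) \<le> sqrt (edge_error e K)"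
      using local_error_nonneg[of K]
      by (intro real_le_rsqrt) (simp add: edge_error_def power_mult_distrib L_def flip: power_mult)
    then show "4 * stress_const * sqrt (local_error K) + 2 * (L\<^sup>2 * L2norm (lebesgue_on K) (element_residual K)) \<le> (4 * stress_const + 2) * sqrt (edge_error e K)"
      using mult_left_mono[OF 1, of "4 * stress_const"] sc by (simp add: distrib_right)
  qed (use M L in simp)
  also have "\<dots> = L ^ k * M / L * (4 * stress_const + 2) * ?X" by (simp add: sum_distrib_left mult.assoc)
  finally show ?thesis .
qed

text \<open>The jumps at an edge as sums over the triangles at the edge: two triangles for an interior edge, one for a boundary edge, where the sum
  is the boundary quantity itself.\<close>

definition shear_jump :: "(real^2) set \<Rightarrow> real^2 \<Rightarrow> real" where
  "shear_jump e x = (\<Sum>K\<in>patch e. V_n d Y \<nu> (edge_normal K e) (piece K uh) x)"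

definition moment_jump :: "(real^2) set \<Rightarrow> real^2 \<Rightarrow> real" where
  "moment_jump e x = (\<Sum>K\<in>patch e. patch_sign e K * M_nn d Y \<nu> (edge_normal K e) (piece K uh) x)"

lemma polyfun_shear_jump: "polyfun r (shear_jump e)"
  unfolding shear_jump_def[abs_def] by (intro polyfun_sum polyfun_V_n piece_Vh(1)[OF uh] patchD)

lemma polyfun_moment_jump: "polyfun r (moment_jump e)"
  unfolding moment_jump_def[abs_def] by (intro polyfun_sum polyfun_cmult polyfun_M_nn piece_Vh(1)[OF uh] patchD)

text \<open>The normal derivative with respect to the outward normals changes its sign across the edge. Therefore the moments enter with signs, and their sum
  is a difference, while the shear forces are added.\<close>

lemma sum_line_residual:
  assumes K: "K \<in> patch e" and w: "smooth w" "bounded {x. w x \<noteq> 0}"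
  shows "(\<Sum>K\<in>patch e. line_residual K (arc_start e) (edge_normal K e) w) =
    (LINT s|lborel. shear_jump e (arc_point e s) * w (arc_point e s))
    - (LINT s|lborel. moment_jump e (arc_point e s) * (\<Sum>i\<in>UNIV. pd i w (arc_point e s) * edge_perp e $ i))"
proof -
  have n: "norm (arc_dir e) = 1" using segment_arc_ends(5)[OF patch_segment[OF K]] .
  let ?d = "\<lambda>x. \<Sum>i\<in>UNIV. pd i w x * edge_perp e $ i"
  have sd: "smooth ?d" by (intro smooth_sum smooth_mult smooth_pd w smooth_const)
  have bd: "bounded {x. ?d x \<noteq> 0}"
    by (rule bounded_subset[OF bounded_Un[THEN iffD2, OF conjI[OF bounded_support_pd[OF w(2), of 1] bounded_support_pd[OF w(2), of 2]]]])
      (auto simp: sum_2)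
  have i1: "integrable lborel (\<lambda>s. V_n d Y \<nu> (edge_normal K e) (piece K uh) (arc_point e s) * w (arc_point e s))" if "K \<in> patch e" for K
    unfolding arc_point_def
    by (rule integrable_line[where f = "\<lambda>x. V_n d Y \<nu> (edge_normal K e) (piece K uh) x * w x",
          OF smooth_mult[OF smooth_V_n[OF piece_Vh(3)[OF uh patchD(1)[OF that]]] w(1)] bounded_support_mult[OF w(2)] n])
  have i2: "integrable lborel (\<lambda>s. patch_sign e K * M_nn d Y \<nu> (edge_normal K e) (piece K uh) (arc_point e s) * ?d (arc_point e s))" if "K \<in> patch e" for K
    unfolding arc_point_def
    by (rule integrable_line[where f = "\<lambda>x. patch_sign e K * M_nn d Y \<nu> (edge_normal K e) (piece K uh) x * ?d x",
          OF smooth_mult[OF smooth_mult[OF smooth_const smooth_M_nn[OF piece_Vh(3)[OF uh patchD(1)[OF that]]]] sd] bounded_support_mult[OF bd] n])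
  have "(\<Sum>K\<in>patch e. line_residual K (arc_start e) (edge_normal K e) w) =
      (\<Sum>K\<in>patch e. LINT s|lborel. V_n d Y \<nu> (edge_normal K e) (piece K uh) (arc_point e s) * w (arc_point e s))
      - (\<Sum>K\<in>patch e. LINT s|lborel. patch_sign e K * M_nn d Y \<nu> (edge_normal K e) (piece K uh) (arc_point e s) * ?d (arc_point e s))"
    unfolding sum_subtractf[symmetric] by (intro sum.cong refl line_residual_edge)
  also have "(\<Sum>K\<in>patch e. LINT s|lborel. V_n d Y \<nu> (edge_normal K e) (piece K uh) (arc_point e s) * w (arc_point e s)) =
      (LINT s|lborel. shear_jump e (arc_point e s) * w (arc_point e s))"
    unfolding shear_jump_def sum_distrib_right by (intro Bochner_Integration.integral_sum[symmetric] i1)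
  also have "(\<Sum>K\<in>patch e. LINT s|lborel. patch_sign e K * M_nn d Y \<nu> (edge_normal K e) (piece K uh) (arc_point e s) * ?d (arc_point e s)) =
      (LINT s|lborel. moment_jump e (arc_point e s) * ?d (arc_point e s))"
    unfolding moment_jump_def sum_distrib_right by (intro Bochner_Integration.integral_sum[symmetric] i2)
  finally show ?thesis .
qed

end

section \<open>Estimates of the jumps\<close>

text \<open>\<open>\<mu>\<close> is the weighted norm of \<open>q\<close> on the reference interval. All bounds are expressed by it.\<close>

lemma edge_reference_boundD:
  assumes ref: "edge_reference_bound \<delta> k N C" and Q: "polyfun N Q" "degree q \<le> N" "\<And>z. Q z = poly q (z $ 1)"
  defines "\<mu> \<equiv> sqrt (LINT s|lborel. bump s * (poly q s)\<^sup>2)"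
  shows "\<mu> \<ge> 0" "(LINT s|lborel. bump s * (poly q s)\<^sup>2) = \<mu>\<^sup>2"
    "\<And>y. \<bar>y\<bar> \<le> 1 \<Longrightarrow> (poly q y)\<^sup>2 \<le> C * \<mu>\<^sup>2" "\<And>z. \<bar>edge_bump \<delta> k z * Q z\<bar> \<le> C * \<mu>"
    "\<And>i j z. \<bar>pd j (pd i (\<lambda>z. edge_bump \<delta> k z * Q z)) z\<bar> \<le> C * \<mu>"
proof -
  have "0 \<le> (LINT s|lborel. bump s * (poly q s)\<^sup>2)" by (intro Bochner_Integration.integral_nonneg) (simp add: bump_bounds)
  then show sq: "(LINT s|lborel. bump s * (poly q s)\<^sup>2) = \<mu>\<^sup>2" and "0 \<le> \<mu>" by (simp_all add: \<mu>_def)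
  have "polyfun N Q \<and> degree q \<le> N \<and> (\<forall>z. Q z = poly q (z $ 1))" using Q by simp
  note b = ref[unfolded edge_reference_bound_def, THEN conjunct2, rule_format, OF this, folded \<mu>_def]
  show "(poly q y)\<^sup>2 \<le> C * \<mu>\<^sup>2" if "\<bar>y\<bar> \<le> 1" for y
    unfolding sq[symmetric] using b that by blast
  show "\<bar>edge_bump \<delta> k z * Q z\<bar> \<le> C * \<mu>" for z using b by blast
  show "\<bar>pd j (pd i (\<lambda>z. edge_bump \<delta> k z * Q z)) z\<bar> \<le> C * \<mu>" for i j z using b by blast
qed

lemma edge_bump_line_zero: "0 < L \<Longrightarrow> s \<notin> {0..L} \<Longrightarrow> bump (s / L) = 0"
  by (intro bump_zero) (auto simp: field_simps)

lemma integral_line_scaled: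
  fixes h :: "real \<Rightarrow> real"
  assumes "L > 0" shows "(LINT s|lborel. h (s / L)) = L * (LINT s|lborel. h s)"
  using lborel_integral_real_affine[of L "\<lambda>s. h (s / L)" 0] assms by simp

context kirchhoff_mesh
begin

text \<open>The polynomial along the edge, in the coordinate that is scaled to the reference interval, and its extension to the plane.\<close>

lemma edge_profile:
  assumes K: "K \<in> patch e" and J: "polyfun N J"
  obtains q Q where "polyfun N Q" "degree q \<le> N" "\<And>z. Q z = poly q (z $ 1)" "\<And>s. J (arc_point e s) = poly q (s / diameter e)"
proof -
  have L: "diameter e > 0" using segment_arc_ends(4)[OF patch_segment[OF K]] .
  let ?v = "diameter e *\<^sub>R arc_dir e"
  obtain q where q: "degree q \<le> N" "\<And>t. J (arc_start e + t *\<^sub>R ?v) = poly q t" using polyfun_line[OF J] by blast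
  let ?B = "(\<chi> i k. if k = 1 then ?v $ i else 0) :: real^2^2"
  have B: "?B *v z = (z $ 1) *\<^sub>R ?v" for z by (simp add: vec_eq_iff matrix_vector_mult_def sum_2)
  show thesis
  proof (rule that[of "\<lambda>z. J (?B *v z + arc_start e)" q])
    show "polyfun N (\<lambda>z. J (?B *v z + arc_start e))" by (rule polyfun_affine[OF J])
    show "J (?B *v z + arc_start e) = poly q (z $ 1)" for z
      unfolding B using q(2)[of "z $ 1"] by (simp only: add.commute)
    show "J (arc_point e s) = poly q (s / diameter e)" for s
      using q(2)[of "s / diameter e"] L by (simp add: arc_point_def)
  qed (rule q(1))
qed

lemma edge_norm_bound:
  assumes K: "K \<in> patch e" and h: "continuous_on e h" and b: "\<And>s. s \<in> {0..diameter e} \<Longrightarrow> (h (arc_point e s))\<^sup>2 \<le> B"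
  shows "(L2norm (arc_measure e) h)\<^sup>2 \<le> diameter e * B"
proof -
  note seg = patch_segment[OF K]
  have L: "diameter e > 0" using segment_arc_ends(4)[OF seg] .
  have h2: "continuous_on e (\<lambda>x. (h x)\<^sup>2)" using h by (intro continuous_intros)
  have "(L2norm (arc_measure e) h)\<^sup>2 = (LINT t|lborel. indicator {0..diameter e} t * (h (arc_point e t))\<^sup>2)"
    unfolding L2norm_sq by (rule arc_integral[OF seg h2])
  also have "\<dots> \<le> (LINT t|lborel. indicator {0..diameter e} t * B)"
  proof (rule integral_mono')
    have B0: "0 \<le> B" using b[of 0] L order_trans[OF zero_le_power2] by auto
    show "integrable lborel (\<lambda>t. indicator {0..diameter e} t * B)"
      by (intro integrable_mult_left integrable_real_indicator) (simp_all add: L less_imp_le)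
    show "indicator {0..diameter e} t * (h (arc_point e t))\<^sup>2 \<le> indicator {0..diameter e} t * B" for t
      using b[of t] by (auto simp: indicator_def)
    show "0 \<le> indicator {0..diameter e} t * B" for t :: real using B0 by simp
  qed
  also have "\<dots> = diameter e * B" using L by simp
  finally show ?thesis .
qed

end

definition moment_jump_const :: "real \<Rightarrow> real \<Rightarrow> real" where
  "moment_jump_const s C = 2 * C ^ 3 * (4 * s + 2)\<^sup>2 / (bump (1/2))\<^sup>2"

definition shear_jump_const :: "real \<Rightarrow> real \<Rightarrow> real" where
  "shear_jump_const s C = 4 * C ^ 3 * ((4 * s + 2)\<^sup>2 + 1) / (bump (1/2))\<^sup>2"

context plate_problem
begin

text \<open>The square of the sum is at most twice the sum of the squares, since a patch consists of at most two triangles.\<close>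

lemma edge_error_sum:
  assumes K: "K \<in> patch e" and b: "b * x \<le> a * (\<Sum>K\<in>patch e. sqrt (edge_error e K))" "b \<ge> 0" "x \<ge> 0"
  shows "(b * x)\<^sup>2 \<le> 2 * a\<^sup>2 * (\<Sum>K\<in>patch e. edge_error e K)"
proof -
  have "(b * x)\<^sup>2 \<le> (a * (\<Sum>K\<in>patch e. sqrt (edge_error e K)))\<^sup>2" using b by (intro power_mono) auto
  also have "\<dots> \<le> a\<^sup>2 * (2 * (\<Sum>K\<in>patch e. edge_error e K))"
    unfolding power_mult_distrib by (intro mult_left_mono sum_patch_sqrt[OF K]) auto
  finally show ?thesis by simp
qed

text \<open>The test function with \<open>k = 1\<close> vanishes on \<open>e\<close>. So the shear forces and the line load do not contribute, and the moments are tested with the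
  normal derivative \<open>bump (1/2)\<close> times the bump times \<open>q\<close>, where \<open>q\<close> is the jump itself. This yields \<open>L bump (1/2) \<mu>\<^sup>2\<close> on the left-hand side of the
  residual identity, and a right-hand side that is linear in \<open>\<mu>\<close>.\<close>

lemma moment_jump_estimate:
  assumes e: "test_edge 1 e" and K: "K \<in> patch e" and ref: "edge_reference_bound (thickness \<kappa>) 1 r C"
  shows "diameter e * (L2norm (arc_measure e) (moment_jump e))\<^sup>2 \<le>
    moment_jump_const stress_const C * (\<Sum>K\<in>patch e. edge_error e K)"
proof -
  obtain q Q where Q: "polyfun r Q" "degree q \<le> r" "\<And>z. Q z = poly q (z $ 1)" "\<And>s. moment_jump e (arc_point e s) = poly q (s / diameter e)"
    by (rule edge_profile[OF K polyfun_moment_jump]) blast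
  have sQ: "smooth Q" by (rule smooth_polyfun[OF Q(1)])
  define L where "L = diameter e"
  have L: "L > 0" unfolding L_def using segment_arc_ends(4)[OF patch_segment[OF K]] .
  have C: "C > 0" using ref by (simp add: edge_reference_bound_def)
  define \<mu> where "\<mu> = sqrt (LINT s|lborel. bump s * (poly q s)\<^sup>2)"
  note mu = edge_reference_boundD(1,2)[OF ref Q(1-3), folded \<mu>_def] and rQ = edge_reference_boundD(3-)[OF ref Q(1-3), folded \<mu>_def]
  let ?w = "edge_test e 1 Q" and ?b = "bump (1/2)"
  have bp: "?b > 0" by (rule bump_pos) auto
  have wl: "?w (arc_point e s) = 0" for s using edge_test_line[OF K Q(3), of 1 s 0] by simp
  have "cut (patch e) ?w x = 0" if "x \<in> S" for x
  proof (rule ccontr)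
    assume n: "cut (patch e) ?w x \<noteq> 0"
    have "?w y = 0" if "y \<notin> edge_box e" for y using edge_test_nonzero[OF K] that by blast
    from cut_on_S[where p = ?w, OF e \<open>x \<in> S\<close> n this] have "x \<in> rel_interior e" by blast
    then obtain s where "x = arc_point e s" using edge_segment(4)[OF patchD[OF K]] by blast
    then have "?w x = 0" using wl by simp
    then show False using n by (simp add: cut_def split: if_splits)
  qed
  then have "(LINT x|arc_measure S. g x * cut (patch e) ?w x) = (LINT x|arc_measure S. 0)"
    using space_arc_measure[OF is_segment_S] by (intro Bochner_Integration.integral_cong) auto
  then have S0: "(LINT x|arc_measure S. g x * cut (patch e) ?w x) = 0" by simp
  have bw: "bounded {x. ?w x \<noteq> 0}" using edge_test_supported(1)[OF K sQ, of 1] by (simp add: supported_in_patch_def)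
  have "(\<Sum>K\<in>patch e. line_residual K (arc_start e) (edge_normal K e) ?w) =
    - (LINT s|lborel. (\<lambda>y. ?b * (bump y * (poly q y)\<^sup>2)) (s / L))"
    unfolding sum_line_residual[OF K smooth_edge_test[OF sQ] bw] edge_test_normal_derivative(2)[OF K Q(3) sQ] wl Q(4) L_def
    by (simp add: power2_eq_square mult_ac)
  also have "\<dots> = - (L * (?b * \<mu>\<^sup>2))" 
    using integral_line_scaled[OF L, of "\<lambda>y. ?b * (bump y * (poly q y)\<^sup>2)"] by (simp add: mu(2))
  finally have "\<bar>- (L * (?b * \<mu>\<^sup>2))\<bar> \<le> L ^ 1 * (C * \<mu>) / L * (4 * stress_const + 2) * (\<Sum>K\<in>patch e. sqrt (edge_error e K))"
    using edge_residual_bound[OF e K sQ, of "C * \<mu>"] rQ C mu(1) unfolding S0 L_def by simp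
  then have 1: "\<mu> * (L * ?b * \<mu>) \<le> \<mu> * (C * (4 * stress_const + 2) * (\<Sum>K\<in>patch e. sqrt (edge_error e K)))"
    using L bp by (simp add: abs_mult power2_eq_square mult_ac)
  have sc: "0 \<le> stress_const" using moment_const_nonneg by (simp add: stress_const_def)
  have X0: "0 \<le> (\<Sum>K\<in>patch e. sqrt (edge_error e K))" by (intro sum_nonneg) (simp add: edge_error_nonneg)
  have "L * ?b * \<mu> \<le> C * (4 * stress_const + 2) * (\<Sum>K\<in>patch e. sqrt (edge_error e K))"
  proof (cases "\<mu> = 0")
    case True then show ?thesis using C sc X0 by simp
  next
    case False
    then have "\<mu> > 0" using mu(1) by simp
    then show ?thesis using 1 by (simp only: mult_le_cancel_left_pos)
  qed
  from edge_error_sum[OF K this _ mu(1)]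
  have 2: "(L * ?b * \<mu>)\<^sup>2 \<le> 2 * (C * (4 * stress_const + 2))\<^sup>2 * (\<Sum>K\<in>patch e. edge_error e K)"
    using L bp by simp
  have "L * (L2norm (arc_measure e) (moment_jump e))\<^sup>2 \<le> L * (L * (C * \<mu>\<^sup>2))"
  proof (rule mult_left_mono)
    show "(L2norm (arc_measure e) (moment_jump e))\<^sup>2 \<le> L * (C * \<mu>\<^sup>2)" unfolding L_def
    proof (rule edge_norm_bound[OF K])
      show "continuous_on e (moment_jump e)" by (rule smooth_continuous[OF smooth_polyfun[OF polyfun_moment_jump]])
      show "(moment_jump e (arc_point e s))\<^sup>2 \<le> C * \<mu>\<^sup>2" if "s \<in> {0..diameter e}" for s
        unfolding Q(4) using rQ that L by (auto simp: L_def)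
    qed
  qed (use L in simp)
  also have "\<dots> = C / ?b\<^sup>2 * (L * ?b * \<mu>)\<^sup>2" using bp by (simp add: power2_eq_square)
  also have "\<dots> \<le> C / ?b\<^sup>2 * (2 * (C * (4 * stress_const + 2))\<^sup>2 * (\<Sum>K\<in>patch e. edge_error e K))"
    using 2 C by (intro mult_left_mono) auto
  also have "\<dots> = 2 * C ^ 3 * (4 * stress_const + 2)\<^sup>2 / ?b\<^sup>2 * (\<Sum>K\<in>patch e. edge_error e K)"
    by (simp add: power_mult_distrib power2_eq_square power3_eq_cube mult_ac)
  finally show ?thesis by (simp add: L_def moment_jump_const_def)
qed

text \<open>The test function with \<open>k = 0\<close> has normal derivative zero on \<open>e\<close>, so that the moments do not contribute. With \<open>q\<close> the difference of
  the jump and a polynomial approximation \<open>G\<close> of the load, the left-hand side of the residual identity is \<open>L bump (1/2) \<mu>\<^sup>2\<close> up to the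
  integral of \<open>(G - g) w\<close>, which is estimated by the Cauchy-Schwarz inequality on the edge.\<close>

lemma shear_jump_estimate:
  assumes e: "test_edge 0 e" and K: "K \<in> patch e" and ref: "edge_reference_bound (thickness \<kappa>) 0 N C"
    and N: "r \<le> N" and G: "polyfun N G" and GS: "e \<notin> edges_S \<T> S \<Longrightarrow> G = (\<lambda>x. 0)"
  defines "G_error \<equiv> (if e \<in> edges_S \<T> S then diameter e ^ 3 * (L2norm (arc_measure e) (\<lambda>x. G x - g x))\<^sup>2 else 0)"
  shows "diameter e ^ 3 * (L2norm (arc_measure e) (\<lambda>x. shear_jump e x - G x))\<^sup>2 \<le>
    shear_jump_const stress_const C * ((\<Sum>K\<in>patch e. edge_error e K) + G_error)"
proof -
  let ?J = "\<lambda>x. shear_jump e x - G x"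
  have pJ: "polyfun N ?J" by (intro polyfun_diff G polyfun_mono[OF polyfun_shear_jump N])
  obtain q Q where Q: "polyfun N Q" "degree q \<le> N" "\<And>z. Q z = poly q (z $ 1)" "\<And>s. ?J (arc_point e s) = poly q (s / diameter e)"
    by (rule edge_profile[OF K pJ]) blast
  have sQ: "smooth Q" by (rule smooth_polyfun[OF Q(1)])
  define L where "L = diameter e"
  note seg = patch_segment[OF K]
  have L: "L > 0" unfolding L_def using segment_arc_ends(4)[OF seg] .
  have C: "C > 0" using ref by (simp add: edge_reference_bound_def)
  define \<mu> where "\<mu> = sqrt (LINT s|lborel. bump s * (poly q s)\<^sup>2)"
  note mu = edge_reference_boundD(1,2)[OF ref Q(1-3), folded \<mu>_def] and rQ = edge_reference_boundD(3-)[OF ref Q(1-3), folded \<mu>_def]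
  define w where "w = edge_test e 0 Q"
  let ?b = "bump (1/2)" and ?X = "\<Sum>K\<in>patch e. sqrt (edge_error e K)"
  let ?ne = "L2norm (arc_measure e)"
  have bp: "?b > 0" by (rule bump_pos) auto
  have sw: "smooth w" unfolding w_def by (rule smooth_edge_test[OF sQ])
  have supw: "supported_in_patch (patch e) w" unfolding w_def by (rule edge_test_supported(1)[OF K sQ])
  have bw: "bounded {x. w x \<noteq> 0}" using supw by (simp add: supported_in_patch_def)
  have zw: "w x = 0" if "x \<notin> edge_box e" for x using edge_test_nonzero[OF K] that unfolding w_def by blast
  have wl: "w (arc_point e s) = bump (s / L) * poly q (s / L) * ?b" for s
    using edge_test_line[OF K Q(3), of 0 s 0] by (simp add: w_def L_def)
  have wb: "\<bar>w x\<bar> \<le> C * \<mu>" for x unfolding w_def edge_test_def using rQ by simp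
  have cw: "continuous_on e w" by (rule smooth_continuous[OF sw])
  have wL: "w \<in> L2 (arc_measure e)" by (rule arc_L2_continuous[OF seg cw])
  have line_arc: "(LINT s|lborel. h (arc_point e s) * w (arc_point e s)) = (LINT x|arc_measure e. h x * w x)"
    if "smooth h" for h
  proof -
    have c: "continuous_on e (\<lambda>x. h x * w x)" by (intro continuous_on_mult cw smooth_continuous[OF that])
    have "h (arc_point e s) * w (arc_point e s) = indicator {0..diameter e} s * (h (arc_point e s) * w (arc_point e s))" for s
      using edge_bump_line_zero[OF L, of s] wl[of s] by (auto simp: indicator_def L_def)
    then show ?thesis unfolding arc_integral[OF seg c] by (intro Bochner_Integration.integral_cong) auto
  qed
  define T where "T = (LINT x|arc_measure S. g x * cut (patch e) w x)"
  have eK: "x \<in> K" if "x \<in> e" for x using edge_segment(2)[OF patchD[OF K]] that by blast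
  have sJV: "smooth (shear_jump e)" and sG: "smooth G" using smooth_polyfun[OF polyfun_shear_jump] smooth_polyfun[OF G] by blast+
  have GL: "G \<in> L2 (arc_measure e)" and JL: "shear_jump e \<in> L2 (arc_measure e)"
    using arc_L2_continuous[OF seg smooth_continuous[OF sG]] arc_L2_continuous[OF seg smooth_continuous[OF sJV]] by blast+
  \<comment> \<open>The norm of the part of the load that \<open>G\<close> does not resolve; off \<open>S\<close> there is no load.\<close>
  define Z where "Z = (if e \<in> edges_S \<T> S then ?ne (\<lambda>x. G x - g x) else 0)"
  have Z0: "Z \<ge> 0" by (simp add: Z_def L2norm_def Bochner_Integration.integral_nonneg)
  have wn: "?ne w \<le> sqrt L * (C * \<mu>)"
  proof -
    have "(?ne w)\<^sup>2 \<le> diameter e * (C * \<mu>)\<^sup>2"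
    proof (rule edge_norm_bound[OF K cw])
      show "(w (arc_point e s))\<^sup>2 \<le> (C * \<mu>)\<^sup>2" for s
        using power_mono[OF wb, of "arc_point e s" 2] by simp
    qed
    then have "?ne w \<le> sqrt (L * (C * \<mu>)\<^sup>2)" unfolding L_def by (rule real_le_rsqrt)
    then show ?thesis using C mu(1) by (simp add: real_sqrt_mult)
  qed
  have split: "\<bar>(LINT x|arc_measure e. G x * w x) - T\<bar> \<le> Z * (sqrt L * (C * \<mu>))"
  proof (cases "e \<in> edges_S \<T> S")
    case True
    then have eS: "e \<subseteq> S" by (simp add: edges_S_def)
    note sub = arc_subsegment[OF seg is_segment_S eS g]
    have "S \<subseteq> closure \<Omega>"
    proof -
      have "K' \<subseteq> closure \<Omega>" if "K' \<in> \<T>" for K' using mesh that by (auto simp: plate_mesh_def)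
      moreover have "S \<subseteq> \<Union>\<T>"
      proof
        fix x assume "x \<in> S"
        then obtain e' where "e' \<in> edges_S \<T> S" "x \<in> e'" using S_edges by blast
        then obtain K' where "K' \<in> \<T>" "e' edge_of K'" "x \<in> e'" by (auto simp: edges_S_def interior_edges_def)
        then show "x \<in> \<Union>\<T>" using edge_segment(2) by blast
      qed
      ultimately show ?thesis by blast
    qed
    then have cS: "continuous_on S (cut (patch e) w)" using cut_continuous[OF supw] continuous_on_subset by blast
    have z: "cut (patch e) w x = 0" if "x \<in> S - e" for x
    proof (rule ccontr)
      assume n: "cut (patch e) w x \<noteq> 0"
      have "x \<in> S" using that by blast
      from cut_on_S[where p = w, OF e this n zw] have "x \<in> rel_interior e" by blast
      then show False using rel_interior_subset that by blast
    qed
    have "T = (LINT x|arc_measure e. g x * cut (patch e) w x)" unfolding T_def by (rule sub(2)[OF cS z])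
    also have "\<dots> = (LINT x|arc_measure e. g x * w x)"
      using space_arc_measure[OF seg] eK K by (intro Bochner_Integration.integral_cong) (auto simp: cut_def)
    finally have "(LINT x|arc_measure e. G x * w x) - T = (LINT x|arc_measure e. G x * w x - g x * w x)"
      using Bochner_Integration.integral_diff[OF L2_mult_integrable[OF GL wL] L2_mult_integrable[OF sub(1) wL]] by simp
    then have "\<bar>(LINT x|arc_measure e. G x * w x) - T\<bar> = \<bar>LINT x|arc_measure e. (G x - g x) * w x\<bar>" by (simp add: left_diff_distrib)
    also have "\<dots> \<le> Z * ?ne w" using L2_Cauchy_Schwarz[OF L2_diff[OF GL sub(1)] wL] True by (simp add: Z_def)
    also have "\<dots> \<le> Z * (sqrt L * (C * \<mu>))" using wn Z0 by (rule mult_left_mono)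
    finally show ?thesis .
  next
    case False
    have "cut (patch e) w x = 0" if "x \<in> S" for x
      using cut_on_S[where p = w, OF e that _ zw] False by blast
    then have "T = (LINT x|arc_measure S. 0)"
      unfolding T_def using space_arc_measure[OF is_segment_S] by (intro Bochner_Integration.integral_cong) auto
    then show ?thesis using GS[OF False] False by (simp add: Z_def)
  qed
  have "(\<Sum>K\<in>patch e. line_residual K (arc_start e) (edge_normal K e) w) = (LINT x|arc_measure e. shear_jump e x * w x)"
    unfolding sum_line_residual[OF K sw bw] edge_test_normal_derivative(1)[OF K Q(3) sQ, folded w_def]
    using line_arc[OF sJV] by simp
  moreover have "\<bar>(\<Sum>K\<in>patch e. line_residual K (arc_start e) (edge_normal K e) w) - T\<bar>
      \<le> L ^ 0 * (C * \<mu>) / L * (4 * stress_const + 2) * ?X"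
    unfolding T_def w_def L_def using rQ C mu(1) by (intro edge_residual_bound[OF e K sQ]) auto
  ultimately have "\<bar>(LINT x|arc_measure e. shear_jump e x * w x) - T\<bar> \<le> C * \<mu> / L * (4 * stress_const + 2) * ?X" by simp
  moreover have "(LINT x|arc_measure e. shear_jump e x * w x) - (LINT x|arc_measure e. G x * w x) = L * (?b * \<mu>\<^sup>2)"
  proof -
    have "(LINT x|arc_measure e. shear_jump e x * w x) - (LINT x|arc_measure e. G x * w x) = (LINT x|arc_measure e. ?J x * w x)"
      using Bochner_Integration.integral_diff[OF L2_mult_integrable[OF JL wL] L2_mult_integrable[OF GL wL]] by (simp add: left_diff_distrib)
    also have "\<dots> = (LINT s|lborel. ?J (arc_point e s) * w (arc_point e s))"
      by (rule line_arc[symmetric]) (rule smooth_polyfun[OF pJ])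
    also have "\<dots> = (LINT s|lborel. (\<lambda>y. ?b * (bump y * (poly q y)\<^sup>2)) (s / L))"
      unfolding Q(4) wl L_def by (simp add: power2_eq_square mult_ac)
    also have "\<dots> = L * (?b * \<mu>\<^sup>2)" 
    using integral_line_scaled[OF L, of "\<lambda>y. ?b * (bump y * (poly q y)\<^sup>2)"] by (simp add: mu(2))
    finally show ?thesis .
  qed
  ultimately have "L * (?b * \<mu>\<^sup>2) \<le> C * \<mu> / L * (4 * stress_const + 2) * ?X + Z * (sqrt L * (C * \<mu>))"
    using split by linarith
  then have "\<mu> * (L * ?b * \<mu>) \<le> \<mu> * (C / L * (4 * stress_const + 2) * ?X + Z * (sqrt L * C))"
    by (simp add: power2_eq_square distrib_left mult_ac)
  moreover have sc: "0 \<le> stress_const" using moment_const_nonneg by (simp add: stress_const_def)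
  moreover have X0: "0 \<le> ?X" by (intro sum_nonneg) (simp add: edge_error_nonneg)
  moreover have "0 \<le> C / L * (4 * stress_const + 2) * ?X + Z * (sqrt L * C)"
    using C L sc X0 Z0 by (intro add_nonneg_nonneg mult_nonneg_nonneg divide_nonneg_nonneg) auto
  ultimately have "L * ?b * \<mu> \<le> C / L * (4 * stress_const + 2) * ?X + Z * (sqrt L * C)"
    using mu(1) by (cases "\<mu> = 0") (simp, simp only: mult_le_cancel_left_pos)
  then have "L * (L * ?b * \<mu>) \<le> L * (C / L * (4 * stress_const + 2) * ?X + Z * (sqrt L * C))" using L by (intro mult_left_mono) auto
  also have "\<dots> = C * ((4 * stress_const + 2) * ?X + L * sqrt L * Z)" using L by (simp add: field_simps)
  finally have "(L * (L * ?b * \<mu>))\<^sup>2 \<le> (C * ((4 * stress_const + 2) * ?X + L * sqrt L * Z))\<^sup>2" using L bp mu(1) by (intro power_mono) auto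
  also have "\<dots> = C\<^sup>2 * ((4 * stress_const + 2) * ?X + L * sqrt L * Z)\<^sup>2" by (simp add: power_mult_distrib)
  also have "\<dots> \<le> C\<^sup>2 * (2 * (4 * stress_const + 2)\<^sup>2 * ?X\<^sup>2 + 2 * G_error)"
  proof (rule mult_left_mono)
    let ?p = "(4 * stress_const + 2) * ?X" and ?s = "L * sqrt L * Z"
    have "?s\<^sup>2 = G_error" using L by (simp add: G_error_def Z_def L_def power_mult_distrib power2_eq_square power3_eq_cube)
    moreover have "(?p + ?s)\<^sup>2 \<le> 2 * ?p\<^sup>2 + 2 * ?s\<^sup>2" using sum_squares_bound[of ?p ?s] by (simp add: power2_sum)
    ultimately show "(?p + ?s)\<^sup>2 \<le> 2 * (4 * stress_const + 2)\<^sup>2 * ?X\<^sup>2 + 2 * G_error" by (simp add: power_mult_distrib)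
  qed simp
  also have "\<dots> \<le> C\<^sup>2 * (4 * ((4 * stress_const + 2)\<^sup>2 + 1) * ((\<Sum>K\<in>patch e. edge_error e K) + G_error))"
  proof (rule mult_left_mono)
    define c where "c = (4 * stress_const + 2)\<^sup>2"
    let ?E = "\<Sum>K\<in>patch e. edge_error e K"
    have "c * ?X\<^sup>2 \<le> c * (2 * ?E)" unfolding c_def by (intro mult_left_mono sum_patch_sqrt[OF K]) simp
    moreover have "0 \<le> G_error" using L by (simp add: G_error_def L_def)
    moreover have "0 \<le> c * G_error" using calculation(2) by (simp add: c_def)
    moreover have "0 \<le> ?E" by (intro sum_nonneg edge_error_nonneg)
    moreover have "4 * (c + 1) * (?E + G_error) = 4 * (c * ?E) + 4 * (c * G_error) + 4 * ?E + 4 * G_error" by (simp add: algebra_simps)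
    ultimately show "2 * (4 * stress_const + 2)\<^sup>2 * ?X\<^sup>2 + 2 * G_error \<le> 4 * ((4 * stress_const + 2)\<^sup>2 + 1) * (?E + G_error)"
      unfolding c_def[symmetric] by (simp add: mult.assoc)
  qed simp
  finally have 2: "(L * (L * ?b * \<mu>))\<^sup>2 \<le> C\<^sup>2 * (4 * ((4 * stress_const + 2)\<^sup>2 + 1) * ((\<Sum>K\<in>patch e. edge_error e K) + G_error))" .
  have "L ^ 3 * (?ne ?J)\<^sup>2 \<le> L ^ 3 * (L * (C * \<mu>\<^sup>2))"
  proof (rule mult_left_mono)
    show "(?ne ?J)\<^sup>2 \<le> L * (C * \<mu>\<^sup>2)" unfolding L_def
    proof (rule edge_norm_bound[OF K])
      show "continuous_on e ?J" by (rule smooth_continuous[OF smooth_polyfun[OF pJ]])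
      show "(?J (arc_point e s))\<^sup>2 \<le> C * \<mu>\<^sup>2" if "s \<in> {0..diameter e}" for s
        unfolding Q(4) using rQ that L by (auto simp: L_def)
    qed
  qed (use L in simp)
  also have "\<dots> = C / ?b\<^sup>2 * (L * (L * ?b * \<mu>))\<^sup>2" using bp by (simp add: power2_eq_square power3_eq_cube)
  also have "\<dots> \<le> C / ?b\<^sup>2 * (C\<^sup>2 * (4 * ((4 * stress_const + 2)\<^sup>2 + 1) * ((\<Sum>K\<in>patch e. edge_error e K) + G_error)))"
    using 2 C by (intro mult_left_mono) auto
  also have "\<dots> = 4 * C ^ 3 * ((4 * stress_const + 2)\<^sup>2 + 1) / ?b\<^sup>2 * ((\<Sum>K\<in>patch e. edge_error e K) + G_error)"
    by (simp add: power2_eq_square power3_eq_cube mult_ac)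
  finally show ?thesis by (simp add: L_def shear_jump_const_def)
qed

end

section \<open>Summation over the mesh\<close>

context kirchhoff_mesh
begin

text \<open>Every triangle belongs to the patches of its own edges only.\<close>

lemma patch_sum_le:
  assumes E: "E \<subseteq> edges \<T>" and y: "\<And>K. K \<in> \<T> \<Longrightarrow> (0::real) \<le> y K"
  shows "(\<Sum>e\<in>E. \<Sum>K\<in>patch e. y K) \<le> 8 * (\<Sum>K\<in>\<T>. y K)"
proof -
  have "(\<Sum>e\<in>E. \<Sum>K\<in>patch e. y K) \<le> (\<Sum>e\<in>edges \<T>. \<Sum>K\<in>patch e. y K)"
    by (intro sum_mono2 finite_edges E sum_nonneg y) (simp add: patch_def)
  also have "\<dots> = (\<Sum>K\<in>\<T>. \<Sum>e | e \<in> edges \<T> \<and> e edge_of K. y K)"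
    unfolding patch_def by (rule sum.swap_restrict[OF finite_edges finite_mesh])
  also have "\<dots> \<le> (\<Sum>K\<in>\<T>. 8 * y K)"
  proof (rule sum_mono)
    fix K assume K: "K \<in> \<T>"
    have "card {e \<in> edges \<T>. e edge_of K} \<le> card {e. e edge_of K}"
      by (intro card_mono card_edges_of_triangle(1)[OF K]) auto
    then have "real (card {e \<in> edges \<T>. e edge_of K}) \<le> 8" using card_edges_of_triangle(2)[OF K] by linarith
    then show "(\<Sum>e | e \<in> edges \<T> \<and> e edge_of K. y K) \<le> 8 * y K"
      using mult_right_mono[OF _ y[OF K]] by simp
  qed
  also have "\<dots> = 8 * (\<Sum>K\<in>\<T>. y K)" by (simp add: sum_distrib_left)
  finally show ?thesis .
qed

lemma interior_edge_in_edges: "interior_edges \<T> \<subseteq> edges \<T>"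
  by (auto simp: interior_edges_def edges_def)

lemma boundary_edge_not_interior: "e \<in> edges \<T> \<Longrightarrow> e \<subseteq> frontier \<Omega> \<Longrightarrow> e \<notin> interior_edges \<T>"
proof
  assume e: "e \<in> edges \<T>" "e \<subseteq> frontier \<Omega>" "e \<in> interior_edges \<T>"
  obtain K K' where "K \<in> patch e" "K' \<in> patch e" "K \<noteq> K'" using interior_edge_pair[OF e(3)] by metis
  then show False using boundary_edge_patch(2)[OF e(1,2)] by simp
qed

lemma patch_of_edge: "e \<in> edges \<T> \<Longrightarrow> \<exists>K. K \<in> patch e"
  by (auto simp: edges_def patch_def)

end

context plate_problem
begin

text \<open>The estimator orders the triangles at an edge arbitrarily, so the jump of the moments agrees with the signed sum up to the sign only.\<close>

lemma jump_eq:
  assumes e: "e \<in> interior_edges \<T>"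
  shows "jump_V d Y \<nu> \<T> e uh x = shear_jump e x" "(jump_M d Y \<nu> \<T> e uh x)\<^sup>2 = (moment_jump e x)\<^sup>2"
proof -
  obtain K K' where K: "adjacent_pair \<T> e = (K, K')" "K \<in> patch e" "K' \<in> patch e" "K \<noteq> K'"
    "patch e = {K, K'}" "edge_normal K' e = - edge_normal K e" using interior_edge_pair[OF e] by metis
  show "jump_V d Y \<nu> \<T> e uh x = shear_jump e x" using K(4) by (simp add: jump_V_def shear_jump_def K(1,5))
  have "(patch_sign e K' + patch_sign e K) *\<^sub>R edge_perp e = 0"
    using K(6) unfolding edge_normal_sign(1)[OF K(2)] edge_normal_sign(1)[OF K(3)] by (simp add: scaleR_add_left)
  moreover have "edge_perp e \<noteq> 0"
  proof
    assume "edge_perp e = 0"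
    then have "norm (arc_dir e) = 0" using norm_perp[of "arc_dir e"] by (simp add: edge_perp_def)
    then show False using segment_arc_ends(5)[OF patch_segment[OF K(2)]] by simp
  qed
  ultimately have "patch_sign e K' = - patch_sign e K" by (simp add: eq_neg_iff_add_eq_0)
  then have "moment_jump e x = patch_sign e K * jump_M d Y \<nu> \<T> e uh x"
    using K(4) by (simp add: jump_M_def moment_jump_def K(1,5) right_diff_distrib)
  moreover have "(patch_sign e K)\<^sup>2 = 1" by (simp add: patch_sign_def)
  ultimately show "(jump_M d Y \<nu> \<T> e uh x)\<^sup>2 = (moment_jump e x)\<^sup>2" by (simp add: power_mult_distrib)
qed

lemma bdry_eq:
  assumes e: "e \<in> edges \<T>" "e \<subseteq> frontier \<Omega>"
  shows "bdry_V d Y \<nu> \<T> e uh x = shear_jump e x" "(bdry_M d Y \<nu> \<T> e uh x)\<^sup>2 = (moment_jump e x)\<^sup>2"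
  by (simp_all add: bdry_V_def bdry_M_def shear_jump_def moment_jump_def boundary_edge_patch(2)[OF e] patch_sign_def Let_def)

definition load_osc :: "(real^2) set \<Rightarrow> real" where
  "load_osc e = (if e \<in> edges_S \<T> S then diameter e ^ 3 * (L2norm (arc_measure e) (\<lambda>x. g x - gh e x))\<^sup>2 else 0)"

lemma local_bound_nonneg: "0 \<le> local_bound K"
  using local_error_nonneg by (simp add: local_bound_def)

lemma edge_error_bound:
  assumes ref: "square_reference_bound (max 1 \<kappa> + 1) r C" and K: "K \<in> patch e"
  shows "edge_error e K \<le> (1 + element_const \<kappa> stress_const C) * local_bound K"
proof -
  let ?R = "(L2norm (lebesgue_on K) (element_residual K))\<^sup>2"
  have "diameter e ^ 4 * ?R \<le> diameter K ^ 4 * ?R"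
    using edge_segment(5)[OF patchD[OF K]] segment_arc_ends(4)[OF patch_segment[OF K]]
    by (intro mult_right_mono power_mono) auto
  moreover have "local_error K \<le> local_bound K" by (simp add: local_bound_def)
  ultimately show ?thesis
    using element_estimate[OF ref patchD(1)[OF K]] by (simp add: edge_error_def distrib_right)
qed

lemma edge_error_sum_bound:
  assumes ref: "square_reference_bound (max 1 \<kappa> + 1) r C" and E: "E \<subseteq> edges \<T>"
  shows "(\<Sum>e\<in>E. \<Sum>K\<in>patch e. edge_error e K) \<le> 8 * (1 + element_const \<kappa> stress_const C) * (\<Sum>K\<in>\<T>. local_bound K)"
proof -
  let ?A = "1 + element_const \<kappa> stress_const C"
  have A: "0 \<le> ?A" using ref by (simp add: element_const_def square_reference_bound_def)
  have "(\<Sum>e\<in>E. \<Sum>K\<in>patch e. edge_error e K) \<le> (\<Sum>e\<in>E. \<Sum>K\<in>patch e. ?A * local_bound K)"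
    by (intro sum_mono edge_error_bound[OF ref])
  also have "\<dots> \<le> 8 * (\<Sum>K\<in>\<T>. ?A * local_bound K)"
    using A local_bound_nonneg by (intro patch_sum_le[OF E] mult_nonneg_nonneg)
  also have "\<dots> = 8 * ?A * (\<Sum>K\<in>\<T>. local_bound K)" by (simp only: sum_distrib_left mult.assoc)
  finally show ?thesis .
qed

lemma moment_jump_sum:
  assumes ref: "edge_reference_bound (thickness \<kappa>) 1 r C" and E: "E \<subseteq> edges \<T>" "\<And>e. e \<in> E \<Longrightarrow> test_edge 1 e"
  shows "(\<Sum>e\<in>E. diameter e * (L2norm (arc_measure e) (moment_jump e))\<^sup>2) \<le>
    moment_jump_const stress_const C * (\<Sum>e\<in>E. \<Sum>K\<in>patch e. edge_error e K)"
  unfolding sum_distrib_left[of _ _ E]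
proof (rule sum_mono)
  fix e assume e: "e \<in> E"
  then obtain K where "K \<in> patch e" using patch_of_edge E(1) by blast
  from moment_jump_estimate[OF E(2)[OF e] this ref]
  show "diameter e * (L2norm (arc_measure e) (moment_jump e))\<^sup>2 \<le> moment_jump_const stress_const C * (\<Sum>K\<in>patch e. edge_error e K)"
    by (simp add: moment_jump_const_def)
qed

text \<open>The approximation \<open>gh e\<close> coincides on \<open>e\<close> with a polynomial, which is used for \<open>G\<close>. Replacing it by \<open>g\<close> in the result costs the oscillation of \<open>g\<close>
  once more.\<close>

lemma shear_jump_bound:
  assumes ref: "edge_reference_bound (thickness \<kappa>) 0 (max r m) C" and e: "test_edge 0 e" and K: "K \<in> patch e"
  shows "diameter e ^ 3 * (L2norm (arc_measure e) (\<lambda>x. shear_jump e x - (if e \<in> edges_S \<T> S then g x else 0)))\<^sup>2 \<le>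
    (2 * shear_jump_const stress_const C + 2) * ((\<Sum>K\<in>patch e. edge_error e K) + load_osc e)"
proof -
  note seg = patch_segment[OF K]
  have L: "diameter e > 0" using segment_arc_ends(4)[OF seg] .
  let ?E = "\<Sum>K\<in>patch e. edge_error e K" and ?n = "L2norm (arc_measure e)" and ?c = "shear_jump_const stress_const C"
  have C: "C > 0" using ref by (simp add: edge_reference_bound_def)
  have c0: "0 \<le> ?c" using C by (simp add: shear_jump_const_def)
  have E0: "0 \<le> ?E" by (intro sum_nonneg edge_error_nonneg)
  show ?thesis
  proof (cases "e \<in> edges_S \<T> S")
    case True
    obtain p where p: "poly_of_degree m p" "\<forall>x\<in>e. gh e x = p x" using gh[OF True] by blast
    have pm: "polyfun (max r m) p" by (rule polyfun_mono[OF poly_of_degree_polyfun[OF p(1)]]) simp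
    have gL: "g \<in> L2 (arc_measure e)"
      using arc_subsegment(1)[OF seg is_segment_S _ g] True by (auto simp: edges_S_def)
    have smL: "h \<in> L2 (arc_measure e)" if "smooth h" for h
      by (rule arc_L2_continuous[OF seg smooth_continuous[OF that]])
    have pL: "p \<in> L2 (arc_measure e)" by (rule smL[OF smooth_polyfun[OF pm]])
    have JL: "shear_jump e \<in> L2 (arc_measure e)" by (rule smL[OF smooth_polyfun[OF polyfun_shear_jump]])
    have o1: "(?n (\<lambda>x. p x - g x))\<^sup>2 = (?n (\<lambda>x. g x - gh e x))\<^sup>2"
      unfolding L2norm_sq using p(2) space_arc_measure[OF seg]
      by (intro Bochner_Integration.integral_cong) (auto simp: power2_commute)
    have o: "load_osc e = diameter e ^ 3 * (?n (\<lambda>x. p x - g x))\<^sup>2" using True by (simp add: load_osc_def o1)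
    have 1: "diameter e ^ 3 * (?n (\<lambda>x. shear_jump e x - p x))\<^sup>2 \<le> ?c * (?E + load_osc e)"
      using shear_jump_estimate[OF e K ref _ pm] True by (simp add: shear_jump_const_def o)
    have "(?n (\<lambda>x. (shear_jump e x - p x) + (p x - g x)))\<^sup>2 \<le> 2 * (?n (\<lambda>x. shear_jump e x - p x))\<^sup>2 + 2 * (?n (\<lambda>x. p x - g x))\<^sup>2"
      by (rule L2norm_add_sq[OF L2_diff[OF JL pL] L2_diff[OF pL gL]])
    then have "diameter e ^ 3 * (?n (\<lambda>x. shear_jump e x - g x))\<^sup>2 \<le> diameter e ^ 3 * (2 * (?n (\<lambda>x. shear_jump e x - p x))\<^sup>2 + 2 * (?n (\<lambda>x. p x - g x))\<^sup>2)"
      using L by (intro mult_left_mono) simp_all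
    also have "\<dots> = 2 * (diameter e ^ 3 * (?n (\<lambda>x. shear_jump e x - p x))\<^sup>2) + 2 * load_osc e" unfolding o by (simp add: distrib_left)
    also have "\<dots> \<le> 2 * (?c * (?E + load_osc e)) + 2 * (?E + load_osc e)"
      using E0 by (intro add_mono mult_left_mono 1) auto
    finally have "diameter e ^ 3 * (?n (\<lambda>x. shear_jump e x - g x))\<^sup>2 \<le> 2 * (?c * (?E + load_osc e)) + 2 * (?E + load_osc e)" .
    then show ?thesis using True by (simp add: distrib_right)
  next
    case False
    have "diameter e ^ 3 * (?n (\<lambda>x. shear_jump e x - 0))\<^sup>2 \<le> ?c * ?E"
      using shear_jump_estimate[OF e K ref _ polyfun.const[of "max r m" 0]] False by (simp add: shear_jump_const_def)
    also have "\<dots> \<le> (2 * ?c + 2) * ?E" using c0 E0 by (intro mult_right_mono) auto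
    finally show ?thesis using False by (simp add: load_osc_def)
  qed
qed

lemma shear_jump_sum:
  assumes ref: "edge_reference_bound (thickness \<kappa>) 0 (max r m) C" and E: "E \<subseteq> edges \<T>" "\<And>e. e \<in> E \<Longrightarrow> test_edge 0 e"
  shows "(\<Sum>e\<in>E. diameter e ^ 3 * (L2norm (arc_measure e) (\<lambda>x. shear_jump e x - (if e \<in> edges_S \<T> S then g x else 0)))\<^sup>2) \<le>
    (2 * shear_jump_const stress_const C + 2) * ((\<Sum>e\<in>E. \<Sum>K\<in>patch e. edge_error e K) + (\<Sum>e\<in>E. load_osc e))"
  unfolding sum.distrib[symmetric] sum_distrib_left[of _ _ E]
proof (rule sum_mono)
  fix e assume e: "e \<in> E"
  then obtain K where "K \<in> patch e" using patch_of_edge E(1) by blast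
  from shear_jump_bound[OF ref E(2)[OF e] this]
  show "diameter e ^ 3 * (L2norm (arc_measure e) (\<lambda>x. shear_jump e x - (if e \<in> edges_S \<T> S then g x else 0)))\<^sup>2
     \<le> (2 * shear_jump_const stress_const C + 2) * ((\<Sum>K\<in>patch e. edge_error e K) + load_osc e)" .
qed

text \<open>All constants are functions of the reference bounds, of \<open>\<kappa>\<close> and of the material parameters. In \<open>16 B + 24 D\<close>, the factors count
  two families of edges for the moments and three for the shear forces, times the number 8 of edges per triangle.\<close>

lemma estimator_bound:
  assumes C0: "square_reference_bound (max 1 \<kappa> + 1) r C0"
    and C1: "edge_reference_bound (thickness \<kappa>) 1 r C1" and C2: "edge_reference_bound (thickness \<kappa>) 0 (max r m) C2"
  defines "A \<equiv> element_const \<kappa> stress_const C0"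
    and "B \<equiv> moment_jump_const stress_const C1" and "D \<equiv> 2 * shear_jump_const stress_const C2 + 2"
  shows "estimator d Y \<nu> \<Gamma>s \<Gamma>f S \<T> f g uh \<le>
    sqrt (A + (16 * B + 24 * D) * (1 + A) + D) * (H2norm \<Omega> (\<lambda>x. u x - uh x) + osc_f \<T> f fh + osc_g \<T> S g gh)"
proof -
  let ?X = "\<Sum>K\<in>\<T>. local_bound K" and ?O = "\<Sum>e\<in>edges_S \<T> S. load_osc e"
  have A0: "A \<ge> 0" using C0 by (simp add: A_def element_const_def square_reference_bound_def)
  have B0: "B \<ge> 0" using C1 by (simp add: B_def moment_jump_const_def edge_reference_bound_def)
  have D0: "D \<ge> 0" using C2 by (simp add: D_def shear_jump_const_def edge_reference_bound_def)
  have X0: "?X \<ge> 0" by (intro sum_nonneg local_bound_nonneg)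
  have O0: "?O \<ge> 0" by (intro sum_nonneg) (auto simp: load_osc_def intro!: mult_nonneg_nonneg diameter_ge_0 zero_le_power
      compact_imp_bounded segment_compact[OF edge_segment(1)] simp: edges_S_def interior_edges_def)
  let ?I = "interior_edges \<T>" and ?S = "edges_S \<T> S"
  have SI: "?S \<subseteq> ?I" by (auto simp: edges_S_def)
  have tI: "test_edge k e" if "e \<in> ?I" for k e
    using that patch_of_edge interior_edge_in_edges by (fastforce simp: test_edge_def)
  have tf: "test_edge k e" if "e \<in> edges_on \<T> \<Gamma>f" for k e
    using that patch_of_edge[of e] by (auto simp: test_edge_def edges_on_def)
  have ts: "test_edge 1 e" if "e \<in> edges_on \<T> \<Gamma>s" for e
    using that patch_of_edge[of e] by (auto simp: test_edge_def edges_on_def)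
  have bE: "e \<in> edges \<T> \<and> e \<subseteq> frontier \<Omega>" if "e \<in> edges_on \<T> \<Gamma>f \<union> edges_on \<T> \<Gamma>s" for e
    using that boundary_parts(2,3) by (auto simp: edges_on_def)
  have bS: "e \<notin> ?S" if "e \<in> edges_on \<T> \<Gamma>f \<union> edges_on \<T> \<Gamma>s" for e
    using bE[OF that] boundary_edge_not_interior SI by blast
  note eB = edge_error_sum_bound[OF C0, folded A_def]
  have V: "(\<Sum>e\<in>E. diameter e ^ 3 * (L2norm (arc_measure e) (\<lambda>x. shear_jump e x - (if e \<in> ?S then g x else 0)))\<^sup>2) \<le>
      D * (8 * (1 + A) * ?X + (\<Sum>e\<in>E. load_osc e))" if "E \<subseteq> edges \<T>" "\<And>e. e \<in> E \<Longrightarrow> test_edge 0 e" for E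
  proof -
    note shear_jump_sum[OF C2 that, folded D_def]
    also have "D * ((\<Sum>e\<in>E. \<Sum>K\<in>patch e. edge_error e K) + (\<Sum>e\<in>E. load_osc e)) \<le> D * (8 * (1 + A) * ?X + (\<Sum>e\<in>E. load_osc e))"
      by (intro mult_left_mono add_right_mono eB that(1) D0)
    finally show ?thesis .
  qed
  have M: "(\<Sum>e\<in>E. diameter e * (L2norm (arc_measure e) (moment_jump e))\<^sup>2) \<le> B * (8 * (1 + A) * ?X)"
    if "E \<subseteq> edges \<T>" "\<And>e. e \<in> E \<Longrightarrow> test_edge 1 e" for E
  proof -
    note moment_jump_sum[OF C1 that, folded B_def]
    also have "B * (\<Sum>e\<in>E. \<Sum>K\<in>patch e. edge_error e K) \<le> B * (8 * (1 + A) * ?X)"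
      by (intro mult_left_mono eB that(1) B0)
    finally show ?thesis .
  qed
  have nM: "(L2norm (arc_measure e) h)\<^sup>2 = (L2norm (arc_measure e) h')\<^sup>2" if "\<And>x. (h x)\<^sup>2 = (h' x)\<^sup>2" for e h h'
    unfolding L2norm_sq that ..
  have t1: "(\<Sum>K\<in>\<T>. diameter K ^ 4 * (L2norm (lebesgue_on K) (\<lambda>x. plate_op d Y \<nu> (piece K uh) x - f x))\<^sup>2) \<le> A * ?X"
    unfolding sum_distrib_left A_def
    using element_estimate[OF C0] by (intro sum_mono) (simp add: element_residual_def[abs_def])
  have "(\<Sum>e\<in>?S. diameter e ^ 3 * (L2norm (arc_measure e) (\<lambda>x. jump_V d Y \<nu> \<T> e uh x - g x))\<^sup>2) =
      (\<Sum>e\<in>?S. diameter e ^ 3 * (L2norm (arc_measure e) (\<lambda>x. shear_jump e x - (if e \<in> ?S then g x else 0)))\<^sup>2)"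
    using jump_eq(1) SI by (intro sum.cong refl) (simp add: subset_iff)
  also have "\<dots> \<le> D * (8 * (1 + A) * ?X + ?O)" using SI interior_edge_in_edges tI by (intro V) blast+
  finally have t2: "(\<Sum>e\<in>?S. diameter e ^ 3 * (L2norm (arc_measure e) (\<lambda>x. jump_V d Y \<nu> \<T> e uh x - g x))\<^sup>2) \<le> \<dots>" .
  have o0: "(\<Sum>e\<in>E. load_osc e) = 0" if "\<And>e. e \<in> E \<Longrightarrow> e \<notin> ?S" for E
    using that by (intro sum.neutral) (simp add: load_osc_def)
  have "(\<Sum>e\<in>?I - ?S. diameter e ^ 3 * (L2norm (arc_measure e) (jump_V d Y \<nu> \<T> e uh))\<^sup>2) =
      (\<Sum>e\<in>?I - ?S. diameter e ^ 3 * (L2norm (arc_measure e) (\<lambda>x. shear_jump e x - (if e \<in> ?S then g x else 0)))\<^sup>2)"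
  proof (intro sum.cong refl arg_cong2[where f = "(*)"] nM)
    show "(jump_V d Y \<nu> \<T> e uh x)\<^sup>2 = (shear_jump e x - (if e \<in> ?S then g x else 0))\<^sup>2" if "e \<in> ?I - ?S" for e x
      using that jump_eq(1)[of e x] by simp
  qed
  also have "\<dots> \<le> D * (8 * (1 + A) * ?X + (\<Sum>e\<in>?I - ?S. load_osc e))" using interior_edge_in_edges tI by (intro V) blast+
  finally have t3: "(\<Sum>e\<in>?I - ?S. diameter e ^ 3 * (L2norm (arc_measure e) (jump_V d Y \<nu> \<T> e uh))\<^sup>2) \<le> D * (8 * (1 + A) * ?X)"
    using o0[of "?I - ?S"] by simp
  have "(\<Sum>e\<in>?I. diameter e * (L2norm (arc_measure e) (jump_M d Y \<nu> \<T> e uh))\<^sup>2) =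
      (\<Sum>e\<in>?I. diameter e * (L2norm (arc_measure e) (moment_jump e))\<^sup>2)"
    by (intro sum.cong refl arg_cong2[where f = "(*)"] nM jump_eq(2))
  also have "\<dots> \<le> B * (8 * (1 + A) * ?X)" using interior_edge_in_edges tI by (intro M) blast+
  finally have t4: "(\<Sum>e\<in>?I. diameter e * (L2norm (arc_measure e) (jump_M d Y \<nu> \<T> e uh))\<^sup>2) \<le> \<dots>" .
  let ?F = "edges_on \<T> \<Gamma>f"
  have "(\<Sum>e\<in>?F. diameter e ^ 3 * (L2norm (arc_measure e) (bdry_V d Y \<nu> \<T> e uh))\<^sup>2) =
      (\<Sum>e\<in>?F. diameter e ^ 3 * (L2norm (arc_measure e) (\<lambda>x. shear_jump e x - (if e \<in> ?S then g x else 0)))\<^sup>2)"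
  proof (intro sum.cong refl arg_cong2[where f = "(*)"] nM)
    show "(bdry_V d Y \<nu> \<T> e uh x)\<^sup>2 = (shear_jump e x - (if e \<in> ?S then g x else 0))\<^sup>2" if "e \<in> ?F" for e x
      using that bE[of e] bS[of e] bdry_eq(1)[of e x] by simp
  qed
  also have "\<dots> \<le> D * (8 * (1 + A) * ?X + (\<Sum>e\<in>?F. load_osc e))" using bE tf by (intro V) blast+
  finally have t5: "(\<Sum>e\<in>?F. diameter e ^ 3 * (L2norm (arc_measure e) (bdry_V d Y \<nu> \<T> e uh))\<^sup>2) \<le> D * (8 * (1 + A) * ?X)"
    using o0[of ?F] bS by simp
  let ?G = "edges_on \<T> \<Gamma>f \<union> edges_on \<T> \<Gamma>s"
  have "(\<Sum>e\<in>?G. diameter e * (L2norm (arc_measure e) (bdry_M d Y \<nu> \<T> e uh))\<^sup>2) =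
      (\<Sum>e\<in>?G. diameter e * (L2norm (arc_measure e) (moment_jump e))\<^sup>2)"
  proof (intro sum.cong refl arg_cong2[where f = "(*)"] nM)
    show "(bdry_M d Y \<nu> \<T> e uh x)\<^sup>2 = (moment_jump e x)\<^sup>2" if "e \<in> ?G" for e x using bdry_eq(2) bE[OF that] by blast
  qed
  also have "\<dots> \<le> B * (8 * (1 + A) * ?X)" using bE tf ts by (intro M) blast+
  finally have t6: "(\<Sum>e\<in>?G. diameter e * (L2norm (arc_measure e) (bdry_M d Y \<nu> \<T> e uh))\<^sup>2) \<le> \<dots>" .
  let ?C = "A + (16 * B + 24 * D) * (1 + A) + D"
  have C0': "?C \<ge> 0" using A0 B0 D0 by simp
  let ?H = "H2norm \<Omega> (\<lambda>x. u x - uh x)"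
  have H: "?H \<ge> 0" "osc_f \<T> f fh \<ge> 0" "osc_g \<T> S g gh \<ge> 0"
    by (auto simp: H2norm_def osc_f_def osc_g_def intro!: sum_nonneg add_nonneg_nonneg)
  have XO: "?X + ?O \<le> (?H + osc_f \<T> f fh + osc_g \<T> S g gh)\<^sup>2"
  proof -
    have "?X = (\<Sum>K\<in>\<T>. local_error K) + (osc_f \<T> f fh)\<^sup>2"
      by (simp add: local_bound_def sum.distrib osc_f_def sum_nonneg power_mult_distrib flip: power_mult)
    moreover have "?O = (osc_g \<T> S g gh)\<^sup>2"
    proof -
      have "(osc_g \<T> S g gh)\<^sup>2 = (\<Sum>e\<in>?S. (diameter e powr (3/2) * L2norm (arc_measure e) (\<lambda>x. g x - gh e x))\<^sup>2)"
        by (simp add: osc_g_def sum_nonneg)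
      also have "\<dots> = ?O"
      proof (intro sum.cong refl)
        fix e assume e: "e \<in> ?S"
        then have "e \<in> edges \<T>" using SI interior_edge_in_edges by blast
        then obtain K where K: "K \<in> patch e" using patch_of_edge by blast
        have "diameter e > 0" using segment_arc_ends(4)[OF patch_segment[OF K]] .
        then have "(diameter e powr (3/2))\<^sup>2 = diameter e ^ 3" by (simp add: powr_powr flip: powr_numeral)
        then show "(diameter e powr (3/2) * L2norm (arc_measure e) (\<lambda>x. g x - gh e x))\<^sup>2 = load_osc e"
          using e by (simp add: load_osc_def power_mult_distrib)
      qed
      finally show ?thesis by simp
    qed
    moreover have "?H\<^sup>2 + (osc_f \<T> f fh)\<^sup>2 + (osc_g \<T> S g gh)\<^sup>2 \<le> (?H + osc_f \<T> f fh + osc_g \<T> S g gh)\<^sup>2"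
      using H by (simp add: power2_eq_square algebra_simps)
    ultimately show ?thesis using sum_local_error by linarith
  qed
  have "A * ?X + D * (8 * (1 + A) * ?X + ?O) + D * (8 * (1 + A) * ?X) + B * (8 * (1 + A) * ?X)
      + D * (8 * (1 + A) * ?X) + B * (8 * (1 + A) * ?X) = (A + (16 * B + 24 * D) * (1 + A)) * ?X + D * ?O"
    by (simp add: algebra_simps)
  also have "\<dots> \<le> ?C * ?X + ?C * ?O"
    using A0 B0 D0 by (intro add_mono[OF mult_right_mono[OF _ X0] mult_right_mono[OF _ O0]]) auto
  also have "\<dots> = ?C * (?X + ?O)" by (simp add: distrib_left)
  also have "\<dots> \<le> ?C * (?H + osc_f \<T> f fh + osc_g \<T> S g gh)\<^sup>2" by (rule mult_left_mono[OF XO C0'])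
  finally have "A * ?X + D * (8 * (1 + A) * ?X + ?O) + D * (8 * (1 + A) * ?X) + B * (8 * (1 + A) * ?X)
      + D * (8 * (1 + A) * ?X) + B * (8 * (1 + A) * ?X) \<le> ?C * (?H + osc_f \<T> f fh + osc_g \<T> S g gh)\<^sup>2" .
  then have "estimator d Y \<nu> \<Gamma>s \<Gamma>f S \<T> f g uh \<le> sqrt (?C * (?H + osc_f \<T> f fh + osc_g \<T> S g gh)\<^sup>2)"
    unfolding estimator_def
    by (intro real_sqrt_le_mono order_trans[OF add_mono[OF add_mono[OF add_mono[OF add_mono[OF add_mono[OF t1 t2] t3] t4] t5] t6]])
  also have "\<dots> = sqrt ?C * (?H + osc_f \<T> f fh + osc_g \<T> S g gh)" using H by (simp add: real_sqrt_mult)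
  finally show ?thesis .
qed

end

theorem theorem3p3:
  fixes \<Omega> \<Gamma>c \<Gamma>s \<Gamma>f :: "(real^2) set" and d Y \<nu> \<kappa> :: real and r m :: nat
  assumes "polygonal_domain \<Omega>" and "boundary_partition \<Omega> \<Gamma>c \<Gamma>s \<Gamma>f"
    and "d > 0" and "Y > 0" and "- 1 < \<nu>" and "\<nu> \<le> 1/2"
    and "plate_coercive \<Omega> \<Gamma>c \<Gamma>s d Y \<nu>"
  shows "\<exists>C>0. \<forall>(\<T> :: (real^2) set set) (S :: (real^2) set) (x0 :: real^2)
      (f :: real^2 \<Rightarrow> real) (g :: real^2 \<Rightarrow> real) (F :: real)
      (Vh :: (real^2 \<Rightarrow> real) set) (u :: real^2 \<Rightarrow> real) (uh :: real^2 \<Rightarrow> real)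
      (fh :: real^2 \<Rightarrow> real) (gh :: (real^2) set \<Rightarrow> real^2 \<Rightarrow> real).
    plate_mesh \<Omega> \<Gamma>c \<Gamma>s \<Gamma>f \<kappa> \<T> \<and>
    (\<exists>p q. p \<noteq> q \<and> S = closed_segment p q \<and> open_segment p q \<subseteq> \<Omega>) \<and>
    S = \<Union>(edges_S \<T> S) \<and>
    x0 \<in> \<Omega> \<and> (\<exists>K\<in>\<T>. x0 extreme_point_of K) \<and>
    f \<in> L2 (lebesgue_on \<Omega>) \<and> g \<in> L2 (arc_measure S) \<and>
    fe_space \<Omega> \<Gamma>c \<Gamma>s \<T> r Vh \<and>
    u \<in> plate_space \<Omega> \<Gamma>c \<Gamma>s \<and>
    (\<forall>v\<in>plate_space \<Omega> \<Gamma>c \<Gamma>s. plate_form \<Omega> d Y \<nu> u v = plate_load \<Omega> S x0 f g F v) \<and>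
    uh \<in> Vh \<and>
    (\<forall>v\<in>Vh. plate_form \<Omega> d Y \<nu> uh v = plate_load \<Omega> S x0 f g F v) \<and>
    fh \<in> Vh \<and>
    (\<forall>e\<in>edges_S \<T> S. \<exists>p. poly_of_degree m p \<and> (\<forall>x\<in>e. gh e x = p x))
    \<longrightarrow> estimator d Y \<nu> \<Gamma>s \<Gamma>f S \<T> f g uh
        \<le> C * (H2norm \<Omega> (\<lambda>x. u x - uh x) + osc_f \<T> f fh + osc_g \<T> S g gh)"
proof -
  have "1 \<le> max 1 \<kappa> + 1" by simp
  then obtain C0 where C0: "square_reference_bound (max 1 \<kappa> + 1) r C0" using square_bump_reference by blast
  have th: "0 < thickness \<kappa>" "thickness \<kappa> \<le> 1" using thickness(1,2)[of \<kappa>] by linarith+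
  obtain C1 where C1: "edge_reference_bound (thickness \<kappa>) 1 r C1" using edge_bump_reference[OF th] by blast
  obtain C2 where C2: "edge_reference_bound (thickness \<kappa>) 0 (max r m) C2" using edge_bump_reference[OF th] by blast
  \<comment> \<open>The value of \<open>stress_const\<close>, which does not depend on the mesh.\<close>
  define s where "s = 16 * moment_const d Y \<nu>"
  define A where "A = element_const \<kappa> s C0"
  define B where "B = moment_jump_const s C1"
  define D where "D = 2 * shear_jump_const s C2 + 2"
  define C where "C = sqrt (A + (16 * B + 24 * D) * (1 + A) + D)"
  have "A \<ge> 0" using C0 by (simp add: A_def element_const_def square_reference_bound_def)
  moreover have "B \<ge> 0" using C1 by (simp add: B_def moment_jump_const_def edge_reference_bound_def)
  moreover have "D > 0" using C2 by (simp add: D_def shear_jump_const_def edge_reference_bound_def add_nonneg_pos)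
  ultimately have C: "C > 0" by (simp add: C_def add_nonneg_pos)
  have est: "estimator d Y \<nu> \<Gamma>s \<Gamma>f S \<T> f g uh \<le> C * (H2norm \<Omega> (\<lambda>x. u x - uh x) + osc_f \<T> f fh + osc_g \<T> S g gh)"
    if "plate_mesh \<Omega> \<Gamma>c \<Gamma>s \<Gamma>f \<kappa> \<T>" "\<exists>p q. p \<noteq> q \<and> S = closed_segment p q \<and> open_segment p q \<subseteq> \<Omega>"
      "S = \<Union>(edges_S \<T> S)" "x0 \<in> \<Omega>" "\<exists>K\<in>\<T>. x0 extreme_point_of K"
      "f \<in> L2 (lebesgue_on \<Omega>)" "g \<in> L2 (arc_measure S)" "fe_space \<Omega> \<Gamma>c \<Gamma>s \<T> r Vh" "u \<in> plate_space \<Omega> \<Gamma>c \<Gamma>s"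
      "\<forall>v\<in>plate_space \<Omega> \<Gamma>c \<Gamma>s. plate_form \<Omega> d Y \<nu> u v = plate_load \<Omega> S x0 f g F v"
      "uh \<in> Vh" "fh \<in> Vh" "\<forall>e\<in>edges_S \<T> S. \<exists>p. poly_of_degree m p \<and> (\<forall>x\<in>e. gh e x = p x)"
    for \<T> S x0 f g F Vh u uh fh gh
  proof -
    interpret plate_problem \<Omega> \<Gamma>c \<Gamma>s \<Gamma>f \<kappa> \<T> d Y \<nu> r m S x0 f g F Vh u uh fh gh
      using assms(1,2) that by unfold_locales (auto simp: polygonal_domain_def)
    show ?thesis
      using estimator_bound[OF C0 C1 C2] unfolding stress_const_def C_def A_def B_def D_def s_def .
  qed
  show ?thesis
    by (intro exI[of _ C] conjI allI impI C, elim conjE, rule est, assumption+)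
qed

end
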